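(* Let $s\in(0,1)$, $N\ge 1$ with $N<2s$, and let $\Omega\subset\mathbb{R}^N$ be a bounded domain with Lipschitz boundary. Let $f:\Omega\times\mathbb{R}\to\mathbb{R}$ be a Carathéodory function, $F(x,t)=\int_0^t f(x,\tau)\,d\tau$, such that: (a) there exist $r\in(1,\frac{N}{N-s})$ and $C>0$ with $|f(x,t)|\le C|t|^{r-1}$ for all $(x,t)\in\Omega\times\mathbb{R}$; (b) there exists $\theta>1$ with $0<\theta F(x,t)\le t f(x,t)$ for all $x\in\Omega$, $t\neq 0$; (c) $f(x,\cdot)\in C^1(\mathbb{R})$ for all $x\in\Omega$ and there exists $\Theta>1$ with $(\Theta-1)f(x,t)t<t^2f'(x,t)$ for all $x\in\Omega$, $t\ne 0$ (where $f'=\partial_t f$); (d) $r<1+\frac{N}{2(N-s)}$. Let $u_0\in W_0^{s,1}(\Omega)$. Then there exists $T>0$ such that problem (P) with initial datum $u_0$ admits a strong solution $u$ on $\Omega\times[0,T]$.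
   Context: Let $\mathcal{C}\Omega=\mathbb{R}^N\setminus\Omega$, $Q=(\mathbb{R}^N\times\mathbb{R}^N)\setminus(\mathcal{C}\Omega\times\mathcal{C}\Omega)$, and $W_0^{s,1}(\Omega)=\{u: u\in L^1(\Omega),\ u=0 \text{ in }\mathcal{C}\Omega,\ \frac{|u(x)-u(y)|}{|x-y|^{N+s}}\in L^1(Q)\}$ with norm $\|u\|_{W_0^{s,1}(\Omega)}=\iint_Q\frac{|u(x)-u(y)|}{|x-y|^{N+s}}dxdy$. Set $1_s^*=\frac{N}{N-s}$ and $E(u)=\|u\|_{W_0^{s,1}(\Omega)}-\int_\Omega F(x,u)dx$ for $u\in W_0^{s,1}(\Omega)$. Problem (P): $u_t+(-\Delta)_1^s u=f(x,u)$ in $\Omega\times(0,T)$, $u=0$ in $(\mathbb{R}^N\setminus\Omega)\times(0,T)$, $u(\cdot,0)=u_0$ in $\Omega$, where $(-\Delta)^s_1$ is the fractional 1-Laplacian (formally $\mathrm{P.V.}\int_{\mathbb{R}^N}\frac{u(x)-u(y)}{|u(x)-u(y)|}\frac{dy}{|x-y|^{N+s}}$). Weak solution on $(0,T)$: a function $u\in L^\infty(0,T;W_0^{s,1}(\Omega)\cap L^2(\Omega))$ with $u_t\in L^2(0,T;L^2(\Omega))$ such that (1) $u(\cdot,0)=u_0$ a.e. in $\Omega$; (2) there exists $\eta(\cdot,\cdot,t)\in L^\infty(\mathbb{R}^N\times\mathbb{R}^N)$, antisymmetric ($\eta(x,y,t)=-\eta(y,x,t)$ for a.e. $(x,y)$),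 with $\|\eta(\cdot,\cdot,t)\|_{L^\infty}\le 1$ and $\eta(x,y,t)\in\operatorname{sign}(u(x,t)-u(y,t))$ for a.e. $(x,y,t)\in\mathbb{R}^N\times\mathbb{R}^N\times[0,T]$ (multivalued sign, $\operatorname{sign}(0)=[-1,1]$), such that $\int_\Omega u_t\phi\,dx+\iint_Q\eta(x,y,t)\frac{\phi(x)-\phi(y)}{|x-y|^{N+s}}dxdy=\int_\Omega f(x,u)\phi\,dx$ for all $\phi\in W_0^{s,1}(\Omega)\cap L^2(\Omega)$ and a.e. $t\in[0,T]$; (3) $u\in C(0,T;L^\kappa(\Omega))$ for $\kappa\in[1,1_s^* )$ and $\int_0^t\|u_t(\cdot,\tau)\|_{L^2(\Omega)}^2d\tau+E(u(\cdot,t))\le E(u_0)$ for a.e. $t\in[0,T)$. Strong solution: a weak solution for which $\int_0^t\|u_t(\cdot,\tau)\|_{L^2(\Omega)}^2d\tau+E(u(\cdot,t))=E(u(\cdot,0))$ for every $[0,t]\subset[0,T)$. *)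

theory Defs
  imports "HOL-Analysis.Analysis"
begin

text \<open>
  Functions are represented by (everywhere defined) representatives, and Lebesgue classes are taken
  into account through \<open>AE\<close>. The space \<open>\<real>\<^sup>N\<close> is a type of class \<^class>\<open>euclidean_space\<close>,
  with \<open>N = DIM('a)\<close>. A time-dependent function is written \<open>u t x\<close>.
\<close>

text \<open>Locally, after a choice of the ``vertical'' direction \<open>e\<close>, the set is the part of an open
  neighbourhood lying strictly above the graph of a Lipschitz function of the coordinates
  orthogonal to \<open>e\<close>.\<close>

definition lipschitz_boundary :: "'a::euclidean_space set \<Rightarrow> bool" where
  "lipschitz_boundary \<Omega> \<longleftrightarrow>
     (\<forall>p\<in>frontier \<Omega>. \<exists>U e L g. open U \<and> p \<in> U \<and> norm e = 1 \<and>
        L-lipschitz_on {z. z \<bullet> e = 0} (g :: 'a \<Rightarrow> real) \<and>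
        \<Omega> \<inter> U = {y \<in> U. g (y - (y \<bullet> e) *\<^sub>R e) < y \<bullet> e})"

definition bounded_lipschitz_domain :: "'a::euclidean_space set \<Rightarrow> bool" where
  "bounded_lipschitz_domain \<Omega> \<longleftrightarrow>
     open \<Omega> \<and> connected \<Omega> \<and> \<Omega> \<noteq> {} \<and> bounded \<Omega> \<and> lipschitz_boundary \<Omega>"

definition caratheodory :: "'a::euclidean_space set \<Rightarrow> ('a \<Rightarrow> real \<Rightarrow> real) \<Rightarrow> bool" where
  "caratheodory \<Omega> f \<longleftrightarrow>
     (\<forall>t. (\<lambda>x. f x t) \<in> borel_measurable (lebesgue_on \<Omega>)) \<and>
     (AE x in lebesgue_on \<Omega>. continuous_on UNIV (f x))"

text \<open>The interval integral is oriented, also for \<open>t < 0\<close>.\<close>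

definition primitive :: "('a \<Rightarrow> real \<Rightarrow> real) \<Rightarrow> 'a \<Rightarrow> real \<Rightarrow> real" where
  "primitive f x t = (LBINT \<tau>=0..ereal t. f x \<tau>)"

definition Lp_space :: "real \<Rightarrow> 'a::euclidean_space set \<Rightarrow> ('a \<Rightarrow> real) set" where
  "Lp_space p \<Omega> =
     {v. v \<in> borel_measurable (lebesgue_on \<Omega>) \<and>
         integrable (lebesgue_on \<Omega>) (\<lambda>x. \<bar>v x\<bar> powr p)}"

definition Lp_norm :: "real \<Rightarrow> 'a::euclidean_space set \<Rightarrow> ('a \<Rightarrow> real) \<Rightarrow> real" where
  "Lp_norm p \<Omega> v = (\<integral>x. \<bar>v x\<bar> powr p \<partial>lebesgue_on \<Omega>) powr (1 / p)"

definition Qset :: "'a set \<Rightarrow> ('a \<times> 'a) set" where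
  "Qset \<Omega> = UNIV - (- \<Omega>) \<times> (- \<Omega>)"

text \<open>On the diagonal the kernel quotients below have the value \<open>0 / 0 = 0\<close>; the diagonal is
  a null set.\<close>

definition W0 :: "real \<Rightarrow> 'a::euclidean_space set \<Rightarrow> ('a \<Rightarrow> real) set" where
  "W0 s \<Omega> =
     {u. integrable (lebesgue_on \<Omega>) u \<and>
         (AE x in lebesgue. x \<notin> \<Omega> \<longrightarrow> u x = 0) \<and>
         integrable (lebesgue_on (Qset \<Omega>))
           (\<lambda>(x, y). \<bar>u x - u y\<bar> / norm (x - y) powr (real DIM('a) + s))}"

definition W0_norm :: "real \<Rightarrow> 'a::euclidean_space set \<Rightarrow> ('a \<Rightarrow> real) \<Rightarrow> real" where
  "W0_norm s \<Omega> u =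
     (\<integral>(x, y). \<bar>u x - u y\<bar> / norm (x - y) powr (real DIM('a) + s) \<partial>lebesgue_on (Qset \<Omega>))"

definition energy ::
  "real \<Rightarrow> 'a::euclidean_space set \<Rightarrow> ('a \<Rightarrow> real \<Rightarrow> real) \<Rightarrow> ('a \<Rightarrow> real) \<Rightarrow> real" where
  "energy s \<Omega> f u = W0_norm s \<Omega> u - (\<integral>x. primitive f x (u x) \<partial>lebesgue_on \<Omega>)"

text \<open>Since the spaces above are sets of functions with a seminorm rather than Banach space types,
  Bochner (strong) measurability on \<open>(0, T)\<close> is spelled out: \<open>u\<close> is the almost everywhere limit, in
  the norm \<open>nrm\<close> of the space \<open>X\<close>, of \<open>X\<close>-valued simple functions.\<close>

definition strongly_measurable ::
  "real \<Rightarrow> ('a \<Rightarrow> real) set \<Rightarrow> (('a \<Rightarrow> real) \<Rightarrow> real) \<Rightarrow> (real \<Rightarrow> 'a \<Rightarrow> real) \<Rightarrow> bool" where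
  "strongly_measurable T X nrm u \<longleftrightarrow>
     (\<exists>S :: nat \<Rightarrow> real \<Rightarrow> 'a \<Rightarrow> real.
        (\<forall>n. simple_function (lebesgue_on {0<..<T}) (S n) \<and> (\<forall>t\<in>{0<..<T}. S n t \<in> X)) \<and>
        (AE t in lebesgue_on {0<..<T}. (\<lambda>n. nrm (\<lambda>x. S n t x - u t x)) \<longlonglongrightarrow> 0))"

definition Bochner_Linf ::
  "real \<Rightarrow> ('a \<Rightarrow> real) set \<Rightarrow> (('a \<Rightarrow> real) \<Rightarrow> real) \<Rightarrow> (real \<Rightarrow> 'a \<Rightarrow> real) set" where
  "Bochner_Linf T X nrm =
     {u. strongly_measurable T X nrm u \<and> (AE t in lebesgue_on {0<..<T}. u t \<in> X) \<and>
         (\<exists>M. AE t in lebesgue_on {0<..<T}. nrm (u t) \<le> M)}"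

definition Bochner_L2 ::
  "real \<Rightarrow> ('a \<Rightarrow> real) set \<Rightarrow> (('a \<Rightarrow> real) \<Rightarrow> real) \<Rightarrow> (real \<Rightarrow> 'a \<Rightarrow> real) set" where
  "Bochner_L2 T X nrm =
     {u. strongly_measurable T X nrm u \<and> (AE t in lebesgue_on {0<..<T}. u t \<in> X) \<and>
         integrable (lebesgue_on {0<..<T}) (\<lambda>t. (nrm (u t))\<^sup>2)}"

definition continuous_into_Lp ::
  "real \<Rightarrow> real \<Rightarrow> 'a::euclidean_space set \<Rightarrow> (real \<Rightarrow> 'a \<Rightarrow> real) \<Rightarrow> bool" where
  "continuous_into_Lp T p \<Omega> u \<longleftrightarrow>
     (\<forall>t\<in>{0..T}. u t \<in> Lp_space p \<Omega> \<and>
        ((\<lambda>\<tau>. Lp_norm p \<Omega> (\<lambda>x. u \<tau> x - u t x)) \<longlongrightarrow> 0) (at t within {0..T}))"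

definition test_function :: "real \<Rightarrow> (real \<Rightarrow> real) \<Rightarrow> bool" where
  "test_function T \<psi> \<longleftrightarrow>
     (\<forall>n. (deriv ^^ n) \<psi> differentiable_on UNIV) \<and>
     (\<exists>a b. 0 < a \<and> b < T \<and> (\<forall>t. t \<notin> {a..b} \<longrightarrow> \<psi> t = 0))"

text \<open>The function \<open>v\<close> is the weak derivative \<open>u\<^sub>t\<close> on \<open>(0, T)\<close> of \<open>u\<close>, as functions with values in
  \<open>L\<^sup>2(\<Omega>)\<close>: the identity \<open>\<integral> \<psi>' u dt = - \<integral> \<psi> v dt\<close> of elements of \<open>L\<^sup>2(\<Omega>)\<close>, paired with
  arbitrary \<open>w \<in> L\<^sup>2(\<Omega>)\<close>.\<close>

definition weak_time_derivative ::
  "real \<Rightarrow> 'a::euclidean_space set \<Rightarrow> (real \<Rightarrow> 'a \<Rightarrow> real) \<Rightarrow> (real \<Rightarrow> 'a \<Rightarrow> real) \<Rightarrow> bool" where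
  "weak_time_derivative T \<Omega> u v \<longleftrightarrow>
     (\<forall>\<psi> w. test_function T \<psi> \<longrightarrow> w \<in> Lp_space 2 \<Omega> \<longrightarrow>
        (\<integral>t. deriv \<psi> t * (\<integral>x. u t x * w x \<partial>lebesgue_on \<Omega>) \<partial>lebesgue_on {0<..<T}) =
        - (\<integral>t. \<psi> t * (\<integral>x. v t x * w x \<partial>lebesgue_on \<Omega>) \<partial>lebesgue_on {0<..<T}))"

definition multi_sign :: "real \<Rightarrow> real set" where
  "multi_sign r = (if r = 0 then {-1..1} else {sgn r})"

text \<open>Almost everywhere conditions in \<open>(x, y, t)\<close> presuppose measurability on the product space,
  which is therefore required of \<open>u\<close> and \<open>\<eta>\<close>.\<close>

definition sign_selection ::
  "real \<Rightarrow> (real \<Rightarrow> 'a::euclidean_space \<Rightarrow> real) \<Rightarrow> ('a \<Rightarrow> 'a \<Rightarrow> real \<Rightarrow> real) \<Rightarrow> bool" where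
  "sign_selection T u \<eta> \<longleftrightarrow>
     (\<lambda>(x, y, t). \<eta> x y t) \<in> borel_measurable (lebesgue_on (UNIV \<times> UNIV \<times> {0..T})) \<and>
     (\<forall>t\<in>{0..T}.
        (\<lambda>(x, y). \<eta> x y t) \<in> borel_measurable lebesgue \<and>
        (AE (x, y) in lebesgue. \<eta> x y t = - \<eta> y x t) \<and>
        (AE (x, y) in lebesgue. \<bar>\<eta> x y t\<bar> \<le> 1)) \<and>
     (AE (x, y, t) in lebesgue_on (UNIV \<times> UNIV \<times> {0..T}). \<eta> x y t \<in> multi_sign (u t x - u t y))"

text \<open>The argument \<open>ut\<close> is the time derivative of \<open>u\<close>.\<close>

definition weak_solution ::
  "real \<Rightarrow> 'a::euclidean_space set \<Rightarrow> ('a \<Rightarrow> real \<Rightarrow> real) \<Rightarrow> ('a \<Rightarrow> real) \<Rightarrow> real \<Rightarrow>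
   (real \<Rightarrow> 'a \<Rightarrow> real) \<Rightarrow> (real \<Rightarrow> 'a \<Rightarrow> real) \<Rightarrow> bool" where
  "weak_solution s \<Omega> f u0 T u ut \<longleftrightarrow>
     (\<lambda>(x, t). u t x) \<in> borel_measurable (lebesgue_on (UNIV \<times> {0<..<T})) \<and>
     u \<in> Bochner_Linf T (W0 s \<Omega> \<inter> Lp_space 2 \<Omega>) (\<lambda>v. W0_norm s \<Omega> v + Lp_norm 2 \<Omega> v) \<and>
     ut \<in> Bochner_L2 T (Lp_space 2 \<Omega>) (Lp_norm 2 \<Omega>) \<and>
     weak_time_derivative T \<Omega> u ut \<and>
     (AE x in lebesgue_on \<Omega>. u 0 x = u0 x) \<and>
     (\<exists>\<eta>. sign_selection T u \<eta> \<and>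
        (AE t in lebesgue_on {0..T}. \<forall>\<phi>\<in>W0 s \<Omega> \<inter> Lp_space 2 \<Omega>.
           (\<integral>x. ut t x * \<phi> x \<partial>lebesgue_on \<Omega>) +
           (\<integral>(x, y). \<eta> x y t * ((\<phi> x - \<phi> y) / norm (x - y) powr (real DIM('a) + s))
              \<partial>lebesgue_on (Qset \<Omega>)) =
           (\<integral>x. f x (u t x) * \<phi> x \<partial>lebesgue_on \<Omega>))) \<and>
     (\<forall>\<kappa>. 1 \<le> \<kappa> \<and> \<kappa> < real DIM('a) / (real DIM('a) - s) \<longrightarrow> continuous_into_Lp T \<kappa> \<Omega> u) \<and>
     (AE t in lebesgue_on {0..<T}.
        (\<integral>\<tau>. (Lp_norm 2 \<Omega> (ut \<tau>))\<^sup>2 \<partial>lebesgue_on {0..t}) + energy s \<Omega> f (u t)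
          \<le> energy s \<Omega> f u0)"

text \<open>The energy is defined on \<^const>\<open>W0\<close> only, so the energy identity at every time presupposes
  that \<open>u t\<close> belongs to that space at every time.\<close>

definition strong_solution ::
  "real \<Rightarrow> 'a::euclidean_space set \<Rightarrow> ('a \<Rightarrow> real \<Rightarrow> real) \<Rightarrow> ('a \<Rightarrow> real) \<Rightarrow> real \<Rightarrow>
   (real \<Rightarrow> 'a \<Rightarrow> real) \<Rightarrow> bool" where
  "strong_solution s \<Omega> f u0 T u \<longleftrightarrow>
     (\<exists>ut. weak_solution s \<Omega> f u0 T u ut \<and>
        (\<forall>t\<in>{0..<T}. u t \<in> W0 s \<Omega> \<and>
           (\<integral>\<tau>. (Lp_norm 2 \<Omega> (ut \<tau>))\<^sup>2 \<partial>lebesgue_on {0..t}) + energy s \<Omega> f (u t)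
             = energy s \<Omega> f (u 0)))"

end

theory Submission
  imports Defs "HOL-Complex_Analysis.Great_Picard"
begin

text \<open>Since \<open>N < 2s\<close> forces \<open>N = 1\<close> and \<open>s > 1/2\<close>, the critical exponent \<open>1/(1-s)\<close> exceeds \<open>2\<close>: sublevel sets of
  the seminorm are precompact in \<open>L\<^sup>2\<close>, and by the growth condition \<open>u \<mapsto> f(\<cdot>, u)\<close> maps them to bounded,
  equi-integrable subsets of \<open>L\<^sup>2\<close>. The solution is the limit of the Euler scheme in which \<open>u\<^sub>k\<^sub>+\<^sub>1\<close>
  minimises the seminorm plus \<open>\<parallel>u - u\<^sub>k - h f(\<cdot>, u\<^sub>k)\<parallel>\<^sup>2/(2h)\<close>. A vanishing smoothing of the seminorm
  gives these minimisers an Euler-Lagrange equation, whose kernel coefficient is antisymmetric, bounded by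
  \<open>1\<close> and converges to \<open>\<eta>\<close>. Weak limits of the difference quotients and of the coefficients are replaced by strong
  limits of convex combinations; the sign relation survives because it is pinned down wherever the almost
  everywhere limit \<open>u(x) - u(y)\<close> is nonzero. For short times, the energy estimate of the scheme keeps the
  seminorm bounded.

  The sign conditions make \<open>f(x, \<cdot>)\<close> nondecreasing, so the energy is a difference of two convex
  functionals. The equation exhibits \<open>f(\<cdot>, u) - u\<^sub>t\<close> as a subgradient of the first and \<open>f(\<cdot>, u)\<close> is one of the second; the
  chain rule for convex functionals, applied to both, yields the energy equality.\<close>

section \<open>Square-integrable functions and convex combinations\<close>

text \<open>The limit equation couples difference quotients, coefficients and nonlinearity, so one
  sequence of convex weights has to serve all three: the first two families are averaged jointly,
  and the third converges strongly, so that its averages have the same limit. The kernel is not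
  integrable near the diagonal. The smoothing therefore acts on the whole quotient (u(x) - u(y))
  K(x, y) and puts an integrable positive weight, not a constant, under the root. The Bochner space
  of the solution asks for strong measurability in the seminorm, whereas compactness controls only
  L2. This is settled last: the chain rule makes the seminorm of u(t) continuous in t, and
  convergence of the seminorms together with L2 convergence implies convergence in the seminorm by
  Scheffe's lemma. All analysis is done with Borel functions that vanish everywhere outside \<Omega>
  and with \<open>lborel\<close>; the \<open>lebesgue_on\<close> integrals and the almost everywhere
  classes of the definitions are reached by a transfer at the end.\<close>

definition square_integrable :: "'a measure \<Rightarrow> ('a \<Rightarrow> real) \<Rightarrow> bool" where
  "square_integrable M f \<longleftrightarrow> f \<in> borel_measurable M \<and> integrable M (\<lambda>x. (f x)\<^sup>2)"

abbreviation L2 :: "('a::euclidean_space \<Rightarrow> real) \<Rightarrow> bool" where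
  "L2 \<equiv> square_integrable lborel"

definition nsq :: "'a measure \<Rightarrow> ('a \<Rightarrow> real) \<Rightarrow> real" where
  "nsq M f = (\<integral>x. (f x)\<^sup>2 \<partial>M)"

lemma nsq_nonneg [simp]: "0 \<le> nsq M f"
  unfolding nsq_def by (rule integral_nonneg_AE) simp

lemma nsq_minus_commute: "nsq M (\<lambda>x. f x - g x) = nsq M (\<lambda>x. g x - f x)"
  by (simp add: nsq_def power2_commute)

lemma nsq_cong_AE:
  assumes "f \<in> borel_measurable M" "g \<in> borel_measurable M" "AE x in M. f x = g x"
  shows "nsq M f = nsq M g"
  unfolding nsq_def using assms by (intro integral_cong_AE) auto

lemma square_integrableD:
  assumes "square_integrable M f"
  shows "f \<in> borel_measurable M" "integrable M (\<lambda>x. (f x)\<^sup>2)"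
  using assms by (auto simp: square_integrable_def)

lemma square_integrable_mult:
  assumes "square_integrable M f" "square_integrable M g"
  shows "integrable M (\<lambda>x. f x * g x)"
proof (rule Bochner_Integration.integrable_bound)
  show "integrable M (\<lambda>x. (f x)\<^sup>2 + (g x)\<^sup>2)" using assms by (auto simp: square_integrable_def)
  show "(\<lambda>x. f x * g x) \<in> borel_measurable M" using assms by (auto simp: square_integrable_def)
  have "\<bar>a * b\<bar> \<le> a\<^sup>2 + b\<^sup>2" for a b :: real
  proof -
    have "0 \<le> (\<bar>a\<bar> - \<bar>b\<bar>)\<^sup>2" by simp
    then have "2 * (\<bar>a\<bar> * \<bar>b\<bar>) \<le> a\<^sup>2 + b\<^sup>2" by (simp add: power2_diff)
    moreover have "0 \<le> \<bar>a\<bar> * \<bar>b\<bar>" by simp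
    ultimately show ?thesis unfolding abs_mult by linarith
  qed
  then show "AE x in M. norm (f x * g x) \<le> norm ((f x)\<^sup>2 + (g x)\<^sup>2)" by auto
qed

lemma square_integrable_add:
  assumes "square_integrable M f" "square_integrable M g"
  shows "square_integrable M (\<lambda>x. f x + g x)"
  using assms square_integrable_mult[OF assms]
  by (auto simp: square_integrable_def power2_sum mult.assoc)

lemma square_integrable_scale:
  assumes "square_integrable M f"
  shows "square_integrable M (\<lambda>x. c * f x)"
  using assms by (auto simp: square_integrable_def power_mult_distrib)

lemma nsq_scale: "nsq M (\<lambda>x. c * f x) = c\<^sup>2 * nsq M f"
  by (simp add: nsq_def power_mult_distrib)

lemma square_integrable_diff:
  assumes "square_integrable M f" "square_integrable M g"
  shows "square_integrable M (\<lambda>x. f x - g x)"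
  using square_integrable_add[OF assms(1) square_integrable_scale[OF assms(2), of "-1"]] by simp

lemma square_integrable_zero [simp]: "square_integrable M (\<lambda>x. 0)"
  by (simp add: square_integrable_def)

lemma square_integrable_sum:
  assumes "\<And>i. i \<in> I \<Longrightarrow> square_integrable M (f i)"
  shows "square_integrable M (\<lambda>x. \<Sum>i\<in>I. c i * f i x)"
  using assms
proof (induction I rule: infinite_finite_induct)
  case (insert i I)
  then show ?case
    by (auto intro!: square_integrable_add square_integrable_scale)
qed auto

lemma square_integrable_bound:
  assumes "square_integrable M f" "g \<in> borel_measurable M" "\<And>x. x \<in> space M \<Longrightarrow> \<bar>g x\<bar> \<le> \<bar>f x\<bar>"
  shows "square_integrable M g"
  unfolding square_integrable_def
proof
  show "integrable M (\<lambda>x. (g x)\<^sup>2)"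
    by (rule Bochner_Integration.integrable_bound[of _ "\<lambda>x. (f x)\<^sup>2"])
      (use assms in \<open>auto simp: square_integrable_def abs_le_square_iff\<close>)
qed (rule assms)

lemma nsq_add_le:
  assumes "square_integrable M f" "square_integrable M g"
  shows "nsq M (\<lambda>x. f x + g x) \<le> 2 * nsq M f + 2 * nsq M g"
proof -
  have "nsq M (\<lambda>x. f x + g x) \<le> (\<integral>x. 2 * (f x)\<^sup>2 + 2 * (g x)\<^sup>2 \<partial>M)"
    unfolding nsq_def
  proof (rule integral_mono)
    show "integrable M (\<lambda>x. (f x + g x)\<^sup>2)"
      using square_integrable_add[OF assms] by (simp add: square_integrable_def)
    show "integrable M (\<lambda>x. 2 * (f x)\<^sup>2 + 2 * (g x)\<^sup>2)"
      using assms by (auto simp: square_integrable_def)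
    fix x
    have "0 \<le> (f x - g x)\<^sup>2" by simp
    then show "(f x + g x)\<^sup>2 \<le> 2 * (f x)\<^sup>2 + 2 * (g x)\<^sup>2"
      by (simp add: power2_diff power2_sum)
  qed
  also have "\<dots> = 2 * nsq M f + 2 * nsq M g"
    unfolding nsq_def using assms by (subst Bochner_Integration.integral_add) (auto simp: square_integrable_def)
  finally show ?thesis .
qed

lemma nsq_diff_le:
  assumes "square_integrable M f" "square_integrable M g"
  shows "nsq M (\<lambda>x. f x - g x) \<le> 2 * nsq M f + 2 * nsq M g"
  using nsq_add_le[OF assms(1) square_integrable_scale[OF assms(2), of "-1"]] nsq_scale[of M "-1" g]
  by simp

lemma nsq_triangle3:
  assumes "square_integrable M f" "square_integrable M g" "square_integrable M h"
  shows "nsq M (\<lambda>x. f x - h x) \<le> 2 * nsq M (\<lambda>x. f x - g x) + 2 * nsq M (\<lambda>x. g x - h x)"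
  using nsq_add_le[OF square_integrable_diff[OF assms(1,2)] square_integrable_diff[OF assms(2,3)]]
  by simp

lemma parallelogram_nsq:
  assumes "square_integrable M f" "square_integrable M g"
  shows "nsq M (\<lambda>x. (f x + g x) / 2) + nsq M (\<lambda>x. f x - g x) / 4 = (nsq M f + nsq M g) / 2"
proof -
  have i: "integrable M (\<lambda>x. ((f x + g x) / 2)\<^sup>2)" "integrable M (\<lambda>x. (f x - g x)\<^sup>2 / 4)"
    using square_integrable_scale[OF square_integrable_add[OF assms], of "1/2"]
      square_integrable_diff[OF assms] by (auto simp: square_integrable_def)
  have "nsq M (\<lambda>x. (f x + g x) / 2) + nsq M (\<lambda>x. f x - g x) / 4
      = (\<integral>x. ((f x + g x) / 2)\<^sup>2 + (f x - g x)\<^sup>2 / 4 \<partial>M)"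
    unfolding nsq_def using i by (subst Bochner_Integration.integral_add) auto
  also have "\<dots> = (\<integral>x. (f x)\<^sup>2 / 2 + (g x)\<^sup>2 / 2 \<partial>M)"
    by (intro Bochner_Integration.integral_cong) (auto simp: power2_eq_square field_simps)
  also have "\<dots> = (nsq M f + nsq M g) / 2"
    unfolding nsq_def using assms
    by (subst Bochner_Integration.integral_add) (auto simp: square_integrable_def add_divide_distrib)
  finally show ?thesis .
qed

text \<open>Discriminant argument for the nonnegative quadratic form in (a, b). The choice (-p,
  \<open>nsq M f\<close>) gives the inequality only after division by \<open>nsq M f\<close>, so the
  degenerate case is treated apart.\<close>

lemma Cauchy_Schwarz_nsq:
  assumes "square_integrable M f" "square_integrable M g"
  shows "\<bar>\<integral>x. f x * g x \<partial>M\<bar> \<le> sqrt (nsq M f) * sqrt (nsq M g)"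
proof -
  have i: "integrable M (\<lambda>x. (f x)\<^sup>2)" "integrable M (\<lambda>x. (g x)\<^sup>2)" "integrable M (\<lambda>x. f x * g x)"
    using assms square_integrable_mult by (auto simp: square_integrable_def)
  define p where "p = (\<integral>x. f x * g x \<partial>M)"
  have *: "0 \<le> a\<^sup>2 * nsq M f + 2 * a * b * p + b\<^sup>2 * nsq M g" for a b
  proof -
    have "0 \<le> (\<integral>x. (a * f x + b * g x)\<^sup>2 \<partial>M)" by simp
    also have "\<dots> = (\<integral>x. a\<^sup>2 * (f x)\<^sup>2 + (2 * a * b) * (f x * g x) + b\<^sup>2 * (g x)\<^sup>2 \<partial>M)"
      by (intro Bochner_Integration.integral_cong) (auto simp: power2_eq_square algebra_simps)
    also have "\<dots> = a\<^sup>2 * nsq M f + 2 * a * b * p + b\<^sup>2 * nsq M g"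
      using i by (simp add: nsq_def p_def)
    finally show ?thesis .
  qed
  have "p\<^sup>2 \<le> nsq M f * nsq M g"
  proof (cases "nsq M f = 0")
    case True
    have "p = 0"
    proof (rule ccontr)
      assume "p \<noteq> 0"
      \<comment> \<open>With \<open>nsq M f = 0\<close> the form is affine in a, and this a makes
        its value -1.\<close>
      have "0 \<le> 2 * (-(nsq M g + 1) / (2 * p)) * p + nsq M g"
        using *[of "-(nsq M g + 1) / (2 * p)" 1] True by simp
      also have "\<dots> = -1" using \<open>p \<noteq> 0\<close> by (simp add: field_simps)
      finally show False by simp
    qed
    then show ?thesis by simp
  next
    case False
    then have pos: "nsq M f > 0" using nsq_nonneg[of M f] by linarith
    have "0 \<le> p\<^sup>2 * nsq M f - 2 * p * nsq M f * p + (nsq M f)\<^sup>2 * nsq M g"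
      using *[of "-p" "nsq M f"] by simp
    then have "0 \<le> nsq M f * (nsq M f * nsq M g - p\<^sup>2)"
      by (simp add: power2_eq_square algebra_simps)
    then show ?thesis using pos by (simp add: zero_le_mult_iff)
  qed
  then have "sqrt (p\<^sup>2) \<le> sqrt (nsq M f * nsq M g)" by (rule real_sqrt_le_mono)
  then show ?thesis by (simp add: p_def real_sqrt_mult)
qed

text \<open>By Tonelli the sum has a finite integral, so it is finite almost everywhere.\<close>

lemma AE_summable_of_summable_integral:
  fixes f :: "nat \<Rightarrow> 'a \<Rightarrow> real"
  assumes "\<And>k. integrable M (f k)" "\<And>k x. 0 \<le> f k x" "summable (\<lambda>k. \<integral>x. f k x \<partial>M)"
  shows "AE x in M. summable (\<lambda>k. f k x)"
proof -
  have [measurable]: "\<And>k. f k \<in> borel_measurable M" using assms(1) by auto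
  have "(\<integral>\<^sup>+x. (\<Sum>k. ennreal (f k x)) \<partial>M) = (\<Sum>k. \<integral>\<^sup>+x. ennreal (f k x) \<partial>M)"
    by (rule nn_integral_suminf) simp
  also have "\<dots> = (\<Sum>k. ennreal (\<integral>x. f k x \<partial>M))"
    using assms by (intro suminf_cong nn_integral_eq_integral) auto
  also have "\<dots> < \<infinity>"
    using assms(2,3) by (subst suminf_ennreal2) (auto intro!: integral_nonneg_AE)
  finally have "AE x in M. (\<Sum>k. ennreal (f k x)) \<noteq> \<infinity>"
    by (intro nn_integral_PInf_AE) auto
  then show ?thesis
    by (rule AE_mp) (use assms(2) summable_suminf_not_top in auto)
qed

text \<open>The partial sums of \<open>Suc (N i)\<close> increase strictly and the k-th one
  dominates \<open>N k\<close>, so one subsequence meets all tail conditions at once.\<close>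

lemma fast_subsequence:
  fixes P :: "nat \<Rightarrow> nat \<Rightarrow> bool"
  assumes "\<And>k. \<exists>N. \<forall>n\<ge>N. P k n"
  obtains r :: "nat \<Rightarrow> nat" where "strict_mono r" "\<And>k n. r k \<le> n \<Longrightarrow> P k n"
proof -
  obtain N where N: "\<And>k n. N k \<le> n \<Longrightarrow> P k n" using assms by metis
  define r where "r k = (\<Sum>i\<le>k. Suc (N i))" for k
  have "strict_mono r" by (rule strict_mono_Suc_iff[THEN iffD2]) (simp add: r_def)
  moreover have "N k \<le> r k" for k
    unfolding r_def by (rule order.trans[OF _ member_le_sum[of k]]) auto
  ultimately show ?thesis using that[of r] N by (meson order.trans)
qed

text \<open>The Riesz-Fischer theorem. Besides norm convergence it records a subsequence that
  converges almost everywhere, which Fatou arguments and the sign relation use later.\<close>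

lemma L2_complete:
  assumes sq: "\<And>n. square_integrable M (f n)"
    and Cauchy: "\<And>e. e > 0 \<Longrightarrow> \<exists>N. \<forall>m\<ge>N. \<forall>n\<ge>N. nsq M (\<lambda>x. f m x - f n x) < e"
  obtains F r where "square_integrable M F" "strict_mono (r :: nat \<Rightarrow> nat)"
    "AE x in M. (\<lambda>n. f (r n) x) \<longlonglongrightarrow> F x" "(\<lambda>n. nsq M (\<lambda>x. f n x - F x)) \<longlonglongrightarrow> 0"
proof -
  have [measurable]: "\<And>n. f n \<in> borel_measurable M" using sq by (auto simp: square_integrable_def)
  have sqd: "square_integrable M (\<lambda>x. f m x - f n x)" for m n by (intro square_integrable_diff sq)
  \<comment> \<open>The rate 8^-k leaves room for a factor 2^k: the functions 2^k d_k^2 have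
    summable integrals, hence |d_k| is eventually below 2^(-k/2), a summable bound.\<close>
  have "\<exists>N. \<forall>n\<ge>N. \<forall>m\<ge>N. nsq M (\<lambda>x. f m x - f n x) < (1/8)^k" for k
    using Cauchy[of "(1/8)^k"] by auto
  then obtain N where N: "\<And>k m n. N k \<le> m \<Longrightarrow> N k \<le> n \<Longrightarrow> nsq M (\<lambda>x. f m x - f n x) < (1/8)^k"
    by metis
  obtain r where r: "strict_mono r" "\<And>k n. r k \<le> n \<Longrightarrow> N k \<le> n"
    using fast_subsequence[of "\<lambda>k n. N k \<le> n"] by auto
  define d where "d k x = f (r (Suc k)) x - f (r k) x" for k x
  have "r k \<le> r (Suc k)" for k using r(1) by (simp add: strict_mono_less_eq)
  then have nd: "nsq M (d k) < (1/8)^k" for k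
    unfolding d_def by (intro N r(2)[of k]) auto
  have sd: "square_integrable M (d k)" for k unfolding d_def by (rule sqd)
  have "AE x in M. summable (\<lambda>k. 2^k * (d k x)\<^sup>2)"
  proof (rule AE_summable_of_summable_integral)
    have e: "(\<integral>x. 2^k * (d k x)\<^sup>2 \<partial>M) = 2^k * nsq M (d k)" for k by (simp add: nsq_def)
    have "summable (\<lambda>k. (1/4::real)^k)" by (intro summable_geometric) simp
    moreover have "2^k * nsq M (d k) \<le> (1/4)^k" for k
    proof -
      have "2^k * nsq M (d k) \<le> 2^k * (1/8)^k" using nd[of k] by (intro mult_left_mono) auto
      also have "\<dots> = (1/4)^k" by (simp flip: power_mult_distrib)
      finally show ?thesis .
    qed
    ultimately have "summable (\<lambda>k. 2^k * nsq M (d k))"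
      by (metis (no_types, lifting) summable_comparison_test'[of "\<lambda>k. (1/4)^k" 0 "\<lambda>k. 2^k * nsq M (d k)"]
          abs_of_nonneg mult_nonneg_nonneg nsq_nonneg real_norm_def zero_le_numeral zero_le_power)
    then show "summable (\<lambda>k. \<integral>x. 2^k * (d k x)\<^sup>2 \<partial>M)" unfolding e .
  qed (use sd in \<open>auto simp: square_integrable_def\<close>)
  then have conv: "AE x in M. convergent (\<lambda>n. f (r n) x)"
  proof (rule AE_mp, intro AE_I2 impI)
    fix x assume s: "summable (\<lambda>k. 2^k * (d k x)\<^sup>2)"
    have "\<forall>\<^sub>F k in sequentially. 2^k * (d k x)\<^sup>2 < 1"
      using summable_LIMSEQ_zero[OF s] by (rule order_tendstoD) simp
    then have ev: "\<forall>\<^sub>F k in sequentially. norm (d k x) \<le> (sqrt (1/2))^k"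
    proof eventually_elim
      case (elim k)
      then have "(d k x)\<^sup>2 \<le> (1/2)^k" by (simp add: field_simps power_divide)
      then have "sqrt ((d k x)\<^sup>2) \<le> sqrt ((1/2)^k)" by (rule real_sqrt_le_mono)
      then show ?case by (metis real_norm_def real_sqrt_abs real_sqrt_power)
    qed
    have "summable (\<lambda>k. (sqrt (1/2))^k)"
      by (rule summable_geometric) (simp add: real_sqrt_divide)
    then have "summable (\<lambda>k. d k x)"
      using ev by (rule summable_comparison_test_ev[rotated])
    then have "convergent (\<lambda>n. \<Sum>k<n. d k x)" by (simp add: summable_iff_convergent)
    then have "convergent (\<lambda>n. f (r n) x - f (r 0) x)"
      unfolding d_def by (simp add: sum_lessThan_telescope[of "\<lambda>k. f (r k) x"])
    from convergent_add[OF this convergent_const[of "f (r 0) x"]]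
    show "convergent (\<lambda>n. f (r n) x)" by simp
  qed
  \<comment> \<open>The value 0 at points of divergence keeps \<open>F\<close> measurable on the
    whole space.\<close>
  define F where "F x = (if convergent (\<lambda>n. f (r n) x) then lim (\<lambda>n. f (r n) x) else 0)" for x
  have [measurable]: "Measurable.pred M (\<lambda>x. convergent (\<lambda>n. f (r n) x))"
    unfolding Cauchy_convergent_iff[symmetric] pred_def by (rule sets_Collect_Cauchy) simp
  have [measurable]: "(\<lambda>x. lim (\<lambda>n. f (r n) x)) \<in> borel_measurable M"
    by (rule borel_measurable_lim_metric) simp
  have [measurable]: "F \<in> borel_measurable M" unfolding F_def by measurable
  have AEF: "AE x in M. (\<lambda>n. f (r n) x) \<longlonglongrightarrow> F x"
    using conv by (rule AE_mp) (auto simp: F_def convergent_LIMSEQ_iff)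
  \<comment> \<open>Fatou's lemma along the subsequence, with m fixed, turns the Cauchy bound into a
    bound for the distance to the limit.\<close>
  have bound: "(\<integral>\<^sup>+x. ennreal ((f m x - F x)\<^sup>2) \<partial>M) \<le> ennreal e"
    if N: "\<forall>m\<ge>N. \<forall>n\<ge>N. nsq M (\<lambda>x. f m x - f n x) < e" and m: "m \<ge> N" for m N e
  proof -
    have "(\<integral>\<^sup>+x. ennreal ((f m x - F x)\<^sup>2) \<partial>M)
        = (\<integral>\<^sup>+x. liminf (\<lambda>n. ennreal ((f m x - f (r n) x)\<^sup>2)) \<partial>M)"
    proof (rule nn_integral_cong_AE, rule AE_mp[OF AEF], intro AE_I2 impI)
      fix x assume "(\<lambda>n. f (r n) x) \<longlonglongrightarrow> F x"
      then have "(\<lambda>n. ennreal ((f m x - f (r n) x)\<^sup>2)) \<longlonglongrightarrow> ennreal ((f m x - F x)\<^sup>2)"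
        by (intro tendsto_intros tendsto_ennrealI)
      then show "ennreal ((f m x - F x)\<^sup>2) = liminf (\<lambda>n. ennreal ((f m x - f (r n) x)\<^sup>2))"
        by (intro lim_imp_Liminf[symmetric]) auto
    qed
    also have "\<dots> \<le> liminf (\<lambda>n. \<integral>\<^sup>+x. ennreal ((f m x - f (r n) x)\<^sup>2) \<partial>M)"
      by (rule nn_integral_liminf) simp
    also have "\<dots> \<le> liminf (\<lambda>n. ennreal e)"
    proof (rule Liminf_mono)
      show "\<forall>\<^sub>F n in sequentially. (\<integral>\<^sup>+x. ennreal ((f m x - f (r n) x)\<^sup>2) \<partial>M) \<le> ennreal e"
        using eventually_ge_at_top[of N]
      proof eventually_elim
        case (elim n)
        then have "r n \<ge> N" using seq_suble[OF r(1), of n] by linarith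
        have "(\<integral>\<^sup>+x. ennreal ((f m x - f (r n) x)\<^sup>2) \<partial>M) = ennreal (nsq M (\<lambda>x. f m x - f (r n) x))"
          unfolding nsq_def using sqd by (intro nn_integral_eq_integral) (auto simp: square_integrable_def)
        then show ?case using N m \<open>r n \<ge> N\<close> by (metis ennreal_leI less_imp_le)
      qed
    qed
    finally show ?thesis by (simp add: Liminf_const)
  qed
  have sqF': "square_integrable M (\<lambda>x. f m x - F x) \<and> nsq M (\<lambda>x. f m x - F x) \<le> e"
    if N: "\<forall>m\<ge>N. \<forall>n\<ge>N. nsq M (\<lambda>x. f m x - f n x) < e" and m: "m \<ge> N" for m N e
  proof -
    have e0: "0 \<le> e" using N[rule_format, OF m m] nsq_nonneg[of M "\<lambda>x. f m x - f m x"] by linarith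
    have i: "integrable M (\<lambda>x. (f m x - F x)\<^sup>2)"
      using order.strict_trans1[OF bound[OF N m], of \<infinity>] by (intro integrableI_bounded) auto
    moreover have "nsq M (\<lambda>x. f m x - F x) \<le> e"
      unfolding nsq_def using bound[OF N m] e0
      by (subst (asm) nn_integral_eq_integral[OF i]) auto
    ultimately show ?thesis by (auto simp: square_integrable_def)
  qed
  obtain N1 where N1: "\<forall>m\<ge>N1. \<forall>n\<ge>N1. nsq M (\<lambda>x. f m x - f n x) < 1"
    using Cauchy[of 1] by auto
  have sF: "square_integrable M F"
    using square_integrable_diff[OF sq[of N1] conjunct1[OF sqF'[OF N1 order_refl]]] by simp
  moreover have "(\<lambda>n. nsq M (\<lambda>x. f n x - F x)) \<longlonglongrightarrow> 0"
  proof (rule LIMSEQ_I)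
    fix e :: real assume "0 < e"
    then obtain N where N: "\<forall>m\<ge>N. \<forall>n\<ge>N. nsq M (\<lambda>x. f m x - f n x) < e/2"
      using Cauchy[of "e/2"] by auto
    have "norm (nsq M (\<lambda>x. f n x - F x) - 0) < e" if "n \<ge> N" for n
      using sqF'[OF N that] \<open>0 < e\<close> by auto
    then show "\<exists>no. \<forall>n\<ge>no. norm (nsq M (\<lambda>x. f n x - F x) - 0) < e" by blast
  qed
  ultimately show ?thesis using that[of F r] r(1) AEF by blast
qed

section \<open>Convex combinations of tails\<close>

definition conv_weights :: "nat \<Rightarrow> (nat \<Rightarrow> real) \<Rightarrow> nat \<Rightarrow> bool" where
  "conv_weights n l N \<longleftrightarrow>
     (\<forall>k. 0 \<le> l k) \<and> (\<forall>k<n. l k = 0) \<and> (\<forall>k\<ge>N. l k = 0) \<and> (\<Sum>k<N. l k) = 1"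

text \<open>The bound \<open>N\<close> need not be the exact end of the support: combinations over
  different ranges become comparable once both are extended to a common range.\<close>

lemma conv_weights_extend:
  assumes "conv_weights n l N" "N \<le> N'"
  shows "(\<Sum>k<N'. l k * a k) = (\<Sum>k<N. l k * (a k :: real))"
  using assms by (intro sum.mono_neutral_right) (auto simp: conv_weights_def)

lemma conv_weights_mono: "conv_weights m l N \<Longrightarrow> n \<le> m \<Longrightarrow> conv_weights n l N"
  by (auto simp: conv_weights_def)

lemma weighted_mean_bound:
  assumes w: "conv_weights n l N" and a: "\<And>k. n \<le> k \<Longrightarrow> \<bar>a k - c\<bar> \<le> (e::real)"
  shows "\<bar>(\<Sum>k<N. l k * a k) - c\<bar> \<le> e"
proof -
  have s: "(\<Sum>k<N. l k) = 1" and nn: "\<And>k. 0 \<le> l k" and z: "\<And>k. k < n \<Longrightarrow> l k = 0"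
    using w by (auto simp: conv_weights_def)
  have "(\<Sum>k<N. l k * a k) - c = (\<Sum>k<N. l k * (a k - c))"
    by (simp add: right_diff_distrib sum_subtractf sum_distrib_right[symmetric] s)
  also have "\<bar>\<dots>\<bar> \<le> (\<Sum>k<N. \<bar>l k * (a k - c)\<bar>)" by (rule sum_abs)
  also have "\<dots> \<le> (\<Sum>k<N. l k * e)"
  proof (rule sum_mono)
    fix k show "\<bar>l k * (a k - c)\<bar> \<le> l k * e"
      using nn[of k] z[of k] a[of k] by (cases "k < n") (auto simp: abs_mult intro!: mult_left_mono)
  qed
  also have "\<dots> = e" by (simp add: sum_distrib_right[symmetric] s)
  finally show ?thesis .
qed

lemma weighted_mean_tendsto:
  assumes w: "\<And>n. conv_weights n (l n) (N n)" and a: "a \<longlonglongrightarrow> (c::real)"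
  shows "(\<lambda>n. \<Sum>k<N n. l n k * a k) \<longlonglongrightarrow> c"
proof (rule LIMSEQ_I)
  fix e :: real assume "0 < e"
  then obtain n0 where n0: "\<And>n. n \<ge> n0 \<Longrightarrow> \<bar>a n - c\<bar> < e/2"
    using LIMSEQ_D[OF a, of "e/2"] by auto
  have "\<bar>(\<Sum>k<N n. l n k * a k) - c\<bar> \<le> e/2" if "n \<ge> n0" for n
    by (rule weighted_mean_bound[OF w]) (use n0 that in \<open>auto intro!: less_imp_le\<close>)
  then show "\<exists>no. \<forall>n\<ge>no. norm ((\<Sum>k<N n. l n k * a k) - c) < e"
    using \<open>0 < e\<close> by (intro exI[of _ n0]) fastforce
qed

text \<open>Jensen's inequality for the square, obtained from the nonnegativity of the variance
  about the mean m.\<close>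

lemma weighted_mean_square_le:
  assumes w: "conv_weights n l N"
  shows "((\<Sum>k<N. l k * a k) - c)\<^sup>2 \<le> (\<Sum>k<N. l k * (a k - (c::real))\<^sup>2)"
proof -
  have s: "(\<Sum>k<N. l k) = 1" and nn: "\<And>k. 0 \<le> l k" using w by (auto simp: conv_weights_def)
  define m where "m = (\<Sum>k<N. l k * (a k - c))"
  have m: "m = (\<Sum>k<N. l k * a k) - c"
    by (simp add: m_def right_diff_distrib sum_subtractf sum_distrib_right[symmetric] s)
  have "0 \<le> (\<Sum>k<N. l k * ((a k - c) - m)\<^sup>2)" by (intro sum_nonneg mult_nonneg_nonneg nn) auto
  also have "\<dots> = (\<Sum>k<N. l k * (a k - c)\<^sup>2 - 2 * m * (l k * (a k - c)) + m\<^sup>2 * l k)"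
    by (intro sum.cong) (auto simp: power2_eq_square algebra_simps)
  also have "\<dots> = (\<Sum>k<N. l k * (a k - c)\<^sup>2) - 2 * m * m + m\<^sup>2"
    by (simp only: sum.distrib sum_subtractf sum_distrib_left[symmetric] s m_def[symmetric] mult_1_right)
  finally show ?thesis by (simp add: m[symmetric] power2_eq_square)
qed

lemma nsq_weighted_mean_le:
  assumes w: "conv_weights n l N" and f: "\<And>k. square_integrable M (f k)" and g: "square_integrable M g"
    and b: "\<And>k. n \<le> k \<Longrightarrow> nsq M (\<lambda>x. f k x - g x) \<le> e"
  shows "nsq M (\<lambda>x. (\<Sum>k<N. l k * f k x) - g x) \<le> e"
proof -
  have d: "square_integrable M (\<lambda>x. f k x - g x)" for k by (intro square_integrable_diff f g)
  have s: "(\<Sum>k<N. l k) = 1" and nn: "\<And>k. 0 \<le> l k" and z: "\<And>k. k < n \<Longrightarrow> l k = 0"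
    using w by (auto simp: conv_weights_def)
  have "nsq M (\<lambda>x. (\<Sum>k<N. l k * f k x) - g x) \<le> (\<integral>x. (\<Sum>k<N. l k * (f k x - g x)\<^sup>2) \<partial>M)"
    unfolding nsq_def
  proof (rule integral_mono)
    show "integrable M (\<lambda>x. ((\<Sum>k<N. l k * f k x) - g x)\<^sup>2)"
      using square_integrable_diff[OF square_integrable_sum[where I = "{..<N}" and c = l and f = f, OF f] g]
      by (simp add: square_integrable_def)
    show "integrable M (\<lambda>x. \<Sum>k<N. l k * (f k x - g x)\<^sup>2)"
      using d by (auto simp: square_integrable_def)
  qed (rule weighted_mean_square_le[OF w])
  also have "\<dots> = (\<Sum>k<N. l k * nsq M (\<lambda>x. f k x - g x))"
    unfolding nsq_def using d by (subst Bochner_Integration.integral_sum) (auto simp: square_integrable_def)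
  also have "\<dots> \<le> (\<Sum>k<N. l k * e)"
  proof (rule sum_mono)
    fix k show "l k * nsq M (\<lambda>x. f k x - g x) \<le> l k * e"
      using nn[of k] z[of k] b[of k] by (cases "k < n") (auto intro!: mult_left_mono)
  qed
  also have "\<dots> = e" by (simp add: sum_distrib_right[symmetric] s)
  finally show ?thesis .
qed

text \<open>A substitute for weak compactness: elements of almost minimal norm in the convex hulls of the
  tails form a Cauchy sequence by the parallelogram law.\<close>

lemma convex_combinations_Cauchy:
  fixes f :: "nat \<Rightarrow> 'a \<Rightarrow> real" and g :: "nat \<Rightarrow> 'b \<Rightarrow> real"
  assumes f: "\<And>k. square_integrable M1 (f k)" and g: "\<And>k. square_integrable M2 (g k)"
    and fB: "\<And>k. nsq M1 (f k) \<le> B" and gB: "\<And>k. nsq M2 (g k) \<le> B"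
  obtains l N where "\<forall>n. conv_weights n (l n) (N n)"
    "\<forall>e>0. \<exists>n0. \<forall>m\<ge>n0. \<forall>n\<ge>n0.
        nsq M1 (\<lambda>x. (\<Sum>k<N m. l m k * f k x) - (\<Sum>k<N n. l n k * f k x)) +
        nsq M2 (\<lambda>x. (\<Sum>k<N m. l m k * g k x) - (\<Sum>k<N n. l n k * g k x)) < e"
proof -
  \<comment> \<open>The sum of the two squared norms is a squared norm in the product space, so that
    the same weights are almost optimal for both families.\<close>
  define Q where "Q l N = nsq M1 (\<lambda>x. \<Sum>k<N. l k * f k x) + nsq M2 (\<lambda>x. \<Sum>k<N. l k * g k x)"
    for l and N :: nat
  define S where "S n = {Q l N |l N. conv_weights n l N}" for n
  define d where "d n = Inf (S n)" for n
  have Qext: "Q l N' = Q l N" if "conv_weights n l N" "N \<le> N'" for n l N N'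
    unfolding Q_def using conv_weights_extend[OF that] by simp
  have bdd: "bdd_below (S n)" for n
    by (rule bdd_belowI[of _ 0]) (auto simp: S_def Q_def)
  have unit: "conv_weights n (\<lambda>k. if k = n then 1 else 0) (Suc n)" for n
    by (auto simp: conv_weights_def)
  have "Q (\<lambda>k. if k = n then 1 else 0) (Suc n) \<le> 2 * B" for n
    using fB[of n] gB[of n] by (simp add: Q_def if_distrib cong: if_cong)
  then have dB: "d n \<le> 2 * B" for n
    unfolding d_def by (intro cInf_lower2[OF _ _ bdd]) (use unit in \<open>auto simp: S_def\<close>)
  have ne: "S n \<noteq> {}" for n using unit[of n] by (auto simp: S_def)
  have "S m \<subseteq> S n" if "n \<le> m" for m n
    using conv_weights_mono that unfolding S_def by blast
  then have "incseq d" unfolding d_def incseq_def by (intro allI impI cInf_superset_mono ne bdd) auto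
  then obtain L where "d \<longlonglongrightarrow> L" using incseq_convergent[of d "2 * B"] dB by blast
  then have "Cauchy d" by (rule LIMSEQ_imp_Cauchy)
  have "\<exists>l N. conv_weights n l N \<and> Q l N < d n + 1 / real (Suc n)" for n
  proof -
    have "\<exists>q\<in>S n. q < d n + 1 / real (Suc n)"
      unfolding d_def by (intro cInf_lessD ne) simp
    then show ?thesis by (auto simp: S_def)
  qed
  then obtain l N where w: "\<And>n. conv_weights n (l n) (N n)" and Q: "\<And>n. Q (l n) (N n) < d n + 1 / real (Suc n)"
    by metis
  define D where "D m n = nsq M1 (\<lambda>x. (\<Sum>k<N m. l m k * f k x) - (\<Sum>k<N n. l n k * f k x)) +
        nsq M2 (\<lambda>x. (\<Sum>k<N m. l m k * g k x) - (\<Sum>k<N n. l n k * g k x))" for m n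
  \<comment> \<open>The midpoint of the two combinations still uses only indices from n on, so its
    value of \<open>Q\<close> is at least \<open>d n\<close>; the parallelogram identity turns this
    into a bound for the distance.\<close>
  have key: "D m n \<le> 2 * (d m - d n) + 2 / real (Suc m) + 2 / real (Suc n)" if "n \<le> m" for m n
  proof -
    define K where "K = max (N m) (N n)"
    define l' where "l' k = (l m k + l n k) / 2" for k
    have Km: "N m \<le> K" and Kn: "N n \<le> K" by (auto simp: K_def)
    have "(\<Sum>k<K. l m k) = 1" "(\<Sum>k<K. l n k) = 1"
      using conv_weights_extend[OF w[of m] Km, of "\<lambda>_. 1"] conv_weights_extend[OF w[of n] Kn, of "\<lambda>_. 1"]
        w[of m] w[of n] by (auto simp: conv_weights_def)
    then have "conv_weights n l' K"
      using w[of m] w[of n] that Km Kn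
      unfolding conv_weights_def l'_def by (auto simp: sum.distrib simp flip: sum_divide_distrib)
    then have "d n \<le> Q l' K" unfolding d_def by (intro cInf_lower bdd) (auto simp: S_def)
    have l': "(\<Sum>k<K. l' k * a k) = ((\<Sum>k<N m. l m k * a k) + (\<Sum>k<N n. l n k * a k)) / 2" for a :: "nat \<Rightarrow> real"
      unfolding conv_weights_extend[OF w Km, symmetric] conv_weights_extend[OF w Kn, symmetric]
        sum.distrib[symmetric] sum_divide_distrib by (simp add: l'_def algebra_simps)
    have "Q l' K + D m n / 4 = (Q (l m) (N m) + Q (l n) (N n)) / 2"
      unfolding Q_def D_def l'
      using parallelogram_nsq[OF square_integrable_sum[where I = "{..<N m}" and c = "l m" and f = f, OF f] square_integrable_sum[where I = "{..<N n}" and c = "l n" and f = f, OF f]]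
        parallelogram_nsq[OF square_integrable_sum[where I = "{..<N m}" and c = "l m" and f = g, OF g] square_integrable_sum[where I = "{..<N n}" and c = "l n" and f = g, OF g]]
      by argo
    then show ?thesis using Q[of m] Q[of n] \<open>d n \<le> Q l' K\<close> by argo
  qed
  have "\<exists>n0. \<forall>m\<ge>n0. \<forall>n\<ge>n0. D m n < e" if "e > 0" for e
  proof -
    have "0 < e / 8" using that by simp
    obtain n1 where n1: "\<forall>m\<ge>n1. \<forall>n\<ge>n1. dist (d m) (d n) < e / 8"
      using metric_CauchyD[OF \<open>Cauchy d\<close> \<open>0 < e / 8\<close>] by blast
    obtain n2 where n2: "1 / real (Suc n2) < e / 8"
      using reals_Archimedean[OF \<open>0 < e / 8\<close>] unfolding inverse_eq_divide by blast
    have "1 / real (Suc m) < e / 8" if "m \<ge> n2" for m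
      using n2 that by (intro order.strict_trans1[OF _ n2]) (auto simp: frac_le)
    note inv = this
    have *: "D m n < e" if "m \<ge> max n1 n2" "n \<ge> max n1 n2" "n \<le> m" for m n
    proof -
      have "d m - d n < e / 8" using n1[rule_format, of m n] that unfolding dist_real_def by linarith
      moreover have "2 / real (Suc m) < e / 4" "2 / real (Suc n) < e / 4" using inv[of m] inv[of n] that by auto
      ultimately show ?thesis using key[OF \<open>n \<le> m\<close>] \<open>e > 0\<close> by argo
    qed
    have "D m n = D n m" for m n
      unfolding D_def by (intro arg_cong2[of _ _ _ _ "(+)"] nsq_minus_commute)
    then show ?thesis using * by (intro exI[of _ "max n1 n2"]) (metis nle_le)
  qed
  then show ?thesis using w by (intro that[of l N]) (auto simp: D_def)
qed

lemma Cauchy_sum_split: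
  fixes a b :: "nat \<Rightarrow> nat \<Rightarrow> real"
  assumes "\<exists>n0. \<forall>m\<ge>n0. \<forall>n\<ge>n0. a m n + b m n < e" "\<And>m n. 0 \<le> a m n" "\<And>m n. 0 \<le> b m n"
  shows "\<exists>n0. \<forall>m\<ge>n0. \<forall>n\<ge>n0. a m n < e" "\<exists>n0. \<forall>m\<ge>n0. \<forall>n\<ge>n0. b m n < e"
proof -
  obtain n0 where n0: "\<And>m n. m \<ge> n0 \<Longrightarrow> n \<ge> n0 \<Longrightarrow> a m n + b m n < e" using assms(1) by blast
  have "a m n < e \<and> b m n < e" if "m \<ge> n0" "n \<ge> n0" for m n
    using n0[OF that] assms(2,3)[of m n] by linarith
  then show "\<exists>n0. \<forall>m\<ge>n0. \<forall>n\<ge>n0. a m n < e" "\<exists>n0. \<forall>m\<ge>n0. \<forall>n\<ge>n0. b m n < e" by blast+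
qed

text \<open>The Cauchy property is fed into \<open>L2_complete\<close> twice. The second time it is
  applied along the first subsequence, so that both almost everywhere limits hold for one composed
  reindexing; the weights still start beyond n because a subsequence outruns its index.\<close>

lemma convex_combinations_converge:
  fixes f :: "nat \<Rightarrow> 'a \<Rightarrow> real" and g :: "nat \<Rightarrow> 'b \<Rightarrow> real"
  assumes f: "\<And>k. square_integrable M1 (f k)" and g: "\<And>k. square_integrable M2 (g k)"
    and fB: "\<And>k. nsq M1 (f k) \<le> B" and gB: "\<And>k. nsq M2 (g k) \<le> B"
  obtains l N F G where "\<And>n. conv_weights n (l n) (N n)"
    "square_integrable M1 F" "square_integrable M2 G"
    "AE x in M1. (\<lambda>n. \<Sum>k<N n. l n k * f k x) \<longlonglongrightarrow> F x"
    "AE x in M2. (\<lambda>n. \<Sum>k<N n. l n k * g k x) \<longlonglongrightarrow> G x"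
    "(\<lambda>n. nsq M1 (\<lambda>x. (\<Sum>k<N n. l n k * f k x) - F x)) \<longlonglongrightarrow> 0"
    "(\<lambda>n. nsq M2 (\<lambda>x. (\<Sum>k<N n. l n k * g k x) - G x)) \<longlonglongrightarrow> 0"
proof -
  obtain l N where w: "\<forall>n. conv_weights n (l n) (N n)"
    and C: "\<forall>e>0. \<exists>n0. \<forall>m\<ge>n0. \<forall>n\<ge>n0.
        nsq M1 (\<lambda>x. (\<Sum>k<N m. l m k * f k x) - (\<Sum>k<N n. l n k * f k x)) +
        nsq M2 (\<lambda>x. (\<Sum>k<N m. l m k * g k x) - (\<Sum>k<N n. l n k * g k x)) < e"
    by (rule convex_combinations_Cauchy[where f = f and g = g, OF f g fB gB])
  have C1: "\<exists>n0. \<forall>m\<ge>n0. \<forall>n\<ge>n0. nsq M1 (\<lambda>x. (\<Sum>k<N m. l m k * f k x) - (\<Sum>k<N n. l n k * f k x)) < e"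
    if "e > 0" for e
    by (rule Cauchy_sum_split(1)[OF C[rule_format, OF that]]) simp_all
  have C2: "\<exists>n0. \<forall>m\<ge>n0. \<forall>n\<ge>n0. nsq M2 (\<lambda>x. (\<Sum>k<N m. l m k * g k x) - (\<Sum>k<N n. l n k * g k x)) < e"
    if "e > 0" for e
    by (rule Cauchy_sum_split(2)[OF C[rule_format, OF that]]) simp_all
  obtain F r where F: "square_integrable M1 F" "strict_mono r"
    "AE x in M1. (\<lambda>n. \<Sum>k<N (r n). l (r n) k * f k x) \<longlonglongrightarrow> F x"
    "(\<lambda>n. nsq M1 (\<lambda>x. (\<Sum>k<N n. l n k * f k x) - F x)) \<longlonglongrightarrow> 0"
    by (rule L2_complete[OF square_integrable_sum[where f = f, OF f] C1])
  have C2': "\<exists>n0. \<forall>m\<ge>n0. \<forall>n\<ge>n0. nsq M2 (\<lambda>x. (\<Sum>k<N (r m). l (r m) k * g k x) - (\<Sum>k<N (r n). l (r n) k * g k x)) < e"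
    if "e > 0" for e
    using C2[OF that] seq_suble[OF F(2)] by (meson order.trans)
  obtain G r' where G: "square_integrable M2 G" "strict_mono r'"
    "AE x in M2. (\<lambda>n. \<Sum>k<N (r (r' n)). l (r (r' n)) k * g k x) \<longlonglongrightarrow> G x"
    "(\<lambda>n. nsq M2 (\<lambda>x. (\<Sum>k<N (r n). l (r n) k * g k x) - G x)) \<longlonglongrightarrow> 0"
    by (rule L2_complete[OF square_integrable_sum[where f = g, OF g] C2'])
  have rr: "strict_mono (r \<circ> r')" using F(2) G(2) by (rule strict_mono_o)
  show ?thesis
  proof (rule that[where l = "l \<circ> (r \<circ> r')" and N = "N \<circ> (r \<circ> r')"])
    show "conv_weights n ((l \<circ> (r \<circ> r')) n) ((N \<circ> (r \<circ> r')) n)" for n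
      using conv_weights_mono[OF w[rule_format] seq_suble[OF rr]] by simp
    show "AE x in M1. (\<lambda>n. \<Sum>k<(N \<circ> (r \<circ> r')) n. (l \<circ> (r \<circ> r')) n k * f k x) \<longlonglongrightarrow> F x"
    proof (rule AE_mp[OF F(3)], intro AE_I2 impI)
      fix x assume "(\<lambda>n. \<Sum>k<N (r n). l (r n) k * f k x) \<longlonglongrightarrow> F x"
      from LIMSEQ_subseq_LIMSEQ[OF this G(2)]
      show "(\<lambda>n. \<Sum>k<(N \<circ> (r \<circ> r')) n. (l \<circ> (r \<circ> r')) n k * f k x) \<longlonglongrightarrow> F x" by (simp add: o_def)
    qed
    show "(\<lambda>n. nsq M1 (\<lambda>x. (\<Sum>k<(N \<circ> (r \<circ> r')) n. (l \<circ> (r \<circ> r')) n k * f k x) - F x)) \<longlonglongrightarrow> 0"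
      using LIMSEQ_subseq_LIMSEQ[OF F(4) rr] by (simp add: o_def)
    show "(\<lambda>n. nsq M2 (\<lambda>x. (\<Sum>k<(N \<circ> (r \<circ> r')) n. (l \<circ> (r \<circ> r')) n k * g k x) - G x)) \<longlonglongrightarrow> 0"
      using LIMSEQ_subseq_LIMSEQ[OF G(4,2)] by (simp add: o_def)
  qed (use F G in \<open>auto simp: o_def\<close>)
qed

section \<open>Equi-integrability from higher moments\<close>

lemma truncation_inequality:
  fixes a R \<kappa> q :: real
  assumes "0 < R" "\<kappa> \<le> q"
  shows "\<bar>a\<bar> powr \<kappa> \<le> (min \<bar>a\<bar> R) powr \<kappa> + R powr (\<kappa> - q) * \<bar>a\<bar> powr q"
proof (cases "\<bar>a\<bar> \<le> R")
  case False
  then have a: "\<bar>a\<bar> > R" "\<bar>a\<bar> > 0" using assms by auto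
  have "\<bar>a\<bar> powr \<kappa> = \<bar>a\<bar> powr (\<kappa> - q) * \<bar>a\<bar> powr q" by (simp flip: powr_add)
  also have "\<dots> \<le> R powr (\<kappa> - q) * \<bar>a\<bar> powr q"
    using a assms by (intro mult_right_mono powr_mono2') auto
  finally show ?thesis by (simp add: add_increasing)
qed (auto simp: min_absorb1)

text \<open>On a set of finite measure the truncations at height R converge by dominated
  convergence, and the part above R costs at most R^(2 - q) times the q-th moment, uniformly in
  n.\<close>

lemma Vitali_L2:
  assumes f[measurable]: "\<And>n. f n \<in> borel_measurable M"
    and lim: "AE x in M. (\<lambda>n. f n x) \<longlonglongrightarrow> 0"
    and A[measurable]: "A \<in> sets M" "emeasure M A < \<infinity>" and off: "\<And>n x. x \<notin> A \<Longrightarrow> f n x = 0"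
    and q: "2 < q" and B: "\<And>n. (\<integral>\<^sup>+x. ennreal (\<bar>f n x\<bar> powr q) \<partial>M) \<le> ennreal B"
  shows "square_integrable M (f n)" "(\<lambda>n. nsq M (f n)) \<longlonglongrightarrow> 0"
proof -
  \<comment> \<open>\<open>ennreal\<close> sends negative reals to 0, so the real bound that can be
    extracted from the hypothesis is \<open>max B 0\<close>.\<close>
  have B0: "0 \<le> max B 0" "ennreal B = ennreal (max B 0)" by (auto simp: max_def ennreal_neg)
  have iq: "integrable M (\<lambda>x. \<bar>f n x\<bar> powr q)" for n
    using order.strict_trans1[OF B[of n], of \<infinity>] by (intro integrableI_bounded) auto
  have Bq: "(\<integral>x. \<bar>f n x\<bar> powr q \<partial>M) \<le> max B 0" for n
    using B[of n] B0 by (subst (asm) nn_integral_eq_integral[OF iq]) auto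
  have p2: "\<bar>a\<bar> powr 2 = a\<^sup>2" for a :: real by simp
  have iA: "integrable M (indicator A :: _ \<Rightarrow> real)" using A by (simp add: integrable_indicator_iff)
  have imin: "integrable M (\<lambda>x. (min \<bar>f n x\<bar> R)\<^sup>2)" if "R > 0" for n R
  proof (rule Bochner_Integration.integrable_bound)
    show "integrable M (\<lambda>x. R\<^sup>2 * indicator A x)" using iA by simp
    show "AE x in M. norm ((min \<bar>f n x\<bar> R)\<^sup>2) \<le> norm (R\<^sup>2 * indicator A x)"
      using that off by (auto simp: indicator_def intro!: power_mono)
  qed simp
  have pw: "(f n x)\<^sup>2 \<le> (min \<bar>f n x\<bar> R)\<^sup>2 + R powr (2 - q) * \<bar>f n x\<bar> powr q" if "R > 0" for n x R
    using truncation_inequality[OF that, of 2 q "f n x"] q that by simp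
  show sq: "square_integrable M (f n)" for n
    unfolding square_integrable_def
  proof
    show "integrable M (\<lambda>x. (f n x)\<^sup>2)"
    proof (rule Bochner_Integration.integrable_bound)
      show "integrable M (\<lambda>x. (min \<bar>f n x\<bar> 1)\<^sup>2 + 1 powr (2 - q) * \<bar>f n x\<bar> powr q)"
        using imin[of 1] iq by (intro Bochner_Integration.integrable_add integrable_mult_right) auto
      show "AE x in M. norm ((f n x)\<^sup>2) \<le> norm ((min \<bar>f n x\<bar> 1)\<^sup>2 + 1 powr (2 - q) * \<bar>f n x\<bar> powr q)"
        using pw[of 1 n] by (auto intro!: order.trans[OF _ abs_ge_self])
    qed simp
  qed simp
  have lim0: "(\<lambda>n. \<integral>x. (min \<bar>f n x\<bar> R)\<^sup>2 \<partial>M) \<longlonglongrightarrow> (\<integral>x. 0 \<partial>M)" if R: "R > 0" for R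
  proof (rule integral_dominated_convergence)
    show "integrable M (\<lambda>x. R\<^sup>2 * indicator A x)" using iA by simp
    show "AE x in M. norm ((min \<bar>f n x\<bar> R)\<^sup>2) \<le> R\<^sup>2 * indicator A x" for n
      using R off by (auto simp: indicator_def intro!: power_mono)
    show "AE x in M. (\<lambda>n. (min \<bar>f n x\<bar> R)\<^sup>2) \<longlonglongrightarrow> 0"
    proof (rule AE_mp[OF lim], intro AE_I2 impI)
      fix x assume "(\<lambda>n. f n x) \<longlonglongrightarrow> 0"
      then have "(\<lambda>n. (min \<bar>f n x\<bar> R)\<^sup>2) \<longlonglongrightarrow> (min \<bar>0\<bar> R)\<^sup>2" by (intro tendsto_intros)
      then show "(\<lambda>n. (min \<bar>f n x\<bar> R)\<^sup>2) \<longlonglongrightarrow> 0" using R by simp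
    qed
  qed auto
  have le: "nsq M (f n) \<le> (\<integral>x. (min \<bar>f n x\<bar> R)\<^sup>2 \<partial>M) + R powr (2 - q) * max B 0" if "R > 0" for n R
  proof -
    have "nsq M (f n) \<le> (\<integral>x. (min \<bar>f n x\<bar> R)\<^sup>2 + R powr (2 - q) * \<bar>f n x\<bar> powr q \<partial>M)"
      unfolding nsq_def using pw[OF that] imin[OF that] iq sq
      by (intro integral_mono Bochner_Integration.integrable_add integrable_mult_right) (auto simp: square_integrable_def)
    also have "\<dots> = (\<integral>x. (min \<bar>f n x\<bar> R)\<^sup>2 \<partial>M) + R powr (2 - q) * (\<integral>x. \<bar>f n x\<bar> powr q \<partial>M)"
      using imin[OF that] iq by simp
    also have "\<dots> \<le> (\<integral>x. (min \<bar>f n x\<bar> R)\<^sup>2 \<partial>M) + R powr (2 - q) * max B 0"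
      using Bq by (intro add_left_mono mult_left_mono) auto
    finally show ?thesis .
  qed
  show "(\<lambda>n. nsq M (f n)) \<longlonglongrightarrow> 0"
  proof (rule LIMSEQ_I)
    fix e :: real assume "0 < e"
    have "((\<lambda>R. R powr (2 - q) * max B 0) \<longlongrightarrow> 0 * max B 0) at_top"
      using q by (intro tendsto_intros tendsto_neg_powr filterlim_ident) auto
    then have "\<forall>\<^sub>F R in at_top. R powr (2 - q) * max B 0 < e / 2"
      using \<open>0 < e\<close> by (intro order_tendstoD(2)[of _ 0]) auto
    then have "\<forall>\<^sub>F R in at_top. R powr (2 - q) * max B 0 < e / 2 \<and> R > 0"
      using eventually_gt_at_top by (rule eventually_conj)
    then obtain R where R: "R > 0" "R powr (2 - q) * max B 0 < e / 2"
      by (auto simp: eventually_at_top_linorder)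
    obtain no where no: "\<And>n. n \<ge> no \<Longrightarrow> (\<integral>x. (min \<bar>f n x\<bar> R)\<^sup>2 \<partial>M) < e / 2"
      using LIMSEQ_D[OF lim0[OF R(1)], of "e/2"] \<open>0 < e\<close> by (auto simp: abs_less_iff)
    have "norm (nsq M (f n) - 0) < e" if "n \<ge> no" for n
      using le[OF R(1), of n] no[OF that] R(2) by simp
    then show "\<exists>no. \<forall>n\<ge>no. norm (nsq M (f n) - 0) < e" by blast
  qed
qed

section \<open>The fractional seminorm in dimension one\<close>

lemma measurable_fst_borel [measurable]: "(fst :: 'a::second_countable_topology \<times> 'b::second_countable_topology \<Rightarrow> 'a) \<in> borel_measurable borel"
  by (intro borel_measurable_continuous_onI continuous_intros)

lemma measurable_snd_borel [measurable]: "(snd :: 'a::second_countable_topology \<times> 'b::second_countable_topology \<Rightarrow> 'b) \<in> borel_measurable borel"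
  by (intro borel_measurable_continuous_onI continuous_intros)

lemma nn_integral_lborel_iterated:
  fixes f :: "'a::euclidean_space \<times> 'b::euclidean_space \<Rightarrow> ennreal"
  assumes "f \<in> borel_measurable borel"
  shows "(\<integral>\<^sup>+z. f z \<partial>lborel) = (\<integral>\<^sup>+x. \<integral>\<^sup>+y. f (x, y) \<partial>lborel \<partial>lborel)"
proof -
  have "f \<in> borel_measurable (lborel \<Otimes>\<^sub>M lborel)" using assms by (simp add: lborel_prod)
  then show ?thesis by (subst lborel.nn_integral_fst) (simp_all add: lborel_prod)
qed

locale fractional_domain =
  fixes \<Omega> :: "'a::euclidean_space set" and s :: real
  assumes dim: "DIM('a) = 1" and s: "0 < s" "s < 1"
    and open_dom: "open \<Omega>" and bounded_dom: "bounded \<Omega>"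
begin

text \<open>The exponent is N + s with N = 1. The value on the diagonal is 1 / 0 = 0.\<close>

definition K :: "'a \<times> 'a \<Rightarrow> real" where
  "K z = 1 / norm (fst z - snd z) powr (1 + s)"

text \<open>For functions that vanish off \<Omega> the integral over all pairs equals the one over
  \<open>Qset \<Omega>\<close>. Values in \<open>ennreal\<close> allow lower semicontinuity to be
  used before finiteness is known.\<close>

definition J :: "('a \<Rightarrow> real) \<Rightarrow> ennreal" where
  "J u = (\<integral>\<^sup>+z. ennreal (\<bar>u (fst z) - u (snd z)\<bar> * K z) \<partial>lborel)"

definition X :: "('a \<Rightarrow> real) set" where
  "X = {u \<in> borel_measurable borel. \<forall>x. x \<notin> \<Omega> \<longrightarrow> u x = 0}"

lemma K_measurable [measurable]: "K \<in> borel_measurable borel"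
  unfolding K_def by measurable

lemma K_nonneg [simp]: "0 \<le> K z" by (simp add: K_def)

lemma dom_measurable [measurable]: "\<Omega> \<in> sets borel" using open_dom by simp

lemma X_measurable [measurable_dest]: "u \<in> X \<Longrightarrow> u \<in> borel_measurable borel"
  by (simp add: X_def)

lemma X_off: "u \<in> X \<Longrightarrow> x \<notin> \<Omega> \<Longrightarrow> u x = 0"
  by (simp add: X_def)

lemma X_diff: "u \<in> X \<Longrightarrow> v \<in> X \<Longrightarrow> (\<lambda>x. u x - v x) \<in> X"
  by (auto simp: X_def)

lemma dom_finite: "emeasure lborel \<Omega> < \<infinity>"
  using emeasure_bounded_finite[OF bounded_dom] .

lemma emeasure_ball_dim1: "0 \<le> R \<Longrightarrow> emeasure lborel (ball (x :: 'a) R) = ennreal (2 * R)"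
  by (simp add: emeasure_ball dim unit_ball_vol_1)

text \<open>A ball of radius \<open>m\<close> has measure \<open>2m\<close>, so at least half of it lies outside \<open>A\<close>.\<close>

lemma kernel_outside_ge:
  assumes [measurable]: "A \<in> sets borel" and m: "0 < m" "emeasure lborel A \<le> ennreal m"
  shows "ennreal (m powr (-s)) \<le> (\<integral>\<^sup>+y. indicator (-A) y * ennreal (K (x, y)) \<partial>lborel)"
proof -
  \<comment> \<open>The centre is removed because \<open>K (x, x) = 0\<close>.\<close>
  let ?B = "ball x m - (A \<union> {x})"
  have "ennreal (2 * m) = emeasure lborel (ball x m)" using m by (simp add: emeasure_ball_dim1)
  also have "\<dots> \<le> emeasure lborel ((A \<union> {x}) \<union> ?B)" by (intro emeasure_mono) auto
  also have "\<dots> \<le> emeasure lborel (A \<union> {x}) + emeasure lborel ?B"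
    by (intro emeasure_subadditive) auto
  also have "emeasure lborel (A \<union> {x}) \<le> emeasure lborel A + emeasure lborel {x}"
    by (intro emeasure_subadditive) auto
  also have "\<dots> \<le> ennreal m" using m by simp
  finally have "ennreal m + ennreal m \<le> ennreal m + emeasure lborel ?B"
    using m by (simp add: ennreal_plus[symmetric] del: ennreal_plus)
  then have B: "ennreal m \<le> emeasure lborel ?B" by (simp add: ennreal_add_left_cancel_le)
  \<comment> \<open>Smallest kernel value on the ball times the measure m of the surviving
    half.\<close>
  have "ennreal (m powr (-s)) = ennreal (m powr (-(1+s))) * ennreal m"
    using m by (simp flip: ennreal_mult powr_add add: powr_mult_base[symmetric] mult.commute)
       (metis add.commute add_diff_cancel_left' diff_minus_eq_add minus_diff_eq powr_mult_base less_imp_le)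
  also have "\<dots> \<le> ennreal (m powr (-(1+s))) * emeasure lborel ?B" using B by (rule mult_left_mono) simp
  also have "\<dots> = (\<integral>\<^sup>+y. ennreal (m powr (-(1+s))) * indicator ?B y \<partial>lborel)"
    by (subst nn_integral_cmult_indicator) auto
  also have "\<dots> \<le> (\<integral>\<^sup>+y. indicator (-A) y * ennreal (K (x, y)) \<partial>lborel)"
  proof (rule nn_integral_mono)
    fix y
    have "m powr (-(1+s)) \<le> K (x, y)" if "y \<in> ?B"
    proof -
      have "0 < norm (x - y)" "norm (x - y) \<le> m" using that by (auto simp: dist_norm)
      then have "norm (x - y) powr (1 + s) \<le> m powr (1 + s)" using s by (intro powr_mono2) auto
      then show ?thesis using \<open>0 < norm (x - y)\<close> m
        unfolding K_def powr_minus_divide by (intro frac_le) auto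
    qed
    then show "ennreal (m powr (-(1+s))) * indicator ?B y \<le> indicator (-A) y * ennreal (K (x, y))"
      by (auto simp: indicator_def intro: ennreal_leI)
  qed
  finally show ?thesis .
qed

section \<open>Weak-type Sobolev inequality\<close>

definition dist_fun :: "('a \<Rightarrow> real) \<Rightarrow> real \<Rightarrow> real" where
  "dist_fun u c = measure lborel {x. c < \<bar>u x\<bar>}"

lemma dist_fun_emeasure:
  assumes "u \<in> X" "0 \<le> c"
  shows "emeasure lborel {x. c < \<bar>u x\<bar>} = ennreal (dist_fun u c)"
    and "dist_fun u c \<le> measure lborel \<Omega>"
proof -
  note [measurable] = X_measurable[OF assms(1)]
  have sub: "{x. c < \<bar>u x\<bar>} \<subseteq> \<Omega>" using assms X_off by fastforce
  have m: "{x. c < \<bar>u x\<bar>} \<in> sets lborel" by measurable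
  have "emeasure lborel {x. c < \<bar>u x\<bar>} \<le> emeasure lborel \<Omega>" using sub by (intro emeasure_mono) auto
  then have "emeasure lborel {x. c < \<bar>u x\<bar>} \<noteq> \<infinity>" using dom_finite by (auto simp: top_unique)
  then show "emeasure lborel {x. c < \<bar>u x\<bar>} = ennreal (dist_fun u c)"
    unfolding dist_fun_def by (intro emeasure_eq_ennreal_measure) simp
  show "dist_fun u c \<le> measure lborel \<Omega>"
    unfolding dist_fun_def using sub m dom_finite
    by (intro measure_mono_fmeasurable) (auto simp: fmeasurable_def)
qed

lemma dist_fun_nonneg [simp]: "0 \<le> dist_fun u c" by (simp add: dist_fun_def)

lemma dist_fun_antimono:
  assumes "u \<in> X" "0 \<le> c" "c \<le> c'"
  shows "dist_fun u c' \<le> dist_fun u c"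
proof -
  note [measurable] = X_measurable[OF assms(1)]
  have m: "{x. c < \<bar>u x\<bar>} \<in> sets lborel" by measurable
  have "ennreal (dist_fun u c') \<le> ennreal (dist_fun u c)"
    using assms m by (subst (1 2) dist_fun_emeasure(1)[symmetric]) (auto intro!: emeasure_mono)
  then show ?thesis by simp
qed

text \<open>The kernel mass between \<open>{\<bar>u\<bar> > 2c}\<close> and \<open>{\<bar>u\<bar> \<le> c}\<close> is at most \<open>J u/c\<close>. Iterating over dyadic levels
  gives the weak-type Sobolev inequality.\<close>

lemma dist_fun_doubling:
  assumes u: "u \<in> X" and J: "J u \<le> ennreal M" "0 \<le> M" and c: "0 < c"
  shows "c * dist_fun u (2 * c) \<le> M * dist_fun u c powr s"
proof (cases "dist_fun u c = 0")
  case True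
  then show ?thesis using dist_fun_antimono[OF u, of c "2*c"] c dist_fun_nonneg[of u "2 * c"]
    by (auto simp: antisym mult_le_0_iff)
next
  case False
  then have pos: "0 < dist_fun u c" using dist_fun_nonneg[of u c] by linarith
  note [measurable] = X_measurable[OF u]
  let ?A = "{x. 2 * c < \<bar>u x\<bar>}" and ?B = "{x. c < \<bar>u x\<bar>}"
  have [measurable]: "?A \<in> sets borel" "?B \<in> sets borel" by measurable
  have "ennreal (c * dist_fun u c powr (-s)) * ennreal (dist_fun u (2 * c))
      = (\<integral>\<^sup>+x. ennreal (c * dist_fun u c powr (-s)) * indicator ?A x \<partial>lborel)"
    using c by (subst nn_integral_cmult_indicator) (auto simp: dist_fun_emeasure[OF u])
  also have "\<dots> \<le> (\<integral>\<^sup>+x. \<integral>\<^sup>+y. ennreal (\<bar>u x - u y\<bar> * K (x, y)) \<partial>lborel \<partial>lborel)"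
  proof (rule nn_integral_mono)
    fix x
    show "ennreal (c * dist_fun u c powr (-s)) * indicator ?A x
        \<le> (\<integral>\<^sup>+y. ennreal (\<bar>u x - u y\<bar> * K (x, y)) \<partial>lborel)"
    proof (cases "x \<in> ?A")
      case True
      have "ennreal (c * dist_fun u c powr (-s)) = ennreal c * ennreal (dist_fun u c powr (-s))"
        using c by (simp add: ennreal_mult)
      also have "\<dots> \<le> ennreal c * (\<integral>\<^sup>+y. indicator (-?B) y * ennreal (K (x, y)) \<partial>lborel)"
        using pos c by (intro mult_left_mono kernel_outside_ge) (auto simp: dist_fun_emeasure[OF u])
      also have "\<dots> = (\<integral>\<^sup>+y. ennreal c * (indicator (-?B) y * ennreal (K (x, y))) \<partial>lborel)"
        by (subst nn_integral_cmult) auto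
      also have "\<dots> \<le> (\<integral>\<^sup>+y. ennreal (\<bar>u x - u y\<bar> * K (x, y)) \<partial>lborel)"
      proof (rule nn_integral_mono)
        fix y
        have "c \<le> \<bar>u x - u y\<bar>" if "y \<in> -?B" using True that by auto
        then show "ennreal c * (indicator (-?B) y * ennreal (K (x, y))) \<le> ennreal (\<bar>u x - u y\<bar> * K (x, y))"
          using c by (auto simp: indicator_def ennreal_mult[symmetric] intro!: ennreal_leI mult_right_mono)
      qed
      finally show ?thesis using True by simp
    qed simp
  qed
  also have "\<dots> = J u" unfolding J_def by (subst nn_integral_lborel_iterated) auto
  also note J(1)
  finally have "c * dist_fun u c powr (-s) * dist_fun u (2 * c) \<le> M"
    using c J(2) by (simp add: ennreal_mult[symmetric])
  then have "(c * dist_fun u c powr (-s) * dist_fun u (2 * c)) * dist_fun u c powr s \<le> M * dist_fun u c powr s"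
    by (rule mult_right_mono) simp
  moreover have "(c * dist_fun u c powr (-s) * dist_fun u (2 * c)) * dist_fun u c powr s
      = c * dist_fun u (2 * c) * (dist_fun u c powr (-s) * dist_fun u c powr s)" by (simp only: mult_ac)
  moreover have "dist_fun u c powr (-s) * dist_fun u c powr s = 1"
    using pos by (simp flip: powr_add)
  ultimately show ?thesis by simp
qed

text \<open>The critical exponent N / (N - s) for N = 1.\<close>

definition pstar :: real where "pstar = 1 / (1 - s)"

lemma pstar: "pstar > 1" "pstar = 1 + pstar * s" "pstar * (1 - s) = 1"
  using s by (auto simp: pstar_def field_simps)

text \<open>The first entry of the maximum starts the induction at level 1. The second is the least
  D > 0 with M D^s \<le> D 2^(-\<open>pstar\<close>), the condition under which the induction step
  reproduces the bound (for M > 0).\<close>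

definition weak_const :: "real \<Rightarrow> real" where
  "weak_const M = max (measure lborel \<Omega>) ((M * 2 powr pstar) powr pstar)"

lemma weak_const_nonneg: "0 \<le> weak_const M"
  by (simp add: weak_const_def max_def)

text \<open>Induction over dyadic levels by the doubling inequality. The decay rate reproduces
  itself because \<open>pstar\<close> = 1 + \<open>pstar\<close> * s.\<close>

lemma weak_type_bound:
  assumes u: "u \<in> X" and J: "J u \<le> ennreal M" "0 \<le> M"
  shows "dist_fun u (2 ^ k) \<le> weak_const M * 2 powr (- pstar * real k)"
proof (induction k)
  case 0
  show ?case using dist_fun_emeasure(2)[OF u, of 1] by (auto simp: weak_const_def)
next
  case (Suc k)
  let ?D = "weak_const M"
  have D: "M * ?D powr s \<le> ?D * 2 powr (-pstar)"
  proof (cases "?D = 0")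
    case False
    then have pos: "0 < ?D" using weak_const_nonneg[of M] by linarith
    have "M * 2 powr pstar = ((M * 2 powr pstar) powr pstar) powr (1 - s)"
      using J(2) pstar by (simp add: powr_powr)
    also have "\<dots> \<le> ?D powr (1 - s)" using s by (intro powr_mono2) (auto simp: weak_const_def)
    finally have "M * 2 powr pstar * (?D powr s * 2 powr (-pstar)) \<le> ?D powr (1 - s) * (?D powr s * 2 powr (-pstar))"
      by (rule mult_right_mono) simp
    moreover have "?D powr (1 - s) * ?D powr s = ?D" using pos by (simp flip: powr_add)
    moreover have "2 powr pstar * 2 powr (-pstar) = (1::real)" by (simp flip: powr_add)
    moreover have "M * 2 powr pstar * (?D powr s * 2 powr (-pstar)) = M * ?D powr s * (2 powr pstar * 2 powr (-pstar))"
      "?D powr (1 - s) * (?D powr s * 2 powr (-pstar)) = ?D powr (1 - s) * ?D powr s * 2 powr (-pstar)"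
      by (simp_all only: mult_ac)
    ultimately show ?thesis by simp
  qed simp
  have "2 ^ k * dist_fun u (2 ^ Suc k) \<le> M * dist_fun u (2 ^ k) powr s"
    using dist_fun_doubling[OF u J, of "2 ^ k"] by simp
  also have "\<dots> \<le> M * (?D * 2 powr (- pstar * real k)) powr s"
    using Suc s J(2) by (intro mult_left_mono powr_mono2) auto
  also have "\<dots> = (M * ?D powr s) * 2 powr (- pstar * real k * s)"
    by (simp add: powr_mult powr_powr weak_const_nonneg)
  also have "\<dots> \<le> (?D * 2 powr (-pstar)) * 2 powr (- pstar * real k * s)"
    by (rule mult_right_mono[OF D]) simp
  finally have "(2 ^ k * dist_fun u (2 ^ Suc k)) * 2 powr (- real k)
      \<le> (?D * 2 powr (-pstar)) * 2 powr (- pstar * real k * s) * 2 powr (- real k)"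
    by (rule mult_right_mono) simp
  moreover have "(2 ^ k * dist_fun u (2 ^ Suc k)) * 2 powr (- real k) = dist_fun u (2 ^ Suc k)"
    by (simp add: powr_minus powr_realpow)
  moreover have "(?D * 2 powr (-pstar)) * 2 powr (- pstar * real k * s) * 2 powr (- real k)
      = ?D * 2 powr (- pstar * real (Suc k))"
  proof -
    have "(- pstar) + (- pstar * real k * s) + (- real k) = - pstar - real k * (1 + pstar * s)"
      by (simp add: algebra_simps)
    also have "\<dots> = - pstar * real (Suc k)" using pstar(2) by (simp add: algebra_simps)
    finally show ?thesis by (simp only: mult.assoc powr_add[symmetric] add.assoc[symmetric])
  qed
  ultimately show ?case by (simp only:)
qed

section \<open>Subcritical embeddings\<close>

lemma powr_le_dyadic_sum:
  assumes "0 \<le> q"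
  shows "ennreal (\<bar>a\<bar> powr q) \<le> 1 + (\<Sum>k. ennreal (2 powr (q * real (Suc k))) * indicator {a. 2 ^ k < \<bar>a\<bar>} a)"
proof (cases "\<bar>a\<bar> \<le> 1")
  case True
  then have "\<bar>a\<bar> powr q \<le> 1" using assms by (simp add: powr_le1)
  then have "ennreal (\<bar>a\<bar> powr q) \<le> ennreal 1" by (rule ennreal_leI)
  then show ?thesis by (simp add: add_increasing2)
next
  case False
  obtain n where n: "\<bar>a\<bar> < 2 ^ n" using real_arch_pow[of 2 "\<bar>a\<bar>"] by auto
  \<comment> \<open>The least k with |a| \<le> 2^(k+1). Minimality, or |a| > 1 when k = 0, gives 2^k
    < |a|, so the k-th term alone dominates.\<close>
  define k where "k = (LEAST k. \<bar>a\<bar> \<le> 2 ^ Suc k)"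
  have "\<bar>a\<bar> \<le> 2 ^ Suc n" using n by (simp add: field_simps)
  then have k: "\<bar>a\<bar> \<le> 2 ^ Suc k" unfolding k_def by (rule LeastI)
  have "2 ^ k < \<bar>a\<bar>"
  proof (cases k)
    case (Suc k')
    then have "\<not> \<bar>a\<bar> \<le> 2 ^ Suc k'" using not_less_Least[of k' "\<lambda>k. \<bar>a\<bar> \<le> 2 ^ Suc k"] k_def by auto
    then show ?thesis using Suc by simp
  qed (use False in simp)
  have "\<bar>a\<bar> powr q \<le> (2 ^ Suc k) powr q" using k assms by (intro powr_mono2) auto
  also have "(2 ^ Suc k) powr q = (2 powr real (Suc k)) powr q" by (simp only: powr_realpow zero_less_numeral)
  also have "\<dots> = 2 powr (q * real (Suc k))" by (simp only: powr_powr mult.commute)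
  finally have "ennreal (\<bar>a\<bar> powr q) \<le> ennreal (2 powr (q * real (Suc k))) * indicator {a. 2 ^ k < \<bar>a\<bar>} a"
    using \<open>2 ^ k < \<bar>a\<bar>\<close> by (simp add: ennreal_leI)
  also have "\<dots> \<le> (\<Sum>k. ennreal (2 powr (q * real (Suc k))) * indicator {a. 2 ^ k < \<bar>a\<bar>} a)"
    (is "?t k \<le> _")
  proof -
    have "sum ?t {k} \<le> suminf ?t" by (rule sum_le_suminf) auto
    then show ?thesis by (simp only: sum.insert[OF finite.emptyI] sum.empty empty_iff not_False_eq_True add_0_right)
  qed
  finally show ?thesis by (simp add: add_increasing)
qed

text \<open>Summing the weak-type bound over dyadic levels gives a geometric series with ratio 2^(q
  - \<open>pstar\<close>); strict subcriticality of q is what makes it converge. The bound depends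
  on u only through M.\<close>

lemma subcritical_embedding:
  assumes q: "0 < q" "q < pstar" and M: "0 \<le> M"
  obtains B where "0 \<le> B" "\<And>u. u \<in> X \<Longrightarrow> J u \<le> ennreal M \<Longrightarrow> (\<integral>\<^sup>+x. ennreal (\<bar>u x\<bar> powr q) \<partial>lborel) \<le> ennreal B"
proof -
  define a where "a k = 2 powr (q * real (Suc k)) * (weak_const M * 2 powr (- pstar * real k))" for k
  have a0: "0 \<le> a k" for k by (simp add: a_def weak_const_nonneg)
  have aeq: "a k = (2 powr q * weak_const M) * (2 powr (q - pstar)) ^ k" for k
  proof -
    have "2 powr (q * real (Suc k)) * 2 powr (- pstar * real k) = 2 powr q * 2 powr ((q - pstar) * real k)"
      by (simp add: algebra_simps flip: powr_add)
    moreover have "2 powr ((q - pstar) * real k) = (2 powr (q - pstar)) ^ k"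
      by (simp flip: powr_powr powr_realpow)
    ultimately show ?thesis by (simp add: a_def mult_ac)
  qed
  have "norm (2 powr (q - pstar)) < (1::real)"
    using q powr_less_mono[of "q - pstar" 0 2] by simp
  then have sm: "summable a" unfolding aeq by (intro summable_mult summable_geometric)
  define B where "B = measure lborel \<Omega> + (\<Sum>k. a k)"
  have "0 \<le> B" unfolding B_def by (intro add_nonneg_nonneg suminf_nonneg sm a0) auto
  moreover have "(\<integral>\<^sup>+x. ennreal (\<bar>u x\<bar> powr q) \<partial>lborel) \<le> ennreal B" if u: "u \<in> X" and Ju: "J u \<le> ennreal M" for u
  proof -
    note [measurable] = X_measurable[OF u]
    have "(\<integral>\<^sup>+x. ennreal (\<bar>u x\<bar> powr q) \<partial>lborel)
       \<le> (\<integral>\<^sup>+x. indicator \<Omega> x + (\<Sum>k. ennreal (2 powr (q * real (Suc k))) * indicator {x. 2 ^ k < \<bar>u x\<bar>} x) \<partial>lborel)"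
    proof (rule nn_integral_mono)
      fix x
      show "ennreal (\<bar>u x\<bar> powr q) \<le> indicator \<Omega> x + (\<Sum>k. ennreal (2 powr (q * real (Suc k))) * indicator {x. 2 ^ k < \<bar>u x\<bar>} x)"
        using powr_le_dyadic_sum[of q "u x"] q X_off[OF u, of x]
        by (cases "x \<in> \<Omega>") (auto simp: indicator_def)
    qed
    also have "\<dots> = emeasure lborel \<Omega> + (\<Sum>k. \<integral>\<^sup>+x. ennreal (2 powr (q * real (Suc k))) * indicator {x. 2 ^ k < \<bar>u x\<bar>} x \<partial>lborel)"
      by (subst nn_integral_add) (auto simp: nn_integral_suminf)
    also have "\<dots> \<le> emeasure lborel \<Omega> + (\<Sum>k. ennreal (a k))"
    proof (intro add_left_mono suminf_le summableI)
      fix k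
      have [measurable]: "{x. 2 ^ k < \<bar>u x\<bar>} \<in> sets borel" by measurable
      have "(\<integral>\<^sup>+x. ennreal (2 powr (q * real (Suc k))) * indicator {x. 2 ^ k < \<bar>u x\<bar>} x \<partial>lborel)
         = ennreal (2 powr (q * real (Suc k)) * dist_fun u (2 ^ k))"
        by (subst nn_integral_cmult_indicator) (auto simp: dist_fun_emeasure[OF u] ennreal_mult)
      also have "\<dots> \<le> ennreal (a k)"
        unfolding a_def by (intro ennreal_leI mult_left_mono weak_type_bound u Ju M) auto
      finally show "(\<integral>\<^sup>+x. ennreal (2 powr (q * real (Suc k))) * indicator {x. 2 ^ k < \<bar>u x\<bar>} x \<partial>lborel) \<le> ennreal (a k)" .
    qed
    also have "\<dots> = ennreal B"
      using dom_finite suminf_nonneg[OF sm a0]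
      by (simp add: suminf_ennreal2[OF a0 sm] B_def emeasure_eq_ennreal_measure)
    finally show ?thesis .
  qed
  ultimately show ?thesis using that by blast
qed

text \<open>Truncation at height R with an exponent q between \<kappa> and \<open>pstar\<close>: the
  part above R is small uniformly on the sublevel set, and the rest is controlled by R^(\<kappa> -
  1) times the L1 norm.\<close>

lemma interpolation_to_zero:
  assumes \<kappa>: "1 \<le> \<kappa>" "\<kappa> < pstar" and M: "0 \<le> M" and e: "0 < e"
  obtains \<delta> where "0 < \<delta>" "\<And>u. u \<in> X \<Longrightarrow> J u \<le> ennreal M \<Longrightarrow> (\<integral>\<^sup>+x. ennreal \<bar>u x\<bar> \<partial>lborel) \<le> ennreal \<delta> \<Longrightarrow>
      (\<integral>\<^sup>+x. ennreal (\<bar>u x\<bar> powr \<kappa>) \<partial>lborel) \<le> ennreal e"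
proof -
  obtain q where q: "\<kappa> < q" "q < pstar" using dense[OF \<kappa>(2)] by blast
  then have "0 < q" using \<kappa> by simp
  obtain B where B: "0 \<le> B" "\<And>u. u \<in> X \<Longrightarrow> J u \<le> ennreal M \<Longrightarrow> (\<integral>\<^sup>+x. ennreal (\<bar>u x\<bar> powr q) \<partial>lborel) \<le> ennreal B"
    by (rule subcritical_embedding[OF \<open>0 < q\<close> q(2) M]) blast
  have "((\<lambda>R. R powr (\<kappa> - q) * B) \<longlongrightarrow> 0 * B) at_top"
    using q by (intro tendsto_intros tendsto_neg_powr filterlim_ident) auto
  then have "\<forall>\<^sub>F R in at_top. R powr (\<kappa> - q) * B < e / 2"
    using e by (intro order_tendstoD(2)[of _ 0]) auto
  then have "\<forall>\<^sub>F R in at_top. R powr (\<kappa> - q) * B < e / 2 \<and> R > 0"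
    using eventually_gt_at_top by (rule eventually_conj)
  then obtain R where R: "R > 0" "R powr (\<kappa> - q) * B < e / 2"
    by (auto simp: eventually_at_top_linorder)
  \<comment> \<open>R is already fixed by the tail; this value makes the lower part contribute
    exactly e / 2.\<close>
  define \<delta> where "\<delta> = e / (2 * R powr (\<kappa> - 1))"
  have "0 < \<delta>" using e R by (simp add: \<delta>_def)
  moreover have "(\<integral>\<^sup>+x. ennreal (\<bar>u x\<bar> powr \<kappa>) \<partial>lborel) \<le> ennreal e"
    if u: "u \<in> X" and Ju: "J u \<le> ennreal M" and small: "(\<integral>\<^sup>+x. ennreal \<bar>u x\<bar> \<partial>lborel) \<le> ennreal \<delta>" for u
  proof -
    note [measurable] = X_measurable[OF u]
    have pw: "\<bar>a\<bar> powr \<kappa> \<le> R powr (\<kappa> - 1) * \<bar>a\<bar> + R powr (\<kappa> - q) * \<bar>a\<bar> powr q" for a :: real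
    proof -
      have "(min \<bar>a\<bar> R) powr \<kappa> \<le> R powr (\<kappa> - 1) * \<bar>a\<bar>"
      proof (cases "a = 0")
        case False
        then have m: "0 < min \<bar>a\<bar> R" using R by auto
        then have "(min \<bar>a\<bar> R) powr \<kappa> = (min \<bar>a\<bar> R) powr (\<kappa> - 1) * min \<bar>a\<bar> R"
          by (simp add: powr_diff)
        also have "\<dots> \<le> R powr (\<kappa> - 1) * \<bar>a\<bar>"
          using m \<kappa> by (intro mult_mono powr_mono2) auto
        finally show ?thesis .
      qed (use R in auto)
      then show ?thesis using truncation_inequality[OF R(1), of \<kappa> q a] q by linarith
    qed
    have "(\<integral>\<^sup>+x. ennreal (\<bar>u x\<bar> powr \<kappa>) \<partial>lborel)
        \<le> (\<integral>\<^sup>+x. ennreal (R powr (\<kappa> - 1)) * ennreal \<bar>u x\<bar> + ennreal (R powr (\<kappa> - q)) * ennreal (\<bar>u x\<bar> powr q) \<partial>lborel)"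
      using pw by (intro nn_integral_mono) (simp add: ennreal_leI flip: ennreal_mult ennreal_plus)
    also have "\<dots> = ennreal (R powr (\<kappa> - 1)) * (\<integral>\<^sup>+x. ennreal \<bar>u x\<bar> \<partial>lborel) + ennreal (R powr (\<kappa> - q)) * (\<integral>\<^sup>+x. ennreal (\<bar>u x\<bar> powr q) \<partial>lborel)"
      by (simp add: nn_integral_add nn_integral_cmult)
    also have "\<dots> \<le> ennreal (R powr (\<kappa> - 1)) * ennreal \<delta> + ennreal (R powr (\<kappa> - q)) * ennreal B"
      using small B(2)[OF u Ju] by (intro add_mono mult_left_mono) auto
    also have "\<dots> = ennreal (R powr (\<kappa> - 1) * \<delta> + R powr (\<kappa> - q) * B)"
      using B(1) \<open>0 < \<delta>\<close> by (simp add: ennreal_mult)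
    also have "\<dots> \<le> ennreal e"
      using R by (intro ennreal_leI) (simp add: \<delta>_def)
    finally show ?thesis .
  qed
  ultimately show ?thesis using that by blast
qed

section \<open>Dyadic cells and compactness\<close>

definition dir :: 'a where "dir = (SOME b. b \<in> Basis)"

lemma Basis_eq: "Basis = {dir}"
proof -
  obtain b :: 'a where b: "Basis = {b}" using dim card_1_singletonE by metis
  have "dir = b" unfolding dir_def b by simp
  then show ?thesis using b by simp
qed

lemma norm_dim1: "norm (x :: 'a) = \<bar>x \<bullet> dir\<bar>"
proof -
  have "norm x = norm (\<Sum>b\<in>Basis. (x \<bullet> b) *\<^sub>R b)" by (simp add: euclidean_representation)
  also have "\<dots> = \<bar>x \<bullet> dir\<bar> * norm dir" by (simp add: Basis_eq)
  also have "norm dir = 1" by (rule norm_Basis) (simp add: Basis_eq)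
  finally show ?thesis by simp
qed

text \<open>Dyadic intervals of length 2^-i in the only coordinate, half-open so that each point
  lies in exactly one of them and its index is a floor.\<close>

definition cell :: "nat \<Rightarrow> int \<Rightarrow> 'a set" where
  "cell i k = {x. of_int k \<le> 2 ^ i * (x \<bullet> dir) \<and> 2 ^ i * (x \<bullet> dir) < of_int k + 1}"

definition cells :: "nat \<Rightarrow> int set" where
  "cells i = {k. cell i k \<inter> \<Omega> \<noteq> {}}"

lemma cell_measurable [measurable]: "cell i k \<in> sets borel"
  unfolding cell_def by measurable

lemma cell_times_measurable [measurable]: "cell i k \<times> cell i k \<in> sets borel"
  by (simp flip: borel_prod)

lemma cell_iff: "x \<in> cell i k \<longleftrightarrow> k = \<lfloor>2 ^ i * (x \<bullet> dir)\<rfloor>"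
  unfolding cell_def mem_Collect_eq by linarith

lemma finite_cells: "finite (cells i)"
proof -
  obtain R where R: "\<And>x. x \<in> \<Omega> \<Longrightarrow> norm x \<le> R" using bounded_dom unfolding bounded_iff by blast
  have "cells i \<subseteq> {\<lfloor>- (2 ^ i * R)\<rfloor>..\<lfloor>2 ^ i * R\<rfloor>}"
  proof
    fix k assume "k \<in> cells i"
    then obtain x where "x \<in> \<Omega>" "x \<in> cell i k" by (auto simp: cells_def)
    then have x: "x \<in> \<Omega>" "k = \<lfloor>2 ^ i * (x \<bullet> dir)\<rfloor>" by (simp_all add: cell_iff)
    have b: "\<bar>x \<bullet> dir\<bar> \<le> R" using R[OF x(1)] by (simp add: norm_dim1)
    have "2 ^ i * (x \<bullet> dir) \<le> 2 ^ i * R" using b by (intro mult_left_mono) auto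
    moreover have "2 ^ i * (- R) \<le> 2 ^ i * (x \<bullet> dir)" using b by (intro mult_left_mono) auto
    ultimately show "k \<in> {\<lfloor>- (2 ^ i * R)\<rfloor>..\<lfloor>2 ^ i * R\<rfloor>}" unfolding x(2) by (auto intro!: floor_mono)
  qed
  then show ?thesis by (rule finite_subset) simp
qed

lemma emeasure_cell: "emeasure lborel (cell i k) = ennreal (1 / 2 ^ i)"
proof (rule antisym)
  let ?l = "(of_int k / 2 ^ i) *\<^sub>R dir" and ?u = "((of_int k + 1) / 2 ^ i) *\<^sub>R dir"
  have dd: "dir \<bullet> dir = 1" using Basis_eq by (metis insertI1 inner_same_Basis)
  have d: "?u \<bullet> dir - ?l \<bullet> dir = 1 / 2 ^ i" by (simp add: dd diff_divide_distrib[symmetric])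
  have le: "?l \<bullet> dir \<le> ?u \<bullet> dir" by (simp add: dd divide_right_mono)
  have "cell i k \<subseteq> cbox ?l ?u"
    by (auto simp: cell_def mem_box Basis_eq dd field_simps)
  then have "emeasure lborel (cell i k) \<le> emeasure lborel (cbox ?l ?u)" by (intro emeasure_mono) auto
  also have "\<dots> = ennreal (1 / 2 ^ i)"
    using d le by (subst emeasure_lborel_cbox) (auto simp: Basis_eq inner_diff_left)
  finally show "emeasure lborel (cell i k) \<le> ennreal (1 / 2 ^ i)" .
  have "box ?l ?u \<subseteq> cell i k"
    by (auto simp: cell_def mem_box Basis_eq dd field_simps)
  then have "emeasure lborel (box ?l ?u) \<le> emeasure lborel (cell i k)" by (intro emeasure_mono) auto
  moreover have "emeasure lborel (box ?l ?u) = ennreal (1 / 2 ^ i)"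
    using d le by (subst emeasure_lborel_box) (auto simp: Basis_eq inner_diff_left)
  ultimately show "ennreal (1 / 2 ^ i) \<le> emeasure lborel (cell i k)" by simp
qed

text \<open>Two distinct points of one cell are at most 2^-i apart, so the kernel between them is at
  least (2^-i)^(-(1+s)).\<close>

lemma cell_kernel:
  assumes "x \<in> cell i k" "y \<in> cell i k"
  shows "\<bar>u x - u y\<bar> \<le> (1 / 2 ^ i) powr (1 + s) * (\<bar>u x - u y\<bar> * K (x, y))"
proof (cases "x = y")
  case False
  have "\<bar>2 ^ i * (x \<bullet> dir) - 2 ^ i * (y \<bullet> dir)\<bar> \<le> 1" using assms unfolding cell_def by auto
  moreover have "2 ^ i * (x \<bullet> dir) - 2 ^ i * (y \<bullet> dir) = 2 ^ i * ((x - y) \<bullet> dir)"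
    by (simp add: inner_diff_left right_diff_distrib)
  ultimately have "2 ^ i * norm (x - y) \<le> 1" by (simp add: norm_dim1 abs_mult)
  then have "norm (x - y) \<le> 1 / 2 ^ i" by (simp add: field_simps)
  then have "norm (x - y) powr (1 + s) \<le> (1 / 2 ^ i) powr (1 + s)" using s by (intro powr_mono2) auto
  then have "1 \<le> (1 / 2 ^ i) powr (1 + s) * K (x, y)" using False by (simp add: K_def)
  then have "\<bar>u x - u y\<bar> * 1 \<le> \<bar>u x - u y\<bar> * ((1 / 2 ^ i) powr (1 + s) * K (x, y))"
    by (intro mult_left_mono) auto
  then show ?thesis by (simp add: mult_ac)
qed simp

text \<open>A Poincare inequality. With h the length of the cell, averaging u(x) - u(y) over y gives
  h |u(x)| \<le> |integral of u| + integral of |u(x) - u(y)|. Integration in x and the kernel bound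
  produce h^(1+s), of which one factor h cancels and h^s remains as the gain.\<close>

lemma Poincare_cell:
  assumes [measurable]: "u \<in> borel_measurable borel" and int: "integrable lborel u"
  shows "(\<integral>\<^sup>+x. indicator (cell i k) x * ennreal \<bar>u x\<bar> \<partial>lborel) \<le>
     ennreal \<bar>\<integral>x. indicator (cell i k) x * u x \<partial>lborel\<bar> +
     ennreal ((1 / 2 ^ i) powr s) * (\<integral>\<^sup>+z. indicator (cell i k \<times> cell i k) z * ennreal (\<bar>u (fst z) - u (snd z)\<bar> * K z) \<partial>lborel)"
proof -
  let ?C = "cell i k" and ?h = "1 / 2 ^ i :: real"
  let ?a = "\<integral>x. indicator ?C x * u x \<partial>lborel"
  let ?I = "\<integral>\<^sup>+z. indicator (?C \<times> ?C) z * ennreal (\<bar>u (fst z) - u (snd z)\<bar> * K z) \<partial>lborel"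
  have iC: "integrable lborel (\<lambda>y. indicator ?C y * u y)"
    using integrable_mult_indicator[of ?C lborel u] int by (simp add: mult.commute)
  have mC: "measure lborel ?C = ?h" using emeasure_cell[of i k] by (simp add: measure_def)
  have iCc: "integrable lborel (\<lambda>y. indicator ?C y * c)" for c :: real
    using emeasure_cell[of i k] by (simp add: integrable_indicator_iff)
  have pw: "ennreal ?h * ennreal \<bar>u x\<bar> \<le> ennreal \<bar>?a\<bar> + (\<integral>\<^sup>+y. indicator ?C y * ennreal \<bar>u x - u y\<bar> \<partial>lborel)" for x
  proof -
    have id: "integrable lborel (\<lambda>y. indicator ?C y * (u x - u y))"
      using iC iCc[of "u x"] by (simp add: right_diff_distrib)
    have "(LBINT y. indicator ?C y * (u x - u y)) = ?h * u x - ?a"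
      using iC iCc[of "u x"] mC by (simp add: right_diff_distrib)
    then have "?h * \<bar>u x\<bar> \<le> \<bar>?a\<bar> + \<bar>\<integral>y. indicator ?C y * (u x - u y) \<partial>lborel\<bar>"
      by (simp add: abs_if split: if_splits)
    also have "\<bar>\<integral>y. indicator ?C y * (u x - u y) \<partial>lborel\<bar> \<le> (LBINT y. \<bar>indicator ?C y * (u x - u y)\<bar>)"
      by (rule integral_abs_bound)
    finally have "ennreal (?h * \<bar>u x\<bar>) \<le> ennreal (\<bar>?a\<bar> + (LBINT y. \<bar>indicator ?C y * (u x - u y)\<bar>))"
      by (intro ennreal_leI) simp
    also have "\<dots> = ennreal \<bar>?a\<bar> + (\<integral>\<^sup>+y. ennreal \<bar>indicator ?C y * (u x - u y)\<bar> \<partial>lborel)"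
      using id by (simp add: nn_integral_eq_integral)
    also have "(\<integral>\<^sup>+y. ennreal \<bar>indicator ?C y * (u x - u y)\<bar> \<partial>lborel) = (\<integral>\<^sup>+y. indicator ?C y * ennreal \<bar>u x - u y\<bar> \<partial>lborel)"
      by (intro nn_integral_cong) (auto simp: indicator_def)
    finally show ?thesis by (simp add: ennreal_mult[symmetric])
  qed
  have "ennreal ?h * (\<integral>\<^sup>+x. indicator ?C x * ennreal \<bar>u x\<bar> \<partial>lborel)
      = (\<integral>\<^sup>+x. indicator ?C x * (ennreal ?h * ennreal \<bar>u x\<bar>) \<partial>lborel)"
    by (subst nn_integral_cmult[symmetric]) (auto intro!: nn_integral_cong simp: mult_ac)
  also have "\<dots> \<le> (\<integral>\<^sup>+x. indicator ?C x * (ennreal \<bar>?a\<bar> + (\<integral>\<^sup>+y. indicator ?C y * ennreal \<bar>u x - u y\<bar> \<partial>lborel)) \<partial>lborel)"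
    by (intro nn_integral_mono mult_left_mono pw) auto
  also have "\<dots> = (\<integral>\<^sup>+x. ennreal \<bar>?a\<bar> * indicator ?C x + (\<integral>\<^sup>+y. indicator ?C x * (indicator ?C y * ennreal \<bar>u x - u y\<bar>) \<partial>lborel) \<partial>lborel)"
    by (intro nn_integral_cong) (auto simp: distrib_left nn_integral_cmult mult.commute)
  also have "\<dots> = ennreal \<bar>?a\<bar> * ennreal ?h + (\<integral>\<^sup>+x. \<integral>\<^sup>+y. indicator ?C x * (indicator ?C y * ennreal \<bar>u x - u y\<bar>) \<partial>lborel \<partial>lborel)"
    by (subst nn_integral_add) (auto simp: nn_integral_cmult_indicator emeasure_cell)
  also have "(\<integral>\<^sup>+x. \<integral>\<^sup>+y. indicator ?C x * (indicator ?C y * ennreal \<bar>u x - u y\<bar>) \<partial>lborel \<partial>lborel)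
      = (\<integral>\<^sup>+z. indicator (?C \<times> ?C) z * ennreal \<bar>u (fst z) - u (snd z)\<bar> \<partial>lborel)"
    by (subst nn_integral_lborel_iterated) (auto intro!: nn_integral_cong simp: indicator_times mult.assoc)
  also have "\<dots> \<le> (\<integral>\<^sup>+z. ennreal (?h powr (1 + s)) * (indicator (?C \<times> ?C) z * ennreal (\<bar>u (fst z) - u (snd z)\<bar> * K z)) \<partial>lborel)"
  proof (rule nn_integral_mono)
    fix z :: "'a \<times> 'a"
    show "indicator (?C \<times> ?C) z * ennreal \<bar>u (fst z) - u (snd z)\<bar>
       \<le> ennreal (?h powr (1 + s)) * (indicator (?C \<times> ?C) z * ennreal (\<bar>u (fst z) - u (snd z)\<bar> * K z))"
      using cell_kernel[of "fst z" i k "snd z" u]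
      by (cases z) (auto simp: indicator_def ennreal_mult[symmetric] intro!: ennreal_leI)
  qed
  also have "\<dots> = ennreal (?h powr (1 + s)) * ?I"
    by (rule nn_integral_cmult) measurable
  also have "ennreal (?h powr (1 + s)) = ennreal ?h * ennreal (?h powr s)"
    by (simp add: powr_add flip: ennreal_mult)
  finally have "ennreal ?h * (\<integral>\<^sup>+x. indicator ?C x * ennreal \<bar>u x\<bar> \<partial>lborel)
      \<le> ennreal ?h * (ennreal \<bar>?a\<bar> + ennreal (?h powr s) * ?I)"
    by (simp add: distrib_left mult_ac)
  \<comment> \<open>Multiplication by 2^i = 1 / h performs the cancellation of h in
    \<open>ennreal\<close>.\<close>
  then have "ennreal (2 ^ i) * (ennreal ?h * (\<integral>\<^sup>+x. indicator ?C x * ennreal \<bar>u x\<bar> \<partial>lborel))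
      \<le> ennreal (2 ^ i) * (ennreal ?h * (ennreal \<bar>?a\<bar> + ennreal (?h powr s) * ?I))"
    by (rule mult_left_mono) simp
  moreover have "ennreal (2 ^ i) * ennreal ?h = 1" by (simp flip: ennreal_mult)
  ultimately show ?thesis by (simp only: mult.assoc[symmetric] mult_1_left)
qed

text \<open>The squares of distinct cells are disjoint, so the local seminorms add up to at most
  \<open>J u\<close>, and the factor 2^(-i s) survives the summation.\<close>

lemma L1_bound_by_cells:
  assumes u: "u \<in> X" and int: "integrable lborel u"
  shows "(\<integral>\<^sup>+x. ennreal \<bar>u x\<bar> \<partial>lborel) \<le>
     (\<Sum>k\<in>cells i. ennreal \<bar>\<integral>x. indicator (cell i k) x * u x \<partial>lborel\<bar>) + ennreal ((1 / 2 ^ i) powr s) * J u"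
proof -
  note [measurable] = X_measurable[OF u]
  have "(\<integral>\<^sup>+x. ennreal \<bar>u x\<bar> \<partial>lborel) \<le> (\<integral>\<^sup>+x. (\<Sum>k\<in>cells i. indicator (cell i k) x * ennreal \<bar>u x\<bar>) \<partial>lborel)"
  proof (rule nn_integral_mono)
    fix x
    show "ennreal \<bar>u x\<bar> \<le> (\<Sum>k\<in>cells i. indicator (cell i k) x * ennreal \<bar>u x\<bar>)"
    proof (cases "x \<in> \<Omega>")
      case True
      let ?k = "\<lfloor>2 ^ i * (x \<bullet> dir)\<rfloor>"
      have k: "x \<in> cell i ?k" by (simp add: cell_iff)
      then have "?k \<in> cells i" using True by (auto simp: cells_def)
      then have "indicator (cell i ?k) x * ennreal \<bar>u x\<bar> \<le> (\<Sum>k\<in>cells i. indicator (cell i k) x * ennreal \<bar>u x\<bar>)"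
        by (intro member_le_sum finite_cells) auto
      then show ?thesis using k by simp
    qed (simp add: X_off[OF u])
  qed
  also have "\<dots> = (\<Sum>k\<in>cells i. \<integral>\<^sup>+x. indicator (cell i k) x * ennreal \<bar>u x\<bar> \<partial>lborel)"
    by (rule nn_integral_sum) measurable
  also have "\<dots> \<le> (\<Sum>k\<in>cells i. ennreal \<bar>\<integral>x. indicator (cell i k) x * u x \<partial>lborel\<bar> +
     ennreal ((1 / 2 ^ i) powr s) * (\<integral>\<^sup>+z. indicator (cell i k \<times> cell i k) z * ennreal (\<bar>u (fst z) - u (snd z)\<bar> * K z) \<partial>lborel))"
    by (intro sum_mono Poincare_cell int) measurable
  also have "\<dots> = (\<Sum>k\<in>cells i. ennreal \<bar>\<integral>x. indicator (cell i k) x * u x \<partial>lborel\<bar>) +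
     ennreal ((1 / 2 ^ i) powr s) * (\<integral>\<^sup>+z. (\<Sum>k\<in>cells i. indicator (cell i k \<times> cell i k) z * ennreal (\<bar>u (fst z) - u (snd z)\<bar> * K z)) \<partial>lborel)"
    by (subst nn_integral_sum) (auto simp: sum.distrib sum_distrib_left)
  also have "(\<integral>\<^sup>+z. (\<Sum>k\<in>cells i. indicator (cell i k \<times> cell i k) z * ennreal (\<bar>u (fst z) - u (snd z)\<bar> * K z)) \<partial>lborel) \<le> J u"
    unfolding J_def
  proof (rule nn_integral_mono)
    fix z :: "'a \<times> 'a"
    let ?c = "ennreal (\<bar>u (fst z) - u (snd z)\<bar> * K z)" and ?k = "\<lfloor>2 ^ i * (fst z \<bullet> dir)\<rfloor>"
    have "(\<Sum>k\<in>cells i. indicator (cell i k \<times> cell i k) z * ?c) \<le> (\<Sum>k\<in>cells i. if k = ?k then ?c else 0)"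
      by (intro sum_mono) (cases z, auto simp: indicator_def cell_iff)
    also have "\<dots> \<le> ?c" using finite_cells by (simp add: sum.delta)
    finally show "(\<Sum>k\<in>cells i. indicator (cell i k \<times> cell i k) z * ?c) \<le> ?c" .
  qed
  finally show ?thesis by (simp add: add_left_mono mult_left_mono)
qed

text \<open>This is total boundedness in L1 in usable form: on a sublevel set of the seminorm
  finitely many cell integrals control the L1 norm up to e.\<close>

lemma cells_control_L1:
  assumes M: "0 \<le> M" and e: "0 < e"
  obtains i \<delta> where "0 < \<delta>" "\<And>u. u \<in> X \<Longrightarrow> integrable lborel u \<Longrightarrow> J u \<le> ennreal M \<Longrightarrow>
      (\<forall>k\<in>cells i. \<bar>\<integral>x. indicator (cell i k) x * u x \<partial>lborel\<bar> \<le> \<delta>) \<Longrightarrow> (\<integral>\<^sup>+x. ennreal \<bar>u x\<bar> \<partial>lborel) \<le> ennreal e"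
proof -
  have lim: "(\<lambda>i. (1 / 2 ^ i) powr s * M) \<longlonglongrightarrow> 0 powr s * M"
    using s by (intro tendsto_intros) (auto simp: power_one_over[symmetric] LIMSEQ_realpow_zero eventually_sequentially)
  then have "\<forall>\<^sub>F i in sequentially. (1 / 2 ^ i) powr s * M < e / 2"
    using e by (intro order_tendstoD(2)[of _ "0 powr s * M"]) auto
  then obtain i where i: "(1 / 2 ^ i) powr s * M < e / 2" by (auto simp: eventually_sequentially)
  \<comment> \<open>The summand 1 keeps the denominator positive even if there are no cells.\<close>
  define \<delta> where "\<delta> = e / (2 * (real (card (cells i)) + 1))"
  have "0 < \<delta>" using e by (simp add: \<delta>_def)
  moreover have "(\<integral>\<^sup>+x. ennreal \<bar>u x\<bar> \<partial>lborel) \<le> ennreal e"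
    if u: "u \<in> X" "integrable lborel u" "J u \<le> ennreal M"
      and a: "\<forall>k\<in>cells i. \<bar>\<integral>x. indicator (cell i k) x * u x \<partial>lborel\<bar> \<le> \<delta>" for u
  proof -
    have "(\<integral>\<^sup>+x. ennreal \<bar>u x\<bar> \<partial>lborel) \<le>
     (\<Sum>k\<in>cells i. ennreal \<bar>\<integral>x. indicator (cell i k) x * u x \<partial>lborel\<bar>) + ennreal ((1 / 2 ^ i) powr s) * J u"
      by (rule L1_bound_by_cells[OF u(1,2)])
    also have "\<dots> \<le> (\<Sum>k\<in>cells i. ennreal \<delta>) + ennreal ((1 / 2 ^ i) powr s) * ennreal M"
      using a u(3) by (intro add_mono sum_mono mult_left_mono ennreal_leI) auto
    also have "\<dots> = ennreal (real (card (cells i)) * \<delta> + (1 / 2 ^ i) powr s * M)"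
      using M \<open>0 < \<delta>\<close> by (simp add: ennreal_mult ennreal_of_nat_eq_real_of_nat)
    also have "\<dots> \<le> ennreal e"
    proof (rule ennreal_leI)
      have "real (card (cells i)) * \<delta> \<le> (real (card (cells i)) + 1) * \<delta>"
        using \<open>0 < \<delta>\<close> by (intro mult_right_mono) auto
      also have "\<dots> = e / 2" by (simp add: \<delta>_def field_simps)
      finally show "real (card (cells i)) * \<delta> + (1 / 2 ^ i) powr s * M \<le> e" using i by simp
    qed
    finally show ?thesis .
  qed
  ultimately show ?thesis using that by blast
qed

end

section \<open>Proximal minimisation of the smoothed seminorm\<close>

lemma inner_tendsto_of_nsq:
  assumes f: "\<And>n. square_integrable M (f n)" and F: "square_integrable M F" and g: "square_integrable M g"
    and lim: "(\<lambda>n. nsq M (\<lambda>x. f n x - F x)) \<longlonglongrightarrow> 0"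
  shows "(\<lambda>n. \<integral>x. f n x * g x \<partial>M) \<longlonglongrightarrow> (\<integral>x. F x * g x \<partial>M)"
proof -
  have "(\<lambda>n. sqrt (nsq M (\<lambda>x. f n x - F x)) * sqrt (nsq M g)) \<longlonglongrightarrow> sqrt 0 * sqrt (nsq M g)"
    by (intro tendsto_intros lim)
  then have lim': "(\<lambda>n. sqrt (nsq M (\<lambda>x. f n x - F x)) * sqrt (nsq M g)) \<longlonglongrightarrow> 0" by simp
  have "norm ((\<integral>x. f n x * g x \<partial>M) - (\<integral>x. F x * g x \<partial>M)) \<le> sqrt (nsq M (\<lambda>x. f n x - F x)) * sqrt (nsq M g)" for n
  proof -
    have "(\<integral>x. f n x * g x \<partial>M) - (\<integral>x. F x * g x \<partial>M) = (\<integral>x. (f n x - F x) * g x \<partial>M)"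
      using square_integrable_mult[OF f[of n] g] square_integrable_mult[OF F g]
      by (simp add: left_diff_distrib)
    then show ?thesis using Cauchy_Schwarz_nsq[OF square_integrable_diff[OF f[of n] F] g] by simp
  qed
  then have "(\<lambda>n. (\<integral>x. f n x * g x \<partial>M) - (\<integral>x. F x * g x \<partial>M)) \<longlonglongrightarrow> 0"
    by (intro Lim_null_comparison[OF _ lim'] always_eventually allI)
  then show ?thesis by (simp add: LIM_zero_iff)
qed

lemma nsq_expand:
  assumes f: "square_integrable M f" and g: "square_integrable M g"
  shows "nsq M (\<lambda>x. f x + g x) = nsq M f + 2 * (\<integral>x. f x * g x \<partial>M) + nsq M g"
proof -
  have "nsq M (\<lambda>x. f x + g x) = (\<integral>x. (f x)\<^sup>2 + 2 * (f x * g x) + (g x)\<^sup>2 \<partial>M)"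
    unfolding nsq_def by (intro Bochner_Integration.integral_cong) (auto simp: power2_sum)
  also have "\<dots> = nsq M f + 2 * (\<integral>x. f x * g x \<partial>M) + nsq M g"
    using f g square_integrable_mult[OF f g] by (simp add: square_integrable_def nsq_def)
  finally show ?thesis .
qed

lemma nsq_tendsto:
  assumes f: "\<And>n. square_integrable M (f n)" and F: "square_integrable M F"
    and lim: "(\<lambda>n. nsq M (\<lambda>x. f n x - F x)) \<longlonglongrightarrow> 0"
  shows "(\<lambda>n. nsq M (f n)) \<longlonglongrightarrow> nsq M F"
proof -
  have eq: "nsq M (f n) = nsq M (\<lambda>x. f n x - F x) + 2 * ((\<integral>x. f n x * F x \<partial>M) - nsq M F) + nsq M F" for n
  proof -
    have "nsq M (\<lambda>x. (f n x - F x) + F x)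
        = nsq M (\<lambda>x. f n x - F x) + 2 * (\<integral>x. (f n x - F x) * F x \<partial>M) + nsq M F"
      by (rule nsq_expand[OF square_integrable_diff[OF f F] F])
    moreover have "(\<integral>x. (f n x - F x) * F x \<partial>M) = (\<integral>x. f n x * F x \<partial>M) - nsq M F"
      using square_integrable_mult[OF f[of n] F] square_integrable_mult[OF F F]
      by (simp add: left_diff_distrib nsq_def power2_eq_square)
    ultimately show ?thesis by simp
  qed
  have "(\<lambda>n. \<integral>x. f n x * F x \<partial>M) \<longlonglongrightarrow> nsq M F"
    using inner_tendsto_of_nsq[where f = f, OF f F F lim] by (simp add: nsq_def power2_eq_square)
  then have "(\<lambda>n. nsq M (\<lambda>x. f n x - F x) + 2 * ((\<integral>x. f n x * F x \<partial>M) - nsq M F) + nsq M F)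
      \<longlonglongrightarrow> 0 + 2 * (nsq M F - nsq M F) + nsq M F"
    by (intro tendsto_intros lim)
  then show ?thesis unfolding eq[symmetric] by simp
qed

lemma AE_lborel_fst_snd:
  fixes P :: "'a::euclidean_space \<Rightarrow> bool"
  assumes "AE x in lborel. P x"
  shows "AE z in lborel. P (fst z) \<and> P (snd (z :: 'a \<times> 'a))"
proof -
  obtain N where N: "{x. \<not> P x} \<subseteq> N" "N \<in> null_sets lborel"
    using AE_E[OF assms] by (auto simp: null_sets_def)
  have [measurable]: "N \<in> sets borel" using N(2) by auto
  have "N \<times> (UNIV :: 'a set) \<in> null_sets (lborel \<Otimes>\<^sub>M lborel)" "(UNIV :: 'a set) \<times> N \<in> null_sets (lborel \<Otimes>\<^sub>M lborel)"
    using N(2) by (auto simp: null_sets_def lborel.emeasure_pair_measure_Times)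
  then have "N \<times> UNIV \<union> UNIV \<times> N \<in> null_sets (lborel :: ('a \<times> 'a) measure)"
    by (intro null_sets.Un) (simp_all add: lborel_prod)
  then show ?thesis by (rule AE_I') (use N(1) in auto)
qed

text \<open>The smoothed modulus of p is the Euclidean norm of the pair (p, c). The reverse triangle
  inequality bounds its increments independently of c, which later dominates the difference
  quotients of the functional.\<close>

lemma norm_pair_lipschitz: "\<bar>sqrt (p\<^sup>2 + c\<^sup>2) - sqrt (q\<^sup>2 + c\<^sup>2)\<bar> \<le> \<bar>p - q :: real\<bar>"
  using norm_triangle_ineq3[of "(p, c)" "(q, c)"] by (simp add: norm_Pair)

lemma norm_pair_midpoint: "sqrt (((p + q) / 2)\<^sup>2 + c\<^sup>2) \<le> (sqrt (p\<^sup>2 + c\<^sup>2) + sqrt (q\<^sup>2 + c\<^sup>2 :: real)) / 2"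
proof -
  have "norm ((p + q) / 2, c) = norm ((1/2) *\<^sub>R ((p, c) + (q, c)))" by simp
  also have "\<dots> = norm ((p, c) + (q, c)) / 2" unfolding norm_scaleR by simp
  also have "\<dots> \<le> (norm (p, c) + norm (q, c)) / 2" by (intro divide_right_mono norm_triangle_ineq) simp
  finally show ?thesis by (simp add: norm_Pair power_divide)
qed

text \<open>For N = 1 the condition N < 2s reads s > 1/2, and this says precisely that 2 lies below
  the critical exponent.\<close>

locale subcritical_domain = fractional_domain +
  assumes half: "1 / 2 < s"
begin

lemma pstar_gt2: "2 < pstar"
  using half s by (simp add: pstar_def field_simps)

text \<open>The Borel representatives, vanishing everywhere outside \<open>\<Omega>\<close>, of the elements of \<open>W\<^sub>0\<^sup>s\<^sup>,\<^sup>1(\<Omega>)\<close>.\<close>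

definition D :: "('a \<Rightarrow> real) set" where "D = {u \<in> X. J u < \<infinity>}"

definition dK :: "('a \<Rightarrow> real) \<Rightarrow> 'a \<times> 'a \<Rightarrow> real" where
  "dK u z = (u (fst z) - u (snd z)) * K z"

lemma dK_measurable [measurable]:
  assumes [measurable]: "u \<in> borel_measurable borel"
  shows "dK u \<in> borel_measurable borel"
  unfolding dK_def by measurable

lemma J_dK: "J u = (\<integral>\<^sup>+z. ennreal \<bar>dK u z\<bar> \<partial>lborel)"
  unfolding J_def dK_def by (simp add: abs_mult)

lemma D_X: "u \<in> D \<Longrightarrow> u \<in> X" by (simp add: D_def)

lemma D_measurable [measurable_dest]: "u \<in> D \<Longrightarrow> u \<in> borel_measurable borel"
  by (simp add: D_def X_def)

lemma D_integrable_dK: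
  assumes "u \<in> D" shows "integrable lborel (dK u)"
proof (rule integrableI_bounded)
  have [measurable]: "u \<in> borel_measurable borel" using assms by measurable
  show "dK u \<in> borel_measurable lborel" by measurable
  show "(\<integral>\<^sup>+z. ennreal (norm (dK u z)) \<partial>lborel) < \<infinity>" using assms by (simp add: D_def J_dK)
qed

lemma D_iff: "u \<in> D \<longleftrightarrow> u \<in> X \<and> integrable lborel (dK u)"
proof -
  have "J u < \<infinity>" if "integrable lborel (dK u)"
    using that by (simp add: J_dK integrable_iff_bounded)
  then show ?thesis using D_integrable_dK[of u] D_X[of u] unfolding D_def by blast
qed

lemma J_eq:
  assumes "u \<in> D" shows "J u = ennreal (LBINT z. \<bar>dK u z\<bar>)"
proof -
  have "integrable lborel (\<lambda>z. \<bar>dK u z\<bar>)" using D_integrable_dK[OF assms] by (rule integrable_abs)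
  then show ?thesis unfolding J_dK by (rule nn_integral_eq_integral) (rule AE_I2, rule abs_ge_zero)
qed

lemma dK_add: "dK (\<lambda>x. u x + v x) z = dK u z + dK v z" by (simp add: dK_def algebra_simps)
lemma dK_diff: "dK (\<lambda>x. u x - v x) z = dK u z - dK v z" by (simp add: dK_def algebra_simps)
lemma dK_scale: "dK (\<lambda>x. c * u x) z = c * dK u z" by (simp add: dK_def algebra_simps)

lemma X_add: "u \<in> X \<Longrightarrow> v \<in> X \<Longrightarrow> (\<lambda>x. u x + v x) \<in> X" by (auto simp: X_def)
lemma X_scale: "u \<in> X \<Longrightarrow> (\<lambda>x. c * u x) \<in> X" by (auto simp: X_def)

lemma D_add: "u \<in> D \<Longrightarrow> v \<in> D \<Longrightarrow> (\<lambda>x. u x + v x) \<in> D"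
  unfolding D_iff by (auto simp: dK_add[abs_def] X_add)
lemma D_diff: "u \<in> D \<Longrightarrow> v \<in> D \<Longrightarrow> (\<lambda>x. u x - v x) \<in> D"
  unfolding D_iff by (auto simp: dK_diff[abs_def] X_diff)
lemma D_scale: "u \<in> D \<Longrightarrow> (\<lambda>x. c * u x) \<in> D"
  unfolding D_iff by (auto simp: dK_scale[abs_def] X_scale)
lemma D_zero: "(\<lambda>x. 0) \<in> D"
  unfolding D_iff by (auto simp: X_def dK_def[abs_def])

lemma J_diff_le:
  assumes "u \<in> X" "v \<in> X" shows "J (\<lambda>x. u x - v x) \<le> J u + J v"
proof -
  note [measurable] = assms[THEN X_measurable]
  have "J (\<lambda>x. u x - v x) \<le> (\<integral>\<^sup>+z. ennreal \<bar>dK u z\<bar> + ennreal \<bar>dK v z\<bar> \<partial>lborel)"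
    unfolding J_dK dK_diff by (intro nn_integral_mono) (simp add: ennreal_leI flip: ennreal_plus)
  also have "\<dots> = J u + J v" unfolding J_dK by (rule nn_integral_add) measurable
  finally show ?thesis .
qed

lemma L2_bound_of_J:
  assumes "0 \<le> M"
  obtains B where "0 \<le> B" "\<And>u. u \<in> X \<Longrightarrow> J u \<le> ennreal M \<Longrightarrow> L2 u \<and> nsq lborel u \<le> B"
proof -
  obtain B where B: "0 \<le> B" "\<And>u. u \<in> X \<Longrightarrow> J u \<le> ennreal M \<Longrightarrow> (\<integral>\<^sup>+x. ennreal (\<bar>u x\<bar> powr 2) \<partial>lborel) \<le> ennreal B"
    by (rule subcritical_embedding[of 2 M]) (use pstar_gt2 assms in auto)
  have "L2 u \<and> nsq lborel u \<le> B" if u: "u \<in> X" "J u \<le> ennreal M" for u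
  proof -
    have b: "(\<integral>\<^sup>+x. ennreal ((u x)\<^sup>2) \<partial>lborel) \<le> ennreal B" using B(2)[OF u] by simp
    note [measurable] = X_measurable[OF u(1)]
    have i: "integrable lborel (\<lambda>x. (u x)\<^sup>2)"
      using order.strict_trans1[OF b, of \<infinity>] by (intro integrableI_bounded) auto
    then show ?thesis using b B(1) unfolding nsq_def
      by (subst (asm) nn_integral_eq_integral[OF i]) (auto simp: square_integrable_def)
  qed
  then show ?thesis using that B(1) by blast
qed

lemma D_square_integrable:
  assumes "u \<in> D" shows "L2 u"
proof -
  have "0 \<le> (LBINT z. \<bar>dK u z\<bar>)" by simp
  from L2_bound_of_J[OF this] show ?thesis using assms J_eq[OF assms] D_X[OF assms] by (metis order_refl)
qed

lemma X_integrable: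
  assumes u: "u \<in> X" and sq: "L2 u" shows "integrable lborel u"
proof (rule Bochner_Integration.integrable_bound)
  show "integrable lborel (\<lambda>x. indicator \<Omega> x + (u x)\<^sup>2)"
    using sq dom_finite by (auto simp: square_integrable_def integrable_indicator_iff)
  show "u \<in> borel_measurable lborel" using u by (auto simp: X_def)
  have "\<bar>a\<bar> \<le> 1 + a\<^sup>2" for a :: real
  proof -
    have "0 \<le> (\<bar>a\<bar> - 1)\<^sup>2" by simp
    then have "2 * \<bar>a\<bar> \<le> 1 + a\<^sup>2" by (simp add: power2_diff)
    then show ?thesis by linarith
  qed
  then show "AE x in lborel. norm (u x) \<le> norm (indicator \<Omega> x + (u x)\<^sup>2 :: real)"
    using X_off[OF u] by (auto simp: indicator_def)
qed

text \<open>The regularised kernel integrand: \<open>c\<close> is integrable, so that it perturbs the functional by a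
  finite amount although the kernel itself is not integrable.\<close>

definition jc :: "('a \<times> 'a \<Rightarrow> real) \<Rightarrow> ('a \<Rightarrow> real) \<Rightarrow> 'a \<times> 'a \<Rightarrow> real" where
  "jc c u z = sqrt ((dK u z)\<^sup>2 + (c z)\<^sup>2)"

lemma jc_ge: "\<bar>dK u z\<bar> \<le> jc c u z"
  unfolding jc_def by simp

lemma jc_nonneg [simp]: "0 \<le> jc c u z" unfolding jc_def by simp

lemma jc_le: "0 \<le> c z \<Longrightarrow> jc c u z \<le> \<bar>dK u z\<bar> + c z"
  using sqrt_sum_squares_le_sum_abs[of "dK u z" "c z"] by (simp add: jc_def)

lemma jc_measurable [measurable]:
  assumes [measurable]: "u \<in> borel_measurable borel" "c \<in> borel_measurable borel"
  shows "jc c u \<in> borel_measurable borel"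
  unfolding jc_def by measurable

text \<open>Positivity at every pair makes the smoothed integrand differentiable everywhere, the
  diagonal included; integrability keeps the perturbation of the functional finite.\<close>

definition weight :: "('a \<times> 'a \<Rightarrow> real) \<Rightarrow> bool" where
  "weight c \<longleftrightarrow> c \<in> borel_measurable borel \<and> (\<forall>z. 0 < c z) \<and> integrable lborel c"

lemma weightD:
  assumes "weight c"
  shows "c \<in> borel_measurable borel" "0 < c z" "integrable lborel c"
  using assms unfolding weight_def by blast+

lemma jc_integrable:
  assumes "u \<in> D" "weight c" shows "integrable lborel (jc c u)"
proof (rule Bochner_Integration.integrable_bound)
  note [measurable] = weightD(1)[OF assms(2)]
  have [measurable]: "u \<in> borel_measurable borel" using assms by measurable
  show "integrable lborel (\<lambda>z. \<bar>dK u z\<bar> + c z)" using D_integrable_dK[OF assms(1)] weightD(3)[OF assms(2)] by auto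
  show "jc c u \<in> borel_measurable lborel" by measurable
  show "AE z in lborel. norm (jc c u z) \<le> norm (\<bar>dK u z\<bar> + c z)"
    using jc_le less_imp_le[OF weightD(2)[OF assms(2)]] by (auto intro!: order.trans[OF _ abs_ge_self])
qed

section \<open>The proximal functional: minimiser, Euler-Lagrange equation and energy
  estimate\<close>

definition prox_energy :: "('a \<times> 'a \<Rightarrow> real) \<Rightarrow> real \<Rightarrow> ('a \<Rightarrow> real) \<Rightarrow> ('a \<Rightarrow> real) \<Rightarrow> real" where
  "prox_energy c h f0 v = (LBINT z. jc c v z) + nsq lborel (\<lambda>x. v x - f0 x) / (2 * h)"

text \<open>Fatou's lemma. The function c is only assumed measurable, so that c = 0 gives the lower
  semicontinuity of \<open>J\<close> itself.\<close>

lemma J_lsc_jc: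
  assumes v: "\<And>n. v n \<in> X" and [measurable]: "V \<in> borel_measurable borel" "c \<in> borel_measurable borel"
    and lim: "AE x in lborel. (\<lambda>n. v n x) \<longlonglongrightarrow> V x"
  shows "(\<integral>\<^sup>+z. ennreal (jc c V z) \<partial>lborel) \<le> liminf (\<lambda>n. \<integral>\<^sup>+z. ennreal (jc c (v n) z) \<partial>lborel)"
proof -
  have [measurable]: "\<And>n. v n \<in> borel_measurable borel" using v X_measurable by auto
  have "(\<integral>\<^sup>+z. ennreal (jc c V z) \<partial>lborel) = (\<integral>\<^sup>+z. liminf (\<lambda>n. ennreal (jc c (v n) z)) \<partial>lborel)"
  proof (rule nn_integral_cong_AE, rule AE_mp[OF AE_lborel_fst_snd[OF lim]], intro AE_I2 impI)
    fix z assume "(\<lambda>n. v n (fst z)) \<longlonglongrightarrow> V (fst z) \<and> (\<lambda>n. v n (snd z)) \<longlonglongrightarrow> V (snd z)"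
    then have "(\<lambda>n. ennreal (jc c (v n) z)) \<longlonglongrightarrow> ennreal (jc c V z)"
      unfolding jc_def dK_def by (intro tendsto_intros tendsto_ennrealI) auto
    then show "ennreal (jc c V z) = liminf (\<lambda>n. ennreal (jc c (v n) z))"
      by (intro lim_imp_Liminf[symmetric]) auto
  qed
  also have "\<dots> \<le> liminf (\<lambda>n. \<integral>\<^sup>+z. ennreal (jc c (v n) z) \<partial>lborel)"
    by (rule nn_integral_liminf) simp
  finally show ?thesis .
qed

text \<open>The direct method without weak topologies: the quadratic term is uniformly convex, so a
  minimising sequence is Cauchy in L2, and Fatou's lemma bounds the smoothed seminorm of its
  limit.\<close>

lemma prox_exists:
  assumes c: "weight c" and f0: "L2 f0" and h: "0 < h"
  obtains v where "v \<in> D" "\<And>w. w \<in> D \<Longrightarrow> prox_energy c h f0 v \<le> prox_energy c h f0 w"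
proof -
  note [measurable] = weightD(1)[OF c]
  let ?E = "prox_energy c h f0"
  have E0: "0 \<le> ?E v" for v using h by (simp add: prox_energy_def)
  define I where "I = Inf (?E ` D)"
  have bdd: "bdd_below (?E ` D)" by (rule bdd_belowI[of _ 0]) (use E0 in auto)
  have I_le: "I \<le> ?E w" if "w \<in> D" for w unfolding I_def using bdd that by (intro cInf_lower) auto
  have "\<exists>v. v \<in> D \<and> ?E v < I + 1 / real (Suc n)" for n
  proof -
    have "\<exists>q\<in>?E ` D. q < I + 1 / real (Suc n)"
      unfolding I_def using D_zero by (intro cInf_lessD) auto
    then show ?thesis by auto
  qed
  then obtain v where v: "\<And>n. v n \<in> D" and vE: "\<And>n. ?E (v n) < I + 1 / real (Suc n)" by metis
  have sqv: "L2 (v n)" for n by (rule D_square_integrable[OF v])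
  have sqd: "L2 (\<lambda>x. v n x - f0 x)" for n by (rule square_integrable_diff[OF sqv f0])
  \<comment> \<open>The midpoint is a competitor. Convexity of the smoothed seminorm and the
    parallelogram identity leave the squared distance divided by 8h as surplus, bounded by the mean
    of the two excesses over the infimum.\<close>
  have key: "nsq lborel (\<lambda>x. v m x - v n x) \<le> 4 * h * (1 / real (Suc m) + 1 / real (Suc n))" for m n
  proof -
    let ?w = "\<lambda>x. (1/2) * (v m x + v n x)"
    have w: "?w \<in> D" by (intro D_scale D_add v)
    have jcw: "(LBINT z. jc c ?w z) \<le> (LBINT z. (jc c (v m) z + jc c (v n) z) / 2)"
    proof (rule integral_mono)
      fix z
      have "dK ?w z = (dK (v m) z + dK (v n) z) / 2" unfolding dK_scale dK_add by simp
      then show "jc c ?w z \<le> (jc c (v m) z + jc c (v n) z) / 2"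
        unfolding jc_def by (simp only: norm_pair_midpoint)
    qed (use jc_integrable[OF _ c] w v in auto)
    also have "\<dots> = ((LBINT z. jc c (v m) z) + (LBINT z. jc c (v n) z)) / 2"
      using jc_integrable[OF v c] by simp
    finally have a: "(LBINT z. jc c ?w z) \<le> ((LBINT z. jc c (v m) z) + (LBINT z. jc c (v n) z)) / 2" .
    have b: "nsq lborel (\<lambda>x. ?w x - f0 x) + nsq lborel (\<lambda>x. v m x - v n x) / 4
        = (nsq lborel (\<lambda>x. v m x - f0 x) + nsq lborel (\<lambda>x. v n x - f0 x)) / 2"
    proof -
      have "(\<lambda>x. ?w x - f0 x) = (\<lambda>x. ((v m x - f0 x) + (v n x - f0 x)) / 2)" by (auto simp: field_simps)
      then show ?thesis using parallelogram_nsq[OF sqd[of m] sqd[of n]] by simp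
    qed
    have b': "nsq lborel (\<lambda>x. ?w x - f0 x) / (2 * h) + nsq lborel (\<lambda>x. v m x - v n x) / 4 / (2 * h)
        = (nsq lborel (\<lambda>x. v m x - f0 x) / (2 * h) + nsq lborel (\<lambda>x. v n x - f0 x) / (2 * h)) / 2"
      using arg_cong[OF b, of "\<lambda>t. t / (2 * h)"] by (simp add: add_divide_distrib)
    have "?E ?w + nsq lborel (\<lambda>x. v m x - v n x) / 4 / (2 * h) \<le> (?E (v m) + ?E (v n)) / 2"
      unfolding prox_energy_def using a b' by argo
    then have "nsq lborel (\<lambda>x. v m x - v n x) / 4 / (2 * h) \<le> (1 / real (Suc m) + 1 / real (Suc n)) / 2"
      using I_le[OF w] vE[of m] vE[of n] by argo
    then have "(nsq lborel (\<lambda>x. v m x - v n x) / 4 / (2 * h)) * (8 * h) \<le> ((1 / real (Suc m) + 1 / real (Suc n)) / 2) * (8 * h)"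
      using h by (intro mult_right_mono) auto
    moreover have "(nsq lborel (\<lambda>x. v m x - v n x) / 4 / (2 * h)) * (8 * h) = nsq lborel (\<lambda>x. v m x - v n x)" using h by simp
    moreover have "((1 / real (Suc m) + 1 / real (Suc n)) / 2) * (8 * h) = 4 * h * (1 / real (Suc m) + 1 / real (Suc n))" by argo
    ultimately show ?thesis by argo
  qed
  have lim0: "(\<lambda>n. 1 / real (Suc n)) \<longlonglongrightarrow> 0" using LIMSEQ_inverse_real_of_nat by (simp add: inverse_eq_divide)
  have "\<exists>N. \<forall>m\<ge>N. \<forall>n\<ge>N. nsq lborel (\<lambda>x. v m x - v n x) < e" if "e > 0" for e
  proof -
    have "0 < e / (8 * h)" using that h by simp
    then have "\<forall>\<^sub>F n in sequentially. 1 / real (Suc n) < e / (8 * h)" using lim0 by (rule order_tendstoD(2)[rotated])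
    then obtain N where N: "\<And>n. n \<ge> N \<Longrightarrow> 1 / real (Suc n) < e / (8 * h)" by (auto simp: eventually_sequentially)
    have "nsq lborel (\<lambda>x. v m x - v n x) < e" if "m \<ge> N" "n \<ge> N" for m n
    proof -
      have "1 / real (Suc m) + 1 / real (Suc n) < e / (4 * h)" using N[OF that(1)] N[OF that(2)] by simp
      then have "4 * h * (1 / real (Suc m) + 1 / real (Suc n)) < 4 * h * (e / (4 * h))"
        using h by (intro mult_strict_left_mono) auto
      then show ?thesis using key[of m n] h by simp
    qed
    then show ?thesis by blast
  qed
  then obtain V0 r where V0: "L2 V0" "strict_mono r"
    "AE x in lborel. (\<lambda>n. v (r n) x) \<longlonglongrightarrow> V0 x" "(\<lambda>n. nsq lborel (\<lambda>x. v n x - V0 x)) \<longlonglongrightarrow> 0"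
    by (rule L2_complete[where f = v, OF sqv])
  \<comment> \<open>The L2 limit vanishes off \<Omega> only almost everywhere; membership in
    \<open>X\<close> asks for every point.\<close>
  define V where "V x = indicator \<Omega> x * V0 x" for x
  have [measurable]: "V0 \<in> borel_measurable borel" using V0(1) by (simp add: square_integrable_def)
  have VX: "V \<in> X" unfolding X_def V_def by auto
  have [measurable]: "V \<in> borel_measurable borel" using VX by (rule X_measurable)
  have VAE: "AE x in lborel. (\<lambda>n. v (r n) x) \<longlonglongrightarrow> V x"
    using V0(3) by (rule AE_mp) (use X_off[OF D_X[OF v]] in \<open>auto simp: V_def indicator_def\<close>)
  have VV0: "AE x in lborel. V x = V0 x"
    using V0(3) VAE by eventually_elim (rule LIMSEQ_unique)
  have "nsq lborel (\<lambda>x. v n x - V x) = nsq lborel (\<lambda>x. v n x - V0 x)" for n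
  proof (rule nsq_cong_AE)
    have [measurable]: "v n \<in> borel_measurable borel" using v by measurable
    show "(\<lambda>x. v n x - V x) \<in> borel_measurable lborel" "(\<lambda>x. v n x - V0 x) \<in> borel_measurable lborel" by auto
  qed (use VV0 in auto)
  then have Vlim: "(\<lambda>n. nsq lborel (\<lambda>x. v (r n) x - V x)) \<longlonglongrightarrow> 0"
    using LIMSEQ_subseq_LIMSEQ[OF V0(4,2)] by (simp add: o_def)
  have sqV: "L2 V"
    by (rule square_integrable_bound[OF V0(1)]) (auto simp: V_def indicator_def)
  have "(\<lambda>n. nsq lborel (\<lambda>x. v (r n) x - f0 x)) \<longlonglongrightarrow> nsq lborel (\<lambda>x. V x - f0 x)"
  proof (rule nsq_tendsto)
    show "(\<lambda>n. nsq lborel (\<lambda>x. (v (r n) x - f0 x) - (V x - f0 x))) \<longlonglongrightarrow> 0" using Vlim by simp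
  qed (use sqd square_integrable_diff[OF sqV f0] in auto)
  then have "(\<lambda>n. I + 1 / real (Suc (r n)) - nsq lborel (\<lambda>x. v (r n) x - f0 x) / (2 * h))
      \<longlonglongrightarrow> I + 0 - nsq lborel (\<lambda>x. V x - f0 x) / (2 * h)"
    using LIMSEQ_subseq_LIMSEQ[OF lim0 V0(2)] h by (intro tendsto_intros) (auto simp: o_def)
  then have liml: "(\<lambda>n. ennreal (I + 1 / real (Suc (r n)) - nsq lborel (\<lambda>x. v (r n) x - f0 x) / (2 * h)))
      \<longlonglongrightarrow> ennreal (I - nsq lborel (\<lambda>x. V x - f0 x) / (2 * h))"
    by (intro tendsto_ennrealI) simp
  have "(\<integral>\<^sup>+z. ennreal (jc c V z) \<partial>lborel) \<le> liminf (\<lambda>n. \<integral>\<^sup>+z. ennreal (jc c (v (r n)) z) \<partial>lborel)"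
    by (rule J_lsc_jc) (use D_X v VAE in auto)
  also have "\<dots> \<le> liminf (\<lambda>n. ennreal (I + 1 / real (Suc (r n)) - nsq lborel (\<lambda>x. v (r n) x - f0 x) / (2 * h)))"
  proof (rule Liminf_mono, rule always_eventually, rule allI)
    fix n
    have "(\<integral>\<^sup>+z. ennreal (jc c (v (r n)) z) \<partial>lborel) = ennreal (LBINT z. jc c (v (r n)) z)"
      by (rule nn_integral_eq_integral) (use jc_integrable[OF v c] in auto)
    also have "\<dots> \<le> ennreal (I + 1 / real (Suc (r n)) - nsq lborel (\<lambda>x. v (r n) x - f0 x) / (2 * h))"
      using vE[of "r n"] unfolding prox_energy_def by (intro ennreal_leI) linarith
    finally show "(\<integral>\<^sup>+z. ennreal (jc c (v (r n)) z) \<partial>lborel) \<le> \<dots>" .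
  qed
  also have "\<dots> = ennreal (I - nsq lborel (\<lambda>x. V x - f0 x) / (2 * h))"
    by (rule lim_imp_Liminf[OF _ liml]) simp
  finally have fat: "(\<integral>\<^sup>+z. ennreal (jc c V z) \<partial>lborel) \<le> ennreal (I - nsq lborel (\<lambda>x. V x - f0 x) / (2 * h))" .
  have "J V \<le> (\<integral>\<^sup>+z. ennreal (jc c V z) \<partial>lborel)"
    unfolding J_dK by (intro nn_integral_mono ennreal_leI jc_ge)
  also note fat
  finally have "J V < top" using ennreal_less_top by (rule order.strict_trans1)
  then have VD: "V \<in> D" using VX unfolding D_def by simp
  have jV: "ennreal (LBINT z. jc c V z) \<le> ennreal (I - nsq lborel (\<lambda>x. V x - f0 x) / (2 * h))"
    using fat by (subst (asm) nn_integral_eq_integral) (use jc_integrable[OF VD c] in auto)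
  \<comment> \<open>The right-hand side of \<open>jV\<close> might be negative and be cut off to 0
    by \<open>ennreal\<close>. Strict positivity of the left-hand side excludes this, so the
    inequality passes to the reals.\<close>
  have pos: "0 < (LBINT z. jc c V z)"
  proof -
    have "0 \<le> (LBINT z. jc c V z)" by simp
    moreover have "(LBINT z. jc c V z) \<noteq> 0"
    proof
      assume "(LBINT z. jc c V z) = 0"
      then have "AE z in lborel. jc c V z = 0"
        using jc_integrable[OF VD c] by (subst (asm) integral_nonneg_eq_0_iff_AE) auto
      moreover have "jc c V z \<noteq> 0" for z
        using weightD(2)[OF c, of z] by (auto simp: jc_def sum_power2_eq_zero_iff)
      ultimately have "AE z in (lborel :: ('a \<times> 'a) measure). False" by auto
      then have "UNIV \<in> null_sets (lborel :: ('a \<times> 'a) measure)" by (subst (asm) AE_iff_null) auto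
      then show False by (simp add: null_sets_def)
    qed
    ultimately show ?thesis by linarith
  qed
  then have "(LBINT z. jc c V z) \<le> I - nsq lborel (\<lambda>x. V x - f0 x) / (2 * h)"
    using jV by (simp add: ennreal_le_iff2)
  then have "?E V \<le> I" unfolding prox_energy_def by linarith
  then show ?thesis using that[OF VD] I_le by (meson order.trans)
qed

text \<open>One-sided variations v + \<tau> \<phi> with positive \<tau> tending to 0 give an
  inequality, and the inequalities for \<phi> and for -\<phi> give the equation. The quotients of
  the smoothed seminorm are dominated by |dK \<phi>|, because its integrand is Lipschitz with
  constant 1.\<close>

lemma prox_Euler_Lagrange:
  assumes c: "weight c" and f0: "L2 f0" and h: "0 < h"
    and v: "v \<in> D" and min: "\<And>w. w \<in> D \<Longrightarrow> prox_energy c h f0 v \<le> prox_energy c h f0 w"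
    and \<phi>: "\<phi> \<in> D"
  shows "(LBINT z. dK v z / jc c v z * dK \<phi> z) + (LBINT x. (v x - f0 x) * \<phi> x) / h = 0"
proof -
  note [measurable] = weightD(1)[OF c]
  have [measurable]: "v \<in> borel_measurable borel" using v by measurable
  have sv: "L2 (\<lambda>x. v x - f0 x)"
    by (rule square_integrable_diff[OF D_square_integrable[OF v] f0])
  have ge: "0 \<le> (LBINT z. dK v z / jc c v z * dK \<phi> z) + (LBINT x. (v x - f0 x) * \<phi> x) / h"
    if \<phi>: "\<phi> \<in> D" for \<phi>
  proof -
    have [measurable]: "\<phi> \<in> borel_measurable borel" using \<phi> by measurable
    have s\<phi>: "L2 \<phi>" by (rule D_square_integrable[OF \<phi>])
    define \<tau> where "\<tau> n = 1 / real (Suc n)" for n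
    have \<tau>: "0 < \<tau> n" for n by (simp add: \<tau>_def)
    have \<tau>0: "\<tau> \<longlonglongrightarrow> 0" unfolding \<tau>_def using LIMSEQ_inverse_real_of_nat by (simp add: inverse_eq_divide)
    define w where "w n x = v x + \<tau> n * \<phi> x" for n x
    have wD: "w n \<in> D" for n unfolding w_def by (intro D_add D_scale v \<phi>)
    have dw: "dK (w n) z = dK v z + \<tau> n * dK \<phi> z" for n z
      unfolding w_def by (subst dK_add) (simp add: dK_scale)
    let ?q = "\<lambda>n z. (jc c (w n) z - jc c v z) / \<tau> n"
    have lim: "(\<lambda>n. LBINT z. ?q n z) \<longlonglongrightarrow> (LBINT z. dK v z / jc c v z * dK \<phi> z)"
    proof (rule integral_dominated_convergence)
      show "integrable lborel (\<lambda>z. \<bar>dK \<phi> z\<bar>)" using D_integrable_dK[OF \<phi>] by simp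
      show "?q n \<in> borel_measurable lborel" for n using D_measurable[OF wD[of n]] by measurable
      show "AE z in lborel. norm (?q n z) \<le> \<bar>dK \<phi> z\<bar>" for n
      proof (rule AE_I2)
        fix z
        have "\<bar>jc c (w n) z - jc c v z\<bar> \<le> \<tau> n * \<bar>dK \<phi> z\<bar>"
          unfolding jc_def dw using norm_pair_lipschitz[of "dK v z + \<tau> n * dK \<phi> z" "c z" "dK v z"] \<tau>[of n]
          by (simp add: abs_mult)
        then show "norm (?q n z) \<le> \<bar>dK \<phi> z\<bar>" using \<tau>[of n] by (simp add: divide_le_eq mult.commute)
      qed
      show "AE z in lborel. (\<lambda>n. ?q n z) \<longlonglongrightarrow> dK v z / jc c v z * dK \<phi> z"
      proof (rule AE_I2)
        fix z
        let ?g = "\<lambda>t. sqrt ((dK v z + t * dK \<phi> z)\<^sup>2 + (c z)\<^sup>2)"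
        have pos: "0 < (dK v z)\<^sup>2 + (c z)\<^sup>2" using weightD(2)[OF c, of z] by (intro add_nonneg_pos) auto
        have "(?g has_real_derivative dK v z / jc c v z * dK \<phi> z) (at 0)"
          using pos unfolding jc_def
          by (auto intro!: derivative_eq_intros simp: field_simps)
        then have "((\<lambda>t. (?g (0 + t) - ?g 0) / t) \<longlongrightarrow> dK v z / jc c v z * dK \<phi> z) (at 0)"
          by (simp add: DERIV_def)
        moreover have "filterlim \<tau> (at 0) sequentially"
          using \<tau>0 \<tau> by (auto simp: filterlim_at intro!: always_eventually) (metis less_irrefl)
        ultimately have "(\<lambda>n. (?g (0 + \<tau> n) - ?g 0) / \<tau> n) \<longlonglongrightarrow> dK v z / jc c v z * dK \<phi> z"
          by (rule filterlim_compose)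
        then show "(\<lambda>n. ?q n z) \<longlonglongrightarrow> dK v z / jc c v z * dK \<phi> z"
          by (simp add: jc_def dw)
      qed
    qed (use D_measurable[OF \<phi>] in measurable)
    \<comment> \<open>The quadratic term is expanded exactly; its second-order part carries a factor
      \<tau> and disappears in the limit.\<close>
    have bnd: "0 \<le> (LBINT z. ?q n z) + (LBINT x. (v x - f0 x) * \<phi> x) / h + \<tau> n * (nsq lborel \<phi> / (2 * h))" for n
    proof -
      have q: "(LBINT z. ?q n z) = ((LBINT z. jc c (w n) z) - (LBINT z. jc c v z)) / \<tau> n"
        using jc_integrable[OF wD c, of n] jc_integrable[OF v c] by simp
      have "(\<lambda>x. w n x - f0 x) = (\<lambda>x. (v x - f0 x) + \<tau> n * \<phi> x)" by (auto simp: w_def)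
      then have "nsq lborel (\<lambda>x. w n x - f0 x) = nsq lborel (\<lambda>x. v x - f0 x)
          + 2 * (LBINT x. (v x - f0 x) * (\<tau> n * \<phi> x)) + nsq lborel (\<lambda>x. \<tau> n * \<phi> x)"
        using nsq_expand[OF sv square_integrable_scale[OF s\<phi>, of "\<tau> n"]] by simp
      also have "(LBINT x. (v x - f0 x) * (\<tau> n * \<phi> x)) = \<tau> n * (LBINT x. (v x - f0 x) * \<phi> x)"
        by (subst integral_mult_right_zero[symmetric]) (simp add: mult_ac)
      also have "nsq lborel (\<lambda>x. \<tau> n * \<phi> x) = (\<tau> n)\<^sup>2 * nsq lborel \<phi>" by (rule nsq_scale)
      finally have ns: "nsq lborel (\<lambda>x. w n x - f0 x) = nsq lborel (\<lambda>x. v x - f0 x)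
          + \<tau> n * (2 * (LBINT x. (v x - f0 x) * \<phi> x) + \<tau> n * nsq lborel \<phi>)"
        by (simp add: algebra_simps power2_eq_square)
      have "0 \<le> (prox_energy c h f0 (w n) - prox_energy c h f0 v) / \<tau> n"
        using min[OF wD[of n]] \<tau>[of n] by simp
      also have "\<dots> = (LBINT z. ?q n z) + (2 * (LBINT x. (v x - f0 x) * \<phi> x) + \<tau> n * nsq lborel \<phi>) / (2 * h)"
        unfolding prox_energy_def ns q using \<tau>[of n] h by (simp add: field_simps)
      finally show ?thesis using h by (simp add: add_divide_distrib)
    qed
    have "(\<lambda>n. (LBINT z. ?q n z) + (LBINT x. (v x - f0 x) * \<phi> x) / h + \<tau> n * (nsq lborel \<phi> / (2 * h)))
       \<longlonglongrightarrow> (LBINT z. dK v z / jc c v z * dK \<phi> z) + (LBINT x. (v x - f0 x) * \<phi> x) / h + 0 * (nsq lborel \<phi> / (2 * h))"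
      by (intro tendsto_add lim tendsto_const tendsto_mult \<tau>0)
    then have "0 \<le> (LBINT z. dK v z / jc c v z * dK \<phi> z) + (LBINT x. (v x - f0 x) * \<phi> x) / h + 0 * (nsq lborel \<phi> / (2 * h))"
      using bnd by (intro LIMSEQ_le_const) auto
    then show ?thesis by simp
  qed
  have "0 \<le> - ((LBINT z. dK v z / jc c v z * dK \<phi> z) + (LBINT x. (v x - f0 x) * \<phi> x) / h)"
    using ge[OF D_scale[OF \<phi>, of "-1"]] by (simp add: dK_scale[of "-1" \<phi>, simplified])
  then show ?thesis using ge[OF \<phi>] by linarith
qed

text \<open>The competitor is u itself, at cost h \<open>nsq g\<close> / 2. The same amount is lost
  when v - u is split into (v - u - hg) + hg, which also weakens the factor 1/(2h) to
  1/(4h).\<close>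

lemma prox_energy_estimate:
  assumes c: "weight c" and g: "L2 g" and h: "0 < h" and u: "u \<in> D" and v: "v \<in> D"
    and min: "\<And>w. w \<in> D \<Longrightarrow> prox_energy c h (\<lambda>x. u x + h * g x) v \<le> prox_energy c h (\<lambda>x. u x + h * g x) w"
  shows "(LBINT z. jc c v z) + nsq lborel (\<lambda>x. v x - u x) / (4 * h) \<le> (LBINT z. jc c u z) + h * nsq lborel g"
proof -
  have s: "L2 (\<lambda>x. v x - u x)"
    by (intro square_integrable_diff D_square_integrable u v)
  have hg: "L2 (\<lambda>x. h * g x)" by (rule square_integrable_scale[OF g])
  have "nsq lborel (\<lambda>x. v x - u x) \<le> 2 * nsq lborel (\<lambda>x. v x - (u x + h * g x)) + 2 * nsq lborel (\<lambda>x. h * g x)"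
    using nsq_add_le[OF square_integrable_diff[OF s hg] hg] by (simp add: algebra_simps)
  also have "nsq lborel (\<lambda>x. h * g x) = h\<^sup>2 * nsq lborel g" by (rule nsq_scale)
  finally have a: "nsq lborel (\<lambda>x. v x - u x) / (4 * h) \<le> (2 * nsq lborel (\<lambda>x. v x - (u x + h * g x)) + 2 * (h\<^sup>2 * nsq lborel g)) / (4 * h)"
    using h by (intro divide_right_mono) auto
  also have "\<dots> = nsq lborel (\<lambda>x. v x - (u x + h * g x)) / (2 * h) + h * nsq lborel g / 2"
    using h by (simp add: field_simps power2_eq_square)
  finally have a: "nsq lborel (\<lambda>x. v x - u x) / (4 * h) \<le> \<dots>" .
  have "nsq lborel (\<lambda>x. u x - (u x + h * g x)) = h\<^sup>2 * nsq lborel g"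
    using nsq_scale[of lborel "-h" g] by simp
  then have "prox_energy c h (\<lambda>x. u x + h * g x) u = (LBINT z. jc c u z) + h * nsq lborel g / 2"
    unfolding prox_energy_def using h by (simp add: power2_eq_square)
  then show ?thesis using min[OF u] a unfolding prox_energy_def by simp
qed

end

lemma floor_approximation: "(\<lambda>n. of_int \<lfloor>real (Suc n) * t\<rfloor> / real (Suc n)) \<longlonglongrightarrow> (t :: real)"
proof (rule LIM_zero_cancel, rule Lim_null_comparison)
  show "\<forall>\<^sub>F n in sequentially. norm (of_int \<lfloor>real (Suc n) * t\<rfloor> / real (Suc n) - t) \<le> 1 / real (Suc n)"
  proof (rule always_eventually, rule allI)
    fix n
    have "\<bar>of_int \<lfloor>real (Suc n) * t\<rfloor> - real (Suc n) * t\<bar> \<le> 1" by linarith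
    then have "\<bar>of_int \<lfloor>real (Suc n) * t\<rfloor> - real (Suc n) * t\<bar> / real (Suc n) \<le> 1 / real (Suc n)"
      by (intro divide_right_mono) auto
    moreover have "of_int \<lfloor>real (Suc n) * t\<rfloor> / real (Suc n) - t = (of_int \<lfloor>real (Suc n) * t\<rfloor> - real (Suc n) * t) / real (Suc n)"
      by (simp add: diff_divide_distrib)
    ultimately show "norm (of_int \<lfloor>real (Suc n) * t\<rfloor> / real (Suc n) - t) \<le> 1 / real (Suc n)" by (simp add: abs_divide)
  qed
  show "(\<lambda>n. 1 / real (Suc n)) \<longlonglongrightarrow> 0" using LIMSEQ_inverse_real_of_nat by (simp add: inverse_eq_divide)
qed

text \<open>The argument q(z) is replaced by its floor approximations, which take countably many
  values; continuity in the second variable passes to the limit.\<close>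

lemma Caratheodory_measurable:
  fixes g :: "'a \<Rightarrow> real \<Rightarrow> real"
  assumes g: "\<And>t. (\<lambda>z. g z t) \<in> borel_measurable M" and cont: "\<And>z. z \<in> space M \<Longrightarrow> continuous_on UNIV (g z)"
    and q[measurable]: "q \<in> borel_measurable M"
  shows "(\<lambda>z. g z (q z)) \<in> borel_measurable M"
proof (rule borel_measurable_LIMSEQ_real)
  let ?q = "\<lambda>n z. of_int \<lfloor>real (Suc n) * q z\<rfloor> / real (Suc n)"
  show "(\<lambda>z. g z (?q n z)) \<in> borel_measurable M" for n
  proof (rule measurable_compose_countable[where f = "\<lambda>i z. g z (of_int i / real (Suc n))" and g = "\<lambda>z. \<lfloor>real (Suc n) * q z\<rfloor>"])
    show "(\<lambda>z. \<lfloor>real (Suc n) * q z\<rfloor>) \<in> measurable M (count_space UNIV)" by measurable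
  qed (rule g)
  fix z assume z: "z \<in> space M"
  have "(\<lambda>n. ?q n z) \<longlonglongrightarrow> q z" by (rule floor_approximation)
  moreover have "isCont (g z) (q z)" using cont[OF z] by (simp add: continuous_on_eq_continuous_at)
  ultimately show "(\<lambda>n. g z (?q n z)) \<longlonglongrightarrow> g z (q z)" by (rule isCont_tendsto_compose[rotated])
qed

section \<open>The Euler scheme\<close>

lemma nsq_sum_le:
  assumes "\<And>i. i \<in> I \<Longrightarrow> square_integrable M (d i)"
  shows "nsq M (\<lambda>x. \<Sum>i\<in>I. d i x) \<le> real (card I) * (\<Sum>i\<in>I. nsq M (d i))"
proof -
  have s: "square_integrable M (\<lambda>x. \<Sum>i\<in>I. d i x)"
    using square_integrable_sum[where f = d and I = I and M = M and c = "\<lambda>_. 1"] assms by simp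
  have i: "integrable M (\<lambda>x. (d i x)\<^sup>2)" if "i \<in> I" for i
    using assms[OF that] by (simp add: square_integrable_def)
  have "nsq M (\<lambda>x. \<Sum>i\<in>I. d i x) \<le> (\<integral>x. (\<Sum>i\<in>I. (d i x)\<^sup>2) * real (card I) \<partial>M)"
    unfolding nsq_def
  proof (rule integral_mono)
    show "integrable M (\<lambda>x. (\<Sum>i\<in>I. d i x)\<^sup>2)" using s by (simp add: square_integrable_def)
    show "integrable M (\<lambda>x. (\<Sum>i\<in>I. (d i x)\<^sup>2) * real (card I))"
      using i by (intro integrable_mult_left Bochner_Integration.integrable_sum) auto
  qed (rule sum_squared_le_sum_of_squares)
  also have "\<dots> = real (card I) * (\<Sum>i\<in>I. nsq M (d i))"
    unfolding nsq_def using i by (simp add: Bochner_Integration.integral_sum mult.commute)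
  finally show ?thesis .
qed

text \<open>The data after normalisation: f is Borel in x, and the remaining conditions hold at
  every x, with value 0 outside \<Omega>. The bound on 2(r - 1) is the growth restriction (d) for N
  = 1; monotonicity is what the sign conditions (b) and (c) provide.\<close>

locale flow = subcritical_domain \<Omega> s for \<Omega> :: "'a::euclidean_space set" and s +
  fixes f :: "'a \<Rightarrow> real \<Rightarrow> real" and u0 :: "'a \<Rightarrow> real" and r C :: real
  assumes f_meas: "\<And>t. (\<lambda>x. f x t) \<in> borel_measurable borel"
    and f_cont: "\<And>x. continuous_on UNIV (f x)"
    and f_off: "\<And>x t. x \<notin> \<Omega> \<Longrightarrow> f x t = 0"
    and f_growth: "\<And>x t. \<bar>f x t\<bar> \<le> C * \<bar>t\<bar> powr (r - 1)"
    and f_mono: "\<And>x. mono (f x)"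
    and C: "0 < C" and r: "1 < r" "2 * (r - 1) < pstar"
    and u0D: "u0 \<in> D"
begin

definition Nf :: "('a \<Rightarrow> real) \<Rightarrow> 'a \<Rightarrow> real" where "Nf u x = f x (u x)"

lemma f_measurable:
  assumes [measurable]: "p \<in> borel_measurable M" "q \<in> borel_measurable M"
  shows "(\<lambda>z. f (p z) (q z)) \<in> borel_measurable M"
proof (rule Caratheodory_measurable[where g = "\<lambda>z. f (p z)" and q = q])
  show "(\<lambda>z. f (p z) t) \<in> borel_measurable M" for t
    using measurable_compose[OF assms(1) f_meas] .
qed (use f_cont in auto)

lemma Nf_X: "u \<in> X \<Longrightarrow> Nf u \<in> X"
  unfolding X_def Nf_def by (auto simp: f_off intro!: f_measurable)

text \<open>An exponent above \<open>2\<close>, so that bounds on \<open>\<bar>Nf u\<bar>\<close> to this power make \<open>(Nf u)\<^sup>2\<close> equi-integrable.\<close>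

definition qf :: real where "qf = (SOME q. 2 < q \<and> q * (r - 1) < pstar)"

lemma qf: "2 < qf" "qf * (r - 1) < pstar" "0 < qf * (r - 1)"
proof -
  have "2 < pstar / (r - 1)" using r by (simp add: field_simps)
  then obtain q where "2 < q" "q < pstar / (r - 1)" using dense by blast
  then have "2 < q \<and> q * (r - 1) < pstar" using r by (simp add: field_simps)
  then have "2 < qf \<and> qf * (r - 1) < pstar" unfolding qf_def by (rule someI[where P = "\<lambda>q. 2 < q \<and> q * (r - 1) < pstar"])
  then show "2 < qf" "qf * (r - 1) < pstar" by auto
  then show "0 < qf * (r - 1)" using r by (intro mult_pos_pos) auto
qed

definition Gq :: "real \<Rightarrow> real" where
  "Gq M = (SOME B. 0 \<le> B \<and> (\<forall>u\<in>X. J u \<le> ennreal M \<longrightarrow> (\<integral>\<^sup>+x. ennreal (\<bar>Nf u x\<bar> powr qf) \<partial>lborel) \<le> ennreal B))"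

text \<open>By the growth condition |Nf u|^\<open>qf\<close> is at most C^\<open>qf\<close>
  |u|^(\<open>qf\<close> (r - 1)), and this exponent of |u| is subcritical by the choice of
  \<open>qf\<close>.\<close>

lemma Gq:
  assumes M: "0 \<le> M"
  shows "0 \<le> Gq M" "u \<in> X \<Longrightarrow> J u \<le> ennreal M \<Longrightarrow> (\<integral>\<^sup>+x. ennreal (\<bar>Nf u x\<bar> powr qf) \<partial>lborel) \<le> ennreal (Gq M)"
proof -
  obtain B where B: "0 \<le> B" "\<And>u. u \<in> X \<Longrightarrow> J u \<le> ennreal M \<Longrightarrow> (\<integral>\<^sup>+x. ennreal (\<bar>u x\<bar> powr (qf * (r - 1))) \<partial>lborel) \<le> ennreal B"
    by (rule subcritical_embedding[OF qf(3,2) M]) blast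
  have "(\<integral>\<^sup>+x. ennreal (\<bar>Nf u x\<bar> powr qf) \<partial>lborel) \<le> ennreal (C powr qf * B)" if u: "u \<in> X" "J u \<le> ennreal M" for u
  proof -
    note [measurable] = X_measurable[OF u(1)]
    have "(\<integral>\<^sup>+x. ennreal (\<bar>Nf u x\<bar> powr qf) \<partial>lborel) \<le> (\<integral>\<^sup>+x. ennreal (C powr qf) * ennreal (\<bar>u x\<bar> powr (qf * (r - 1))) \<partial>lborel)"
    proof (rule nn_integral_mono)
      fix x
      have "\<bar>Nf u x\<bar> powr qf \<le> (C * \<bar>u x\<bar> powr (r - 1)) powr qf"
        unfolding Nf_def using f_growth qf by (intro powr_mono2) auto
      also have "\<dots> = C powr qf * \<bar>u x\<bar> powr (qf * (r - 1))"
        using C by (simp add: powr_mult powr_powr mult.commute)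
      finally show "ennreal (\<bar>Nf u x\<bar> powr qf) \<le> ennreal (C powr qf) * ennreal (\<bar>u x\<bar> powr (qf * (r - 1)))"
        by (simp add: ennreal_leI flip: ennreal_mult)
    qed
    also have "\<dots> = ennreal (C powr qf) * (\<integral>\<^sup>+x. ennreal (\<bar>u x\<bar> powr (qf * (r - 1))) \<partial>lborel)"
      by (rule nn_integral_cmult) measurable
    also have "\<dots> \<le> ennreal (C powr qf) * ennreal B" by (intro mult_left_mono B(2) u) simp
    finally show ?thesis using B(1) by (simp add: ennreal_mult)
  qed
  then have "0 \<le> C powr qf * B \<and> (\<forall>u\<in>X. J u \<le> ennreal M \<longrightarrow> (\<integral>\<^sup>+x. ennreal (\<bar>Nf u x\<bar> powr qf) \<partial>lborel) \<le> ennreal (C powr qf * B))"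
    using B(1) by auto
  then have "0 \<le> Gq M \<and> (\<forall>u\<in>X. J u \<le> ennreal M \<longrightarrow> (\<integral>\<^sup>+x. ennreal (\<bar>Nf u x\<bar> powr qf) \<partial>lborel) \<le> ennreal (Gq M))"
    unfolding Gq_def by (rule someI[where P = "\<lambda>B. 0 \<le> B \<and> (\<forall>u\<in>X. J u \<le> ennreal M \<longrightarrow> (\<integral>\<^sup>+x. ennreal (\<bar>Nf u x\<bar> powr qf) \<partial>lborel) \<le> ennreal B)"])
  then show "0 \<le> Gq M" "u \<in> X \<Longrightarrow> J u \<le> ennreal M \<Longrightarrow> (\<integral>\<^sup>+x. ennreal (\<bar>Nf u x\<bar> powr qf) \<partial>lborel) \<le> ennreal (Gq M)"
    by auto
qed

text \<open>From y^2 \<le> 1 + |y|^\<open>qf\<close>, where the constant 1 is integrated over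
  \<Omega> only.\<close>

definition G :: "real \<Rightarrow> real" where "G M = measure lborel \<Omega> + Gq M"

lemma G_nonneg: "0 \<le> M \<Longrightarrow> 0 \<le> G M" by (simp add: G_def Gq)

lemma Nf_square_integrable:
  assumes M: "0 \<le> M" and u: "u \<in> X" "J u \<le> ennreal M"
  shows "L2 (Nf u)" "nsq lborel (Nf u) \<le> G M"
proof -
  note [measurable] = X_measurable[OF Nf_X[OF u(1)]]
  have "(\<integral>\<^sup>+x. ennreal ((Nf u x)\<^sup>2) \<partial>lborel) \<le> (\<integral>\<^sup>+x. indicator \<Omega> x + ennreal (\<bar>Nf u x\<bar> powr qf) \<partial>lborel)"
  proof (rule nn_integral_mono)
    fix x
    show "ennreal ((Nf u x)\<^sup>2) \<le> indicator \<Omega> x + ennreal (\<bar>Nf u x\<bar> powr qf)"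
    proof (cases "x \<in> \<Omega>")
      case True
      have "(min \<bar>Nf u x\<bar> 1) powr 2 \<le> 1" by (rule powr_le1) auto
      then have "(Nf u x)\<^sup>2 \<le> 1 + \<bar>Nf u x\<bar> powr qf"
        using truncation_inequality[of 1 2 qf "Nf u x"] qf by simp
      then have "ennreal ((Nf u x)\<^sup>2) \<le> ennreal (1 + \<bar>Nf u x\<bar> powr qf)" by (rule ennreal_leI)
      then show ?thesis using True by simp
    qed (simp add: Nf_def f_off)
  qed
  also have "\<dots> = emeasure lborel \<Omega> + (\<integral>\<^sup>+x. ennreal (\<bar>Nf u x\<bar> powr qf) \<partial>lborel)"
    by (subst nn_integral_add) auto
  also have "\<dots> \<le> ennreal (measure lborel \<Omega>) + ennreal (Gq M)"
    using dom_finite by (intro add_mono Gq(2)[OF M u]) (simp add: emeasure_eq_ennreal_measure)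
  also have "\<dots> = ennreal (G M)" using Gq(1)[OF M] by (simp add: G_def)
  finally have b: "(\<integral>\<^sup>+x. ennreal ((Nf u x)\<^sup>2) \<partial>lborel) \<le> ennreal (G M)" .
  have i: "integrable lborel (\<lambda>x. (Nf u x)\<^sup>2)"
    using order.strict_trans1[OF b, of \<infinity>] by (intro integrableI_bounded) auto
  then show "L2 (Nf u)" by (simp add: square_integrable_def)
  show "nsq lborel (Nf u) \<le> G M"
    using b G_nonneg[OF M] unfolding nsq_def by (subst (asm) nn_integral_eq_integral[OF i]) auto
qed

text \<open>Symmetry of the weight makes the smoothed coefficients antisymmetric; the mass bound 1
  enters the constant \<open>M0\<close> and the norm of the weighted coefficients.\<close>

definition w0 :: "'a \<times> 'a \<Rightarrow> real" where
  "w0 = (SOME w. weight w \<and> (\<forall>x y. w (x, y) = w (y, x)) \<and> (LBINT z. w z) \<le> 1)"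

lemma w0: "weight w0" "w0 (x, y) = w0 (y, x)" "(LBINT z. w0 z) \<le> 1"
proof -
  obtain w1 :: "'a \<Rightarrow> real" where w1: "w1 \<in> borel_measurable lborel" "\<And>x. 0 < w1 x" "integrable lborel w1"
    using sigma_finite_measure.obtain_positive_integrable_function[OF sigma_finite_lborel] by metis
  have [measurable]: "w1 \<in> borel_measurable borel" using w1(1) by simp
  define I where "I = (LBINT x. w1 x)"
  have I0: "0 \<le> I" unfolding I_def using w1(2) by (intro integral_nonneg_AE) (auto intro: less_imp_le)
  have nI: "(\<integral>\<^sup>+x. ennreal (w1 x) \<partial>lborel) = ennreal I"
    unfolding I_def using w1 by (intro nn_integral_eq_integral) (auto intro: less_imp_le)
  \<comment> \<open>A tensor square of a positive integrable function with integral I. The divisor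
    makes the mass I^2 / (1 + I^2), at most 1.\<close>
  define w where "w z = w1 (fst z) * w1 (snd z) / (1 + I\<^sup>2)" for z
  have wpos: "0 < w z" for z unfolding w_def using w1(2) by (intro divide_pos_pos mult_pos_pos add_pos_nonneg) auto
  have [measurable]: "w \<in> borel_measurable borel" unfolding w_def by measurable
  have "(\<integral>\<^sup>+z. ennreal (w z) \<partial>lborel) = (\<integral>\<^sup>+x. \<integral>\<^sup>+y. ennreal (w1 x / (1 + I\<^sup>2)) * ennreal (w1 y) \<partial>lborel \<partial>lborel)"
    by (subst nn_integral_lborel_iterated)
      (auto simp: w_def less_imp_le[OF w1(2)] add_nonneg_nonneg simp flip: ennreal_mult intro!: nn_integral_cong)
  also have "\<dots> = (\<integral>\<^sup>+x. ennreal (I / (1 + I\<^sup>2)) * ennreal (w1 x) \<partial>lborel)"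
  proof (rule nn_integral_cong)
    fix x
    have "(\<integral>\<^sup>+y. ennreal (w1 x / (1 + I\<^sup>2)) * ennreal (w1 y) \<partial>lborel) = ennreal (w1 x / (1 + I\<^sup>2)) * ennreal I"
      by (subst nn_integral_cmult) (simp_all add: nI)
    also have "\<dots> = ennreal (w1 x / (1 + I\<^sup>2) * I)"
      using I0 w1(2)[of x] by (intro ennreal_mult[symmetric] divide_nonneg_nonneg) auto
    also have "w1 x / (1 + I\<^sup>2) * I = I / (1 + I\<^sup>2) * w1 x" by simp
    also have "ennreal \<dots> = ennreal (I / (1 + I\<^sup>2)) * ennreal (w1 x)"
      using I0 w1(2)[of x] by (intro ennreal_mult divide_nonneg_nonneg) auto
    finally show "(\<integral>\<^sup>+y. ennreal (w1 x / (1 + I\<^sup>2)) * ennreal (w1 y) \<partial>lborel) = ennreal (I / (1 + I\<^sup>2)) * ennreal (w1 x)" .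
  qed
  also have "\<dots> = ennreal (I / (1 + I\<^sup>2) * I)"
    using I0 by (simp add: nn_integral_cmult nI add_nonneg_nonneg flip: ennreal_mult)
  also have "I / (1 + I\<^sup>2) * I = I\<^sup>2 / (1 + I\<^sup>2)" by (simp add: power2_eq_square)
  also have "\<dots> \<le> 1" by (simp add: divide_le_eq add_pos_nonneg)
  finally have le: "(\<integral>\<^sup>+z. ennreal (w z) \<partial>lborel) \<le> ennreal 1" by (simp add: ennreal_leI)
  have i: "integrable lborel w"
    using order.strict_trans1[OF le, of \<infinity>] less_imp_le[OF wpos] by (intro integrableI_bounded) auto
  have "(LBINT z. w z) \<le> 1"
    using le less_imp_le[OF wpos] by (subst (asm) nn_integral_eq_integral[OF i]) auto
  then have "weight w \<and> (\<forall>x y. w (x, y) = w (y, x)) \<and> (LBINT z. w z) \<le> 1"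
    using wpos i unfolding weight_def by (auto simp: w_def[of "(_, _)"] mult.commute)
  then have *: "weight w0 \<and> (\<forall>x y. w0 (x, y) = w0 (y, x)) \<and> (LBINT z. w0 z) \<le> 1"
    unfolding w0_def by (rule someI[where P = "\<lambda>w. weight w \<and> (\<forall>x y. w (x, y) = w (y, x)) \<and> (LBINT z. w z) \<le> 1"])
  then show "weight w0" "w0 (x, y) = w0 (y, x)" "(LBINT z. w0 z) \<le> 1" by blast+
qed

definition cn :: "nat \<Rightarrow> 'a \<times> 'a \<Rightarrow> real" where "cn n z = w0 z / real (Suc n)"

lemma cn: "weight (cn n)" "(LBINT z. cn n z) \<le> 1"
proof -
  note [measurable] = weightD(1)[OF w0(1)]
  show "weight (cn n)"
    using weightD(2,3)[OF w0(1)] unfolding weight_def cn_def by (auto simp del: of_nat_Suc)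
  have "(LBINT z. cn n z) = (LBINT z. w0 z) / real (Suc n)" unfolding cn_def by simp
  also have "\<dots> \<le> 1" using w0(3) by (simp add: divide_le_eq)
  finally show "(LBINT z. cn n z) \<le> 1" .
qed

text \<open>Of the two spare units one pays for the mass of the smoothing weight at the initial
  datum, the other for the growth of the energy up to time \<open>T1\<close>.\<close>

definition M0 :: real where "M0 = (LBINT z. \<bar>dK u0 z\<bar>) + 2"

lemma M0: "2 \<le> M0" by (simp add: M0_def)

text \<open>The energy estimate is available up to time \<open>T1\<close>; the margin beyond \<open>T\<close> accommodates the step that is in
  progress at time \<open>T\<close>.\<close>

definition T1 :: real where "T1 = 1 / (G M0 + 1)"
definition T :: real where "T = T1 / 2"
definition hn :: "nat \<Rightarrow> real" where "hn n = T / real (Suc n)"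

lemma T: "0 < T1" "0 < T" "T1 * G M0 \<le> 1"
  using G_nonneg[of M0] M0 by (auto simp: T1_def T_def divide_le_eq)

lemma hn: "0 < hn n" "hn n \<le> T" "real (Suc n) * hn n = T"
  using T(2) by (auto simp: hn_def divide_le_eq)

lemma hn_tendsto: "hn \<longlonglongrightarrow> 0"
proof -
  have "(\<lambda>n. T * inverse (real (Suc n))) \<longlonglongrightarrow> T * 0"
    by (intro tendsto_intros LIMSEQ_inverse_real_of_nat)
  then show ?thesis by (simp add: hn_def[abs_def] divide_inverse)
qed

section \<open>The scheme and its energy estimate\<close>

definition step :: "nat \<Rightarrow> ('a \<Rightarrow> real) \<Rightarrow> 'a \<Rightarrow> real" where
  "step n u = (SOME v. v \<in> D \<and> (\<forall>w\<in>D. prox_energy (cn n) (hn n) (\<lambda>x. u x + hn n * Nf u x) v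
      \<le> prox_energy (cn n) (hn n) (\<lambda>x. u x + hn n * Nf u x) w))"

primrec U :: "nat \<Rightarrow> nat \<Rightarrow> 'a \<Rightarrow> real" where
  "U n 0 = u0"
| "U n (Suc k) = step n (U n k)"

lemma D_Nf:
  assumes "u \<in> D" shows "L2 (Nf u)"
proof (rule Nf_square_integrable(1))
  show "0 \<le> (LBINT z. \<bar>dK u z\<bar>)" by simp
qed (simp_all add: J_eq[OF assms] D_X[OF assms])

lemma step:
  assumes u: "u \<in> D"
  shows "step n u \<in> D" "w \<in> D \<Longrightarrow> prox_energy (cn n) (hn n) (\<lambda>x. u x + hn n * Nf u x) (step n u)
      \<le> prox_energy (cn n) (hn n) (\<lambda>x. u x + hn n * Nf u x) w"
proof -
  let ?P = "\<lambda>v. v \<in> D \<and> (\<forall>w\<in>D. prox_energy (cn n) (hn n) (\<lambda>x. u x + hn n * Nf u x) v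
      \<le> prox_energy (cn n) (hn n) (\<lambda>x. u x + hn n * Nf u x) w)"
  have sq: "L2 (\<lambda>x. u x + hn n * Nf u x)"
    by (intro square_integrable_add square_integrable_scale D_square_integrable D_Nf u)
  obtain v where "?P v" by (rule prox_exists[OF cn(1) sq hn(1)]) blast
  then have "?P (step n u)" unfolding step_def by (rule someI[where P = ?P])
  then show "step n u \<in> D" "w \<in> D \<Longrightarrow> prox_energy (cn n) (hn n) (\<lambda>x. u x + hn n * Nf u x) (step n u)
      \<le> prox_energy (cn n) (hn n) (\<lambda>x. u x + hn n * Nf u x) w" by auto
qed

lemma U_D: "U n k \<in> D"
  by (induction k) (auto simp: u0D step(1))

lemma U_square_integrable: "L2 (U n k)"
  by (rule D_square_integrable[OF U_D])

definition dU :: "nat \<Rightarrow> nat \<Rightarrow> 'a \<Rightarrow> real" where "dU n k x = U n (Suc k) x - U n k x"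

lemma dU_square_integrable: "L2 (dU n k)"
  unfolding dU_def[abs_def] by (intro square_integrable_diff U_square_integrable)

lemma J_le_jc: "u \<in> D \<Longrightarrow> J u \<le> ennreal (LBINT z. jc (cn n) u z)"
proof -
  assume u: "u \<in> D"
  have "(LBINT z. \<bar>dK u z\<bar>) \<le> (LBINT z. jc (cn n) u z)"
    using D_integrable_dK[OF u] jc_integrable[OF u cn(1)] by (intro integral_mono jc_ge) auto
  then show ?thesis using J_eq[OF u] by (simp add: ennreal_leI)
qed

lemma jc_u0: "(LBINT z. jc (cn n) u0 z) \<le> M0 - 1"
proof -
  have "(LBINT z. jc (cn n) u0 z) \<le> (LBINT z. \<bar>dK u0 z\<bar> + cn n z)"
    using D_integrable_dK[OF u0D] jc_integrable[OF u0D cn(1)] weightD[OF cn(1)]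
    by (intro integral_mono jc_le) (auto intro: less_imp_le)
  also have "\<dots> \<le> M0 - 1"
    using D_integrable_dK[OF u0D] weightD(3)[OF cn(1)] cn(2)[of n] by (simp add: M0_def)
  finally show ?thesis .
qed

text \<open>A discrete continuation argument: the bound at step k keeps the seminorm below
  \<open>M0\<close>, hence the nonlinearity below \<open>G M0\<close>, and the next step then costs
  at most h \<open>G M0\<close>. As long as k h \<le> \<open>T1\<close> the total cost stays within
  the spare unit of \<open>M0\<close>.\<close>

lemma scheme_energy:
  assumes "real k * hn n \<le> T1"
  shows "(LBINT z. jc (cn n) (U n k) z) + (\<Sum>j<k. nsq lborel (dU n j)) / (4 * hn n) \<le> M0 - 1 + real k * hn n * G M0"
  using assms
proof (induction k)
  case 0
  show ?case using jc_u0[of n] by simp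
next
  case (Suc k)
  have kT: "real k * hn n \<le> T1" using Suc.prems hn(1)[of n] by (simp add: algebra_simps)
  note IH = Suc.IH[OF kT]
  have "0 \<le> (\<Sum>j<k. nsq lborel (dU n j)) / (4 * hn n)" using hn(1)[of n] by (intro divide_nonneg_pos sum_nonneg) auto
  moreover have "real k * hn n * G M0 \<le> T1 * G M0" using kT G_nonneg[of M0] M0 by (intro mult_right_mono) auto
  ultimately have "(LBINT z. jc (cn n) (U n k) z) \<le> M0" using IH T(3) by linarith
  then have JM: "J (U n k) \<le> ennreal M0" using J_le_jc[OF U_D] by (meson ennreal_leI order.trans)
  have g: "nsq lborel (Nf (U n k)) \<le> G M0" using Nf_square_integrable(2)[OF _ D_X[OF U_D] JM] M0 by simp
  have "(LBINT z. jc (cn n) (U n (Suc k)) z) + nsq lborel (\<lambda>x. U n (Suc k) x - U n k x) / (4 * hn n)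
      \<le> (LBINT z. jc (cn n) (U n k) z) + hn n * nsq lborel (Nf (U n k))"
    using prox_energy_estimate[where c = "cn n" and h = "hn n" and u = "U n k" and v = "step n (U n k)" and g = "Nf (U n k)",
        OF cn(1) D_Nf[OF U_D] hn(1) U_D step(1)[OF U_D] step(2)[OF U_D]] by simp
  also have "hn n * nsq lborel (Nf (U n k)) \<le> hn n * G M0" using g hn(1)[of n] by (intro mult_left_mono) auto
  finally have "(LBINT z. jc (cn n) (U n (Suc k)) z) + nsq lborel (dU n k) / (4 * hn n)
      \<le> (LBINT z. jc (cn n) (U n k) z) + hn n * G M0" by (simp add: dU_def[abs_def])
  then show ?case using IH by (simp add: add_divide_distrib algebra_simps)
qed

lemma scheme_bounds:
  assumes k: "real k * hn n \<le> T1"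
  shows "J (U n k) \<le> ennreal M0" "(\<Sum>j<k. nsq lborel (dU n j)) \<le> 4 * hn n * M0"
proof -
  have "real k * hn n * G M0 \<le> T1 * G M0" using k G_nonneg[of M0] M0 by (intro mult_right_mono) auto
  then have *: "(LBINT z. jc (cn n) (U n k) z) + (\<Sum>j<k. nsq lborel (dU n j)) / (4 * hn n) \<le> M0"
    using scheme_energy[OF k] T(3) by linarith
  have "0 \<le> (\<Sum>j<k. nsq lborel (dU n j)) / (4 * hn n)" using hn(1)[of n] by (intro divide_nonneg_pos sum_nonneg) auto
  then have "(LBINT z. jc (cn n) (U n k) z) \<le> M0" using * by linarith
  then show "J (U n k) \<le> ennreal M0" using J_le_jc[OF U_D] by (meson ennreal_leI order.trans)
  have "0 \<le> (LBINT z. jc (cn n) (U n k) z)" by simp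
  then have "(\<Sum>j<k. nsq lborel (dU n j)) / (4 * hn n) \<le> M0" using * by linarith
  then show "(\<Sum>j<k. nsq lborel (dU n j)) \<le> 4 * hn n * M0" using hn(1)[of n] by (simp add: divide_le_eq mult.commute)
qed

text \<open>Cauchy-Schwarz over the steps between j and k: the squared L2 distance is linear in the
  elapsed time, which is Holder continuity with exponent 1/2.\<close>

lemma U_diff_bound:
  assumes "j \<le> k" "real k * hn n \<le> T1"
  shows "nsq lborel (\<lambda>x. U n k x - U n j x) \<le> real (k - j) * hn n * (4 * M0)"
proof -
  have "(\<lambda>x. U n k x - U n j x) = (\<lambda>x. \<Sum>i\<in>{j..<k}. dU n i x)"
    unfolding dU_def by (subst sum_Suc_diff') (use assms in auto)
  then have "nsq lborel (\<lambda>x. U n k x - U n j x) \<le> real (card {j..<k}) * (\<Sum>i\<in>{j..<k}. nsq lborel (dU n i))"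
    using nsq_sum_le[of "{j..<k}" lborel "dU n"] dU_square_integrable by simp
  also have "\<dots> \<le> real (card {j..<k}) * (\<Sum>i<k. nsq lborel (dU n i))"
    by (intro mult_left_mono sum_mono2) auto
  also have "\<dots> \<le> real (card {j..<k}) * (4 * hn n * M0)" using scheme_bounds(2)[OF assms(2)] by (intro mult_left_mono) auto
  finally show ?thesis by (simp add: algebra_simps)
qed

section \<open>Piecewise constant interpolants\<close>

definition idx :: "nat \<Rightarrow> real \<Rightarrow> nat" where "idx n t = nat \<lfloor>t / hn n\<rfloor>"

lemma idx:
  assumes "0 \<le> t"
  shows "real (idx n t) * hn n \<le> t" "t < (real (idx n t) + 1) * hn n"
proof -
  have e: "real (idx n t) = of_int \<lfloor>t / hn n\<rfloor>" using assms hn(1)[of n] by (simp add: idx_def)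
  show "real (idx n t) * hn n \<le> t"
    unfolding e by (rule pos_le_divide_eq[OF hn(1), THEN iffD1]) linarith
  show "t < (real (idx n t) + 1) * hn n"
    unfolding e by (rule pos_divide_less_eq[OF hn(1), THEN iffD1]) linarith
qed

lemma idx_mono: "0 \<le> t \<Longrightarrow> t \<le> t' \<Longrightarrow> idx n t \<le> idx n t'"
  unfolding idx_def using hn(1)[of n] by (intro nat_mono floor_mono divide_right_mono) auto

lemma idx_measurable [measurable]: "idx n \<in> measurable borel (count_space UNIV)"
  unfolding idx_def by measurable

text \<open>The step in progress at time t ends before t + h \<le> 2T = \<open>T1\<close>.\<close>

lemma idx_T1:
  assumes "0 \<le> t" "t \<le> T"
  shows "real (idx n t) * hn n \<le> T1" "real (Suc (idx n t)) * hn n \<le> T1"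
  using idx(1)[OF assms(1), of n] hn(1,2)[of n] assms by (auto simp: T_def algebra_simps)

lemma idx_less: "0 \<le> t \<Longrightarrow> t < T \<Longrightarrow> idx n t < Suc n"
proof (rule ccontr)
  assume t: "0 \<le> t" "t < T" and "\<not> idx n t < Suc n"
  then have "real (Suc n) * hn n \<le> real (idx n t) * hn n" using hn(1)[of n] by (intro mult_right_mono) auto
  then show False using idx(1)[OF t(1), of n] hn(3)[of n] t by linarith
qed

text \<open>The interpolants at the left and at the right end of the current step. The nonlinearity is evaluated at the left
  one, the coefficient \<open>\<eta>n\<close> at the right one.\<close>

definition ub :: "nat \<Rightarrow> real \<Rightarrow> 'a \<Rightarrow> real" where "ub n t = U n (idx n t)"
definition ub' :: "nat \<Rightarrow> real \<Rightarrow> 'a \<Rightarrow> real" where "ub' n t = U n (Suc (idx n t))"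
definition vn :: "nat \<Rightarrow> real \<Rightarrow> 'a \<Rightarrow> real" where "vn n t x = dU n (idx n t) x / hn n"
definition gn :: "nat \<Rightarrow> real \<Rightarrow> 'a \<Rightarrow> real" where "gn n t x = f x (ub n t x)"
definition \<eta>n :: "nat \<Rightarrow> real \<Rightarrow> 'a \<times> 'a \<Rightarrow> real" where
  "\<eta>n n t z = dK (ub' n t) z / jc (cn n) (ub' n t) z"

lemma ub_D: "ub n t \<in> D" "ub' n t \<in> D" by (simp_all add: ub_def ub'_def U_D del: U.simps)

lemma U_measurable [measurable]: "U n k \<in> borel_measurable borel" using U_D D_measurable by blast

lemma dU_measurable [measurable]: "dU n k \<in> borel_measurable borel" unfolding dU_def by measurable

lemma ub_measurable [measurable]:
  assumes [measurable]: "p \<in> borel_measurable M" "q \<in> borel_measurable M"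
  shows "(\<lambda>z. ub n (p z) (q z)) \<in> borel_measurable M" "(\<lambda>z. ub' n (p z) (q z)) \<in> borel_measurable M"
    "(\<lambda>z. vn n (p z) (q z)) \<in> borel_measurable M"
proof -
  have i: "(\<lambda>z. idx n (p z)) \<in> measurable M (count_space UNIV)" by measurable
  show "(\<lambda>z. ub n (p z) (q z)) \<in> borel_measurable M"
    unfolding ub_def by (rule measurable_compose_countable[OF _ i]) measurable
  show "(\<lambda>z. ub' n (p z) (q z)) \<in> borel_measurable M"
    unfolding ub'_def by (rule measurable_compose_countable[OF _ i]) (simp del: U.simps)
  have "(\<lambda>z. dU n (idx n (p z)) (q z)) \<in> borel_measurable M"
    by (rule measurable_compose_countable[OF _ i]) measurable
  then show "(\<lambda>z. vn n (p z) (q z)) \<in> borel_measurable M" unfolding vn_def by simp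
qed

lemma gn_measurable [measurable]:
  assumes [measurable]: "p \<in> borel_measurable M" "q \<in> borel_measurable M"
  shows "(\<lambda>z. gn n (p z) (q z)) \<in> borel_measurable M"
  unfolding gn_def by (intro f_measurable) measurable

lemma \<eta>n_measurable [measurable]:
  assumes [measurable]: "p \<in> borel_measurable M" "q \<in> borel_measurable M"
  shows "(\<lambda>z. \<eta>n n (p z) (q z)) \<in> borel_measurable M"
proof -
  have [measurable]: "cn n \<in> borel_measurable borel" using weightD(1)[OF cn(1)] .
  have [measurable]: "(\<lambda>z. fst (q z)) \<in> borel_measurable M" "(\<lambda>z. snd (q z)) \<in> borel_measurable M"
    using measurable_compose[OF assms(2) measurable_fst_borel] measurable_compose[OF assms(2) measurable_snd_borel] by auto
  show ?thesis unfolding \<eta>n_def jc_def dK_def by measurable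
qed

lemma \<eta>n_le1: "\<bar>\<eta>n n t z\<bar> \<le> 1"
proof -
  have "0 < jc (cn n) (ub' n t) z"
    unfolding jc_def using weightD(2)[OF cn(1), of n z] by (intro real_sqrt_gt_zero add_nonneg_pos) auto
  then show ?thesis unfolding \<eta>n_def using jc_ge[of "ub' n t" z "cn n"] by (simp add: abs_divide)
qed

lemma \<eta>n_antisym: "\<eta>n n t (x, y) = - \<eta>n n t (y, x)"
proof -
  have "K (x, y) = K (y, x)" by (simp add: K_def norm_minus_commute)
  then have "dK (ub' n t) (x, y) = - dK (ub' n t) (y, x)" by (simp add: dK_def algebra_simps)
  moreover have "cn n (x, y) = cn n (y, x)" by (simp add: cn_def w0(2))
  ultimately show ?thesis by (simp add: \<eta>n_def jc_def)
qed

lemma ub_J: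
  assumes "0 \<le> t" "t \<le> T"
  shows "J (ub n t) \<le> ennreal M0" "J (ub' n t) \<le> ennreal M0"
  unfolding ub_def ub'_def by (rule scheme_bounds(1)[OF idx_T1(1)[OF assms]], rule scheme_bounds(1)[OF idx_T1(2)[OF assms]])

lemma ub_time_diff:
  assumes "0 \<le> t" "t \<le> t'" "t' \<le> T"
  shows "nsq lborel (\<lambda>x. ub n t' x - ub n t x) \<le> (t' - t + hn n) * (4 * M0)"
proof -
  have t': "0 \<le> t'" using assms by simp
  have le: "idx n t \<le> idx n t'" using idx_mono assms by blast
  have "real (idx n t' - idx n t) * hn n \<le> t' - t + hn n"
    using idx(1)[OF t', of n] idx(2)[OF assms(1), of n] le by (simp add: of_nat_diff algebra_simps)
  then show ?thesis
    unfolding ub_def using U_diff_bound[OF le idx_T1(1)[OF t' assms(3)]] M0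
    by (meson mult_right_mono order.trans mult_nonneg_nonneg zero_le_numeral)
qed

lemma ub'_diff:
  assumes "0 \<le> t" "t \<le> T"
  shows "nsq lborel (\<lambda>x. ub' n t x - ub n t x) \<le> hn n * (4 * M0)"
  using U_diff_bound[of "idx n t" "Suc (idx n t)" n] idx_T1(2)[OF assms] unfolding ub_def ub'_def by simp

text \<open>The Euler-Lagrange equation of a single step, with (v - u - h Nf u) / h written as
  \<open>vn\<close> - \<open>gn\<close>. It holds at every t because the interpolants are iterates
  with the index of t.\<close>

lemma scheme_equation:
  assumes \<phi>: "\<phi> \<in> D"
  shows "(LBINT x. vn n t x * \<phi> x) + (LBINT z. \<eta>n n t z * dK \<phi> z) = (LBINT x. gn n t x * \<phi> x)"
proof -
  let ?u = "ub n t" and ?v = "ub' n t"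
  have u: "?u \<in> D" by (rule ub_D)
  have v: "?v = step n ?u" by (simp add: ub_def ub'_def)
  have sq: "L2 (\<lambda>x. ?u x + hn n * Nf ?u x)"
    by (intro square_integrable_add square_integrable_scale D_square_integrable D_Nf u)
  have EL: "(LBINT z. \<eta>n n t z * dK \<phi> z) + (LBINT x. (?v x - (?u x + hn n * Nf ?u x)) * \<phi> x) / hn n = 0"
    unfolding \<eta>n_def by (rule prox_Euler_Lagrange[OF cn(1) sq hn(1) ub_D(2) _ \<phi>]) (use step(2)[OF u] in \<open>simp add: v\<close>)
  have sv: "L2 (vn n t)"
    unfolding vn_def using square_integrable_scale[OF dU_square_integrable, of "1 / hn n"] by simp
  have sg: "L2 (gn n t)" using D_Nf[OF u] by (simp add: gn_def[abs_def] Nf_def[abs_def])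
  have s\<phi>: "L2 \<phi>" by (rule D_square_integrable[OF \<phi>])
  have "(LBINT x. (?v x - (?u x + hn n * Nf ?u x)) * \<phi> x) = (LBINT x. hn n * (vn n t x * \<phi> x - gn n t x * \<phi> x))"
    using hn(1)[of n] by (intro Bochner_Integration.integral_cong)
      (auto simp: vn_def gn_def dU_def Nf_def ub_def ub'_def field_simps simp del: U.simps)
  also have "\<dots> = hn n * ((LBINT x. vn n t x * \<phi> x) - (LBINT x. gn n t x * \<phi> x))"
    using square_integrable_mult[OF sv s\<phi>] square_integrable_mult[OF sg s\<phi>] by simp
  finally show ?thesis using EL hn(1)[of n] by simp
qed

lemma vn_square_integrable: "L2 (vn n t)"
  unfolding vn_def using square_integrable_scale[OF dU_square_integrable, of "1 / hn n"] by simp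

lemma vn_nsq: "nsq lborel (vn n t) = nsq lborel (dU n (idx n t)) / (hn n)\<^sup>2"
  unfolding vn_def using nsq_scale[of lborel "1 / hn n"] by (simp add: power_divide)

text \<open>A step of length h contributes h times \<open>nsq (dU n k)\<close> / h^2; the energy
  estimate bounds the sum of the increments by 4 h \<open>M0\<close>.\<close>

lemma vn_space_time:
  shows "L2 (\<lambda>z :: real \<times> 'a. indicator {0..<T} (fst z) * vn n (fst z) (snd z))"
    and "nsq lborel (\<lambda>z :: real \<times> 'a. indicator {0..<T} (fst z) * vn n (fst z) (snd z)) \<le> 4 * M0"
proof -
  let ?F = "\<lambda>z :: real \<times> 'a. indicator {0..<T} (fst z) * vn n (fst z) (snd z)"
  have [measurable]: "?F \<in> borel_measurable borel" by measurable
  have h: "0 < hn n" by (rule hn)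
  let ?I = "\<lambda>k. {real k * hn n..<(real k + 1) * hn n}"
  have nd: "(\<integral>\<^sup>+x. ennreal ((vn n t x)\<^sup>2) \<partial>lborel) = ennreal (nsq lborel (vn n t))" for t
    unfolding nsq_def using vn_square_integrable by (intro nn_integral_eq_integral) (auto simp: square_integrable_def)
  have "(\<integral>\<^sup>+z. ennreal ((?F z)\<^sup>2) \<partial>lborel) = (\<integral>\<^sup>+t. \<integral>\<^sup>+x. ennreal ((?F (t, x))\<^sup>2) \<partial>lborel \<partial>lborel)"
    by (rule nn_integral_lborel_iterated) measurable
  also have "\<dots> \<le> (\<integral>\<^sup>+t. (\<Sum>k<Suc n. ennreal (nsq lborel (dU n k) / (hn n)\<^sup>2) * indicator (?I k) t) \<partial>lborel)"
  proof (rule nn_integral_mono)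
    fix t
    show "(\<integral>\<^sup>+x. ennreal ((?F (t, x))\<^sup>2) \<partial>lborel) \<le> (\<Sum>k<Suc n. ennreal (nsq lborel (dU n k) / (hn n)\<^sup>2) * indicator (?I k) t)"
    proof (cases "t \<in> {0..<T}")
      case True
      then have t: "0 \<le> t" "t < T" by auto
      have "(\<integral>\<^sup>+x. ennreal ((?F (t, x))\<^sup>2) \<partial>lborel) = ennreal (nsq lborel (dU n (idx n t)) / (hn n)\<^sup>2) * indicator (?I (idx n t)) t"
        using True idx[OF t(1), of n] by (simp add: nd vn_nsq)
      also have "\<dots> \<le> (\<Sum>k<Suc n. ennreal (nsq lborel (dU n k) / (hn n)\<^sup>2) * indicator (?I k) t)"
        by (rule member_le_sum) (use idx_less[OF t] in auto)
      finally show ?thesis .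
    qed simp
  qed
  also have "\<dots> = (\<Sum>k<Suc n. ennreal (nsq lborel (dU n k) / (hn n)\<^sup>2) * emeasure lborel (?I k))"
    by (subst nn_integral_sum) (auto simp: nn_integral_cmult_indicator)
  also have "\<dots> = (\<Sum>k<Suc n. ennreal (nsq lborel (dU n k) / hn n))"
  proof (rule sum.cong[OF refl])
    fix k
    have "real k * hn n \<le> (real k + 1) * hn n" using h by (intro mult_right_mono) auto
    then have "emeasure lborel (?I k) = ennreal (hn n)" by (simp add: algebra_simps)
    then show "ennreal (nsq lborel (dU n k) / (hn n)\<^sup>2) * emeasure lborel (?I k) = ennreal (nsq lborel (dU n k) / hn n)"
      using h by (simp add: power2_eq_square flip: ennreal_mult)
  qed
  also have "\<dots> = ennreal ((\<Sum>k<Suc n. nsq lborel (dU n k)) / hn n)"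
    using h by (subst sum_ennreal) (auto simp: sum_divide_distrib simp del: sum.lessThan_Suc)
  also have "\<dots> \<le> ennreal (4 * M0)"
  proof (rule ennreal_leI)
    have "real (Suc n) * hn n \<le> T1" using hn(3)[of n] T by (simp add: T_def)
    from scheme_bounds(2)[OF this] show "(\<Sum>k<Suc n. nsq lborel (dU n k)) / hn n \<le> 4 * M0"
      using h by (simp add: divide_le_eq mult_ac del: sum.lessThan_Suc)
  qed
  finally have b: "(\<integral>\<^sup>+z. ennreal ((?F z)\<^sup>2) \<partial>lborel) \<le> ennreal (4 * M0)" .
  have i: "integrable lborel (\<lambda>z. (?F z)\<^sup>2)"
    using order.strict_trans1[OF b, of \<infinity>] by (intro integrableI_bounded) auto
  then show "L2 ?F" by (simp add: square_integrable_def)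
  show "nsq lborel ?F \<le> 4 * M0"
    using b M0 unfolding nsq_def by (subst (asm) nn_integral_eq_integral[OF i]) auto
qed

end

section \<open>Functions of space and time\<close>

lemma lborel_Fubini:
  fixes F :: "'a::euclidean_space \<times> 'b::euclidean_space \<Rightarrow> real"
  assumes "integrable lborel F"
  shows "AE x in lborel. integrable lborel (\<lambda>y. F (x, y))"
    and "integrable lborel (\<lambda>x. LBINT y. F (x, y))"
    and "(LBINT x. \<integral>y. F (x, y) \<partial>lborel) = (LBINT z. F z)"
    and "AE y in lborel. integrable lborel (\<lambda>x. F (x, y))"
    and "integrable lborel (\<lambda>y. LBINT x. F (x, y))"
    and "(LBINT y. \<integral>x. F (x, y) \<partial>lborel) = (LBINT z. F z)"
proof -
  have i: "integrable (lborel \<Otimes>\<^sub>M lborel) F" using assms by (simp add: lborel_prod)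
  have i': "integrable (lborel \<Otimes>\<^sub>M lborel) (case_prod (\<lambda>x y. F (x, y)))" using i by simp
  show "AE x in lborel. integrable lborel (\<lambda>y. F (x, y))"
    "integrable lborel (\<lambda>x. LBINT y. F (x, y))"
    using lborel_pair.AE_integrable_fst'[OF i] lborel_pair.integrable_fst'[OF i] by auto
  show "(LBINT x. \<integral>y. F (x, y) \<partial>lborel) = (LBINT z. F z)"
    using lborel_pair.integral_fst'[OF i] by (simp add: lborel_prod)
  show "AE y in lborel. integrable lborel (\<lambda>x. F (x, y))"
    "integrable lborel (\<lambda>y. LBINT x. F (x, y))"
    using lborel_pair.AE_integrable_snd[OF i'] lborel_pair.integrable_snd[OF i'] by auto
  show "(LBINT y. \<integral>x. F (x, y) \<partial>lborel) = (LBINT z. F z)"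
    using lborel_pair.integral_snd[OF i'] by (simp add: lborel_prod)
qed

lemma Pair_measurable_borel [measurable]:
  "(\<lambda>y. (x :: 'a::second_countable_topology, y :: 'b::second_countable_topology)) \<in> borel_measurable borel"
  "(\<lambda>x. (x :: 'a::second_countable_topology, y :: 'b::second_countable_topology)) \<in> borel_measurable borel"
  by (intro borel_measurable_continuous_onI continuous_intros)+

lemma square_integrable_Fubini:
  fixes F :: "'a::euclidean_space \<times> 'b::euclidean_space \<Rightarrow> real"
  assumes "L2 F"
  shows "AE x in lborel. L2 (\<lambda>y. F (x, y))"
    and "integrable lborel (\<lambda>x. nsq lborel (\<lambda>y. F (x, y)))"
    and "(LBINT x. nsq lborel (\<lambda>y. F (x, y))) = nsq lborel F"
    and "AE y in lborel. L2 (\<lambda>x. F (x, y))"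
    and "integrable lborel (\<lambda>y. nsq lborel (\<lambda>x. F (x, y)))"
    and "(LBINT y. nsq lborel (\<lambda>x. F (x, y))) = nsq lborel F"
proof -
  have i: "integrable lborel (\<lambda>z. (F z)\<^sup>2)" and m: "F \<in> borel_measurable borel"
    using assms by (auto simp: square_integrable_def)
  have [measurable]: "(\<lambda>y. F (x, y)) \<in> borel_measurable borel" "(\<lambda>x. F (x, y)) \<in> borel_measurable borel" for x y
    using m by measurable
  show "AE x in lborel. L2 (\<lambda>y. F (x, y))"
    "AE y in lborel. L2 (\<lambda>x. F (x, y))"
    using lborel_Fubini(1,4)[OF i] by (auto simp: square_integrable_def)
  show "integrable lborel (\<lambda>x. nsq lborel (\<lambda>y. F (x, y)))" "integrable lborel (\<lambda>y. nsq lborel (\<lambda>x. F (x, y)))"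
    "(LBINT x. nsq lborel (\<lambda>y. F (x, y))) = nsq lborel F"
    "(LBINT y. nsq lborel (\<lambda>x. F (x, y))) = nsq lborel F"
    using lborel_Fubini(2,3,5,6)[OF i] by (auto simp: nsq_def)
qed

lemma AE_lborel_iterate:
  fixes P :: "'a::euclidean_space \<times> 'b::euclidean_space \<Rightarrow> bool"
  assumes "AE z in lborel. P z"
  shows "AE x in lborel. AE y in lborel. P (x, y)" "AE y in lborel. AE x in lborel. P (x, y)"
proof -
  obtain N where N: "{z. \<not> P z} \<subseteq> N" "N \<in> null_sets lborel"
    using AE_E[OF assms] by (auto simp: null_sets_def)
  have a: "AE z in lborel \<Otimes>\<^sub>M lborel. z \<notin> N"
    unfolding lborel_prod by (rule AE_not_in[OF N(2)])
  have m: "{x \<in> space (lborel \<Otimes>\<^sub>M lborel). case x of (x, y) \<Rightarrow> (x, y) \<notin> N} \<in> sets (lborel \<Otimes>\<^sub>M lborel)"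
  proof -
    have "{x \<in> space (lborel \<Otimes>\<^sub>M lborel). case x of (x, y) \<Rightarrow> (x, y) \<notin> N} = - N"
      by (auto simp: space_pair_measure)
    moreover have "- N \<in> sets borel" using null_setsD2[OF N(2)] by auto
    ultimately show ?thesis unfolding lborel_prod by simp
  qed
  have 1: "AE x in lborel. AE y in lborel. (x, y) \<notin> N" using lborel_pair.AE_pair[OF a] .
  then have 2: "AE y in lborel. AE x in lborel. (x, y) \<notin> N"
    using lborel_pair.AE_commute[of "\<lambda>x y. (x, y) \<notin> N"] m by simp
  have *: "\<And>z. z \<notin> N \<Longrightarrow> P z" using N(1) by auto
  show "AE x in lborel. AE y in lborel. P (x, y)"
    using 1 by eventually_elim (auto elim!: eventually_mono intro: *)
  show "AE y in lborel. AE x in lborel. P (x, y)"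
    using 2 by eventually_elim (auto elim!: eventually_mono intro: *)
qed

lemma AE_lborel_prodI:
  fixes P :: "'a::euclidean_space \<times> 'b::euclidean_space \<Rightarrow> bool"
  assumes "{z. P z} \<in> sets borel" "AE x in lborel. AE y in lborel. P (x, y)"
  shows "AE z in lborel. P z"
proof -
  have "AE z in lborel \<Otimes>\<^sub>M lborel. P z"
  proof (rule lborel_pair.AE_pair_measure)
    show "{x \<in> space (lborel \<Otimes>\<^sub>M lborel). P x} \<in> sets (lborel \<Otimes>\<^sub>M lborel)"
      unfolding lborel_prod using assms(1) by simp
  qed (rule assms(2))
  then show ?thesis unfolding lborel_prod .
qed

lemma AE_lborel_fst_neq: "AE z in (lborel :: (real \<times> 'a::euclidean_space) measure). fst z \<noteq> c"
proof (rule AE_lborel_prodI)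
  have "{z :: real \<times> 'a. fst z \<noteq> c} = - (fst -` {c})" by auto
  then show "{z :: real \<times> 'a. fst z \<noteq> c} \<in> sets borel"
    using measurable_sets[OF measurable_fst_borel, of "{c}"] by (metis borel_closed borel_comp closed_singleton Int_UNIV_right space_borel)
  show "AE x in lborel. AE y in (lborel :: 'a measure). fst (x, y) \<noteq> c"
    using AE_lborel_singleton[of c] by eventually_elim simp
qed

lemma square_integrable_slices:
  fixes F :: "real \<times> 'b::euclidean_space \<Rightarrow> real"
  assumes [measurable]: "F \<in> borel_measurable borel" and T: "0 \<le> T" and c: "0 \<le> c"
    and sl: "\<And>t. t \<in> {0..<T} \<Longrightarrow> L2 (\<lambda>x. F (t, x)) \<and> nsq lborel (\<lambda>x. F (t, x)) \<le> c"
    and off: "\<And>t x. t \<notin> {0..<T} \<Longrightarrow> F (t, x) = 0"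
  shows "L2 F" "nsq lborel F \<le> c * T"
proof -
  have "(\<integral>\<^sup>+z. ennreal ((F z)\<^sup>2) \<partial>lborel) = (\<integral>\<^sup>+t. \<integral>\<^sup>+x. ennreal ((F (t, x))\<^sup>2) \<partial>lborel \<partial>lborel)"
    by (rule nn_integral_lborel_iterated) measurable
  also have "\<dots> \<le> (\<integral>\<^sup>+t. ennreal c * indicator {0..<T} t \<partial>lborel)"
  proof (rule nn_integral_mono)
    fix t
    show "(\<integral>\<^sup>+x. ennreal ((F (t, x))\<^sup>2) \<partial>lborel) \<le> ennreal c * indicator {0..<T} t"
    proof (cases "t \<in> {0..<T}")
      case True
      have "(\<integral>\<^sup>+x. ennreal ((F (t, x))\<^sup>2) \<partial>lborel) = ennreal (nsq lborel (\<lambda>x. F (t, x)))"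
        unfolding nsq_def using sl[OF True] by (intro nn_integral_eq_integral) (auto simp: square_integrable_def)
      then show ?thesis using sl[OF True] True by (simp add: ennreal_leI)
    qed (simp add: off)
  qed
  also have "\<dots> = ennreal (c * T)"
    using T c by (subst nn_integral_cmult_indicator) (auto simp: ennreal_mult)
  finally have b: "(\<integral>\<^sup>+z. ennreal ((F z)\<^sup>2) \<partial>lborel) \<le> ennreal (c * T)" .
  have i: "integrable lborel (\<lambda>z. (F z)\<^sup>2)"
    using order.strict_trans1[OF b, of \<infinity>] by (intro integrableI_bounded) auto
  then show "L2 F" by (simp add: square_integrable_def)
  show "nsq lborel F \<le> c * T"
    using b T c unfolding nsq_def by (subst (asm) nn_integral_eq_integral[OF i]) auto
qed

text \<open>Half-open intervals make consecutive integrals add up exactly. At points where the slice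
  is not integrable the integral has the default value 0.\<close>

definition time_int :: "real \<Rightarrow> real \<Rightarrow> (real \<times> 'b \<Rightarrow> real) \<Rightarrow> 'b \<Rightarrow> real" where
  "time_int a b F x = (LBINT \<tau>. indicator {a..<b} \<tau> * F (\<tau>, x))"

text \<open>Joint measurability in both endpoints and the point is what the limit function and the
  Steklov averages require, since their limits of integration move with the time variable.\<close>

lemma time_int_measurable:
  fixes F :: "real \<times> 'b::euclidean_space \<Rightarrow> real"
  assumes [measurable]: "F \<in> borel_measurable borel"
  shows "(\<lambda>z. time_int (fst z) (fst (snd z)) F (snd (snd z))) \<in> borel_measurable borel"
proof -
  have "(\<lambda>z :: (real \<times> real \<times> 'b) \<times> real. (snd z, snd (snd (fst z)))) \<in> borel_measurable borel"
    by (intro borel_measurable_continuous_onI continuous_intros)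
  then have m1[measurable]: "(\<lambda>z :: (real \<times> real \<times> 'b) \<times> real. F (snd z, snd (snd (fst z)))) \<in> borel_measurable borel"
    by (rule measurable_compose) measurable
  have [measurable]: "Measurable.pred borel (\<lambda>z :: (real \<times> real \<times> 'b) \<times> real. fst (fst z) \<le> snd z \<and> snd z < fst (snd (fst z)))"
    by measurable
  have "(\<lambda>z :: (real \<times> real \<times> 'b) \<times> real. (if fst (fst z) \<le> snd z \<and> snd z < fst (snd (fst z)) then 1 else 0) * F (snd z, snd (snd (fst z)))) \<in> borel_measurable borel"
    by measurable
  then have "(\<lambda>(p, \<tau>). (if fst p \<le> \<tau> \<and> \<tau> < fst (snd p) then 1 else 0) * F (\<tau>, snd (snd p))) \<in> borel_measurable (borel \<Otimes>\<^sub>M lborel)"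
    by (simp add: borel_prod case_prod_beta' measurable_lborel1 cong: measurable_cong_sets sets_pair_measure_cong)
  then have "(\<lambda>p. LBINT \<tau>. (if fst p \<le> \<tau> \<and> \<tau> < fst (snd p) then 1 else 0) * F (\<tau>, snd (snd p))) \<in> borel_measurable borel"
    by (rule lborel.borel_measurable_lebesgue_integral)
  also have "(\<lambda>p. LBINT \<tau>. (if fst p \<le> \<tau> \<and> \<tau> < fst (snd p) then 1 else 0) * F (\<tau>, snd (snd p)))
      = (\<lambda>z. time_int (fst z) (fst (snd z)) F (snd (snd z)))"
    unfolding time_int_def by (intro ext Bochner_Integration.integral_cong) (auto simp: indicator_def)
  finally show ?thesis .
qed

lemma time_int_measurable_x [measurable]:
  fixes F :: "real \<times> 'b::euclidean_space \<Rightarrow> real"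
  assumes "F \<in> borel_measurable borel"
  shows "time_int a b F \<in> borel_measurable borel"
proof -
  have "(\<lambda>x :: 'b. (a, b, x)) \<in> borel_measurable borel" by (intro borel_measurable_continuous_onI continuous_intros)
  from measurable_compose[OF this time_int_measurable[OF assms]] show ?thesis by simp
qed

text \<open>Cauchy-Schwarz in time against the indicator of the interval for almost every x,
  followed by Fubini in x.\<close>

lemma time_int_nsq:
  fixes F :: "real \<times> 'b::euclidean_space \<Rightarrow> real"
  assumes F: "L2 F" and ab: "a \<le> b"
  shows "L2 (time_int a b F)" "nsq lborel (time_int a b F) \<le> (b - a) * nsq lborel F"
proof -
  have [measurable]: "F \<in> borel_measurable borel" using F by (simp add: square_integrable_def)
  have ind: "L2 (indicator {a..<b} :: real \<Rightarrow> real)" "nsq lborel (indicator {a..<b} :: real \<Rightarrow> real) = b - a"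
  proof -
    have e: "(indicator {a..<b} \<tau> :: real)\<^sup>2 = indicator {a..<b} \<tau>" for \<tau> by (simp add: indicator_def)
    show "L2 (indicator {a..<b} :: real \<Rightarrow> real)"
      unfolding square_integrable_def e using ab by (auto simp: integrable_indicator_iff)
    show "nsq lborel (indicator {a..<b} :: real \<Rightarrow> real) = b - a"
      unfolding nsq_def e using ab by simp
  qed
  have AEb: "AE x in lborel. (time_int a b F x)\<^sup>2 \<le> (b - a) * nsq lborel (\<lambda>\<tau>. F (\<tau>, x))"
    using square_integrable_Fubini(4)[OF F]
  proof (rule AE_mp, intro AE_I2 impI)
    fix x assume s: "L2 (\<lambda>\<tau>. F (\<tau>, x))"
    have "\<bar>time_int a b F x\<bar> \<le> sqrt (b - a) * sqrt (nsq lborel (\<lambda>\<tau>. F (\<tau>, x)))"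
      unfolding time_int_def using Cauchy_Schwarz_nsq[OF ind(1) s] ind(2) by simp
    then have "\<bar>time_int a b F x\<bar>\<^sup>2 \<le> (sqrt (b - a) * sqrt (nsq lborel (\<lambda>\<tau>. F (\<tau>, x))))\<^sup>2"
      by (intro power_mono) auto
    then show "(time_int a b F x)\<^sup>2 \<le> (b - a) * nsq lborel (\<lambda>\<tau>. F (\<tau>, x))"
      using ab by (simp add: power_mult_distrib)
  qed
  have i: "integrable lborel (\<lambda>x. (b - a) * nsq lborel (\<lambda>\<tau>. F (\<tau>, x)))"
    using square_integrable_Fubini(5)[OF F] by simp
  have i': "integrable lborel (\<lambda>x. (time_int a b F x)\<^sup>2)"
  proof (rule Bochner_Integration.integrable_bound[OF i])
    show "AE x in lborel. norm ((time_int a b F x)\<^sup>2) \<le> norm ((b - a) * nsq lborel (\<lambda>\<tau>. F (\<tau>, x)))"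
      using AEb by (rule AE_mp) (use ab in auto)
  qed measurable
  then show "L2 (time_int a b F)" by (auto simp: square_integrable_def)
  have "nsq lborel (time_int a b F) \<le> (LBINT x. (b - a) * nsq lborel (\<lambda>\<tau>. F (\<tau>, x)))"
    unfolding nsq_def[of lborel "time_int a b F"] by (rule integral_mono_AE[OF i' i AEb])
  also have "\<dots> = (b - a) * nsq lborel F" using square_integrable_Fubini(6)[OF F] by simp
  finally show "nsq lborel (time_int a b F) \<le> (b - a) * nsq lborel F" .
qed

lemma square_integrable_slice_integrable:
  fixes F :: "real \<Rightarrow> real"
  assumes "L2 F"
  shows "integrable lborel (\<lambda>\<tau>. indicator {a..<b} \<tau> * F \<tau>)"
proof (rule square_integrable_mult)
  show "L2 (indicator {a..<b} :: real \<Rightarrow> real)"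
  proof -
    have e: "(indicator {a..<b} \<tau> :: real)\<^sup>2 = indicator {a..<b} \<tau>" for \<tau> by (simp add: indicator_def)
    show ?thesis unfolding square_integrable_def e
      by (cases "a \<le> b") (auto simp: integrable_indicator_iff)
  qed
qed fact

text \<open>Only almost everywhere: where a slice is not integrable, the default value of the
  integral breaks linearity.\<close>

lemma time_int_linear:
  fixes F :: "real \<times> 'b::euclidean_space \<Rightarrow> real"
  assumes F: "L2 F" and G: "L2 G"
  shows "AE x in lborel. time_int a b (\<lambda>z. F z - G z) x = time_int a b F x - time_int a b G x"
  using square_integrable_Fubini(4)[OF F] square_integrable_Fubini(4)[OF G]
proof eventually_elim
  case (elim x)
  show ?case unfolding time_int_def
    using square_integrable_slice_integrable[OF elim(1)] square_integrable_slice_integrable[OF elim(2)]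
    by (simp add: right_diff_distrib)
qed

lemma time_int_sum:
  fixes F :: "nat \<Rightarrow> real \<times> 'b::euclidean_space \<Rightarrow> real"
  assumes F: "\<And>k. L2 (F k)" and I: "finite I"
  shows "AE x in lborel. time_int a b (\<lambda>z. \<Sum>k\<in>I. l k * F k z) x = (\<Sum>k\<in>I. l k * time_int a b (F k) x)"
proof -
  have "AE x in lborel. \<forall>k. L2 (\<lambda>\<tau>. F k (\<tau>, x))"
    using square_integrable_Fubini(4)[OF F] by (subst AE_all_countable) auto
  then show ?thesis
  proof eventually_elim
    case (elim x)
    have i: "integrable lborel (\<lambda>\<tau>. indicator {a..<b} \<tau> * F k (\<tau>, x))" for k
      using square_integrable_slice_integrable elim by blast
    have "time_int a b (\<lambda>z. \<Sum>k\<in>I. l k * F k z) x = (LBINT \<tau>. (\<Sum>k\<in>I. l k * (indicator {a..<b} \<tau> * F k (\<tau>, x))))"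
      unfolding time_int_def by (intro Bochner_Integration.integral_cong) (auto simp: sum_distrib_left mult_ac)
    also have "\<dots> = (\<Sum>k\<in>I. l k * time_int a b (F k) x)"
      unfolding time_int_def using i by (subst Bochner_Integration.integral_sum) auto
    finally show ?case .
  qed
qed

lemma time_int_split:
  fixes F :: "real \<times> 'b::euclidean_space \<Rightarrow> real"
  assumes F: "L2 F" and "a \<le> b" "b \<le> c"
  shows "AE x in lborel. time_int a c F x = time_int a b F x + time_int b c F x"
  using square_integrable_Fubini(4)[OF F]
proof eventually_elim
  case (elim x)
  have "time_int a c F x = (LBINT \<tau>. indicator {a..<b} \<tau> * F (\<tau>, x) + indicator {b..<c} \<tau> * F (\<tau>, x))"
    unfolding time_int_def using assms(2,3)
    by (intro Bochner_Integration.integral_cong) (auto simp: indicator_def)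
  then show ?case unfolding time_int_def
    using square_integrable_slice_integrable[OF elim] by simp
qed

context subcritical_domain
begin

text \<open>L2 convergence gives almost everywhere convergence along a subsequence, and the Fatou
  lemma for \<open>jc\<close> with zero weight applies to it.\<close>

lemma J_lsc_L2:
  assumes w: "\<And>n. w n \<in> D" "\<And>n. J (w n) \<le> ennreal M" and W: "W \<in> X" "L2 W"
    and lim: "(\<lambda>n. nsq lborel (\<lambda>x. w n x - W x)) \<longlonglongrightarrow> 0"
  shows "J W \<le> ennreal M"
proof -
  have sq: "L2 (\<lambda>x. w n x - W x)" for n
    by (intro square_integrable_diff D_square_integrable w W)
  obtain r where r: "strict_mono r" "AE x in lborel. (\<lambda>n. (w (r n) x - W x)\<^sup>2) \<longlonglongrightarrow> 0"
    using tendsto_L1_AE_subseq[of lborel "\<lambda>n x. (w n x - W x)\<^sup>2"] sq lim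
    by (auto simp: square_integrable_def nsq_def)
  have ae: "AE x in lborel. (\<lambda>n. w (r n) x) \<longlonglongrightarrow> W x"
    using r(2)
  proof eventually_elim
    case (elim x)
    then have "(\<lambda>n. sqrt ((w (r n) x - W x)\<^sup>2)) \<longlonglongrightarrow> sqrt 0" by (rule tendsto_real_sqrt)
    then have "(\<lambda>n. w (r n) x - W x) \<longlonglongrightarrow> 0" by (simp add: tendsto_rabs_zero_iff)
    then show ?case by (rule LIM_zero_cancel)
  qed
  have jc0: "jc (\<lambda>z. 0) u z = \<bar>dK u z\<bar>" for u z by (simp add: jc_def)
  have "J W = (\<integral>\<^sup>+z. ennreal (jc (\<lambda>z. 0) W z) \<partial>lborel)" by (simp add: jc0 J_dK)
  also have "\<dots> \<le> liminf (\<lambda>n. \<integral>\<^sup>+z. ennreal (jc (\<lambda>z. 0) (w (r n)) z) \<partial>lborel)"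
    by (rule J_lsc_jc) (use D_X w X_measurable[OF W(1)] ae in auto)
  also have "\<dots> \<le> liminf (\<lambda>n. ennreal M)"
    by (rule Liminf_mono, rule always_eventually) (use w(2) in \<open>simp add: jc0 J_dK\<close>)
  finally show ?thesis by (simp add: Liminf_const)
qed

text \<open>Differences of members of the sequence have seminorm at most 2M. Smallness of finitely
  many of their cell integrals makes them small in L1, and interpolation then makes them small in
  L2. Thus convergence of countably many real sequences yields the L2 Cauchy property.\<close>

lemma cells_Cauchy_imp_L2_Cauchy:
  assumes w: "\<And>n. w n \<in> D" "\<And>n. J (w n) \<le> ennreal M" and M: "0 \<le> M"
    and conv: "\<And>i k. convergent (\<lambda>n. LBINT x. indicator (cell i k) x * w n x)" and e: "0 < e"
  shows "\<exists>N. \<forall>m\<ge>N. \<forall>n\<ge>N. nsq lborel (\<lambda>x. w m x - w n x) < e"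
proof -
  have M2: "0 \<le> 2 * M" using M by simp
  have e2: "0 < e / 2" using e by simp
  have k2: "1 \<le> (2::real)" by simp
  obtain \<delta> where \<delta>: "0 < \<delta>" "\<And>u. u \<in> X \<Longrightarrow> J u \<le> ennreal (2 * M) \<Longrightarrow> (\<integral>\<^sup>+x. ennreal \<bar>u x\<bar> \<partial>lborel) \<le> ennreal \<delta> \<Longrightarrow>
      (\<integral>\<^sup>+x. ennreal (\<bar>u x\<bar> powr 2) \<partial>lborel) \<le> ennreal (e / 2)"
    by (rule interpolation_to_zero[OF k2 pstar_gt2 M2 e2]) blast
  obtain i \<delta>' where \<delta>': "0 < \<delta>'" "\<And>u. u \<in> X \<Longrightarrow> integrable lborel u \<Longrightarrow> J u \<le> ennreal (2 * M) \<Longrightarrow>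
      (\<forall>k\<in>cells i. \<bar>\<integral>x. indicator (cell i k) x * u x \<partial>lborel\<bar> \<le> \<delta>') \<Longrightarrow> (\<integral>\<^sup>+x. ennreal \<bar>u x\<bar> \<partial>lborel) \<le> ennreal \<delta>"
    by (rule cells_control_L1[OF M2 \<delta>(1)]) blast
  let ?F = "\<lambda>k n. \<integral>x. indicator (cell i k) x * w n x \<partial>lborel"
  have "\<exists>N. \<forall>m\<ge>N. \<forall>n\<ge>N. dist (?F k m) (?F k n) < \<delta>'" for k
    using convergent_Cauchy[OF conv[of i k]] \<delta>'(1) by (rule metric_CauchyD)
  then obtain N where N: "\<And>k m n. N k \<le> m \<Longrightarrow> N k \<le> n \<Longrightarrow> dist (?F k m) (?F k n) < \<delta>'" by metis
  define N' where "N' = Max (insert 0 (N ` cells i))"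
  have "nsq lborel (\<lambda>x. w m x - w n x) < e" if mn: "m \<ge> N'" "n \<ge> N'" for m n
  proof -
    let ?u = "\<lambda>x. w m x - w n x"
    have uD: "?u \<in> D" by (intro D_diff w)
    have uX: "?u \<in> X" by (rule D_X[OF uD])
    have int: "integrable lborel (w n)" for n
      by (rule X_integrable[OF D_X[OF w(1)] D_square_integrable[OF w(1)]])
    have iu: "integrable lborel ?u" using int by simp
    have "J ?u \<le> J (w m) + J (w n)" by (intro J_diff_le D_X w)
    also have "\<dots> \<le> ennreal M + ennreal M" by (intro add_mono w)
    finally have Ju: "J ?u \<le> ennreal (2 * M)" using M by (simp flip: ennreal_plus)
    have "\<forall>k\<in>cells i. \<bar>\<integral>x. indicator (cell i k) x * ?u x \<partial>lborel\<bar> \<le> \<delta>'"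
    proof
      fix k assume k: "k \<in> cells i"
      have "N k \<le> N'" unfolding N'_def using k finite_cells by (intro Max_ge) auto
      then have d: "dist (?F k m) (?F k n) < \<delta>'" using mn by (intro N) auto
      have ii: "integrable lborel (\<lambda>x. indicator (cell i k) x * w n x)" for n
        using integrable_mult_indicator[of "cell i k" lborel "w n"] int by simp
      have "(LBINT x. indicator (cell i k) x * ?u x) = ?F k m - ?F k n"
        using ii by (simp add: right_diff_distrib)
      then show "\<bar>\<integral>x. indicator (cell i k) x * ?u x \<partial>lborel\<bar> \<le> \<delta>'" using d by (simp add: dist_real_def)
    qed
    from \<delta>(2)[OF uX Ju \<delta>'(2)[OF uX iu Ju this]]
    have b: "(\<integral>\<^sup>+x. ennreal ((?u x)\<^sup>2) \<partial>lborel) \<le> ennreal (e / 2)" by simp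
    have "ennreal (nsq lborel ?u) \<le> ennreal (e / 2)"
      using b D_square_integrable[OF uD] unfolding nsq_def
      by (subst (asm) nn_integral_eq_integral) (auto simp: square_integrable_def)
    then show ?thesis using e by simp
  qed
  then show ?thesis by blast
qed

end

section \<open>Reordering space and time variables\<close>

lemma borel_measurable_pairI:
  fixes f :: "'a::second_countable_topology \<times> 'b::euclidean_space \<Rightarrow> 'c::topological_space"
  assumes "f \<in> borel_measurable borel"
  shows "f \<in> borel_measurable (borel \<Otimes>\<^sub>M lborel)"
proof -
  have "sets (borel \<Otimes>\<^sub>M lborel) = sets (borel \<Otimes>\<^sub>M borel :: ('a \<times> 'b) measure)"
    by (intro sets_pair_measure_cong) simp_all
  then have "sets (borel \<Otimes>\<^sub>M lborel) = sets (borel :: ('a \<times> 'b) measure)" by (simp only: borel_prod)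
  then show ?thesis using assms by (simp cong: measurable_cong_sets)
qed

text \<open>The definition of a sign selection orders the variables as (x, y, t), while the equation
  is read at fixed t. Two exchanges by Tonelli bring t to the outside.\<close>

lemma nn_integral_lborel_rotate:
  fixes f :: "'a::euclidean_space \<times> 'b::euclidean_space \<times> 'c::euclidean_space \<Rightarrow> ennreal"
  assumes f: "f \<in> borel_measurable borel"
  shows "(\<integral>\<^sup>+z. f z \<partial>lborel) = (\<integral>\<^sup>+t. \<integral>\<^sup>+p. f (fst p, snd p, t) \<partial>lborel \<partial>lborel)"
proof -
  have c1: "(\<lambda>q :: ('a \<times> 'c) \<times> 'b. (fst (fst q), snd q, snd (fst q))) \<in> borel_measurable borel"
    by (intro borel_measurable_continuous_onI continuous_intros)
  have c2: "(\<lambda>y :: 'b \<times> 'c. (x, fst y, snd y)) \<in> borel_measurable borel" for x :: 'a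
    by (intro borel_measurable_continuous_onI continuous_intros)
  have c3: "(\<lambda>p :: 'a \<times> 'b. (fst p, snd p, t)) \<in> borel_measurable borel" for t :: 'c
    by (intro borel_measurable_continuous_onI continuous_intros)
  have m1: "(\<lambda>q :: ('a \<times> 'c) \<times> 'b. f (fst (fst q), snd q, snd (fst q))) \<in> borel_measurable borel"
    using measurable_compose[OF c1 f] .
  have m2: "(\<lambda>y :: 'b \<times> 'c. f (x, y)) \<in> borel_measurable borel" for x :: 'a
    using measurable_compose[OF c2 f] by simp
  have m3: "(\<lambda>p :: 'a \<times> 'b. f (fst p, snd p, t)) \<in> borel_measurable borel" for t :: 'c
    using measurable_compose[OF c3 f] by simp
  have "(\<lambda>(p :: 'a \<times> 'c, y :: 'b). f (fst p, y, snd p)) \<in> borel_measurable (borel \<Otimes>\<^sub>M lborel)"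
    using borel_measurable_pairI[OF m1] by (simp only: case_prod_beta')
  then have mg: "(\<lambda>p :: 'a \<times> 'c. \<integral>\<^sup>+y. f (fst p, y, snd p) \<partial>lborel) \<in> borel_measurable borel"
    by (rule lborel.borel_measurable_nn_integral)
  then have mg': "(\<lambda>(x :: 'a, t :: 'c). \<integral>\<^sup>+y. f (x, y, t) \<partial>lborel) \<in> borel_measurable (lborel \<Otimes>\<^sub>M lborel)"
    unfolding lborel_prod by (simp add: case_prod_beta')
  have "(\<integral>\<^sup>+z. f z \<partial>lborel) = (\<integral>\<^sup>+x. \<integral>\<^sup>+q. f (x, q) \<partial>lborel \<partial>lborel)"
    by (rule nn_integral_lborel_iterated[OF f])
  also have "\<dots> = (\<integral>\<^sup>+x. \<integral>\<^sup>+t. \<integral>\<^sup>+y. f (x, y, t) \<partial>lborel \<partial>lborel \<partial>lborel)"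
  proof (rule nn_integral_cong)
    fix x :: 'a
    have "(\<lambda>(y, t). f (x, y, t)) \<in> borel_measurable (lborel \<Otimes>\<^sub>M lborel)"
      unfolding lborel_prod using m2[of x] by (simp add: case_prod_beta')
    from lborel_pair.Fubini'[OF this] nn_integral_lborel_iterated[OF m2[of x]]
    show "(\<integral>\<^sup>+q. f (x, q) \<partial>lborel) = (\<integral>\<^sup>+t. \<integral>\<^sup>+y. f (x, y, t) \<partial>lborel \<partial>lborel)" by simp
  qed
  also have "\<dots> = (\<integral>\<^sup>+t. \<integral>\<^sup>+x. \<integral>\<^sup>+y. f (x, y, t) \<partial>lborel \<partial>lborel \<partial>lborel)"
    using lborel_pair.Fubini'[OF mg'] by simp
  also have "\<dots> = (\<integral>\<^sup>+t. \<integral>\<^sup>+p. f (fst p, snd p, t) \<partial>lborel \<partial>lborel)"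
    using nn_integral_lborel_iterated[OF m3] by simp
  finally show ?thesis .
qed

lemma AE_lborel_rotate:
  fixes P :: "'a::euclidean_space \<times> 'b::euclidean_space \<times> 'c::euclidean_space \<Rightarrow> bool"
  assumes "AE z in lborel. P z"
  shows "AE t in lborel. AE p in lborel. P (fst p, snd p, t)"
proof -
  obtain N where N: "{z. \<not> P z} \<subseteq> N" "N \<in> null_sets lborel"
    using AE_E[OF assms] by (auto simp: null_sets_def)
  have NB[measurable]: "N \<in> sets borel" using null_setsD2[OF N(2)] by simp
  have c3: "(\<lambda>p :: 'a \<times> 'b. (fst p, snd p, t)) \<in> borel_measurable borel" for t :: 'c
    by (intro borel_measurable_continuous_onI continuous_intros)
  have m3: "(\<lambda>p :: 'a \<times> 'b. indicator N (fst p, snd p, t) :: ennreal) \<in> borel_measurable borel" for t :: 'c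
    by (rule measurable_compose[OF c3]) measurable
  have c4: "(\<lambda>q :: 'c \<times> 'a \<times> 'b. (fst (snd q), snd (snd q), fst q)) \<in> borel_measurable borel"
    by (intro borel_measurable_continuous_onI continuous_intros)
  have m4: "(\<lambda>q :: 'c \<times> 'a \<times> 'b. indicator N (fst (snd q), snd (snd q), fst q) :: ennreal) \<in> borel_measurable borel"
    by (rule measurable_compose[OF c4]) measurable
  have "(\<lambda>(t :: 'c, p :: 'a \<times> 'b). indicator N (fst p, snd p, t) :: ennreal) \<in> borel_measurable (borel \<Otimes>\<^sub>M lborel)"
    using borel_measurable_pairI[OF m4] by (simp only: case_prod_beta')
  then have mg: "(\<lambda>t. \<integral>\<^sup>+p. indicator N (fst p, snd p, t) \<partial>(lborel :: ('a \<times> 'b) measure)) \<in> borel_measurable lborel"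
    using lborel.borel_measurable_nn_integral[of "\<lambda>t p. indicator N (fst p, snd p, t)"] by simp
  have "(\<integral>\<^sup>+t. \<integral>\<^sup>+p. indicator N (fst p, snd p, t) \<partial>(lborel :: ('a \<times> 'b) measure) \<partial>lborel) = (\<integral>\<^sup>+z. indicator N z \<partial>lborel)"
    by (rule nn_integral_lborel_rotate[symmetric]) measurable
  also have "\<dots> = 0" using N(2) by (simp add: null_sets_def)
  finally have "AE t in lborel. (\<integral>\<^sup>+p. indicator N (fst p, snd p, t) \<partial>(lborel :: ('a \<times> 'b) measure)) = 0"
    using nn_integral_0_iff_AE[OF mg] by simp
  then show ?thesis
  proof eventually_elim
    case (elim t)
    then have "AE p in lborel. indicator N (fst p, snd p, t) = (0 :: ennreal)"
      using nn_integral_0_iff_AE[of "\<lambda>p. indicator N (fst p, snd p, t)" lborel] m3 by simp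
    then show ?case by eventually_elim (use N(1) in \<open>auto simp: indicator_def split: if_splits\<close>)
  qed
qed

text \<open>Null sets of (t, x) stay null when pulled back to triples through the first or through
  the second space variable; this carries almost everywhere convergence of functions over to
  differences at two points.\<close>

lemma AE_lborel_space_time_pairs:
  fixes P :: "real \<times> 'a::euclidean_space \<Rightarrow> bool"
  assumes "AE z in lborel. P z"
  shows "AE z in (lborel :: ('a \<times> 'a \<times> real) measure). P (snd (snd z), fst z) \<and> P (snd (snd z), fst (snd z))"
proof -
  obtain N where N: "{z. \<not> P z} \<subseteq> N" "N \<in> null_sets lborel"
    using AE_E[OF assms] by (auto simp: null_sets_def)
  have NB: "- N \<in> sets borel" using null_setsD2[OF N(2)] by auto
  have a: "AE z in lborel. z \<in> - N" using AE_not_in[OF N(2)] by simp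
  note i = AE_lborel_iterate[OF a]
  have c1: "(\<lambda>z :: 'a \<times> 'a \<times> real. (snd (snd z), fst z)) \<in> borel_measurable borel"
    and c2: "(\<lambda>z :: 'a \<times> 'a \<times> real. (snd (snd z), fst (snd z))) \<in> borel_measurable borel"
    and c3: "(\<lambda>z :: 'a \<times> real. (snd z, x)) \<in> borel_measurable borel" for x :: 'a
    by (intro borel_measurable_continuous_onI continuous_intros)+
  have c4: "(\<lambda>z :: 'a \<times> real. (snd z, fst z)) \<in> borel_measurable borel"
    by (intro borel_measurable_continuous_onI continuous_intros)
  have 1: "AE z in (lborel :: ('a \<times> 'a \<times> real) measure). (snd (snd z), fst z) \<in> - N"
  proof (rule AE_lborel_prodI)
    show "{z :: 'a \<times> 'a \<times> real. (snd (snd z), fst z) \<in> - N} \<in> sets borel"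
      using measurable_sets[OF c1 NB] by (simp add: vimage_def)
    show "AE x in lborel. AE y in (lborel :: ('a \<times> real) measure). (snd (snd (x, y)), fst (x, y)) \<in> - N"
      using i(2)
    proof eventually_elim
      case (elim x)
      show ?case
      proof (rule AE_lborel_prodI)
        show "{y :: 'a \<times> real. (snd (snd (x, y)), fst (x, y)) \<in> - N} \<in> sets borel"
          using measurable_sets[OF c3[of x] NB] by (simp add: vimage_def)
      qed (use elim in simp)
    qed
  qed
  have 2: "AE z in (lborel :: ('a \<times> 'a \<times> real) measure). (snd (snd z), fst (snd z)) \<in> - N"
  proof (rule AE_lborel_prodI)
    show "{z :: 'a \<times> 'a \<times> real. (snd (snd z), fst (snd z)) \<in> - N} \<in> sets borel"
      using measurable_sets[OF c2 NB] by (simp add: vimage_def)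
    have "AE y in (lborel :: ('a \<times> real) measure). (snd y, fst y) \<in> - N"
    proof (rule AE_lborel_prodI)
      show "{y :: 'a \<times> real. (snd y, fst y) \<in> - N} \<in> sets borel"
        using measurable_sets[OF c4 NB] by (simp add: vimage_def)
    qed (use i(2) in simp)
    then show "AE x in (lborel :: 'a measure). AE y in (lborel :: ('a \<times> real) measure). (snd (snd (x, y)), fst (snd (x, y))) \<in> - N"
      by simp
  qed
  from 1 2 show ?thesis by eventually_elim (use N(1) in auto)
qed

lemma tendsto_zero_of_abs_le:
  fixes a :: "nat \<Rightarrow> real"
  assumes "\<And>e. 0 < e \<Longrightarrow> \<exists>N. \<forall>n\<ge>N. \<bar>a n\<bar> \<le> e"
  shows "a \<longlonglongrightarrow> 0"
proof (rule LIMSEQ_I)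
  fix e :: real assume "0 < e"
  then obtain N where "\<forall>n\<ge>N. \<bar>a n\<bar> \<le> e / 2" using assms[of "e / 2"] by auto
  then show "\<exists>no. \<forall>n\<ge>no. norm (a n - 0) < e" using \<open>0 < e\<close> by (intro exI[of _ N]) force
qed

section \<open>Compactness of the interpolants\<close>

context flow
begin

text \<open>Extension by zero in time, so that all space-time norms are taken over the whole product
  space.\<close>

definition cut :: "(real \<Rightarrow> 'a \<Rightarrow> real) \<Rightarrow> real \<times> 'a \<Rightarrow> real" where
  "cut w z = indicator {0..<T} (fst z) * w (fst z) (snd z)"

lemma cut_diff: "cut (\<lambda>t x. a t x - b t x) z = cut a z - cut b z"
  by (simp add: cut_def right_diff_distrib)

lemma cut_slices:
  assumes m: "cut w \<in> borel_measurable borel" and c: "0 \<le> c"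
    and sl: "\<And>t. t \<in> {0..<T} \<Longrightarrow> L2 (w t) \<and> nsq lborel (w t) \<le> c"
  shows "L2 (cut w)" "nsq lborel (cut w) \<le> c * T"
proof -
  have *: "(\<lambda>x. cut w (t, x)) = w t" if "t \<in> {0..<T}" for t using that by (auto simp: cut_def)
  show "L2 (cut w)" "nsq lborel (cut w) \<le> c * T"
    by (rule square_integrable_slices[OF m less_imp_le[OF T(2)] c]; use sl * in \<open>auto simp: cut_def\<close>)+
qed

lemma cut_measurable:
  assumes [measurable]: "(\<lambda>z. w (fst z) (snd z)) \<in> borel_measurable borel"
  shows "cut w \<in> borel_measurable borel"
  unfolding cut_def by measurable

lemma cut_ub_measurable [measurable]:
  "cut (ub n) \<in> borel_measurable borel" "cut (ub' n) \<in> borel_measurable borel"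
  "cut (vn n) \<in> borel_measurable borel" "cut (gn n) \<in> borel_measurable borel"
  by (intro cut_measurable; measurable)+

lemma hn_antimono: "m \<le> n \<Longrightarrow> hn n \<le> hn m"
  unfolding hn_def using T(2) by (intro divide_left_mono) auto

lemma idx_eq:
  assumes "real k * hn n \<le> t" "t < (real k + 1) * hn n"
  shows "idx n t = k"
proof -
  have "real k \<le> t / hn n" "t / hn n < real k + 1" using assms hn(1)[of n] by (simp_all add: pos_le_divide_eq pos_divide_less_eq)
  then have "\<lfloor>t / hn n\<rfloor> = int k" by (intro floor_unique) auto
  then show ?thesis by (simp add: idx_def)
qed

text \<open>The difference quotient is constant on each step, so at grid points its time integral
  telescopes to the iterate without error.\<close>

lemma U_eq_integral:
  "has_bochner_integral lborel (\<lambda>\<tau>. indicator {0..<real k * hn n} \<tau> * vn n \<tau> x) (U n k x - u0 x)"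
proof (induction k)
  case 0
  then show ?case by (simp add: has_bochner_integral_zero)
next
  case (Suc k)
  let ?h = "hn n"
  let ?J = "{real k * ?h..<real (Suc k) * ?h}"
  have h: "0 < ?h" by (rule hn)
  have le: "0 \<le> real k * ?h" "real k * ?h \<le> real (Suc k) * ?h" using h by (auto simp: algebra_simps)
  have "measure lborel ?J = ?h" using le by (simp add: measure_def algebra_simps)
  then have "has_bochner_integral lborel (\<lambda>\<tau>. indicator ?J \<tau> * (dU n k x / ?h)) (?h * (dU n k x / ?h))"
    using le by (intro has_bochner_integral_mult_left) (auto intro!: has_bochner_integral_real_indicator simp: has_bochner_integral_iff)
  then have "has_bochner_integral lborel (\<lambda>\<tau>. indicator ?J \<tau> * (dU n k x / ?h)) (U n (Suc k) x - U n k x)"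
    using h by (simp add: dU_def del: U.simps)
  from has_bochner_integral_add[OF Suc.IH this]
  have "has_bochner_integral lborel (\<lambda>\<tau>. indicator {0..<real k * ?h} \<tau> * vn n \<tau> x + indicator ?J \<tau> * (dU n k x / ?h)) (U n (Suc k) x - u0 x)"
    by (simp del: U.simps of_nat_Suc)
  moreover have "indicator {0..<real k * ?h} \<tau> * vn n \<tau> x + indicator ?J \<tau> * (dU n k x / ?h)
      = indicator {0..<real (Suc k) * ?h} \<tau> * vn n \<tau> x" for \<tau>
  proof (cases "\<tau> \<in> ?J")
    case True
    then have "idx n \<tau> = k" by (intro idx_eq) (auto simp: add.commute)
    then show ?thesis using True le by (auto simp: vn_def indicator_def)
  next
    case False
    then show ?thesis using le by (auto simp: indicator_def)
  qed
  ultimately show ?case by (simp only:)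
qed

text \<open>The left interpolant equals the integral of the quotients up to the last grid point
  before t. The error is the integral over the remaining interval, shorter than h.\<close>

lemma ub_minus_time_int:
  assumes t: "0 \<le> t" "t \<le> T"
  shows "L2 (\<lambda>x. ub n t x - (u0 x + time_int 0 t (cut (vn n)) x))"
    and "nsq lborel (\<lambda>x. ub n t x - (u0 x + time_int 0 t (cut (vn n)) x)) \<le> hn n * (4 * M0)"
proof -
  let ?a = "real (idx n t) * hn n" and ?F = "cut (vn n)"
  have F: "L2 ?F" "nsq lborel ?F \<le> 4 * M0"
    using vn_space_time[of n] by (simp_all add: cut_def[abs_def])
  have a: "0 \<le> ?a" "?a \<le> t" "t - ?a \<le> hn n"
    using idx[OF t(1), of n] hn(1)[of n] by (auto simp: algebra_simps)
  have eq: "time_int 0 ?a ?F x = ub n t x - u0 x" for x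
  proof -
    have "time_int 0 ?a ?F x = (LBINT \<tau>. indicator {0..<?a} \<tau> * vn n \<tau> x)"
      unfolding time_int_def cut_def using a t by (intro Bochner_Integration.integral_cong) (auto simp: indicator_def)
    then show ?thesis using has_bochner_integral_integral_eq[OF U_eq_integral[of "idx n t" n x]] by (simp add: ub_def)
  qed
  show sq: "L2 (\<lambda>x. ub n t x - (u0 x + time_int 0 t ?F x))"
    by (intro square_integrable_diff square_integrable_add D_square_integrable ub_D u0D time_int_nsq(1) F t)
  have [measurable]: "?F \<in> borel_measurable borel" by measurable
  have "AE x in lborel. ub n t x - (u0 x + time_int 0 t ?F x) = (-1) * time_int ?a t ?F x"
    using time_int_split[OF F(1) a(1,2)] by eventually_elim (simp add: eq)
  then have "nsq lborel (\<lambda>x. ub n t x - (u0 x + time_int 0 t ?F x)) = nsq lborel (\<lambda>x. (-1) * time_int ?a t ?F x)"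
    using sq by (intro nsq_cong_AE) (auto simp: square_integrable_def)
  also have "\<dots> = nsq lborel (time_int ?a t ?F)" by (subst nsq_scale) simp
  also have "\<dots> \<le> (t - ?a) * nsq lborel ?F" by (rule time_int_nsq(2)[OF F(1) a(2)])
  also have "\<dots> \<le> hn n * (4 * M0)" using a F(2) hn(1)[of n] by (intro mult_mono) auto
  finally show "nsq lborel (\<lambda>x. ub n t x - (u0 x + time_int 0 t ?F x)) \<le> hn n * (4 * M0)" .
qed

lemma M0_nonneg: "0 \<le> M0" using M0 by simp

text \<open>An Arzela-Ascoli argument. Cell integrals at grid times are countably many bounded real
  sequences, which gives the L2 Cauchy property at each grid time; the Holder bound in time spreads
  it uniformly over the interval.\<close>

lemma uniformly_Cauchy_subsequence:
  obtains \<rho> :: "nat \<Rightarrow> nat" where "strict_mono \<rho>"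
    "\<forall>e>0. \<exists>N. \<forall>m\<ge>N. \<forall>n\<ge>N. \<forall>t\<in>{0..T}. nsq lborel (\<lambda>x. ub (\<rho> m) t x - ub (\<rho> n) t x) \<le> e"
proof -
  obtain B where B: "0 \<le> B" "\<And>u. u \<in> X \<Longrightarrow> J u \<le> ennreal M0 \<Longrightarrow> L2 u \<and> nsq lborel u \<le> B"
    by (rule L2_bound_of_J[OF M0_nonneg]) blast
  \<comment> \<open>The grid times of all step sizes, capped at T: a countable dense set of times at
    which convergence is arranged.\<close>
  define tt where "tt m j = min T (real j * hn m)" for m j
  have tt: "0 \<le> tt m j" "tt m j \<le> T" for m j using T(2) hn(1)[of m] by (auto simp: tt_def)
  let ?F = "\<lambda>n (m, j, i, k). \<integral>x. indicator (cell i k) x * ub n (tt m j) x \<partial>lborel"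
  have bnd: "norm (?F n q) \<le> sqrt B" for n q
  proof -
    obtain m j i k where q: "q = (m, j, i, k)" by (cases q) auto
    have e: "(indicator (cell i k) x :: real)\<^sup>2 = indicator (cell i k) x" for x by (simp add: indicator_def)
    have ind: "L2 (indicator (cell i k) :: 'a \<Rightarrow> real)" "nsq lborel (indicator (cell i k) :: 'a \<Rightarrow> real) \<le> 1"
      unfolding square_integrable_def nsq_def e using emeasure_cell[of i k] by (auto simp: integrable_indicator_iff measure_def)
    have ub: "L2 (ub n (tt m j))" "nsq lborel (ub n (tt m j)) \<le> B"
      using B(2)[OF D_X[OF ub_D(1)] ub_J(1)[OF tt]] by auto
    have "\<bar>\<integral>x. indicator (cell i k) x * ub n (tt m j) x \<partial>lborel\<bar> \<le> sqrt (nsq lborel (indicator (cell i k) :: 'a \<Rightarrow> real)) * sqrt (nsq lborel (ub n (tt m j)))"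
      by (rule Cauchy_Schwarz_nsq[OF ind(1) ub(1)])
    also have "\<dots> \<le> 1 * sqrt B" using ind(2) ub(2) by (intro mult_mono) auto
    finally show ?thesis by (simp add: q)
  qed
  \<comment> \<open>Diagonal selection over the countable set of indices (m, j, i, k).\<close>
  obtain \<rho> where \<rho>: "strict_mono (\<rho> :: nat \<Rightarrow> nat)" "\<And>q. q \<in> UNIV \<Longrightarrow> \<exists>l. (\<lambda>n. ?F (\<rho> n) q) \<longlonglongrightarrow> l"
    using function_convergent_subsequence[of "UNIV :: (nat \<times> nat \<times> nat \<times> int) set" ?F "sqrt B"] bnd by blast
  have conv: "convergent (\<lambda>n. LBINT x. indicator (cell i k) x * ub (\<rho> n) (tt m j) x)" for m j i k
    using \<rho>(2)[of "(m, j, i, k)"] by (simp add: convergent_def)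
  have pt: "\<exists>N. \<forall>a\<ge>N. \<forall>b\<ge>N. nsq lborel (\<lambda>x. ub (\<rho> a) (tt m j) x - ub (\<rho> b) (tt m j) x) < e" if "0 < e" for m j e
    by (rule cells_Cauchy_imp_L2_Cauchy[OF ub_D(1) ub_J(1)[OF tt] M0_nonneg conv that])
  have "\<exists>N. \<forall>a\<ge>N. \<forall>b\<ge>N. \<forall>t\<in>{0..T}. nsq lborel (\<lambda>x. ub (\<rho> a) t x - ub (\<rho> b) t x) \<le> e" if e: "0 < e" for e
  proof -
    have "(\<lambda>n. 64 * M0 * hn n) \<longlonglongrightarrow> 64 * M0 * 0" by (intro tendsto_intros hn_tendsto)
    then have "\<forall>\<^sub>F n in sequentially. 64 * M0 * hn n < e / 2" using e by (intro order_tendstoD(2)[of _ "64 * M0 * 0"]) auto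
    then obtain m where m: "64 * M0 * hn m < e / 2" by (auto simp: eventually_sequentially)
    have e8: "0 < e / 8" using e by simp
    obtain N where N: "\<And>j a b. N j \<le> a \<Longrightarrow> N j \<le> b \<Longrightarrow> nsq lborel (\<lambda>x. ub (\<rho> a) (tt m j) x - ub (\<rho> b) (tt m j) x) < e / 8"
      using pt[OF e8, of m] by metis
    \<comment> \<open>Containing m, it also ensures that all later step sizes are at most
      \<open>hn m\<close>.\<close>
    define N' where "N' = Max (insert m (N ` {..Suc m}))"
    have N'm: "m \<le> N'" unfolding N'_def by (intro Max_ge) auto
    have "nsq lborel (\<lambda>x. ub (\<rho> a) t x - ub (\<rho> b) t x) \<le> e" if ab: "a \<ge> N'" "b \<ge> N'" and t: "t \<in> {0..T}" for a b t
    proof -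
      have t0: "0 \<le> t" "t \<le> T" using t by auto
      let ?j = "idx m t"
      have j: "real ?j * hn m \<le> t" "t - real ?j * hn m \<le> hn m" using idx[OF t0(1), of m] by (auto simp: algebra_simps)
      have tj: "tt m ?j = real ?j * hn m" using j t0 by (simp add: tt_def)
      have jm: "?j \<le> Suc m"
      proof (rule ccontr)
        assume "\<not> ?j \<le> Suc m"
        then have "real (Suc (Suc m)) * hn m \<le> real ?j * hn m" using hn(1)[of m] by (intro mult_right_mono) auto
        then show False using j(1) t0 hn(1,3)[of m] by (simp add: algebra_simps)
      qed
      then have "N ?j \<le> N'" unfolding N'_def by (intro Max_ge) auto
      then have Q: "nsq lborel (\<lambda>x. ub (\<rho> a) (tt m ?j) x - ub (\<rho> b) (tt m ?j) x) < e / 8" using ab by (intro N) auto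
      have near: "nsq lborel (\<lambda>x. ub (\<rho> c) t x - ub (\<rho> c) (tt m ?j) x) \<le> 8 * M0 * hn m" if "c \<ge> N'" for c
      proof -
        have "m \<le> \<rho> c" using N'm that seq_suble[OF \<rho>(1), of c] by linarith
        then have "hn (\<rho> c) \<le> hn m" by (rule hn_antimono)
        have "nsq lborel (\<lambda>x. ub (\<rho> c) t x - ub (\<rho> c) (tt m ?j) x) \<le> (t - tt m ?j + hn (\<rho> c)) * (4 * M0)"
          using tt[of m ?j] j tj t0 by (intro ub_time_diff) auto
        also have "\<dots> \<le> (2 * hn m) * (4 * M0)" using \<open>hn (\<rho> c) \<le> hn m\<close> j tj M0 by (intro mult_right_mono) auto
        finally show ?thesis by (simp add: mult_ac)
      qed
      have s: "L2 (ub n t)" for n t by (rule D_square_integrable[OF ub_D(1)])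
      have "nsq lborel (\<lambda>x. ub (\<rho> a) t x - ub (\<rho> b) t x) \<le> 2 * nsq lborel (\<lambda>x. ub (\<rho> a) t x - ub (\<rho> a) (tt m ?j) x)
          + 2 * nsq lborel (\<lambda>x. ub (\<rho> a) (tt m ?j) x - ub (\<rho> b) t x)"
        by (rule nsq_triangle3[OF s s s])
      moreover have "nsq lborel (\<lambda>x. ub (\<rho> a) (tt m ?j) x - ub (\<rho> b) t x) \<le> 2 * nsq lborel (\<lambda>x. ub (\<rho> a) (tt m ?j) x - ub (\<rho> b) (tt m ?j) x)
          + 2 * nsq lborel (\<lambda>x. ub (\<rho> b) (tt m ?j) x - ub (\<rho> b) t x)"
        by (rule nsq_triangle3[OF s s s])
      moreover have "nsq lborel (\<lambda>x. ub (\<rho> b) (tt m ?j) x - ub (\<rho> b) t x) = nsq lborel (\<lambda>x. ub (\<rho> b) t x - ub (\<rho> b) (tt m ?j) x)"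
        by (rule nsq_minus_commute)
      moreover have "0 \<le> M0 * hn m" using M0 hn(1)[of m] by (intro mult_nonneg_nonneg) auto
      ultimately show ?thesis using Q near[OF ab(1)] near[OF ab(2)] m by linarith
    qed
    then show ?thesis by blast
  qed
  then show ?thesis using \<rho>(1) that by blast
qed

text \<open>Three successive extractions: uniform Cauchy property, almost everywhere convergence of
  the left interpolants, then of the right ones. The right interpolants inherit the Cauchy property
  because their squared distance to the left ones is of order h.\<close>

lemma space_time_limits:
  obtains \<sigma> :: "nat \<Rightarrow> nat" and W W' where "strict_mono \<sigma>"
    "\<forall>e>0. \<exists>N. \<forall>m\<ge>N. \<forall>n\<ge>N. \<forall>t\<in>{0..T}. nsq lborel (\<lambda>x. ub (\<sigma> m) t x - ub (\<sigma> n) t x) \<le> e"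
    "L2 W" "L2 W'"
    "AE z in lborel. (\<lambda>n. cut (ub (\<sigma> n)) z) \<longlonglongrightarrow> W z" "AE z in lborel. (\<lambda>n. cut (ub' (\<sigma> n)) z) \<longlonglongrightarrow> W' z"
    "(\<lambda>n. nsq lborel (\<lambda>z. cut (ub (\<sigma> n)) z - W z)) \<longlonglongrightarrow> 0"
    "(\<lambda>n. nsq lborel (\<lambda>z. cut (ub' (\<sigma> n)) z - W' z)) \<longlonglongrightarrow> 0"
proof -
  obtain \<rho> :: "nat \<Rightarrow> nat" where \<rho>: "strict_mono \<rho>"
    "\<forall>e>0. \<exists>N. \<forall>m\<ge>N. \<forall>n\<ge>N. \<forall>t\<in>{0..T}. nsq lborel (\<lambda>x. ub (\<rho> m) t x - ub (\<rho> n) t x) \<le> e"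
    by (rule uniformly_Cauchy_subsequence)
  obtain B where B: "0 \<le> B" "\<And>u. u \<in> X \<Longrightarrow> J u \<le> ennreal M0 \<Longrightarrow> L2 u \<and> nsq lborel u \<le> B"
    by (rule L2_bound_of_J[OF M0_nonneg]) blast
  have s: "L2 (ub n t)" "L2 (ub' n t)" for n t
    by (rule D_square_integrable[OF ub_D(1)], rule D_square_integrable[OF ub_D(2)])
  have sW: "L2 (cut (ub n))" for n
    using B(2)[OF D_X[OF ub_D(1)] ub_J(1)] B(1) by (intro cut_slices(1)[of _ B]) auto
  have sW': "L2 (cut (ub' n))" for n
    using B(2)[OF D_X[OF ub_D(2)] ub_J(2)] B(1) by (intro cut_slices(1)[of _ B]) auto
  have dW: "nsq lborel (\<lambda>z. cut (ub m) z - cut (ub n) z) \<le> e * T"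
    if "0 \<le> e" "\<forall>t\<in>{0..T}. nsq lborel (\<lambda>x. ub m t x - ub n t x) \<le> e" for m n e
  proof -
    have "nsq lborel (cut (\<lambda>t x. ub m t x - ub n t x)) \<le> e * T"
      by (rule cut_slices(2)) (use that s in \<open>auto intro!: cut_measurable square_integrable_diff\<close>)
    then show ?thesis by (simp add: cut_diff[abs_def])
  qed
  have dW': "nsq lborel (\<lambda>z. cut (ub' n) z - cut (ub n) z) \<le> hn n * (4 * M0) * T" for n
  proof -
    have "nsq lborel (cut (\<lambda>t x. ub' n t x - ub n t x)) \<le> hn n * (4 * M0) * T"
      using ub'_diff s hn(1)[of n] M0 by (intro cut_slices(2)) (auto intro!: cut_measurable square_integrable_diff)
    then show ?thesis by (simp add: cut_diff[abs_def])
  qed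
  have C1: "\<exists>N. \<forall>m\<ge>N. \<forall>n\<ge>N. nsq lborel (\<lambda>z. cut (ub (\<rho> m)) z - cut (ub (\<rho> n)) z) < e" if "0 < e" for e
  proof -
    have "0 < e / (2 * T)" using that T by simp
    then obtain N where N: "\<forall>m\<ge>N. \<forall>n\<ge>N. \<forall>t\<in>{0..T}. nsq lborel (\<lambda>x. ub (\<rho> m) t x - ub (\<rho> n) t x) \<le> e / (2 * T)"
      using \<rho>(2) by blast
    have "nsq lborel (\<lambda>z. cut (ub (\<rho> m)) z - cut (ub (\<rho> n)) z) < e" if mn: "m \<ge> N" "n \<ge> N" for m n
    proof -
      have "nsq lborel (\<lambda>z. cut (ub (\<rho> m)) z - cut (ub (\<rho> n)) z) \<le> e / (2 * T) * T"
        using N mn \<open>0 < e / (2 * T)\<close> by (intro dW) auto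
      also have "\<dots> < e" using \<open>0 < e\<close> T by simp
      finally show ?thesis .
    qed
    then show ?thesis by blast
  qed
  obtain W r1 where W: "L2 W" "strict_mono r1"
    "AE z in lborel. (\<lambda>n. cut (ub (\<rho> (r1 n))) z) \<longlonglongrightarrow> W z" "(\<lambda>n. nsq lborel (\<lambda>z. cut (ub (\<rho> n)) z - W z)) \<longlonglongrightarrow> 0"
    by (rule L2_complete[where f = "\<lambda>n. cut (ub (\<rho> n))", OF sW C1])
  let ?q = "\<lambda>n. \<rho> (r1 n)"
  have qm: "strict_mono ?q" using \<rho>(1) W(2) by (auto simp: strict_mono_def)
  have hq: "hn (?q n) \<le> hn n" for n by (rule hn_antimono[OF seq_suble[OF qm]])
  have C2: "\<exists>N. \<forall>m\<ge>N. \<forall>n\<ge>N. nsq lborel (\<lambda>z. cut (ub' (?q m)) z - cut (ub' (?q n)) z) < e" if "0 < e" for e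
  proof -
    have "0 < e / 16" using that by simp
    from C1[OF this] obtain N1 where N1: "\<forall>m\<ge>N1. \<forall>n\<ge>N1. nsq lborel (\<lambda>z. cut (ub (\<rho> m)) z - cut (ub (\<rho> n)) z) < e / 16"
      by blast
    have "(\<lambda>n. hn n * (4 * M0) * T) \<longlonglongrightarrow> 0 * (4 * M0) * T" by (intro tendsto_intros hn_tendsto)
    then have "\<forall>\<^sub>F n in sequentially. hn n * (4 * M0) * T < e / 16"
      using that by (intro order_tendstoD(2)[of _ "0 * (4 * M0) * T"]) auto
    then obtain N2 where N2: "\<And>n. n \<ge> N2 \<Longrightarrow> hn n * (4 * M0) * T < e / 16" by (auto simp: eventually_sequentially)
    have "nsq lborel (\<lambda>z. cut (ub' (?q m)) z - cut (ub' (?q n)) z) < e" if mn: "m \<ge> max N1 N2" "n \<ge> max N1 N2" for m n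
    proof -
      have d: "nsq lborel (\<lambda>z. cut (ub' (?q k)) z - cut (ub (?q k)) z) < e / 16" if "k \<ge> N2" for k
      proof -
        have "hn (?q k) * (4 * M0) * T \<le> hn k * (4 * M0) * T" using hq[of k] M0 T by (intro mult_right_mono) auto
        then show ?thesis using dW'[of "?q k"] N2[OF that] by linarith
      qed
      have "r1 m \<ge> N1" "r1 n \<ge> N1" using mn seq_suble[OF W(2), of m] seq_suble[OF W(2), of n] by auto
      then have "nsq lborel (\<lambda>z. cut (ub (?q m)) z - cut (ub (?q n)) z) < e / 16" using N1 by blast
      moreover have "nsq lborel (\<lambda>z. cut (ub' (?q m)) z - cut (ub' (?q n)) z) \<le>
          2 * nsq lborel (\<lambda>z. cut (ub' (?q m)) z - cut (ub (?q m)) z) + 2 * nsq lborel (\<lambda>z. cut (ub (?q m)) z - cut (ub' (?q n)) z)"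
        by (rule nsq_triangle3[OF sW' sW sW'])
      moreover have "nsq lborel (\<lambda>z. cut (ub (?q m)) z - cut (ub' (?q n)) z) \<le>
          2 * nsq lborel (\<lambda>z. cut (ub (?q m)) z - cut (ub (?q n)) z) + 2 * nsq lborel (\<lambda>z. cut (ub (?q n)) z - cut (ub' (?q n)) z)"
        by (rule nsq_triangle3[OF sW sW sW'])
      moreover have "nsq lborel (\<lambda>z. cut (ub (?q n)) z - cut (ub' (?q n)) z) = nsq lborel (\<lambda>z. cut (ub' (?q n)) z - cut (ub (?q n)) z)"
        by (rule nsq_minus_commute)
      ultimately show ?thesis using d[of m] d[of n] mn \<open>0 < e\<close> by simp
    qed
    then show ?thesis by blast
  qed
  obtain W' r2 where W': "L2 W'" "strict_mono r2"
    "AE z in lborel. (\<lambda>n. cut (ub' (?q (r2 n))) z) \<longlonglongrightarrow> W' z" "(\<lambda>n. nsq lborel (\<lambda>z. cut (ub' (?q n)) z - W' z)) \<longlonglongrightarrow> 0"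
    by (rule L2_complete[where f = "\<lambda>n. cut (ub' (?q n))", OF sW' C2])
  define \<sigma> where "\<sigma> n = \<rho> (r1 (r2 n))" for n
  have rr: "strict_mono (\<lambda>n. r1 (r2 n))" using W(2) W'(2) by (auto simp: strict_mono_def)
  show ?thesis
  proof (rule that[of \<sigma> W W'])
    show "strict_mono \<sigma>" using \<rho>(1) rr by (auto simp: strict_mono_def \<sigma>_def)
    show "\<forall>e>0. \<exists>N. \<forall>m\<ge>N. \<forall>n\<ge>N. \<forall>t\<in>{0..T}. nsq lborel (\<lambda>x. ub (\<sigma> m) t x - ub (\<sigma> n) t x) \<le> e"
      unfolding \<sigma>_def using \<rho>(2) seq_suble[OF rr] by (meson order.trans)
    show "AE z in lborel. (\<lambda>n. cut (ub (\<sigma> n)) z) \<longlonglongrightarrow> W z"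
      using W(3)
    proof eventually_elim
      case (elim z)
      from LIMSEQ_subseq_LIMSEQ[OF elim W'(2)] show ?case by (simp add: o_def \<sigma>_def)
    qed
    show "(\<lambda>n. nsq lborel (\<lambda>z. cut (ub (\<sigma> n)) z - W z)) \<longlonglongrightarrow> 0"
      using LIMSEQ_subseq_LIMSEQ[OF W(4) rr] by (simp add: o_def \<sigma>_def)
    show "(\<lambda>n. nsq lborel (\<lambda>z. cut (ub' (\<sigma> n)) z - W' z)) \<longlonglongrightarrow> 0"
      using LIMSEQ_subseq_LIMSEQ[OF W'(4,2)] by (simp add: o_def \<sigma>_def)
  qed (use W W' in \<open>auto simp: \<sigma>_def\<close>)
qed

text \<open>The weight makes the bounded coefficients square-integrable over all pairs of points.\<close>

definition \<eta>w :: "nat \<Rightarrow> 'a \<times> 'a \<times> real \<Rightarrow> real" where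
  "\<eta>w n z = indicator {0..<T} (snd (snd z)) * \<eta>n n (snd (snd z)) (fst z, fst (snd z)) * sqrt (w0 (fst z, fst (snd z)))"

lemma \<eta>w_measurable [measurable]: "\<eta>w n \<in> borel_measurable borel"
proof -
  have c: "(\<lambda>z :: 'a \<times> 'a \<times> real. (fst z, fst (snd z))) \<in> borel_measurable borel"
    by (intro borel_measurable_continuous_onI continuous_intros)
  have [measurable]: "(\<lambda>z :: 'a \<times> 'a \<times> real. snd (snd z)) \<in> borel_measurable borel" by measurable
  have [measurable]: "(\<lambda>z :: 'a \<times> 'a \<times> real. w0 (fst z, fst (snd z))) \<in> borel_measurable borel"
    by (rule measurable_compose[OF c weightD(1)[OF w0(1)]])
  have [measurable]: "(\<lambda>z :: 'a \<times> 'a \<times> real. \<eta>n n (snd (snd z)) (fst z, fst (snd z))) \<in> borel_measurable borel"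
    by (intro \<eta>n_measurable c) measurable
  show ?thesis unfolding \<eta>w_def by measurable
qed

lemma \<eta>w_square_integrable: "L2 (\<eta>w n)" "nsq lborel (\<eta>w n) \<le> T"
proof -
  have wpos: "0 \<le> w0 z" for z using weightD(2)[OF w0(1), of z] by simp
  have "(\<integral>\<^sup>+z. ennreal ((\<eta>w n z)\<^sup>2) \<partial>lborel) = (\<integral>\<^sup>+t. \<integral>\<^sup>+p. ennreal ((\<eta>w n (fst p, snd p, t))\<^sup>2) \<partial>lborel \<partial>lborel)"
    by (rule nn_integral_lborel_rotate) measurable
  also have "\<dots> \<le> (\<integral>\<^sup>+t. indicator {0..<T} t * (\<integral>\<^sup>+p. ennreal (w0 p) \<partial>lborel) \<partial>lborel)"
  proof (rule nn_integral_mono)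
    fix t
    have "(\<eta>w n (fst p, snd p, t))\<^sup>2 \<le> indicator {0..<T} t * w0 p" for p
    proof -
      have "(\<eta>n n t p)\<^sup>2 \<le> 1" using \<eta>n_le1[of n t p] by (simp add: abs_square_le_1)
      then have "(\<eta>n n t p)\<^sup>2 * w0 p \<le> 1 * w0 p" using wpos by (rule mult_right_mono)
      then show ?thesis using wpos[of p] by (simp add: \<eta>w_def power_mult_distrib indicator_def)
    qed
    then have "(\<integral>\<^sup>+p. ennreal ((\<eta>w n (fst p, snd p, t))\<^sup>2) \<partial>lborel) \<le> (\<integral>\<^sup>+p. ennreal (indicator {0..<T} t * w0 p) \<partial>lborel)"
      by (intro nn_integral_mono ennreal_leI)
    also have "\<dots> = indicator {0..<T} t * (\<integral>\<^sup>+p. ennreal (w0 p) \<partial>lborel)"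
      by (simp add: indicator_def)
    finally show "(\<integral>\<^sup>+p. ennreal ((\<eta>w n (fst p, snd p, t))\<^sup>2) \<partial>lborel) \<le> indicator {0..<T} t * (\<integral>\<^sup>+p. ennreal (w0 p) \<partial>lborel)" .
  qed
  also have "\<dots> \<le> (\<integral>\<^sup>+t. ennreal 1 * indicator {0..<T} t \<partial>lborel)"
  proof (rule nn_integral_mono)
    fix t :: real
    have "(\<integral>\<^sup>+p. ennreal (w0 p) \<partial>lborel) = ennreal (LBINT p. w0 p)"
      using weightD(3)[OF w0(1)] wpos by (intro nn_integral_eq_integral) auto
    also have "\<dots> \<le> ennreal 1" using w0(3) by (rule ennreal_leI)
    finally show "indicator {0..<T} t * (\<integral>\<^sup>+p. ennreal (w0 p) \<partial>lborel) \<le> ennreal 1 * indicator {0..<T} t"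
      by (simp add: indicator_def)
  qed
  also have "\<dots> = ennreal T" using T(2) by (subst nn_integral_cmult_indicator) auto
  finally have b: "(\<integral>\<^sup>+z. ennreal ((\<eta>w n z)\<^sup>2) \<partial>lborel) \<le> ennreal T" .
  have i: "integrable lborel (\<lambda>z. (\<eta>w n z)\<^sup>2)"
    using order.strict_trans1[OF b, of \<infinity>] by (intro integrableI_bounded) auto
  then show "L2 (\<eta>w n)" by (simp add: square_integrable_def)
  show "nsq lborel (\<eta>w n) \<le> T"
    using b T unfolding nsq_def by (subst (asm) nn_integral_eq_integral[OF i]) auto
qed

end

section \<open>The limit of the scheme\<close>

lemma nsq_zero_imp_AE:
  assumes "square_integrable M f" "nsq M f \<le> 0"
  shows "AE x in M. f x = 0"
proof -
  have "nsq M f = 0" using assms(2) nsq_nonneg[of M f] by linarith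
  then have "(\<integral>x. (f x)\<^sup>2 \<partial>M) = 0" by (simp only: nsq_def)
  then have "AE x in M. (f x)\<^sup>2 = 0"
    using assms(1) by (subst (asm) integral_nonneg_eq_0_iff_AE) (auto simp: square_integrable_def)
  then show ?thesis by eventually_elim simp
qed

lemma powr_abs_diff_le:
  fixes a b q :: real
  assumes "0 \<le> q"
  shows "\<bar>a - b\<bar> powr q \<le> 2 powr q * (\<bar>a\<bar> powr q + \<bar>b\<bar> powr q)"
proof -
  have "\<bar>a - b\<bar> powr q \<le> (2 * max \<bar>a\<bar> \<bar>b\<bar>) powr q" using assms by (intro powr_mono2) auto
  also have "\<dots> = 2 powr q * (max \<bar>a\<bar> \<bar>b\<bar>) powr q" by (simp add: powr_mult)
  also have "(max \<bar>a\<bar> \<bar>b\<bar>) powr q \<le> \<bar>a\<bar> powr q + \<bar>b\<bar> powr q" by (simp add: max_def)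
  finally show ?thesis by simp
qed

text \<open>The outcome of the compactness argument, with indices and weights fixed so that the
  solution and its coefficient can be defined once from them. H serves as the witness that the
  averaged coefficients converge almost everywhere; v is normalised to vanish outside [0, T) and
  \<Omega>.\<close>

locale flow_limit = flow \<Omega> s f u0 r C
  for \<Omega> :: "'a::euclidean_space set" and s f u0 r C +
  fixes \<sigma> :: "nat \<Rightarrow> nat" and l :: "nat \<Rightarrow> nat \<Rightarrow> real" and N :: "nat \<Rightarrow> nat"
    and v :: "real \<times> 'a \<Rightarrow> real" and H :: "'a \<times> 'a \<times> real \<Rightarrow> real" and W W' :: "real \<times> 'a \<Rightarrow> real"
  assumes \<sigma>: "strict_mono \<sigma>"
    and uC: "\<forall>e>0. \<exists>N. \<forall>m\<ge>N. \<forall>n\<ge>N. \<forall>t\<in>{0..T}. nsq lborel (\<lambda>x. ub (\<sigma> m) t x - ub (\<sigma> n) t x) \<le> e"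
    and W: "L2 W" "L2 W'"
      "AE z in lborel. (\<lambda>n. cut (ub (\<sigma> n)) z) \<longlonglongrightarrow> W z" "AE z in lborel. (\<lambda>n. cut (ub' (\<sigma> n)) z) \<longlonglongrightarrow> W' z"
      "(\<lambda>n. nsq lborel (\<lambda>z. cut (ub (\<sigma> n)) z - W z)) \<longlonglongrightarrow> 0"
      "(\<lambda>n. nsq lborel (\<lambda>z. cut (ub' (\<sigma> n)) z - W' z)) \<longlonglongrightarrow> 0"
    and w: "\<And>n. conv_weights n (l n) (N n)"
    and v: "L2 v" and v_off: "\<And>t x. t \<notin> {0..<T} \<or> x \<notin> \<Omega> \<Longrightarrow> v (t, x) = 0"
    and v_lim: "(\<lambda>n. nsq lborel (\<lambda>z. (\<Sum>k<N n. l n k * cut (vn (\<sigma> k)) z) - v z)) \<longlonglongrightarrow> 0"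
    and H_lim: "AE z in lborel. (\<lambda>n. \<Sum>k<N n. l n k * \<eta>w (\<sigma> k) z) \<longlonglongrightarrow> H z"

lemma (in flow) ex_flow_limit: "\<exists>\<sigma> l N v H W W'. flow_limit \<Omega> s f u0 r C \<sigma> l N v H W W'"
proof -
  obtain \<sigma> :: "nat \<Rightarrow> nat" and W W' where \<sigma>: "strict_mono \<sigma>"
    "\<forall>e>0. \<exists>N. \<forall>m\<ge>N. \<forall>n\<ge>N. \<forall>t\<in>{0..T}. nsq lborel (\<lambda>x. ub (\<sigma> m) t x - ub (\<sigma> n) t x) \<le> e"
    "L2 W" "L2 W'"
    "AE z in lborel. (\<lambda>n. cut (ub (\<sigma> n)) z) \<longlonglongrightarrow> W z" "AE z in lborel. (\<lambda>n. cut (ub' (\<sigma> n)) z) \<longlonglongrightarrow> W' z"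
    "(\<lambda>n. nsq lborel (\<lambda>z. cut (ub (\<sigma> n)) z - W z)) \<longlonglongrightarrow> 0"
    "(\<lambda>n. nsq lborel (\<lambda>z. cut (ub' (\<sigma> n)) z - W' z)) \<longlonglongrightarrow> 0"
    by (rule space_time_limits)
  \<comment> \<open>The lemma on convex combinations asks for one bound valid for both
    families.\<close>
  have F: "L2 (cut (vn n))" "nsq lborel (cut (vn n)) \<le> 4 * M0 + T" for n
    using vn_space_time[of n] T by (simp_all add: cut_def[abs_def])
  have E: "nsq lborel (\<eta>w n) \<le> 4 * M0 + T" for n using \<eta>w_square_integrable(2)[of n] M0 by simp
  obtain l N V H where V: "\<And>n. conv_weights n (l n) (N n)"
    "L2 V" "L2 H"
    "AE z in lborel. (\<lambda>n. \<Sum>k<N n. l n k * cut (vn (\<sigma> k)) z) \<longlonglongrightarrow> V z"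
    "AE z in lborel. (\<lambda>n. \<Sum>k<N n. l n k * \<eta>w (\<sigma> k) z) \<longlonglongrightarrow> H z"
    "(\<lambda>n. nsq lborel (\<lambda>z. (\<Sum>k<N n. l n k * cut (vn (\<sigma> k)) z) - V z)) \<longlonglongrightarrow> 0"
    "(\<lambda>n. nsq lborel (\<lambda>z. (\<Sum>k<N n. l n k * \<eta>w (\<sigma> k) z) - H z)) \<longlonglongrightarrow> 0"
    by (rule convex_combinations_converge[where f = "\<lambda>k. cut (vn (\<sigma> k))" and g = "\<lambda>k. \<eta>w (\<sigma> k)",
          OF F(1) \<eta>w_square_integrable(1) F(2) E]) blast
  let ?S = "{0..<T} \<times> \<Omega>"
  \<comment> \<open>All quotients vanish outside this set, so cutting the limit off there can only
    reduce its distance to their averages.\<close>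
  define v where "v z = indicator ?S z * V z" for z
  have [measurable]: "V \<in> borel_measurable borel" using V(2) by (simp add: square_integrable_def)
  have [measurable]: "?S \<in> sets borel" by (simp flip: borel_prod)
  have [measurable]: "v \<in> borel_measurable borel" unfolding v_def by measurable
  have sv: "L2 v"
    by (rule square_integrable_bound[OF V(2)]) (auto simp: v_def indicator_def)
  have off: "cut (vn n) z = 0" if "z \<notin> ?S" for n z
    using that X_off[OF D_X[OF U_D]] by (cases z) (auto simp: cut_def vn_def dU_def indicator_def simp del: U.simps)
  have sC: "L2 (\<lambda>z. (\<Sum>k<N n. l n k * cut (vn (\<sigma> k)) z))" for n
    by (rule square_integrable_sum[where f = "\<lambda>k. cut (vn (\<sigma> k))"]) (rule F)
  have le: "nsq lborel (\<lambda>z. (\<Sum>k<N n. l n k * cut (vn (\<sigma> k)) z) - v z)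
      \<le> nsq lborel (\<lambda>z. (\<Sum>k<N n. l n k * cut (vn (\<sigma> k)) z) - V z)" for n
    unfolding nsq_def
  proof (rule integral_mono)
    show "integrable lborel (\<lambda>z. ((\<Sum>k<N n. l n k * cut (vn (\<sigma> k)) z) - v z)\<^sup>2)"
      "integrable lborel (\<lambda>z. ((\<Sum>k<N n. l n k * cut (vn (\<sigma> k)) z) - V z)\<^sup>2)"
      using square_integrable_diff[OF sC sv] square_integrable_diff[OF sC V(2)] by (auto simp: square_integrable_def)
    fix z show "((\<Sum>k<N n. l n k * cut (vn (\<sigma> k)) z) - v z)\<^sup>2 \<le> ((\<Sum>k<N n. l n k * cut (vn (\<sigma> k)) z) - V z)\<^sup>2"
      by (cases "z \<in> ?S") (simp_all add: v_def off)
  qed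
  have vlim: "(\<lambda>n. nsq lborel (\<lambda>z. (\<Sum>k<N n. l n k * cut (vn (\<sigma> k)) z) - v z)) \<longlonglongrightarrow> 0"
    by (rule tendsto_sandwich[OF _ _ tendsto_const V(6)]) (auto simp: le)
  have "flow_limit \<Omega> s f u0 r C \<sigma> l N v H W W'"
    by unfold_locales (use \<sigma> V sv vlim in \<open>auto simp: v_def\<close>)
  then show ?thesis by blast
qed

section \<open>The limit function\<close>

context flow_limit
begin

text \<open>Defined through its time derivative rather than as a limit of interpolants: joint
  measurability, the initial value and a representative at every time come for free, and convergence
  of the interpolants is proved afterwards.\<close>

definition u :: "real \<Rightarrow> 'a \<Rightarrow> real" where "u t x = u0 x + time_int 0 t v x"

definition Vn :: "nat \<Rightarrow> real \<times> 'a \<Rightarrow> real" where "Vn n z = (\<Sum>k<N n. l n k * cut (vn (\<sigma> k)) z)"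

lemma v_measurable [measurable]: "v \<in> borel_measurable borel"
  using v by (simp add: square_integrable_def)

lemma u_measurable: "(\<lambda>z. u (fst z) (snd z)) \<in> borel_measurable borel"
proof -
  have [measurable]: "u0 \<in> borel_measurable borel" using u0D by (rule D_measurable)
  have c: "(\<lambda>z :: real \<times> 'a. (0 :: real, fst z, snd z)) \<in> borel_measurable borel"
    by (intro borel_measurable_continuous_onI continuous_intros)
  have [measurable]: "(\<lambda>z. time_int 0 (fst z) v (snd z)) \<in> borel_measurable borel"
    using measurable_compose[OF c time_int_measurable[OF v_measurable]] by simp
  show ?thesis unfolding u_def by measurable
qed

lemma u_t_measurable [measurable]: "u t \<in> borel_measurable borel"
  using measurable_compose[OF Pair_measurable_borel(1) u_measurable] by simp

lemma u_off: "x \<notin> \<Omega> \<Longrightarrow> u t x = 0"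
  using X_off[OF D_X[OF u0D]] by (simp add: u_def time_int_def v_off)

lemma u_X: "u t \<in> X" unfolding X_def using u_off by auto

lemma u_0: "u 0 = u0" by (simp add: u_def[abs_def] time_int_def)

lemma u_square_integrable: "0 \<le> t \<Longrightarrow> L2 (u t)"
  unfolding u_def[abs_def] by (intro square_integrable_add D_square_integrable u0D time_int_nsq v)

lemma cut_vn: "L2 (cut (vn n))"
  using vn_space_time[of n] by (simp_all add: cut_def[abs_def])

lemma Vn_square_integrable: "L2 (Vn n)"
  unfolding Vn_def by (rule square_integrable_sum[where f = "\<lambda>k. cut (vn (\<sigma> k))"]) (rule cut_vn)

lemma Vn_lim: "(\<lambda>n. nsq lborel (\<lambda>z. Vn n z - v z)) \<longlonglongrightarrow> 0"
  using v_lim by (simp add: Vn_def)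

lemma ub_square_integrable: "L2 (ub n t)" "L2 (ub' n t)"
  by (rule D_square_integrable[OF ub_D(1)], rule D_square_integrable[OF ub_D(2)])

text \<open>Averages commute with the time integral, so the difference consists of the averaged
  interpolation errors, of squared norm at most of order h, and the time integral of the error in
  the averaged quotients.\<close>

lemma mean_of_ub_close:
  assumes t: "0 \<le> t" "t \<le> T"
  shows "nsq lborel (\<lambda>x. (\<Sum>k<N n. l n k * ub (\<sigma> k) t x) - u t x)
      \<le> 2 * (hn n * (4 * M0)) + 2 * (T * nsq lborel (\<lambda>z. Vn n z - v z))"
proof -
  let ?B = "\<lambda>k x. ub (\<sigma> k) t x - (u0 x + time_int 0 t (cut (vn (\<sigma> k))) x)"
  have B: "L2 (?B k)" for k by (rule ub_minus_time_int(1)[OF t])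
  have nB: "nsq lborel (\<lambda>x. ?B k x - 0) \<le> hn n * (4 * M0)" if "n \<le> k" for k
  proof -
    have "n \<le> \<sigma> k" using seq_suble[OF \<sigma>, of k] that by linarith
    then have "hn (\<sigma> k) * (4 * M0) \<le> hn n * (4 * M0)" using M0 by (intro mult_right_mono hn_antimono) auto
    then show ?thesis using ub_minus_time_int(2)[OF t, of "\<sigma> k"] by simp
  qed
  have 1: "nsq lborel (\<lambda>x. (\<Sum>k<N n. l n k * ?B k x) - 0) \<le> hn n * (4 * M0)"
    by (rule nsq_weighted_mean_le[where f = ?B, OF w B square_integrable_zero nB])
  have d: "L2 (\<lambda>z. Vn n z - v z)" by (intro square_integrable_diff Vn_square_integrable v)
  have 2: "nsq lborel (time_int 0 t (\<lambda>z. Vn n z - v z)) \<le> T * nsq lborel (\<lambda>z. Vn n z - v z)"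
    using time_int_nsq(2)[OF d t(1)] mult_right_mono[OF t(2) nsq_nonneg[of lborel "\<lambda>z. Vn n z - v z"]] by simp
  have s1: "(\<Sum>k<N n. l n k) = 1" using w[of n] by (simp add: conv_weights_def)
  have AEeq: "AE x in lborel. (\<Sum>k<N n. l n k * ub (\<sigma> k) t x) - u t x = (\<Sum>k<N n. l n k * ?B k x) + time_int 0 t (\<lambda>z. Vn n z - v z) x"
    using time_int_sum[where F = "\<lambda>k. cut (vn (\<sigma> k))" and l = "l n" and I = "{..<N n}" and a = 0 and b = t, OF cut_vn finite_lessThan]
      time_int_linear[OF Vn_square_integrable[of n] v, of 0 t]
  proof eventually_elim
    case (elim x)
    have "(\<Sum>k<N n. l n k * ?B k x) = (\<Sum>k<N n. l n k * ub (\<sigma> k) t x - (l n k * u0 x + l n k * time_int 0 t (cut (vn (\<sigma> k))) x))"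
      by (intro sum.cong) (auto simp: algebra_simps)
    also have "\<dots> = (\<Sum>k<N n. l n k * ub (\<sigma> k) t x) - (u0 x + (\<Sum>k<N n. l n k * time_int 0 t (cut (vn (\<sigma> k))) x))"
      by (simp add: sum_subtractf sum.distrib sum_distrib_right[symmetric] s1)
    finally show ?case using elim by (simp add: u_def Vn_def[abs_def])
  qed
  have sB: "L2 (\<lambda>x. \<Sum>k<N n. l n k * ?B k x)"
    by (rule square_integrable_sum[where f = ?B]) (rule B)
  have sU: "L2 (\<lambda>x. \<Sum>k<N n. l n k * ub (\<sigma> k) t x)"
    by (rule square_integrable_sum[where f = "\<lambda>k. ub (\<sigma> k) t"]) (rule ub_square_integrable)
  have st: "L2 (time_int 0 t (\<lambda>z. Vn n z - v z))" by (rule time_int_nsq(1)[OF d t(1)])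
  have "nsq lborel (\<lambda>x. (\<Sum>k<N n. l n k * ub (\<sigma> k) t x) - u t x)
      = nsq lborel (\<lambda>x. (\<Sum>k<N n. l n k * ?B k x) + time_int 0 t (\<lambda>z. Vn n z - v z) x)"
    using square_integrable_diff[OF sU u_square_integrable[OF t(1)]] square_integrable_add[OF sB st] AEeq
    by (intro nsq_cong_AE) (auto dest: square_integrableD)
  also have "\<dots> \<le> 2 * nsq lborel (\<lambda>x. \<Sum>k<N n. l n k * ?B k x) + 2 * nsq lborel (time_int 0 t (\<lambda>z. Vn n z - v z))"
    by (rule nsq_add_le[OF sB st])
  finally show ?thesis using 1 2 by simp
qed

text \<open>The uniform Cauchy property keeps a single interpolant close to every average over a
  later tail. Convergence of the averages therefore carries over to the sequence itself, uniformly
  in time.\<close>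

lemma u_conv:
  assumes e: "0 < e"
  shows "\<exists>m0. \<forall>m\<ge>m0. \<forall>t\<in>{0..T}. nsq lborel (\<lambda>x. ub (\<sigma> m) t x - u t x) \<le> e"
proof -
  obtain N1 where N1: "\<forall>m\<ge>N1. \<forall>n\<ge>N1. \<forall>t\<in>{0..T}. nsq lborel (\<lambda>x. ub (\<sigma> m) t x - ub (\<sigma> n) t x) \<le> e / 4"
    using uC[rule_format, of "e / 4"] e by auto
  have "(\<lambda>n. 2 * (hn n * (4 * M0)) + 2 * (T * nsq lborel (\<lambda>z. Vn n z - v z))) \<longlonglongrightarrow> 2 * (0 * (4 * M0)) + 2 * (T * 0)"
    by (intro tendsto_intros hn_tendsto Vn_lim)
  then have "\<forall>\<^sub>F n in sequentially. 2 * (hn n * (4 * M0)) + 2 * (T * nsq lborel (\<lambda>z. Vn n z - v z)) < e / 4"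
    using e by (intro order_tendstoD(2)[of _ "2 * (0 * (4 * M0)) + 2 * (T * 0)"]) auto
  then obtain N2 where N2: "\<And>n. n \<ge> N2 \<Longrightarrow> 2 * (hn n * (4 * M0)) + 2 * (T * nsq lborel (\<lambda>z. Vn n z - v z)) < e / 4"
    by (auto simp: eventually_sequentially)
  define n where "n = max N1 N2"
  have "nsq lborel (\<lambda>x. ub (\<sigma> m) t x - u t x) \<le> e" if m: "m \<ge> N1" and t: "t \<in> {0..T}" for m t
  proof -
    let ?A = "\<lambda>x. \<Sum>k<N n. l n k * ub (\<sigma> k) t x"
    have sA: "L2 ?A"
      by (rule square_integrable_sum[where f = "\<lambda>k. ub (\<sigma> k) t"]) (rule ub_square_integrable)
    have t0: "0 \<le> t" "t \<le> T" using t by auto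
    have "nsq lborel (\<lambda>x. ?A x - ub (\<sigma> m) t x) \<le> e / 4"
      by (rule nsq_weighted_mean_le[where f = "\<lambda>k. ub (\<sigma> k) t", OF w ub_square_integrable(1) ub_square_integrable(1)])
        (use N1 m t in \<open>auto simp: n_def\<close>)
    then have a: "nsq lborel (\<lambda>x. ub (\<sigma> m) t x - ?A x) \<le> e / 4" by (subst nsq_minus_commute)
    have b: "nsq lborel (\<lambda>x. ?A x - u t x) \<le> e / 4"
      using mean_of_ub_close[OF t0, of n] N2[of n] by (simp add: n_def)
    show ?thesis using nsq_triangle3[OF ub_square_integrable(1)[of "\<sigma> m" t] sA u_square_integrable[OF t0(1)]] a b e by linarith
  qed
  then show ?thesis by blast
qed

lemma ub_tendsto_u:
  assumes "t \<in> {0..T}"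
  shows "(\<lambda>n. nsq lborel (\<lambda>x. ub (\<sigma> n) t x - u t x)) \<longlonglongrightarrow> 0"
proof (rule tendsto_zero_of_abs_le)
  fix e :: real assume "0 < e"
  from u_conv[OF this] show "\<exists>N. \<forall>n\<ge>N. \<bar>nsq lborel (\<lambda>x. ub (\<sigma> n) t x - u t x)\<bar> \<le> e"
    using assms by (simp only: abs_of_nonneg[OF nsq_nonneg]) blast
qed

text \<open>Lower semicontinuity transports the bound of the scheme to every single time, T
  included.\<close>

lemma u_J:
  assumes "t \<in> {0..T}"
  shows "J (u t) \<le> ennreal M0"
proof (rule J_lsc_L2)
  show "ub (\<sigma> n) t \<in> D" "J (ub (\<sigma> n) t) \<le> ennreal M0" for n using ub_D ub_J assms by auto
  show "L2 (u t)" using u_square_integrable assms by auto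
qed (use u_X ub_tendsto_u[OF assms] in auto)

lemma u_D:
  assumes "t \<in> {0..T}" shows "u t \<in> D"
proof -
  have "J (u t) < \<infinity>" using order.strict_trans1[OF u_J[OF assms] ennreal_less_top] by simp
  then show ?thesis using u_X by (simp add: D_def)
qed

lemma u_time:
  assumes "0 \<le> a" "a \<le> b"
  shows "nsq lborel (\<lambda>x. u b x - u a x) \<le> (b - a) * nsq lborel v"
proof -
  have "AE x in lborel. u b x - u a x = time_int a b v x"
    using time_int_split[OF v assms] by eventually_elim (simp add: u_def)
  then have "nsq lborel (\<lambda>x. u b x - u a x) = nsq lborel (time_int a b v)"
    by (intro nsq_cong_AE) auto
  then show ?thesis using time_int_nsq(2)[OF v assms(2)] by simp
qed

lemma cut_u_measurable [measurable]: "cut u \<in> borel_measurable borel"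
  by (rule cut_measurable[OF u_measurable])

lemma cut_u_square_integrable: "L2 (cut u)"
proof -
  obtain B where B: "0 \<le> B" "\<And>w. w \<in> X \<Longrightarrow> J w \<le> ennreal M0 \<Longrightarrow> L2 w \<and> nsq lborel w \<le> B"
    by (rule L2_bound_of_J[OF M0_nonneg]) blast
  show ?thesis using B u_X u_J by (intro cut_slices(1)[of _ B]) auto
qed

lemma cut_ub_square_integrable: "L2 (cut (ub n))" "L2 (cut (ub' n))"
proof -
  obtain B where B: "0 \<le> B" "\<And>w. w \<in> X \<Longrightarrow> J w \<le> ennreal M0 \<Longrightarrow> L2 w \<and> nsq lborel w \<le> B"
    by (rule L2_bound_of_J[OF M0_nonneg]) blast
  show "L2 (cut (ub n))"
    using B(2)[OF D_X[OF ub_D(1)] ub_J(1)] B(1) by (intro cut_slices(1)[of _ B]) auto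
  show "L2 (cut (ub' n))"
    using B(2)[OF D_X[OF ub_D(2)] ub_J(2)] B(1) by (intro cut_slices(1)[of _ B]) auto
qed

lemma cut_conv: "(\<lambda>n. nsq lborel (\<lambda>z. cut (ub (\<sigma> n)) z - cut u z)) \<longlonglongrightarrow> 0"
  "(\<lambda>n. nsq lborel (\<lambda>z. cut (ub' (\<sigma> n)) z - cut u z)) \<longlonglongrightarrow> 0"
proof -
  show 1: "(\<lambda>n. nsq lborel (\<lambda>z. cut (ub (\<sigma> n)) z - cut u z)) \<longlonglongrightarrow> 0"
  proof (rule tendsto_zero_of_abs_le)
    fix e :: real assume e: "0 < e"
    then have "0 < e / T" using T by simp
    then obtain m0 where m0: "\<forall>m\<ge>m0. \<forall>t\<in>{0..T}. nsq lborel (\<lambda>x. ub (\<sigma> m) t x - u t x) \<le> e / T"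
      using u_conv by blast
    have "nsq lborel (\<lambda>z. cut (ub (\<sigma> n)) z - cut u z) \<le> e" if "n \<ge> m0" for n
    proof -
      have "nsq lborel (cut (\<lambda>t x. ub (\<sigma> n) t x - u t x)) \<le> e / T * T"
      proof (rule cut_slices(2))
        show "cut (\<lambda>t x. ub (\<sigma> n) t x - u t x) \<in> borel_measurable borel"
          using cut_ub_measurable(1)[of "\<sigma> n"] cut_u_measurable by (simp add: cut_diff[abs_def])
      qed (use m0 that \<open>0 < e / T\<close> ub_square_integrable u_square_integrable in \<open>auto intro!: square_integrable_diff\<close>)
      then show ?thesis using T by (simp add: cut_diff[abs_def])
    qed
    then show "\<exists>N. \<forall>n\<ge>N. \<bar>nsq lborel (\<lambda>z. cut (ub (\<sigma> n)) z - cut u z)\<bar> \<le> e" by auto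
  qed
  have 2: "(\<lambda>n. nsq lborel (\<lambda>z. cut (ub' (\<sigma> n)) z - cut (ub (\<sigma> n)) z)) \<longlonglongrightarrow> 0"
  proof (rule tendsto_sandwich[OF _ _ tendsto_const])
    show "(\<lambda>n. hn (\<sigma> n) * (4 * M0) * T) \<longlonglongrightarrow> 0"
    proof -
      have "(\<lambda>n. hn (\<sigma> n) * (4 * M0) * T) \<longlonglongrightarrow> 0 * (4 * M0) * T"
        using LIMSEQ_subseq_LIMSEQ[OF hn_tendsto \<sigma>] by (intro tendsto_intros) (simp add: o_def)
      then show ?thesis by simp
    qed
    show "\<forall>\<^sub>F n in sequentially. nsq lborel (\<lambda>z. cut (ub' (\<sigma> n)) z - cut (ub (\<sigma> n)) z) \<le> hn (\<sigma> n) * (4 * M0) * T"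
    proof (rule always_eventually, rule allI)
      fix n
      have "nsq lborel (cut (\<lambda>t x. ub' (\<sigma> n) t x - ub (\<sigma> n) t x)) \<le> hn (\<sigma> n) * (4 * M0) * T"
        using ub'_diff ub_square_integrable hn(1)[of "\<sigma> n"] M0 by (intro cut_slices(2)) (auto intro!: cut_measurable square_integrable_diff)
      then show "nsq lborel (\<lambda>z. cut (ub' (\<sigma> n)) z - cut (ub (\<sigma> n)) z) \<le> hn (\<sigma> n) * (4 * M0) * T"
        by (simp add: cut_diff[abs_def])
    qed
  qed auto
  show "(\<lambda>n. nsq lborel (\<lambda>z. cut (ub' (\<sigma> n)) z - cut u z)) \<longlonglongrightarrow> 0"
  proof (rule tendsto_sandwich[OF _ _ tendsto_const])
    have "(\<lambda>n. 2 * nsq lborel (\<lambda>z. cut (ub' (\<sigma> n)) z - cut (ub (\<sigma> n)) z) + 2 * nsq lborel (\<lambda>z. cut (ub (\<sigma> n)) z - cut u z)) \<longlonglongrightarrow> 2 * 0 + 2 * 0"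
      by (intro tendsto_intros 1 2)
    then show "(\<lambda>n. 2 * nsq lborel (\<lambda>z. cut (ub' (\<sigma> n)) z - cut (ub (\<sigma> n)) z) + 2 * nsq lborel (\<lambda>z. cut (ub (\<sigma> n)) z - cut u z)) \<longlonglongrightarrow> 0" by simp
    show "\<forall>\<^sub>F n in sequentially. nsq lborel (\<lambda>z. cut (ub' (\<sigma> n)) z - cut u z)
      \<le> 2 * nsq lborel (\<lambda>z. cut (ub' (\<sigma> n)) z - cut (ub (\<sigma> n)) z) + 2 * nsq lborel (\<lambda>z. cut (ub (\<sigma> n)) z - cut u z)"
      by (intro always_eventually allI nsq_triangle3 cut_ub_square_integrable cut_u_square_integrable)
  qed auto
qed

lemma L2_limit_unique:
  assumes "\<And>n. square_integrable M (a n)" "square_integrable M A" "square_integrable M B"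
    "(\<lambda>n. nsq M (\<lambda>x. a n x - A x)) \<longlonglongrightarrow> 0" "(\<lambda>n. nsq M (\<lambda>x. a n x - B x)) \<longlonglongrightarrow> 0"
  shows "AE x in M. A x = B x"
proof -
  have "(\<lambda>n. 2 * nsq M (\<lambda>x. a n x - A x) + 2 * nsq M (\<lambda>x. a n x - B x)) \<longlonglongrightarrow> 2 * 0 + 2 * 0"
    by (intro tendsto_intros assms)
  moreover have "nsq M (\<lambda>x. A x - B x) \<le> 2 * nsq M (\<lambda>x. a n x - A x) + 2 * nsq M (\<lambda>x. a n x - B x)" for n
    using nsq_triangle3[OF assms(2,1,3), of n] nsq_minus_commute[of M A "a n"] by simp
  ultimately have "nsq M (\<lambda>x. A x - B x) \<le> 2 * 0 + 2 * 0" by (intro LIMSEQ_le_const) auto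
  then have "AE x in M. A x - B x = 0"
    by (intro nsq_zero_imp_AE square_integrable_diff assms) simp
  then show ?thesis by eventually_elim simp
qed

text \<open>The space-time limits found by compactness both coincide with the cut-off limit
  function, by uniqueness of L2 limits; their pointwise convergence is thereby convergence to
  u.\<close>

lemma ub_AE:
  "AE z in lborel. fst z \<in> {0..<T} \<longrightarrow> (\<lambda>n. ub (\<sigma> n) (fst z) (snd z)) \<longlonglongrightarrow> u (fst z) (snd z)"
  "AE z in lborel. fst z \<in> {0..<T} \<longrightarrow> (\<lambda>n. ub' (\<sigma> n) (fst z) (snd z)) \<longlonglongrightarrow> u (fst z) (snd z)"
proof -
  have "AE z in lborel. W z = cut u z" "AE z in lborel. W' z = cut u z"
    by (rule L2_limit_unique[where a = "\<lambda>n. cut (ub (\<sigma> n))", OF cut_ub_square_integrable(1) W(1) cut_u_square_integrable W(5) cut_conv(1)],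
        rule L2_limit_unique[where a = "\<lambda>n. cut (ub' (\<sigma> n))", OF cut_ub_square_integrable(2) W(2) cut_u_square_integrable W(6) cut_conv(2)])
  then show "AE z in lborel. fst z \<in> {0..<T} \<longrightarrow> (\<lambda>n. ub (\<sigma> n) (fst z) (snd z)) \<longlonglongrightarrow> u (fst z) (snd z)"
    "AE z in lborel. fst z \<in> {0..<T} \<longrightarrow> (\<lambda>n. ub' (\<sigma> n) (fst z) (snd z)) \<longlonglongrightarrow> u (fst z) (snd z)"
    using W(3,4) by (eventually_elim, auto simp: cut_def)+
qed

lemma cut_Nf_measurable [measurable]: "cut (\<lambda>t. Nf (u t)) \<in> borel_measurable borel"
proof (rule cut_measurable)
  show "(\<lambda>z. Nf (u (fst z)) (snd z)) \<in> borel_measurable borel"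
    unfolding Nf_def by (intro f_measurable u_measurable measurable_snd_borel)
qed

lemma Nf_u_square_integrable: "t \<in> {0..T} \<Longrightarrow> L2 (Nf (u t))"
  using D_Nf[OF u_D] .

lemma cut_Nf_square_integrable: "L2 (cut (\<lambda>t. Nf (u t)))"
  using Nf_square_integrable[OF M0_nonneg u_X u_J] G_nonneg[OF M0_nonneg] by (intro cut_slices(1)[of _ "G M0"]) auto

lemma cut_gn_square_integrable: "L2 (cut (gn n))"
proof -
  have e: "gn n t = Nf (ub n t)" for t by (auto simp: gn_def Nf_def)
  show ?thesis
    using Nf_square_integrable[OF M0_nonneg D_X[OF ub_D(1)] ub_J(1)] G_nonneg[OF M0_nonneg]
    by (intro cut_slices(1)[of _ "G M0"]) (auto simp: e)
qed

text \<open>Vitali's theorem on [0, T) \<times> \<Omega>: continuity of f(x, \<cdot>) gives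
  convergence almost everywhere, and the \<open>qf\<close>-th moments of both terms, bounded on each
  time slice by \<open>Gq M0\<close>, give equi-integrability.\<close>

lemma gn_conv: "(\<lambda>n. nsq lborel (\<lambda>z. cut (gn (\<sigma> n)) z - cut (\<lambda>t. Nf (u t)) z)) \<longlonglongrightarrow> 0"
proof (rule Vitali_L2(2)[where A = "{0..<T} \<times> \<Omega>" and q = qf and B = "2 powr qf * (2 * Gq M0) * T"])
  show "AE z in lborel. (\<lambda>n. cut (gn (\<sigma> n)) z - cut (\<lambda>t. Nf (u t)) z) \<longlonglongrightarrow> 0"
    using ub_AE(1)
  proof eventually_elim
    case (elim z)
    show ?case
    proof (cases "fst z \<in> {0..<T}")
      case True
      have "isCont (f (snd z)) (u (fst z) (snd z))" using f_cont by (simp add: continuous_on_eq_continuous_at)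
      then have "(\<lambda>n. f (snd z) (ub (\<sigma> n) (fst z) (snd z))) \<longlonglongrightarrow> f (snd z) (u (fst z) (snd z))"
        by (rule isCont_tendsto_compose) (use elim True in blast)
      then show ?thesis using True by (simp add: cut_def gn_def Nf_def LIM_zero)
    qed (simp add: cut_def)
  qed
  show "{0..<T} \<times> \<Omega> \<in> sets lborel" by (simp flip: borel_prod)
  have "bounded ({0..<T} \<times> \<Omega>)" by (intro bounded_Times bounded_dom) (auto intro: bounded_subset[OF bounded_closed_interval[of 0 T]])
  then show "emeasure lborel ({0..<T} \<times> \<Omega>) < \<infinity>" using emeasure_bounded_finite by blast
  show "cut (gn (\<sigma> n)) z - cut (\<lambda>t. Nf (u t)) z = 0" if "z \<notin> {0..<T} \<times> \<Omega>" for n z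
    using that by (cases z) (auto simp: cut_def gn_def Nf_def f_off)
  show "2 < qf" by (rule qf)
  fix n
  have Gq0: "0 \<le> Gq M0" using Gq(1)[OF M0_nonneg] .
  have [measurable]: "(\<lambda>z. cut (gn (\<sigma> n)) z - cut (\<lambda>t. Nf (u t)) z) \<in> borel_measurable borel" by measurable
  have "(\<integral>\<^sup>+z. ennreal (\<bar>cut (gn (\<sigma> n)) z - cut (\<lambda>t. Nf (u t)) z\<bar> powr qf) \<partial>lborel)
      = (\<integral>\<^sup>+t. \<integral>\<^sup>+x. ennreal (\<bar>cut (gn (\<sigma> n)) (t, x) - cut (\<lambda>t. Nf (u t)) (t, x)\<bar> powr qf) \<partial>lborel \<partial>lborel)"
    by (rule nn_integral_lborel_iterated) measurable
  also have "\<dots> \<le> (\<integral>\<^sup>+t. ennreal (2 powr qf * (2 * Gq M0)) * indicator {0..<T} t \<partial>lborel)"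
  proof (rule nn_integral_mono)
    fix t
    show "(\<integral>\<^sup>+x. ennreal (\<bar>cut (gn (\<sigma> n)) (t, x) - cut (\<lambda>t. Nf (u t)) (t, x)\<bar> powr qf) \<partial>lborel)
      \<le> ennreal (2 powr qf * (2 * Gq M0)) * indicator {0..<T} t"
    proof (cases "t \<in> {0..<T}")
      case True
      then have t: "t \<in> {0..T}" by auto
      let ?b = "ub (\<sigma> n) t"
      have [measurable]: "Nf ?b \<in> borel_measurable borel" "Nf (u t) \<in> borel_measurable borel"
        using Nf_X[OF D_X[OF ub_D(1)]] Nf_X[OF u_X] X_measurable by auto
      have "(\<integral>\<^sup>+x. ennreal (\<bar>cut (gn (\<sigma> n)) (t, x) - cut (\<lambda>t. Nf (u t)) (t, x)\<bar> powr qf) \<partial>lborel)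
          \<le> (\<integral>\<^sup>+x. ennreal (2 powr qf) * (ennreal (\<bar>Nf ?b x\<bar> powr qf) + ennreal (\<bar>Nf (u t) x\<bar> powr qf)) \<partial>lborel)"
      proof (rule nn_integral_mono)
        fix x
        have "cut (gn (\<sigma> n)) (t, x) = Nf ?b x" "cut (\<lambda>t. Nf (u t)) (t, x) = Nf (u t) x"
          using True by (auto simp: cut_def gn_def Nf_def)
        then show "ennreal (\<bar>cut (gn (\<sigma> n)) (t, x) - cut (\<lambda>t. Nf (u t)) (t, x)\<bar> powr qf)
           \<le> ennreal (2 powr qf) * (ennreal (\<bar>Nf ?b x\<bar> powr qf) + ennreal (\<bar>Nf (u t) x\<bar> powr qf))"
          using powr_abs_diff_le[of qf "Nf ?b x" "Nf (u t) x"] qf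
          by (simp add: ennreal_leI flip: ennreal_mult ennreal_plus)
      qed
      also have "\<dots> = ennreal (2 powr qf) * ((\<integral>\<^sup>+x. ennreal (\<bar>Nf ?b x\<bar> powr qf) \<partial>lborel) + (\<integral>\<^sup>+x. ennreal (\<bar>Nf (u t) x\<bar> powr qf) \<partial>lborel))"
        by (subst nn_integral_cmult) (auto simp: nn_integral_add)
      also have "\<dots> \<le> ennreal (2 powr qf) * (ennreal (Gq M0) + ennreal (Gq M0))"
        using t by (intro mult_left_mono add_mono Gq(2)[OF M0_nonneg] D_X ub_D ub_J u_X u_J) auto
      also have "\<dots> = ennreal (2 powr qf * (2 * Gq M0))"
        using Gq0 by (simp flip: ennreal_plus ennreal_mult)
      finally show ?thesis using True by simp
    qed (simp add: cut_def)
  qed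
  also have "\<dots> = ennreal (2 powr qf * (2 * Gq M0) * T)"
    using Gq0 T by (subst nn_integral_cmult_indicator) (auto simp: ennreal_mult)
  finally show "(\<integral>\<^sup>+z. ennreal (\<bar>cut (gn (\<sigma> n)) z - cut (\<lambda>t. Nf (u t)) z\<bar> powr qf) \<partial>lborel) \<le> ennreal (2 powr qf * (2 * Gq M0) * T)" .
qed measurable

definition Gn :: "nat \<Rightarrow> real \<times> 'a \<Rightarrow> real" where "Gn n z = (\<Sum>k<N n. l n k * cut (gn (\<sigma> k)) z)"

lemma Gn_square_integrable: "L2 (Gn n)"
  unfolding Gn_def by (rule square_integrable_sum[where f = "\<lambda>k. cut (gn (\<sigma> k))"]) (rule cut_gn_square_integrable)

lemma Gn_lim: "(\<lambda>n. nsq lborel (\<lambda>z. Gn n z - cut (\<lambda>t. Nf (u t)) z)) \<longlonglongrightarrow> 0"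
proof (rule tendsto_zero_of_abs_le)
  fix e :: real assume "0 < e"
  then have "\<forall>\<^sub>F n in sequentially. nsq lborel (\<lambda>z. cut (gn (\<sigma> n)) z - cut (\<lambda>t. Nf (u t)) z) < e"
    using gn_conv by (intro order_tendstoD(2))
  then obtain n0 where n0: "\<And>n. n \<ge> n0 \<Longrightarrow> nsq lborel (\<lambda>z. cut (gn (\<sigma> n)) z - cut (\<lambda>t. Nf (u t)) z) < e"
    by (auto simp: eventually_sequentially)
  have "nsq lborel (\<lambda>z. Gn n z - cut (\<lambda>t. Nf (u t)) z) \<le> e" if "n \<ge> n0" for n
    unfolding Gn_def
    by (rule nsq_weighted_mean_le[where f = "\<lambda>k. cut (gn (\<sigma> k))", OF w cut_gn_square_integrable cut_Nf_square_integrable])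
      (use n0 that in \<open>auto intro!: less_imp_le\<close>)
  then show "\<exists>N. \<forall>n\<ge>N. \<bar>nsq lborel (\<lambda>z. Gn n z - cut (\<lambda>t. Nf (u t)) z)\<bar> \<le> e" by auto
qed

end

lemma sgn_limit:
  fixes p c :: "nat \<Rightarrow> real"
  assumes p: "p \<longlonglongrightarrow> P" "P \<noteq> 0" and c: "c \<longlonglongrightarrow> 0"
  shows "(\<lambda>n. p n / sqrt ((p n)\<^sup>2 + (c n)\<^sup>2)) \<longlonglongrightarrow> sgn P"
proof -
  have "(\<lambda>n. p n / sqrt ((p n)\<^sup>2 + (c n)\<^sup>2)) \<longlonglongrightarrow> P / sqrt (P\<^sup>2 + 0\<^sup>2)"
    using p c by (intro tendsto_intros) auto
  then show ?thesis using p(2) by (simp add: sgn_div_norm divide_inverse mult.commute real_sgn_eq)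
qed

section \<open>The coefficient and the limit equation\<close>

context flow_limit
begin

text \<open>By Fubini, L2 convergence in space-time is L1 convergence in t of the squared slice
  norms. Both families enter through their sum, so that one subsequence works for both.\<close>

lemma slices_converge:
  obtains \<rho> :: "nat \<Rightarrow> nat" where "strict_mono \<rho>"
    "AE t in lborel. (\<lambda>n. nsq lborel (\<lambda>x. Vn (\<rho> n) (t, x) - v (t, x))) \<longlonglongrightarrow> 0"
    "AE t in lborel. (\<lambda>n. nsq lborel (\<lambda>x. Gn (\<rho> n) (t, x) - cut (\<lambda>t. Nf (u t)) (t, x))) \<longlonglongrightarrow> 0"
proof -
  let ?g = "cut (\<lambda>t. Nf (u t))"
  let ?A = "\<lambda>n t. nsq lborel (\<lambda>x. Vn n (t, x) - v (t, x))"
  let ?B = "\<lambda>n t. nsq lborel (\<lambda>x. Gn n (t, x) - ?g (t, x))"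
  have dA: "L2 (\<lambda>z. Vn n z - v z)" for n by (intro square_integrable_diff Vn_square_integrable v)
  have dB: "L2 (\<lambda>z. Gn n z - ?g z)" for n
    by (intro square_integrable_diff Gn_square_integrable cut_Nf_square_integrable)
  have i: "integrable lborel (\<lambda>t. ?A n t + ?B n t)" for n
    using square_integrable_Fubini(2)[OF dA[of n]] square_integrable_Fubini(2)[OF dB[of n]] by simp
  have eq: "(LBINT t. norm (?A n t + ?B n t)) = nsq lborel (\<lambda>z. Vn n z - v z) + nsq lborel (\<lambda>z. Gn n z - ?g z)" for n
    using square_integrable_Fubini(2,3)[OF dA[of n]] square_integrable_Fubini(2,3)[OF dB[of n]]
    by (simp add: abs_of_nonneg add_nonneg_nonneg)
  have "(\<lambda>n. nsq lborel (\<lambda>z. Vn n z - v z) + nsq lborel (\<lambda>z. Gn n z - ?g z)) \<longlonglongrightarrow> 0 + 0"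
    by (intro tendsto_intros Vn_lim Gn_lim)
  then have "(\<lambda>n. LBINT t. norm (?A n t + ?B n t)) \<longlonglongrightarrow> 0" unfolding eq by simp
  then obtain \<rho> where \<rho>: "strict_mono (\<rho> :: nat \<Rightarrow> nat)" "AE t in lborel. (\<lambda>n. ?A (\<rho> n) t + ?B (\<rho> n) t) \<longlonglongrightarrow> 0"
    using tendsto_L1_AE_subseq[where u = "\<lambda>n t. ?A n t + ?B n t", OF i] by blast
  have "AE t in lborel. (\<lambda>n. ?A (\<rho> n) t) \<longlonglongrightarrow> 0"
    using \<rho>(2) by eventually_elim (rule tendsto_sandwich[OF _ _ tendsto_const], auto)
  moreover have "AE t in lborel. (\<lambda>n. ?B (\<rho> n) t) \<longlonglongrightarrow> 0"
    using \<rho>(2) by eventually_elim (rule tendsto_sandwich[OF _ _ tendsto_const], auto)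
  ultimately show ?thesis using \<rho>(1) that by blast
qed

text \<open>The averages without the weight and without the time cut-off: bounded by 1 and
  antisymmetric at every point.\<close>

definition En :: "nat \<Rightarrow> 'a \<times> 'a \<times> real \<Rightarrow> real" where
  "En n z = (\<Sum>k<N n. l n k * \<eta>n (\<sigma> k) (snd (snd z)) (fst z, fst (snd z)))"

text \<open>Defined by pointwise limits and not taken from \<open>H\<close>, so that measurability, antisymmetry and the bound hold everywhere.\<close>

definition \<eta> :: "'a \<times> 'a \<times> real \<Rightarrow> real" where
  "\<eta> z = (if snd (snd z) \<in> {0..<T} \<and> convergent (\<lambda>n. En n z) then lim (\<lambda>n. En n z) else 0)"

lemma En_measurable [measurable]: "En n \<in> borel_measurable borel"
proof -
  have c: "(\<lambda>z :: 'a \<times> 'a \<times> real. (fst z, fst (snd z))) \<in> borel_measurable borel"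
    by (intro borel_measurable_continuous_onI continuous_intros)
  have "(\<lambda>z :: 'a \<times> 'a \<times> real. \<eta>n k (snd (snd z)) (fst z, fst (snd z))) \<in> borel_measurable borel" for k
    by (intro \<eta>n_measurable c) measurable
  then show ?thesis unfolding En_def by measurable
qed

lemma \<eta>_measurable [measurable]: "\<eta> \<in> borel_measurable borel"
proof -
  have [measurable]: "Measurable.pred borel (\<lambda>z. convergent (\<lambda>n. En n z))"
    unfolding Cauchy_convergent_iff[symmetric] pred_def by (rule sets_Collect_Cauchy) simp
  have [measurable]: "(\<lambda>z. lim (\<lambda>n. En n z)) \<in> borel_measurable borel"
    by (rule borel_measurable_lim_metric) simp
  have [measurable]: "Measurable.pred borel (\<lambda>z :: 'a \<times> 'a \<times> real. snd (snd z) \<in> {0..<T})" by measurable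
  show ?thesis unfolding \<eta>_def by measurable
qed

lemma slice_measurable [measurable]:
  "(\<lambda>p. En n (fst p, snd p, t)) \<in> borel_measurable borel" "(\<lambda>p. \<eta> (fst p, snd p, t)) \<in> borel_measurable borel"
proof -
  have c: "(\<lambda>p :: 'a \<times> 'a. (fst p, snd p, t)) \<in> borel_measurable borel"
    by (intro borel_measurable_continuous_onI continuous_intros)
  show "(\<lambda>p. En n (fst p, snd p, t)) \<in> borel_measurable borel" "(\<lambda>p. \<eta> (fst p, snd p, t)) \<in> borel_measurable borel"
    by (rule measurable_compose[OF c En_measurable], rule measurable_compose[OF c \<eta>_measurable])
qed

lemma En_le1: "\<bar>En n z\<bar> \<le> 1"
proof -
  have "\<bar>(\<Sum>k<N n. l n k * \<eta>n (\<sigma> k) (snd (snd z)) (fst z, fst (snd z))) - 0\<bar> \<le> 1"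
    by (rule weighted_mean_bound[OF w]) (simp add: \<eta>n_le1)
  then show ?thesis by (simp add: En_def)
qed

lemma \<eta>_le1: "\<bar>\<eta> z\<bar> \<le> 1"
proof (cases "snd (snd z) \<in> {0..<T} \<and> convergent (\<lambda>n. En n z)")
  case True
  then have "(\<lambda>n. \<bar>En n z\<bar>) \<longlonglongrightarrow> \<bar>\<eta> z\<bar>"
    by (intro tendsto_rabs) (simp add: \<eta>_def convergent_LIMSEQ_iff)
  then show ?thesis by (rule LIMSEQ_le_const2) (use En_le1 in auto)
qed (auto simp: \<eta>_def)

lemma \<eta>_antisym: "\<eta> (x, y, t) = - \<eta> (y, x, t)"
proof -
  have E: "En n (x, y, t) = - En n (y, x, t)" for n
    by (simp add: En_def \<eta>n_antisym[of _ _ x y] sum_negf)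
  then have c: "convergent (\<lambda>n. En n (x, y, t)) = convergent (\<lambda>n. En n (y, x, t))"
    using convergent_minus_iff[of "\<lambda>n. En n (y, x, t)"] by (simp only: E)
  show ?thesis
  proof (cases "t \<in> {0..<T} \<and> convergent (\<lambda>n. En n (y, x, t))")
    case True
    then have "(\<lambda>n. - En n (y, x, t)) \<longlonglongrightarrow> - lim (\<lambda>n. En n (y, x, t))"
      by (intro tendsto_minus) (simp add: convergent_LIMSEQ_iff)
    then have "lim (\<lambda>n. En n (x, y, t)) = - lim (\<lambda>n. En n (y, x, t))"
      unfolding E by (rule limI)
    then show ?thesis using True c by (simp add: \<eta>_def)
  qed (auto simp: \<eta>_def c)
qed

text \<open>The weighted averages converge to \<open>H\<close>, and the factor
  \<open>sqrt w0\<close> is positive at every pair, so it can be divided out.\<close>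

lemma En_convergent_AE: "AE z in lborel. snd (snd z) \<in> {0..<T} \<longrightarrow> (\<lambda>n. En n z) \<longlonglongrightarrow> \<eta> z"
  using H_lim
proof eventually_elim
  case (elim z)
  show ?case
  proof
    assume t: "snd (snd z) \<in> {0..<T}"
    let ?s = "sqrt (w0 (fst z, fst (snd z)))"
    have s: "0 < ?s" using weightD(2)[OF w0(1)] by simp
    have "(\<Sum>k<N n. l n k * \<eta>w (\<sigma> k) z) = En n z * ?s" for n
      using t unfolding \<eta>w_def En_def sum_distrib_right by (intro sum.cong) auto
    then have "(\<lambda>n. En n z * ?s) \<longlonglongrightarrow> H z" using elim by simp
    then have "(\<lambda>n. En n z * ?s / ?s) \<longlonglongrightarrow> H z / ?s" using s by (intro tendsto_divide tendsto_const) auto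
    moreover have "En n z * ?s / ?s = En n z" for n using s by (intro nonzero_mult_div_cancel_right) simp
    ultimately have "(\<lambda>n. En n z) \<longlonglongrightarrow> H z / ?s" by simp
    then have "convergent (\<lambda>n. En n z)" by (rule convergentI)
    then show "(\<lambda>n. En n z) \<longlonglongrightarrow> \<eta> z" using t by (simp add: \<eta>_def convergent_LIMSEQ_iff)
  qed
qed

text \<open>Where u(x) and u(y) differ, the smoothed signs themselves converge to the sign of the
  difference, because the weight tends to 0 pointwise, and so do their averages over tails. Where
  they agree, the bound by 1 is all that the multivalued sign demands.\<close>

lemma \<eta>_sign: "AE z in lborel. snd (snd z) \<in> {0..<T} \<longrightarrow> \<eta> z \<in> multi_sign (u (snd (snd z)) (fst z) - u (snd (snd z)) (fst (snd z)))"
  using En_convergent_AE AE_lborel_space_time_pairs[OF ub_AE(2)]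
proof eventually_elim
  case (elim z)
  show ?case
  proof
    obtain x y t where z: "z = (x, y, t)" by (cases z) auto
    assume t: "snd (snd z) \<in> {0..<T}"
    show "\<eta> z \<in> multi_sign (u (snd (snd z)) (fst z) - u (snd (snd z)) (fst (snd z)))"
    proof (cases "u t x = u t y")
      case True
      then show ?thesis using \<eta>_le1[of z] by (auto simp: z multi_sign_def abs_le_iff)
    next
      case False
      then have "x \<noteq> y" by auto
      then have K: "0 < K (x, y)" by (simp add: K_def)
      let ?p = "\<lambda>n. dK (ub' (\<sigma> n) t) (x, y)" and ?P = "dK (u t) (x, y)"
      have p: "?p \<longlonglongrightarrow> ?P" unfolding dK_def using elim t by (intro tendsto_intros) (auto simp: z)
      have P: "?P \<noteq> 0" using False K by (simp add: dK_def)
      have c: "(\<lambda>n. cn (\<sigma> n) (x, y)) \<longlonglongrightarrow> 0"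
      proof -
        have "(\<lambda>n. w0 (x, y) * inverse (real (Suc n))) \<longlonglongrightarrow> w0 (x, y) * 0"
          by (intro tendsto_intros LIMSEQ_inverse_real_of_nat)
        then have "(\<lambda>n. cn n (x, y)) \<longlonglongrightarrow> 0" by (simp add: cn_def divide_inverse)
        from LIMSEQ_subseq_LIMSEQ[OF this \<sigma>] show ?thesis by (simp add: o_def)
      qed
      have "(\<lambda>n. \<eta>n (\<sigma> n) t (x, y)) \<longlonglongrightarrow> sgn ?P"
        unfolding \<eta>n_def jc_def by (rule sgn_limit[OF p P c])
      then have "(\<lambda>n. \<Sum>k<N n. l n k * \<eta>n (\<sigma> k) t (x, y)) \<longlonglongrightarrow> sgn ?P"
        by (rule weighted_mean_tendsto[OF w])
      moreover have "(\<lambda>n. \<Sum>k<N n. l n k * \<eta>n (\<sigma> k) t (x, y)) \<longlonglongrightarrow> \<eta> z"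
        using elim t by (simp add: En_def z)
      ultimately have "\<eta> z = sgn ?P" by (blast intro: LIMSEQ_unique)
      also have "\<dots> = sgn (u t x - u t y)" using K by (simp add: dK_def sgn_mult)
      finally show ?thesis using False by (simp add: multi_sign_def z)
    qed
  qed
qed

text \<open>The exceptional set of times comes from the slice convergences alone. It is therefore
  independent of \<phi>, and one null set serves all test functions.\<close>

lemma limit_equation:
  "AE t in lborel. t \<in> {0..<T} \<longrightarrow> (\<forall>\<phi>\<in>D. (LBINT x. v (t, x) * \<phi> x) +
      (LBINT p. \<eta> (fst p, snd p, t) * dK \<phi> p) = (LBINT x. Nf (u t) x * \<phi> x))"
proof -
  obtain \<rho> :: "nat \<Rightarrow> nat" where \<rho>: "strict_mono \<rho>"
    "AE t in lborel. (\<lambda>n. nsq lborel (\<lambda>x. Vn (\<rho> n) (t, x) - v (t, x))) \<longlonglongrightarrow> 0"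
    "AE t in lborel. (\<lambda>n. nsq lborel (\<lambda>x. Gn (\<rho> n) (t, x) - cut (\<lambda>t. Nf (u t)) (t, x))) \<longlonglongrightarrow> 0"
    by (rule slices_converge)
  from \<rho>(2,3) square_integrable_Fubini(1)[OF v] AE_lborel_rotate[OF En_convergent_AE]
  show ?thesis
  proof eventually_elim
    case (elim t)
    show ?case
    proof (intro impI ballI)
      fix \<phi> assume t: "t \<in> {0..<T}" and \<phi>: "\<phi> \<in> D"
      have s\<phi>: "L2 \<phi>" by (rule D_square_integrable[OF \<phi>])
      have i\<phi>: "integrable lborel (dK \<phi>)" by (rule D_integrable_dK[OF \<phi>])
      have [measurable]: "\<phi> \<in> borel_measurable borel" using \<phi> by (rule D_measurable)
      have sl: "cut a (t, x) = a t x" for a x using t by (simp add: cut_def)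
      have Vt: "Vn n (t, x) = (\<Sum>k<N n. l n k * vn (\<sigma> k) t x)" for n x by (simp add: Vn_def sl)
      have gnt: "L2 (gn k t)" for k
        using D_Nf[OF ub_D(1)[of k t]] by (simp add: gn_def[abs_def] Nf_def[abs_def])
      have Gt: "Gn n (t, x) = (\<Sum>k<N n. l n k * gn (\<sigma> k) t x)" for n x by (simp add: Gn_def sl)
      have sV: "L2 (\<lambda>x. Vn n (t, x))" for n
        unfolding Vt by (rule square_integrable_sum[where f = "\<lambda>k. vn (\<sigma> k) t"]) (rule vn_square_integrable)
      have sG: "L2 (\<lambda>x. Gn n (t, x))" for n
        unfolding Gt by (rule square_integrable_sum[where f = "\<lambda>k. gn (\<sigma> k) t"]) (rule gnt)
      have i\<eta>: "integrable lborel (\<lambda>p. \<eta>n k t p * dK \<phi> p)" for k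
      proof (rule Bochner_Integration.integrable_bound[OF i\<phi>])
        show "AE p in lborel. norm (\<eta>n k t p * dK \<phi> p) \<le> norm (dK \<phi> p)"
          using \<eta>n_le1 by (auto simp: abs_mult intro!: mult_left_le_one_le)
      qed measurable
      have eq: "(LBINT x. Vn n (t, x) * \<phi> x) + (LBINT p. En n (fst p, snd p, t) * dK \<phi> p) = (LBINT x. Gn n (t, x) * \<phi> x)" for n
      proof -
        have "(LBINT x. Vn n (t, x) * \<phi> x) = (LBINT x. (\<Sum>k<N n. l n k * (vn (\<sigma> k) t x * \<phi> x)))"
          by (intro Bochner_Integration.integral_cong) (auto simp: Vt sum_distrib_right mult.assoc)
        also have "\<dots> = (\<Sum>k<N n. l n k * (LBINT x. vn (\<sigma> k) t x * \<phi> x))"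
          using square_integrable_mult[OF vn_square_integrable s\<phi>] by (subst Bochner_Integration.integral_sum) auto
        finally have 1: "(LBINT x. Vn n (t, x) * \<phi> x) = (\<Sum>k<N n. l n k * (LBINT x. vn (\<sigma> k) t x * \<phi> x))" .
        have "(LBINT x. Gn n (t, x) * \<phi> x) = (LBINT x. (\<Sum>k<N n. l n k * (gn (\<sigma> k) t x * \<phi> x)))"
          by (intro Bochner_Integration.integral_cong) (auto simp: Gt sum_distrib_right mult.assoc)
        also have "\<dots> = (\<Sum>k<N n. l n k * (LBINT x. gn (\<sigma> k) t x * \<phi> x))"
          using square_integrable_mult[OF gnt s\<phi>] by (subst Bochner_Integration.integral_sum) auto
        finally have 2: "(LBINT x. Gn n (t, x) * \<phi> x) = (\<Sum>k<N n. l n k * (LBINT x. gn (\<sigma> k) t x * \<phi> x))" .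
        have "(LBINT p. En n (fst p, snd p, t) * dK \<phi> p) = (LBINT p. (\<Sum>k<N n. l n k * (\<eta>n (\<sigma> k) t p * dK \<phi> p)))"
          by (intro Bochner_Integration.integral_cong) (auto simp: En_def sum_distrib_right mult.assoc)
        also have "\<dots> = (\<Sum>k<N n. l n k * (LBINT p. \<eta>n (\<sigma> k) t p * dK \<phi> p))"
          using i\<eta> by (subst Bochner_Integration.integral_sum) auto
        finally have 3: "(LBINT p. En n (fst p, snd p, t) * dK \<phi> p) = (\<Sum>k<N n. l n k * (LBINT p. \<eta>n (\<sigma> k) t p * dK \<phi> p))" .
        show ?thesis unfolding 1 2 3 sum.distrib[symmetric] distrib_left[symmetric] scheme_equation[OF \<phi>] ..
      qed
      have L1: "(\<lambda>n. LBINT x. Vn (\<rho> n) (t, x) * \<phi> x) \<longlonglongrightarrow> (LBINT x. v (t, x) * \<phi> x)"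
        by (rule inner_tendsto_of_nsq[where f = "\<lambda>n x. Vn (\<rho> n) (t, x)"]) (use sV elim s\<phi> in auto)
      have L2: "(\<lambda>n. LBINT x. Gn (\<rho> n) (t, x) * \<phi> x) \<longlonglongrightarrow> (LBINT x. Nf (u t) x * \<phi> x)"
        by (rule inner_tendsto_of_nsq[where f = "\<lambda>n x. Gn (\<rho> n) (t, x)"])
          (use sG elim(2) s\<phi> t Nf_u_square_integrable in \<open>auto simp: sl\<close>)
      \<comment> \<open>The coefficients are bounded by 1 and \<open>dK \<phi>\<close> is
        integrable, so almost everywhere convergence at this fixed t suffices.\<close>
      have L3: "(\<lambda>n. LBINT p. En (\<rho> n) (fst p, snd p, t) * dK \<phi> p) \<longlonglongrightarrow> (LBINT p. \<eta> (fst p, snd p, t) * dK \<phi> p)"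
      proof (rule integral_dominated_convergence)
        show "integrable lborel (\<lambda>p. \<bar>dK \<phi> p\<bar>)" using i\<phi> by (rule integrable_abs)
        show "AE p in lborel. norm (En (\<rho> n) (fst p, snd p, t) * dK \<phi> p) \<le> \<bar>dK \<phi> p\<bar>" for n
          using En_le1 by (auto simp: abs_mult intro!: mult_left_le_one_le)
        show "AE p in lborel. (\<lambda>n. En (\<rho> n) (fst p, snd p, t) * dK \<phi> p) \<longlonglongrightarrow> \<eta> (fst p, snd p, t) * dK \<phi> p"
          using elim(4)
        proof eventually_elim
          case (elim p)
          then have "(\<lambda>n. En n (fst p, snd p, t)) \<longlonglongrightarrow> \<eta> (fst p, snd p, t)" using t by simp
          from LIMSEQ_subseq_LIMSEQ[OF this \<rho>(1)]
          have "(\<lambda>n. En (\<rho> n) (fst p, snd p, t)) \<longlonglongrightarrow> \<eta> (fst p, snd p, t)" by (simp add: o_def)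
          then show ?case by (intro tendsto_intros)
        qed
        show "(\<lambda>p. En (\<rho> n) (fst p, snd p, t) * dK \<phi> p) \<in> borel_measurable lborel" for n
          using slice_measurable(1)[of "\<rho> n"] by measurable
        show "(\<lambda>p. \<eta> (fst p, snd p, t) * dK \<phi> p) \<in> borel_measurable lborel"
          using slice_measurable(2) by measurable
      qed
      have "(\<lambda>n. LBINT x. Gn (\<rho> n) (t, x) * \<phi> x) \<longlonglongrightarrow> (LBINT x. v (t, x) * \<phi> x) + (LBINT p. \<eta> (fst p, snd p, t) * dK \<phi> p)"
        unfolding eq[symmetric] by (intro tendsto_add L1 L3)
      then show "(LBINT x. v (t, x) * \<phi> x) + (LBINT p. \<eta> (fst p, snd p, t) * dK \<phi> p) = (LBINT x. Nf (u t) x * \<phi> x)"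
        using L2 by (rule LIMSEQ_unique)
    qed
  qed
qed

end

section \<open>A chain rule for subgradients\<close>

definition shift :: "real \<Rightarrow> (real \<times> 'b \<Rightarrow> real) \<Rightarrow> real \<times> 'b \<Rightarrow> real" where
  "shift \<sigma> F z = F (fst z + \<sigma>, snd z)"

lemma shift_measurable [measurable]:
  fixes F :: "real \<times> 'b::euclidean_space \<Rightarrow> real"
  assumes "F \<in> borel_measurable borel"
  shows "shift \<sigma> F \<in> borel_measurable borel"
proof -
  have "(\<lambda>z :: real \<times> 'b. (fst z + \<sigma>, snd z)) \<in> borel_measurable borel"
    by (intro borel_measurable_continuous_onI continuous_intros)
  from measurable_compose[OF this assms] show ?thesis by (simp add: shift_def[abs_def])
qed

lemma nn_integral_shift:
  fixes g :: "real \<times> 'b::euclidean_space \<Rightarrow> ennreal"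
  assumes g: "g \<in> borel_measurable borel"
  shows "(\<integral>\<^sup>+z. g (fst z + \<sigma>, snd z) \<partial>lborel) = (\<integral>\<^sup>+z. g z \<partial>lborel)"
proof -
  have "(\<lambda>z :: real \<times> 'b. (fst z + \<sigma>, snd z)) \<in> borel_measurable borel"
    by (intro borel_measurable_continuous_onI continuous_intros)
  from measurable_compose[OF this g]
  have 1: "(\<integral>\<^sup>+z. g (fst z + \<sigma>, snd z) \<partial>lborel) = (\<integral>\<^sup>+t. \<integral>\<^sup>+x. g (t + \<sigma>, x) \<partial>lborel \<partial>lborel)"
    by (subst nn_integral_lborel_iterated) auto
  have "(\<lambda>(t, x). g (t, x)) \<in> borel_measurable (borel \<Otimes>\<^sub>M lborel)" using borel_measurable_pairI[OF g] by simp
  then have m: "(\<lambda>t. \<integral>\<^sup>+x. g (t, x) \<partial>lborel) \<in> borel_measurable borel"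
    using lborel.borel_measurable_nn_integral[of "\<lambda>t x. g (t, x)"] by simp
  have "(\<integral>\<^sup>+t. \<integral>\<^sup>+x. g (t, x) \<partial>lborel \<partial>lborel) = (\<integral>\<^sup>+t. \<integral>\<^sup>+x. g (\<sigma> + 1 * t, x) \<partial>lborel \<partial>lborel)"
    using nn_integral_real_affine[OF m, of 1 \<sigma>] by simp
  then show ?thesis using 1 nn_integral_lborel_iterated[OF g] by (simp add: add.commute)
qed

lemma shift_L2:
  fixes F :: "real \<times> 'b::euclidean_space \<Rightarrow> real"
  assumes F: "L2 F"
  shows "L2 (shift \<sigma> F)" "nsq lborel (shift \<sigma> F) = nsq lborel F"
proof -
  have m[measurable]: "F \<in> borel_measurable borel" using F by (simp add: square_integrable_def)
  have i: "integrable lborel (\<lambda>z. (F z)\<^sup>2)" using F by (simp add: square_integrable_def)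
  have "(\<integral>\<^sup>+z. ennreal ((shift \<sigma> F z)\<^sup>2) \<partial>lborel) = (\<integral>\<^sup>+z. ennreal ((F z)\<^sup>2) \<partial>lborel)"
    unfolding shift_def by (rule nn_integral_shift) measurable
  also have "\<dots> = ennreal (nsq lborel F)" unfolding nsq_def using i by (intro nn_integral_eq_integral) auto
  finally have e: "(\<integral>\<^sup>+z. ennreal ((shift \<sigma> F z)\<^sup>2) \<partial>lborel) = ennreal (nsq lborel F)" .
  have i': "integrable lborel (\<lambda>z. (shift \<sigma> F z)\<^sup>2)"
    by (rule integrableI_bounded) (use e in auto)
  then show "L2 (shift \<sigma> F)" by (simp add: square_integrable_def)
  have "ennreal (nsq lborel (shift \<sigma> F)) = (\<integral>\<^sup>+z. ennreal ((shift \<sigma> F z)\<^sup>2) \<partial>lborel)"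
    unfolding nsq_def using i' by (intro nn_integral_eq_integral[symmetric]) auto
  then show "nsq lborel (shift \<sigma> F) = nsq lborel F" using e by simp
qed

lemma shift_diff: "shift \<sigma> F z - shift \<sigma> G z = shift \<sigma> (\<lambda>z. F z - G z) z"
  by (simp add: shift_def)

text \<open>Continuity of time translations in L2. It is evident for functions that are piecewise
  constant in time, such as the interpolants of the scheme, and is stable under L2 limits.\<close>

definition transl_cont :: "(real \<times> 'b::euclidean_space \<Rightarrow> real) \<Rightarrow> bool" where
  "transl_cont F \<longleftrightarrow> L2 F \<and>
     (\<forall>e>0. \<exists>d>0. \<forall>\<sigma>. \<bar>\<sigma>\<bar> < d \<longrightarrow> nsq lborel (\<lambda>z. shift \<sigma> F z - F z) \<le> e)"

lemma transl_contI:
  assumes "L2 F"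
    "\<And>e. 0 < e \<Longrightarrow> \<exists>d>0. \<forall>\<sigma>. \<bar>\<sigma>\<bar> < d \<longrightarrow> nsq lborel (\<lambda>z. shift \<sigma> F z - F z) \<le> e"
  shows "transl_cont F"
  using assms by (simp add: transl_cont_def)

lemma transl_cont_zero: "transl_cont (\<lambda>z. 0)"
  by (intro transl_contI exI[of _ 1]) (auto simp: shift_def nsq_def)

lemma transl_cont_lincomb:
  assumes F: "transl_cont F" and G: "transl_cont G"
  shows "transl_cont (\<lambda>z. a * F z + b * G z)"
proof (rule transl_contI)
  have sF: "L2 F" and sG: "L2 G" using F G by (auto simp: transl_cont_def)
  show "L2 (\<lambda>z. a * F z + b * G z)"
    by (intro square_integrable_add square_integrable_scale sF sG)
  fix e :: real assume e: "0 < e"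
  define c where "c = 4 * (a\<^sup>2 + b\<^sup>2 + 1)"
  have c: "0 < c" "2 * a\<^sup>2 \<le> c / 2" "2 * b\<^sup>2 \<le> c / 2" by (auto simp: c_def add_nonneg_pos)
  have ec: "0 < e / c" using e c by simp
  obtain d1 where d1: "0 < d1" "\<And>\<sigma>. \<bar>\<sigma>\<bar> < d1 \<Longrightarrow> nsq lborel (\<lambda>z. shift \<sigma> F z - F z) \<le> e / c"
    using F ec unfolding transl_cont_def by meson
  obtain d2 where d2: "0 < d2" "\<And>\<sigma>. \<bar>\<sigma>\<bar> < d2 \<Longrightarrow> nsq lborel (\<lambda>z. shift \<sigma> G z - G z) \<le> e / c"
    using G ec unfolding transl_cont_def by meson
  have "nsq lborel (\<lambda>z. shift \<sigma> (\<lambda>z. a * F z + b * G z) z - (a * F z + b * G z)) \<le> e" if "\<bar>\<sigma>\<bar> < min d1 d2" for \<sigma>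
  proof -
    let ?f = "\<lambda>z. shift \<sigma> F z - F z" and ?g = "\<lambda>z. shift \<sigma> G z - G z"
    have sf: "L2 ?f" "L2 ?g"
      by (intro square_integrable_diff shift_L2 sF sG)+
    have "nsq lborel (\<lambda>z. shift \<sigma> (\<lambda>z. a * F z + b * G z) z - (a * F z + b * G z)) = nsq lborel (\<lambda>z. a * ?f z + b * ?g z)"
      by (intro arg_cong[where f = "nsq lborel"] ext) (simp add: shift_def algebra_simps)
    also have "\<dots> \<le> 2 * nsq lborel (\<lambda>z. a * ?f z) + 2 * nsq lborel (\<lambda>z. b * ?g z)"
      by (intro nsq_add_le square_integrable_scale sf)
    also have "\<dots> = (2 * a\<^sup>2) * nsq lborel ?f + (2 * b\<^sup>2) * nsq lborel ?g" by (simp add: nsq_scale)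
    also have "\<dots> \<le> (c / 2) * (e / c) + (c / 2) * (e / c)"
      using c d1(2)[of \<sigma>] d2(2)[of \<sigma>] that by (intro add_mono mult_mono) auto
    also have "\<dots> = e" using c by simp
    finally show ?thesis .
  qed
  then show "\<exists>d>0. \<forall>\<sigma>. \<bar>\<sigma>\<bar> < d \<longrightarrow> nsq lborel (\<lambda>z. shift \<sigma> (\<lambda>z. a * F z + b * G z) z - (a * F z + b * G z)) \<le> e"
    using d1 d2 by (intro exI[of _ "min d1 d2"]) auto
qed

lemma transl_cont_sum:
  assumes "finite I" "\<And>i. i \<in> I \<Longrightarrow> transl_cont (F i)"
  shows "transl_cont (\<lambda>z. \<Sum>i\<in>I. c i * F i z)"
  using assms
proof (induction I rule: finite_induct)
  case (insert i I)
  have "transl_cont (\<lambda>z. c i * F i z + 1 * (\<Sum>i\<in>I. c i * F i z))"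
    using insert by (intro transl_cont_lincomb) auto
  then show ?case using insert by simp
qed (simp add: transl_cont_zero)

text \<open>Translation is an isometry of L2, so an approximant's modulus of continuity passes to
  the limit up to twice the approximation error.\<close>

lemma transl_cont_limit:
  assumes F: "\<And>n. transl_cont (F n)" and G: "L2 G"
    and lim: "(\<lambda>n. nsq lborel (\<lambda>z. F n z - G z)) \<longlonglongrightarrow> 0"
  shows "transl_cont G"
proof (rule transl_contI[OF G])
  fix e :: real assume e: "0 < e"
  have sF: "L2 (F n)" for n using F by (auto simp: transl_cont_def)
  \<comment> \<open>Nested triangle inequalities use this bound with weights 2, 4 and 4, in total 10
    e / 12.\<close>
  have "\<forall>\<^sub>F n in sequentially. nsq lborel (\<lambda>z. F n z - G z) < e / 12"
    using e by (intro order_tendstoD(2)[OF lim]) auto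
  then obtain n where n: "nsq lborel (\<lambda>z. F n z - G z) < e / 12" by (auto simp: eventually_sequentially)
  have "0 < e / 12" using e by simp
  then obtain d where d: "0 < d" "\<And>\<sigma>. \<bar>\<sigma>\<bar> < d \<Longrightarrow> nsq lborel (\<lambda>z. shift \<sigma> (F n) z - F n z) \<le> e / 12"
    using F[of n] unfolding transl_cont_def by meson
  have "nsq lborel (\<lambda>z. shift \<sigma> G z - G z) \<le> e" if "\<bar>\<sigma>\<bar> < d" for \<sigma>
  proof -
    have "nsq lborel (\<lambda>z. shift \<sigma> (F n) z - shift \<sigma> G z) = nsq lborel (\<lambda>z. F n z - G z)"
      unfolding shift_diff using shift_L2(2)[OF square_integrable_diff[OF sF[of n] G], of \<sigma>] by simp
    then have a: "nsq lborel (\<lambda>z. shift \<sigma> G z - shift \<sigma> (F n) z) < e / 12" using n by (subst nsq_minus_commute) simp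
    have "nsq lborel (\<lambda>z. shift \<sigma> G z - G z) \<le> 2 * nsq lborel (\<lambda>z. shift \<sigma> G z - shift \<sigma> (F n) z) + 2 * nsq lborel (\<lambda>z. shift \<sigma> (F n) z - G z)"
      by (intro nsq_triangle3 shift_L2 sF G)
    moreover have "nsq lborel (\<lambda>z. shift \<sigma> (F n) z - G z) \<le> 2 * nsq lborel (\<lambda>z. shift \<sigma> (F n) z - F n z) + 2 * nsq lborel (\<lambda>z. F n z - G z)"
      by (intro nsq_triangle3 shift_L2 sF G)
    ultimately show ?thesis using a n d(2)[OF that] e by linarith
  qed
  then show "\<exists>d>0. \<forall>\<sigma>. \<bar>\<sigma>\<bar> < d \<longrightarrow> nsq lborel (\<lambda>z. shift \<sigma> G z - G z) \<le> e" using d(1) by blast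
qed

text \<open>A shift by \<sigma> changes the indicator only within distance |\<sigma>| of the two
  endpoints, a set of measure at most 4 |\<sigma>|.\<close>

lemma transl_cont_step:
  fixes d :: "'b::euclidean_space \<Rightarrow> real"
  assumes d: "L2 d" and ab: "a \<le> b"
  shows "transl_cont (\<lambda>z. indicator {a..<b} (fst z) * d (snd z))"
proof -
  have [measurable]: "d \<in> borel_measurable borel" and i: "integrable lborel (\<lambda>x. (d x)\<^sup>2)"
    using d by (auto simp: square_integrable_def)
  have nd: "(\<integral>\<^sup>+x. ennreal ((d x)\<^sup>2) \<partial>lborel) = ennreal (nsq lborel d)"
    unfolding nsq_def using i by (intro nn_integral_eq_integral) auto
  let ?F = "\<lambda>z :: real \<times> 'b. indicator {a..<b} (fst z) * d (snd z)"
  have mF[measurable]: "?F \<in> borel_measurable borel" by measurable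
  have bound: "(\<integral>\<^sup>+z. ennreal ((indicator S (fst z) * d (snd z))\<^sup>2) \<partial>lborel) = emeasure lborel S * ennreal (nsq lborel d)"
    if [measurable]: "S \<in> sets borel" for S
  proof -
    have "(\<integral>\<^sup>+z. ennreal ((indicator S (fst z) * d (snd z))\<^sup>2) \<partial>lborel)
        = (\<integral>\<^sup>+t. \<integral>\<^sup>+x. ennreal ((indicator S t * d x)\<^sup>2) \<partial>lborel \<partial>lborel)"
      by (subst nn_integral_lborel_iterated) auto
    also have "\<dots> = (\<integral>\<^sup>+t. ennreal (nsq lborel d) * indicator S t \<partial>lborel)"
      by (intro nn_integral_cong) (auto simp: indicator_def nd)
    finally show ?thesis by (subst (asm) nn_integral_cmult_indicator) (auto simp: mult.commute)
  qed
  show ?thesis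
  proof (rule transl_contI)
    have "(\<integral>\<^sup>+z. ennreal ((?F z)\<^sup>2) \<partial>lborel) < \<infinity>"
      using bound[of "{a..<b}"] ab by (simp add: ennreal_mult_less_top)
    then have "integrable lborel (\<lambda>z. (?F z)\<^sup>2)" by (intro integrableI_bounded) auto
    then show sF: "L2 ?F" by (simp add: square_integrable_def)
    fix e :: real assume e: "0 < e"
    define c where "c = e / (4 * (nsq lborel d + 1))"
    have c: "0 < c" unfolding c_def using e by (intro divide_pos_pos mult_pos_pos add_nonneg_pos) auto
    have "nsq lborel (\<lambda>z. shift \<sigma> ?F z - ?F z) \<le> e" if \<sigma>: "\<bar>\<sigma>\<bar> < c" for \<sigma>
    proof -
      let ?S = "{a - \<bar>\<sigma>\<bar>..a + \<bar>\<sigma>\<bar>} \<union> {b - \<bar>\<sigma>\<bar>..b + \<bar>\<sigma>\<bar>}"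
      have sd: "L2 (\<lambda>z. shift \<sigma> ?F z - ?F z)" by (intro square_integrable_diff shift_L2 sF)
      have "ennreal (nsq lborel (\<lambda>z. shift \<sigma> ?F z - ?F z)) = (\<integral>\<^sup>+z. ennreal ((shift \<sigma> ?F z - ?F z)\<^sup>2) \<partial>lborel)"
        unfolding nsq_def using sd by (intro nn_integral_eq_integral[symmetric]) (auto simp: square_integrable_def)
      also have "\<dots> \<le> (\<integral>\<^sup>+z. ennreal ((indicator ?S (fst z) * d (snd z))\<^sup>2) \<partial>lborel)"
        by (intro nn_integral_mono ennreal_leI) (auto simp: shift_def indicator_def)
      also have "\<dots> = emeasure lborel ?S * ennreal (nsq lborel d)" by (rule bound) auto
      also have "\<dots> \<le> (ennreal (2 * \<bar>\<sigma>\<bar>) + ennreal (2 * \<bar>\<sigma>\<bar>)) * ennreal (nsq lborel d)"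
        by (intro mult_right_mono order.trans[OF emeasure_subadditive] add_mono) auto
      also have "\<dots> = ennreal (4 * \<bar>\<sigma>\<bar> * nsq lborel d)"
        by (simp flip: ennreal_plus ennreal_mult)
      finally have "nsq lborel (\<lambda>z. shift \<sigma> ?F z - ?F z) \<le> 4 * \<bar>\<sigma>\<bar> * nsq lborel d"
        by (subst (asm) ennreal_le_iff) auto
      also have "\<dots> \<le> 4 * c * (nsq lborel d + 1)" using \<sigma> by (intro mult_mono) auto
      also have "\<dots> = e"
      proof -
        have "nsq lborel d + 1 \<noteq> 0" using nsq_nonneg[of lborel d] by linarith
        moreover have "4 * (e / (4 * p)) * p = e" if "p \<noteq> 0" for p using that by simp
        ultimately show ?thesis unfolding c_def by blast
      qed
      finally show ?thesis .
    qed
    then show "\<exists>d>0. \<forall>\<sigma>. \<bar>\<sigma>\<bar> < d \<longrightarrow> nsq lborel (\<lambda>z. shift \<sigma> ?F z - ?F z) \<le> e" using c by blast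
  qed
qed

section \<open>Steklov averages\<close>

definition steklov :: "real \<Rightarrow> (real \<times> 'b \<Rightarrow> real) \<Rightarrow> real \<times> 'b \<Rightarrow> real" where
  "steklov h F z = time_int (fst z) (fst z + h) F (snd z) / h"

lemma steklov_measurable [measurable]:
  fixes F :: "real \<times> 'b::euclidean_space \<Rightarrow> real"
  assumes "F \<in> borel_measurable borel"
  shows "steklov h F \<in> borel_measurable borel"
proof -
  have "(\<lambda>z :: real \<times> 'b. (fst z, fst z + h, snd z)) \<in> borel_measurable borel"
    by (intro borel_measurable_continuous_onI continuous_intros)
  from measurable_compose[OF this time_int_measurable[OF assms]]
  show ?thesis unfolding steklov_def by simp
qed

text \<open>The error of the average is the mean over 0 \<le> \<sigma> < h of the translation
  errors. Cauchy-Schwarz in \<sigma> and Tonelli bound its squared norm by the mean of theirs, hence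
  by e.\<close>

lemma steklov_L2:
  fixes F :: "real \<times> 'b::euclidean_space \<Rightarrow> real"
  assumes F: "L2 F" and h: "0 < h" and e: "0 \<le> e"
    and b: "\<And>\<sigma>. 0 \<le> \<sigma> \<Longrightarrow> \<sigma> < h \<Longrightarrow> nsq lborel (\<lambda>z. shift \<sigma> F z - F z) \<le> e"
  shows "L2 (\<lambda>z. steklov h F z - F z)" "nsq lborel (\<lambda>z. steklov h F z - F z) \<le> e"
proof -
  have m[measurable]: "F \<in> borel_measurable borel" using F by (simp add: square_integrable_def)
  have mi[measurable]: "(indicator {0..<h} :: real \<Rightarrow> real) \<in> borel_measurable borel" by measurable
  let ?g = "\<lambda>t x \<sigma>. indicator {0..<h} \<sigma> * (F (t + \<sigma>, x) - F (t, x))"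
  have c1: "(\<lambda>q :: real \<times> 'b \<times> real. (fst q + snd (snd q), fst (snd q))) \<in> borel_measurable borel"
    and c2: "(\<lambda>q :: real \<times> 'b \<times> real. (fst q, fst (snd q))) \<in> borel_measurable borel"
    by (intro borel_measurable_continuous_onI continuous_intros)+
  have [measurable]: "(\<lambda>q :: real \<times> 'b \<times> real. F (fst q + snd (snd q), fst (snd q))) \<in> borel_measurable borel"
    "(\<lambda>q :: real \<times> 'b \<times> real. F (fst q, fst (snd q))) \<in> borel_measurable borel"
    using measurable_compose[OF c1 m] measurable_compose[OF c2 m] by auto
  have [measurable]: "(\<lambda>q :: real \<times> 'b \<times> real. indicator {0..<h} (snd (snd q)) :: real) \<in> borel_measurable borel"
    by measurable
  have mg: "(\<lambda>q :: real \<times> 'b \<times> real. ennreal ((?g (fst q) (fst (snd q)) (snd (snd q)))\<^sup>2)) \<in> borel_measurable borel"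
    by measurable
  have mg': "(\<lambda>q :: 'b \<times> real. ennreal ((?g t (fst q) (snd q))\<^sup>2)) \<in> borel_measurable borel" for t
    using measurable_compose[OF Pair_measurable_borel(1)[of t] mg] by simp
  have ind: "L2 (indicator {0..<h} :: real \<Rightarrow> real)" "nsq lborel (indicator {0..<h} :: real \<Rightarrow> real) = h"
  proof -
    have e: "(indicator {0..<h} \<tau> :: real)\<^sup>2 = indicator {0..<h} \<tau>" for \<tau> by (simp add: indicator_def)
    show "L2 (indicator {0..<h} :: real \<Rightarrow> real)"
      unfolding square_integrable_def e using h by (auto simp: integrable_indicator_iff)
    show "nsq lborel (indicator {0..<h} :: real \<Rightarrow> real) = h"
      unfolding nsq_def e using h by simp
  qed
  have pw: "ennreal ((steklov h F (t, x) - F (t, x))\<^sup>2) \<le> ennreal (1 / h) * (\<integral>\<^sup>+\<sigma>. ennreal ((?g t x \<sigma>)\<^sup>2) \<partial>lborel)"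
    if sx: "L2 (\<lambda>\<tau>. F (\<tau>, x))" for t x
  proof -
    have sx': "L2 (\<lambda>\<sigma>. F (t + \<sigma>, x))"
    proof -
      have "integrable lborel (\<lambda>\<sigma>. (F (t + 1 * \<sigma>, x))\<^sup>2)"
        using sx lborel_integrable_real_affine[of "\<lambda>\<tau>. (F (\<tau>, x))\<^sup>2" 1 t] by (simp add: square_integrable_def)
      moreover have "(\<lambda>\<sigma>. F (t + \<sigma>, x)) \<in> borel_measurable borel"
      proof -
        have "(\<lambda>\<sigma>. (t + \<sigma>, x)) \<in> borel_measurable borel"
          by (intro borel_measurable_continuous_onI continuous_intros)
        from measurable_compose[OF this m] show ?thesis by simp
      qed
      ultimately show ?thesis by (simp add: square_integrable_def)
    qed
    have sg: "L2 (?g t x)"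
    proof -
      have 1: "L2 (\<lambda>\<sigma>. indicator {0..<h} \<sigma> * F (t + \<sigma>, x))"
        by (rule square_integrable_bound[OF sx']) (use sx' in \<open>auto simp: indicator_def square_integrable_def\<close>)
      have 2: "L2 (\<lambda>\<sigma>. F (t, x) * indicator {0..<h} \<sigma>)"
        by (rule square_integrable_scale[OF ind(1)])
      show ?thesis using square_integrable_diff[OF 1 2] by (simp add: right_diff_distrib mult.commute)
    qed
    have "time_int t (t + h) F x = (LBINT \<sigma>. indicator {t..<t + h} (t + 1 * \<sigma>) * F (t + 1 * \<sigma>, x))"
      unfolding time_int_def using lborel_integral_real_affine[of 1 "\<lambda>\<tau>. indicator {t..<t + h} \<tau> * F (\<tau>, x)" t] by simp
    also have "\<dots> = (LBINT \<sigma>. indicator {0..<h} \<sigma> * F (t + \<sigma>, x))"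
      by (intro Bochner_Integration.integral_cong) (auto simp: indicator_def)
    finally have ti: "time_int t (t + h) F x = (LBINT \<sigma>. indicator {0..<h} \<sigma> * F (t + \<sigma>, x))" .
    have "(LBINT \<sigma>. ?g t x \<sigma>) = time_int t (t + h) F x - h * F (t, x)"
      unfolding ti using square_integrable_slice_integrable[OF sx', of 0 h] h by (simp add: right_diff_distrib)
    then have "steklov h F (t, x) - F (t, x) = (LBINT \<sigma>. indicator {0..<h} \<sigma> * ?g t x \<sigma>) / h"
    proof -
      have "(LBINT \<sigma>. indicator {0..<h} \<sigma> * ?g t x \<sigma>) = (LBINT \<sigma>. ?g t x \<sigma>)"
        by (intro Bochner_Integration.integral_cong) (auto simp: indicator_def)
      with \<open>(LBINT \<sigma>. ?g t x \<sigma>) = time_int t (t + h) F x - h * F (t, x)\<close> show ?thesis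
        using h by (simp add: steklov_def diff_divide_distrib)
    qed
    moreover have "\<bar>\<integral>\<sigma>. indicator {0..<h} \<sigma> * ?g t x \<sigma> \<partial>lborel\<bar> \<le> sqrt h * sqrt (nsq lborel (?g t x))"
      using Cauchy_Schwarz_nsq[OF ind(1) sg] ind(2) by simp
    ultimately have "\<bar>steklov h F (t, x) - F (t, x)\<bar> \<le> sqrt h * sqrt (nsq lborel (?g t x)) / h"
      using h by (simp add: divide_right_mono)
    then have "\<bar>steklov h F (t, x) - F (t, x)\<bar>\<^sup>2 \<le> (sqrt h * sqrt (nsq lborel (?g t x)) / h)\<^sup>2"
      by (rule power_mono) simp
    also have "\<dots> = 1 / h * nsq lborel (?g t x)"
      using h by (simp add: power_divide power_mult_distrib power2_eq_square[of h])
    finally have "ennreal ((steklov h F (t, x) - F (t, x))\<^sup>2) \<le> ennreal (1 / h * nsq lborel (?g t x))"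
      by (intro ennreal_leI) simp
    also have "\<dots> = ennreal (1 / h) * ennreal (nsq lborel (?g t x))" using h by (intro ennreal_mult) auto
    also have "ennreal (nsq lborel (?g t x)) = (\<integral>\<^sup>+\<sigma>. ennreal ((?g t x \<sigma>)\<^sup>2) \<partial>lborel)"
      unfolding nsq_def using sg by (intro nn_integral_eq_integral[symmetric]) (auto simp: square_integrable_def)
    finally show ?thesis .
  qed
  have "(\<integral>\<^sup>+z. ennreal ((steklov h F z - F z)\<^sup>2) \<partial>lborel) = (\<integral>\<^sup>+t. \<integral>\<^sup>+x. ennreal ((steklov h F (t, x) - F (t, x))\<^sup>2) \<partial>lborel \<partial>lborel)"
    by (rule nn_integral_lborel_iterated) measurable
  also have "\<dots> \<le> (\<integral>\<^sup>+t. \<integral>\<^sup>+x. ennreal (1 / h) * (\<integral>\<^sup>+\<sigma>. ennreal ((?g t x \<sigma>)\<^sup>2) \<partial>lborel) \<partial>lborel \<partial>lborel)"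
    by (rule nn_integral_mono, rule nn_integral_mono_AE, rule AE_mp[OF square_integrable_Fubini(4)[OF F]]) (use pw in auto)
  also have "\<dots> = (\<integral>\<^sup>+t. ennreal (1 / h) * (\<integral>\<^sup>+q. ennreal ((?g t (fst q) (snd q))\<^sup>2) \<partial>lborel) \<partial>lborel)"
  proof (rule nn_integral_cong)
    fix t
    have "(\<lambda>(x, \<sigma>). ennreal ((?g t x \<sigma>)\<^sup>2)) \<in> borel_measurable (borel \<Otimes>\<^sub>M lborel)"
      using borel_measurable_pairI[OF mg'[of t]] by (simp only: case_prod_beta')
    then have mm: "(\<lambda>x. \<integral>\<^sup>+\<sigma>. ennreal ((?g t x \<sigma>)\<^sup>2) \<partial>lborel) \<in> borel_measurable lborel"
      using lborel.borel_measurable_nn_integral[of "\<lambda>x \<sigma>. ennreal ((?g t x \<sigma>)\<^sup>2)"] by simp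
    have "(\<integral>\<^sup>+q. ennreal ((?g t (fst q) (snd q))\<^sup>2) \<partial>lborel) = (\<integral>\<^sup>+x. \<integral>\<^sup>+\<sigma>. ennreal ((?g t x \<sigma>)\<^sup>2) \<partial>lborel \<partial>lborel)"
      using nn_integral_lborel_iterated[OF mg'[of t]] by simp
    then show "(\<integral>\<^sup>+x. ennreal (1 / h) * (\<integral>\<^sup>+\<sigma>. ennreal ((?g t x \<sigma>)\<^sup>2) \<partial>lborel) \<partial>lborel)
        = ennreal (1 / h) * (\<integral>\<^sup>+q. ennreal ((?g t (fst q) (snd q))\<^sup>2) \<partial>lborel)"
      using nn_integral_cmult[OF mm, of "ennreal (1 / h)"] by simp
  qed
  also have "\<dots> = ennreal (1 / h) * (\<integral>\<^sup>+t. \<integral>\<^sup>+q. ennreal ((?g t (fst q) (snd q))\<^sup>2) \<partial>lborel \<partial>lborel)"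
  proof (rule nn_integral_cmult)
    have "(\<lambda>(t, q). ennreal ((?g t (fst q) (snd q))\<^sup>2)) \<in> borel_measurable (borel \<Otimes>\<^sub>M (lborel :: ('b \<times> real) measure))"
      using borel_measurable_pairI[OF mg] by (simp only: case_prod_beta')
    then show "(\<lambda>t. \<integral>\<^sup>+q. ennreal ((?g t (fst q) (snd q))\<^sup>2) \<partial>(lborel :: ('b \<times> real) measure)) \<in> borel_measurable lborel"
      using lborel.borel_measurable_nn_integral[of "\<lambda>t q. ennreal ((?g t (fst q) (snd q))\<^sup>2)"] by simp
  qed
  also have "(\<integral>\<^sup>+t. \<integral>\<^sup>+q. ennreal ((?g t (fst q) (snd q))\<^sup>2) \<partial>(lborel :: ('b \<times> real) measure) \<partial>lborel)
      = (\<integral>\<^sup>+q. ennreal ((?g (fst q) (fst (snd q)) (snd (snd q)))\<^sup>2) \<partial>(lborel :: (real \<times> 'b \<times> real) measure))"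
    using nn_integral_lborel_iterated[OF mg] by simp
  also have "\<dots> = (\<integral>\<^sup>+\<sigma>. \<integral>\<^sup>+p. ennreal ((?g (fst p) (snd p) \<sigma>)\<^sup>2) \<partial>lborel \<partial>lborel)"
    using nn_integral_lborel_rotate[OF mg] by simp
  also have "\<dots> \<le> (\<integral>\<^sup>+\<sigma>. ennreal e * indicator {0..<h} \<sigma> \<partial>lborel)"
  proof (rule nn_integral_mono)
    fix \<sigma> :: real
    show "(\<integral>\<^sup>+p. ennreal ((?g (fst p) (snd p) \<sigma>)\<^sup>2) \<partial>lborel) \<le> ennreal e * indicator {0..<h} \<sigma>"
    proof (cases "\<sigma> \<in> {0..<h}")
      case True
      have sd: "L2 (\<lambda>z. shift \<sigma> F z - F z)" by (intro square_integrable_diff shift_L2 F)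
      have "(\<integral>\<^sup>+p. ennreal ((?g (fst p) (snd p) \<sigma>)\<^sup>2) \<partial>lborel) = (\<integral>\<^sup>+p. ennreal ((shift \<sigma> F p - F p)\<^sup>2) \<partial>lborel)"
        using True by (intro nn_integral_cong) (auto simp: shift_def)
      also have "\<dots> = ennreal (nsq lborel (\<lambda>z. shift \<sigma> F z - F z))"
        unfolding nsq_def using sd by (intro nn_integral_eq_integral) (auto simp: square_integrable_def)
      finally show ?thesis using True b[of \<sigma>] by (simp add: ennreal_leI)
    qed simp
  qed
  also have "\<dots> = ennreal (e * h)"
    using h e by (subst nn_integral_cmult_indicator) (auto simp: ennreal_mult)
  finally have bd: "(\<integral>\<^sup>+z. ennreal ((steklov h F z - F z)\<^sup>2) \<partial>lborel) \<le> ennreal e"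
    using h e by (simp add: mult_left_mono flip: ennreal_mult)
  have i: "integrable lborel (\<lambda>z. (steklov h F z - F z)\<^sup>2)"
    using order.strict_trans1[OF bd, of \<infinity>] by (intro integrableI_bounded) auto
  then show "L2 (\<lambda>z. steklov h F z - F z)" by (simp add: square_integrable_def)
  show "nsq lborel (\<lambda>z. steklov h F z - F z) \<le> e"
    using bd e unfolding nsq_def by (subst (asm) nn_integral_eq_integral[OF i]) auto
qed

lemma inner_tendsto2:
  assumes f: "\<And>n. square_integrable M (f n)" "square_integrable M F" "(\<lambda>n. nsq M (\<lambda>x. f n x - F x)) \<longlonglongrightarrow> 0"
    and g: "\<And>n. square_integrable M (g n)" "square_integrable M G" "(\<lambda>n. nsq M (\<lambda>x. g n x - G x)) \<longlonglongrightarrow> 0"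
  shows "(\<lambda>n. \<integral>x. f n x * g n x \<partial>M) \<longlonglongrightarrow> (\<integral>x. F x * G x \<partial>M)"
proof -
  have "(\<lambda>n. sqrt (nsq M (f n)) * sqrt (nsq M (\<lambda>x. g n x - G x))) \<longlonglongrightarrow> sqrt (nsq M F) * sqrt 0"
    by (intro tendsto_intros nsq_tendsto f g)
  then have z: "(\<lambda>n. sqrt (nsq M (f n)) * sqrt (nsq M (\<lambda>x. g n x - G x))) \<longlonglongrightarrow> 0" by simp
  have "norm (\<integral>x. f n x * (g n x - G x) \<partial>M) \<le> sqrt (nsq M (f n)) * sqrt (nsq M (\<lambda>x. g n x - G x))" for n
    using Cauchy_Schwarz_nsq[OF f(1)[of n] square_integrable_diff[OF g(1)[of n] g(2)]] by simp
  then have 1: "(\<lambda>n. \<integral>x. f n x * (g n x - G x) \<partial>M) \<longlonglongrightarrow> 0"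
    by (intro Lim_null_comparison[OF _ z] always_eventually allI)
  have 2: "(\<lambda>n. \<integral>x. f n x * G x \<partial>M) \<longlonglongrightarrow> (\<integral>x. F x * G x \<partial>M)"
    by (rule inner_tendsto_of_nsq[where f = f, OF f(1,2) g(2) f(3)])
  have eq: "(\<integral>x. f n x * g n x \<partial>M) = (\<integral>x. f n x * (g n x - G x) \<partial>M) + (\<integral>x. f n x * G x \<partial>M)" for n
    using square_integrable_mult[OF f(1)[of n] g(1)[of n]] square_integrable_mult[OF f(1)[of n] g(2)]
    by (simp add: right_diff_distrib)
  show ?thesis unfolding eq using tendsto_add[OF 1 2] by simp
qed

lemma square_integrable_slab:
  fixes F :: "real \<times> 'b::euclidean_space \<Rightarrow> real"
  assumes F: "L2 F" and [measurable]: "S \<in> sets borel"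
  shows "L2 (\<lambda>z. indicator S (fst z) * F z)"
proof (rule square_integrable_bound[OF F])
  have [measurable]: "F \<in> borel_measurable borel" using F by (simp add: square_integrable_def)
  show "(\<lambda>z. indicator S (fst z) * F z) \<in> borel_measurable lborel" by measurable
qed (auto simp: indicator_def)

lemma nsq_slab_le:
  fixes F :: "real \<times> 'b::euclidean_space \<Rightarrow> real"
  assumes F: "L2 F" and S: "S \<in> sets borel"
  shows "nsq lborel (\<lambda>z. indicator S (fst z) * F z) \<le> nsq lborel F"
  unfolding nsq_def using F square_integrable_slab[OF F S]
  by (intro integral_mono) (auto simp: square_integrable_def indicator_def)

lemma slab_tendsto_zero:
  fixes F :: "real \<times> 'b::euclidean_space \<Rightarrow> real"
  assumes F: "L2 F" and h: "h \<longlonglongrightarrow> 0"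
  shows "(\<lambda>n. nsq lborel (\<lambda>z. indicator {c..<c + h n} (fst z) * F z)) \<longlonglongrightarrow> 0"
proof -
  have [measurable]: "F \<in> borel_measurable borel" and i: "integrable lborel (\<lambda>z. (F z)\<^sup>2)"
    using F by (auto simp: square_integrable_def)
  have "(\<lambda>n. LBINT z. (indicator {c..<c + h n} (fst z) * F z)\<^sup>2) \<longlonglongrightarrow> (\<integral>z. 0 \<partial>(lborel :: (real \<times> 'b) measure))"
  proof (rule integral_dominated_convergence)
    show "integrable lborel (\<lambda>z. (F z)\<^sup>2)" by (rule i)
    show "AE z in lborel. norm ((indicator {c..<c + h n} (fst z) * F z)\<^sup>2) \<le> (F z)\<^sup>2" for n
      by (auto simp: indicator_def)
    have "AE z in (lborel :: (real \<times> 'b) measure). fst z \<noteq> c" by (rule AE_lborel_fst_neq)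
    then show "AE z in lborel. (\<lambda>n. (indicator {c..<c + h n} (fst z) * F z)\<^sup>2) \<longlonglongrightarrow> 0"
    proof eventually_elim
      case (elim z)
      have "\<forall>\<^sub>F n in sequentially. (indicator {c..<c + h n} (fst z) * F z)\<^sup>2 = 0"
      proof (cases "fst z < c")
        case False
        then have "0 < fst z - c" using elim by simp
        then have "\<forall>\<^sub>F n in sequentially. h n < fst z - c" using h by (intro order_tendstoD(2))
        then show ?thesis by eventually_elim (auto simp: indicator_def)
      qed (auto simp: indicator_def)
      then show ?case by (rule tendsto_eventually)
    qed
  qed measurable
  then show ?thesis by (simp add: nsq_def)
qed

lemma AE_lborel_shift:
  assumes "AE t in lborel. P (t :: real)"
  shows "AE t in lborel. P (t + c)"
proof -
  obtain N where N: "{z. \<not> P z} \<subseteq> N" "N \<in> null_sets lborel"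
    using AE_E[OF assms] by (auto simp: null_sets_def)
  have [measurable]: "N \<in> sets borel" using null_setsD2[OF N(2)] by simp
  have "AE t in lborel. t \<in> - N" using AE_not_in[OF N(2)] by simp
  then have "AE t in lborel. c + 1 * t \<in> - N" by (intro AE_borel_affine) auto
  then show ?thesis by eventually_elim (use N(1) in \<open>auto simp: add.commute\<close>)
qed

lemma bounded_interval_integrable:
  fixes g :: "real \<Rightarrow> real"
  assumes [measurable]: "g \<in> borel_measurable borel" and b: "\<And>t. t \<in> {a..<b} \<Longrightarrow> \<bar>g t\<bar> \<le> B"
  shows "integrable lborel (\<lambda>t. indicator {a..<b} t * g t)"
proof (rule Bochner_Integration.integrable_bound)
  show "integrable lborel (\<lambda>t. indicator {a..<b} t * B)"
    by (cases "a \<le> b") (auto simp: integrable_indicator_iff)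
  show "AE t in lborel. norm (indicator {a..<b} t * g t) \<le> norm (indicator {a..<b} t * B)"
    using b by (auto simp: indicator_def intro: order.trans[OF _ abs_ge_self])
qed measurable

text \<open>The chain rule along \<open>u\<close> with derivative \<open>v\<close> for a functional whose values \<open>\<theta>\<close> along \<open>u\<close> satisfy a
  subgradient inequality: the difference quotients of \<open>\<theta>\<close> are squeezed between pairings of \<open>\<xi>\<close>, and of a
  translate of \<open>\<xi>\<close>, with the Steklov averages of \<open>v\<close>. Lower semicontinuity and the
  subgradient inequality make the right averages of \<open>\<theta>\<close> converge at every time.\<close>

locale subgradient_curve =
  fixes T :: real and v \<xi> :: "real \<times> 'b::euclidean_space \<Rightarrow> real" and U :: "real \<Rightarrow> 'b \<Rightarrow> real"
    and \<theta> :: "real \<Rightarrow> real" and B :: real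
  assumes v: "transl_cont v" and \<xi>: "transl_cont \<xi>"
    and U: "\<And>a b. 0 \<le> a \<Longrightarrow> a \<le> b \<Longrightarrow> b \<le> T \<Longrightarrow> AE x in lborel. U b x - U a x = time_int a b v x"
    and Um [measurable]: "\<And>t. U t \<in> borel_measurable borel"
    and \<theta>m [measurable]: "\<theta> \<in> borel_measurable borel" and \<theta>b: "\<And>t. t \<in> {0..T} \<Longrightarrow> \<bar>\<theta> t\<bar> \<le> B"
    and lsc: "\<And>t e. t \<in> {0..T} \<Longrightarrow> 0 < e \<Longrightarrow> \<exists>d>0. \<forall>s\<in>{0..T}. \<bar>s - t\<bar> < d \<longrightarrow> \<theta> t - e \<le> \<theta> s"
    and sub: "AE t in lborel. t \<in> {0..<T} \<longrightarrow> (\<forall>s\<in>{0..T}. \<theta> t + (LBINT x. \<xi> (t, x) * (U s x - U t x)) \<le> \<theta> s)"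
begin

lemma sv: "L2 v" and s\<xi>: "L2 \<xi>"
  using v \<xi> by (auto simp: transl_cont_def)

lemma mv [measurable]: "v \<in> borel_measurable borel" and m\<xi> [measurable]: "\<xi> \<in> borel_measurable borel"
  using sv s\<xi> by (auto simp: square_integrable_def)

lemma Udiff: "0 \<le> a \<Longrightarrow> a \<le> b \<Longrightarrow> b \<le> T \<Longrightarrow> L2 (\<lambda>x. U b x - U a x)"
proof -
  assume ab: "0 \<le> a" "a \<le> b" "b \<le> T"
  have "integrable lborel (\<lambda>x. (U b x - U a x)\<^sup>2) \<longleftrightarrow> integrable lborel (\<lambda>x. (time_int a b v x)\<^sup>2)"
    by (rule integrable_cong_AE) (use U[OF ab] in auto)
  then show ?thesis using time_int_nsq(1)[OF sv ab(2)] by (simp add: square_integrable_def)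
qed

text \<open>No continuity of \<theta> is presupposed. Lower semicontinuity bounds the averages from
  below; from above, the subgradient inequality at times t after c is tested with the state at c
  itself.\<close>

lemma right_average:
  assumes c: "0 \<le> c" and h: "\<And>n. 0 < h n" "\<And>n. c + h n \<le> T" "h \<longlonglongrightarrow> 0"
  shows "(\<lambda>n. (LBINT t. indicator {c..<c + h n} t * \<theta> t) / h n) \<longlonglongrightarrow> \<theta> c"
proof -
  have cT: "c \<in> {0..T}" using c h(1,2)[of 0] by auto
  let ?V = "\<lambda>n. nsq lborel (\<lambda>z. indicator {c..<c + h n} (fst z) * v z)"
  let ?X = "\<lambda>n. nsq lborel (\<lambda>z. indicator {c..<c + h n} (fst z) * \<xi> z)"
  let ?A = "\<lambda>n. (LBINT t. indicator {c..<c + h n} t * \<theta> t) / h n"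
  have i\<theta>: "integrable lborel (\<lambda>t. indicator {c..<c + h n} t * \<theta> t)" for n
    by (rule bounded_interval_integrable[of _ _ _ B]) (use c h(2)[of n] \<theta>b in auto)
  have ic: "integrable lborel (\<lambda>t. indicator {c..<c + h n} t * k)" "(LBINT t. indicator {c..<c + h n} t * k) = h n * k" for n and k :: real
    using h(1)[of n] by (auto simp: integrable_indicator_iff)
  \<comment> \<open>\<open>?X\<close> and \<open>?V\<close> are squared norms over the shrinking
    time slab and tend to 0; the estimate is arranged so that nothing else is left after division by
    h.\<close>
  have upper: "?A n \<le> \<theta> c + (?X n + ?V n) / 2" for n
  proof -
    have hn: "0 < h n" by (rule h)
    let ?a = "\<lambda>t. nsq lborel (\<lambda>x. indicator {c..<c + h n} t * \<xi> (t, x))"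
    have sx: "L2 (\<lambda>z. indicator {c..<c + h n} (fst z) * \<xi> z)"
      by (rule square_integrable_slab[OF s\<xi>]) auto
    have sV: "L2 (\<lambda>z. indicator {c..<c + h n} (fst z) * v z)"
      by (rule square_integrable_slab[OF sv]) auto
    have ia: "integrable lborel ?a" "(LBINT t. ?a t) = ?X n"
      using square_integrable_Fubini(2,3)[OF sx] by auto
    have ae: "AE t in lborel. indicator {c..<c + h n} t * \<theta> t \<le> indicator {c..<c + h n} t * (\<theta> c + ?V n / 2) + h n / 2 * ?a t"
      using sub square_integrable_Fubini(1)[OF s\<xi>]
    proof eventually_elim
      case (elim t)
      show ?case
      proof (cases "t \<in> {c..<c + h n}")
        case True
        then have t: "t \<in> {0..<T}" "c \<le> t" "t \<le> T" "t - c \<le> h n" using c h(2)[of n] by auto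
        let ?D = "\<lambda>x. U c x - U t x"
        have sD: "L2 ?D"
          using square_integrable_scale[OF Udiff[OF c t(2,3)], of "-1"] by simp
        have nD: "nsq lborel ?D \<le> h n * ?V n"
        proof -
          have "nsq lborel ?D = nsq lborel (time_int c t (\<lambda>z. indicator {c..<c + h n} (fst z) * v z))"
          proof (subst nsq_minus_commute, rule nsq_cong_AE)
            have "time_int c t (\<lambda>z. indicator {c..<c + h n} (fst z) * v z) x = time_int c t v x" for x
              unfolding time_int_def using True by (intro Bochner_Integration.integral_cong) (auto simp: indicator_def)
            then show "AE x in lborel. U t x - U c x = time_int c t (\<lambda>z. indicator {c..<c + h n} (fst z) * v z) x"
              using U[OF c t(2,3)] by simp
          qed (use sV in \<open>auto simp: square_integrable_def intro!: time_int_measurable_x\<close>)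
          also have "\<dots> \<le> (t - c) * ?V n" by (rule time_int_nsq(2)[OF sV t(2)])
          also have "\<dots> \<le> h n * ?V n" using t(4) by (intro mult_right_mono) auto
          finally show ?thesis .
        qed
        have "\<theta> t + (LBINT x. \<xi> (t, x) * ?D x) \<le> \<theta> c" using elim(1) t cT by blast
        moreover have "\<bar>\<integral>x. \<xi> (t, x) * ?D x \<partial>lborel\<bar> \<le> sqrt (nsq lborel (\<lambda>x. \<xi> (t, x))) * sqrt (nsq lborel ?D)"
          by (rule Cauchy_Schwarz_nsq[OF elim(2) sD])
        \<comment> \<open>Moving the factor h from the increment to \<xi> before the
          arithmetic-geometric mean balances the two terms: both contribute order h once integrated
          over the slab.\<close>
        moreover have "sqrt (nsq lborel (\<lambda>x. \<xi> (t, x))) * sqrt (nsq lborel ?D) \<le> h n / 2 * nsq lborel (\<lambda>x. \<xi> (t, x)) + ?V n / 2"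
        proof -
          let ?p = "nsq lborel (\<lambda>x. \<xi> (t, x))"
          have "sqrt ?p * sqrt (nsq lborel ?D) \<le> sqrt ?p * sqrt (h n * ?V n)" using nD by (intro mult_left_mono) auto
          also have "\<dots> = sqrt (h n * ?p) * sqrt (?V n)" by (simp add: real_sqrt_mult)
          also have "\<dots> \<le> (h n * ?p + ?V n) / 2"
            using arith_geo_mean_sqrt[of "h n * ?p" "?V n"] hn by (simp add: real_sqrt_mult)
          finally show ?thesis by simp
        qed
        ultimately have "\<theta> t \<le> \<theta> c + ?V n / 2 + h n / 2 * nsq lborel (\<lambda>x. \<xi> (t, x))" by linarith
        then show ?thesis using True by simp
      next
        case False
        then show ?thesis using hn by simp
      qed
    qed
    have "(LBINT t. indicator {c..<c + h n} t * \<theta> t) \<le> (LBINT t. indicator {c..<c + h n} t * (\<theta> c + ?V n / 2) + h n / 2 * ?a t)"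
      by (rule integral_mono_AE) (use i\<theta> ic ia ae in auto)
    also have "\<dots> = h n * (\<theta> c + ?V n / 2) + h n / 2 * ?X n" using ic ia by simp
    finally show ?thesis using hn by (simp add: pos_divide_le_eq algebra_simps add_divide_distrib)
  qed
  have lim0: "(\<lambda>n. \<theta> c + (?X n + ?V n) / 2) \<longlonglongrightarrow> \<theta> c + (0 + 0) / 2"
    by (intro tendsto_intros slab_tendsto_zero s\<xi> sv h) auto
  show ?thesis
  proof (rule LIMSEQ_I)
    fix e :: real assume e: "0 < e"
    obtain d where d: "0 < d" "\<forall>s\<in>{0..T}. \<bar>s - c\<bar> < d \<longrightarrow> \<theta> c - e / 2 \<le> \<theta> s"
      using lsc[OF cT, of "e / 2"] e by auto
    have "\<forall>\<^sub>F n in sequentially. h n < d" using d(1) h(3) by (intro order_tendstoD(2))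
    moreover have "\<forall>\<^sub>F n in sequentially. \<theta> c + (?X n + ?V n) / 2 < \<theta> c + e"
      using lim0 e by (intro order_tendstoD(2)[of _ "\<theta> c + (0 + 0) / 2"]) auto
    ultimately have "\<forall>\<^sub>F n in sequentially. norm (?A n - \<theta> c) < e"
    proof eventually_elim
      case (elim n)
      have "h n * (\<theta> c - e / 2) = (LBINT t. indicator {c..<c + h n} t * (\<theta> c - e / 2))" by (rule ic(2)[symmetric])
      also have "\<dots> \<le> (LBINT t. indicator {c..<c + h n} t * \<theta> t)"
      proof (rule integral_mono)
        fix t
        show "indicator {c..<c + h n} t * (\<theta> c - e / 2) \<le> indicator {c..<c + h n} t * \<theta> t"
        proof (cases "t \<in> {c..<c + h n}")
          case True
          then have "t \<in> {0..T}" "\<bar>t - c\<bar> < d" using c h(2)[of n] elim by auto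
          then show ?thesis using d(2) True by simp
        qed simp
      qed (rule ic(1) i\<theta>)+
      finally have "\<theta> c - e / 2 \<le> ?A n" using h(1)[of n] by (simp add: pos_le_divide_eq mult.commute)
      moreover have "?A n < \<theta> c + e" using upper[of n] elim by linarith
      ultimately show ?case using e by (simp add: abs_less_iff)
    qed
    then show "\<exists>no. \<forall>n\<ge>no. norm (?A n - \<theta> c) < e" by (simp add: eventually_sequentially)
  qed
qed

text \<open>The integrated difference quotient of \<theta> has two readings. Pointwise it lies
  between two pairings with a common limit; as a difference of translated integrals it reduces to
  right averages at b and at 0.\<close>

theorem chain_rule:
  assumes b: "0 \<le> b" "b < T"
  shows "\<theta> b - \<theta> 0 = (LBINT z. (indicator {0..<b} (fst z) * \<xi> z) * v z)"
proof -
  define h where "h n = (T - b) / real (Suc (Suc n))" for n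
  have h: "0 < h n" "b + h n \<le> T" for n
  proof -
    show "0 < h n" using b by (simp add: h_def)
    have "(T - b) / real (Suc (Suc n)) \<le> (T - b) / 1" using b by (intro divide_left_mono) auto
    then show "b + h n \<le> T" by (simp add: h_def)
  qed
  have h0: "h \<longlonglongrightarrow> 0"
  proof -
    have "(\<lambda>n. (T - b) * inverse (real (Suc (Suc n)))) \<longlonglongrightarrow> (T - b) * 0"
      by (intro tendsto_mult tendsto_const LIMSEQ_Suc[OF LIMSEQ_inverse_real_of_nat])
    then show ?thesis by (simp add: h_def[abs_def] divide_inverse)
  qed
  let ?\<chi> = "\<lambda>z :: real \<times> 'b. indicator {0..<b} (fst z) :: real"
  let ?A = "\<lambda>n. steklov (h n) v"
  let ?S = "\<lambda>n z. ?\<chi> z * shift (h n) \<xi> z"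
  have sA': "L2 (\<lambda>z. ?A n z - v z)" for n
  proof (rule steklov_L2(1)[OF sv h(1), of "4 * nsq lborel v"])
    fix \<sigma>
    show "nsq lborel (\<lambda>z. shift \<sigma> v z - v z) \<le> 4 * nsq lborel v"
      using nsq_diff_le[OF shift_L2(1)[OF sv] sv, of \<sigma>] shift_L2(2)[OF sv, of \<sigma>] by simp
  qed simp
  have sA: "L2 (?A n)" for n
    using square_integrable_add[OF sA' sv, of n] by simp
  have limA: "(\<lambda>n. nsq lborel (\<lambda>z. ?A n z - v z)) \<longlonglongrightarrow> 0"
  proof (rule tendsto_zero_of_abs_le)
    fix e :: real assume e: "0 < e"
    obtain d where d: "0 < d" "\<And>\<sigma>. \<bar>\<sigma>\<bar> < d \<Longrightarrow> nsq lborel (\<lambda>z. shift \<sigma> v z - v z) \<le> e"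
      using v e unfolding transl_cont_def by meson
    have "\<forall>\<^sub>F n in sequentially. h n < d" using d(1) h0 by (intro order_tendstoD(2))
    then obtain N where N: "\<And>n. n \<ge> N \<Longrightarrow> h n < d" by (auto simp: eventually_sequentially)
    have "nsq lborel (\<lambda>z. ?A n z - v z) \<le> e" if "n \<ge> N" for n
      by (rule steklov_L2(2)[OF sv h(1)]) (use e d(2) N[OF that] in auto)
    then show "\<exists>N. \<forall>n\<ge>N. \<bar>nsq lborel (\<lambda>z. ?A n z - v z)\<bar> \<le> e" by auto
  qed
  have limS0: "(\<lambda>n. nsq lborel (\<lambda>z. shift (h n) \<xi> z - \<xi> z)) \<longlonglongrightarrow> 0"
  proof (rule tendsto_zero_of_abs_le)
    fix e :: real assume e: "0 < e"
    obtain d where d: "0 < d" "\<And>\<sigma>. \<bar>\<sigma>\<bar> < d \<Longrightarrow> nsq lborel (\<lambda>z. shift \<sigma> \<xi> z - \<xi> z) \<le> e"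
      using \<xi> e unfolding transl_cont_def by meson
    have "\<forall>\<^sub>F n in sequentially. h n < d" using d(1) h0 by (intro order_tendstoD(2))
    then obtain N where N: "\<And>n. n \<ge> N \<Longrightarrow> h n < d" by (auto simp: eventually_sequentially)
    have "nsq lborel (\<lambda>z. shift (h n) \<xi> z - \<xi> z) \<le> e" if "n \<ge> N" for n
      using d(2)[of "h n"] N[OF that] h(1)[of n] by simp
    then show "\<exists>N. \<forall>n\<ge>N. \<bar>nsq lborel (\<lambda>z. shift (h n) \<xi> z - \<xi> z)\<bar> \<le> e" by auto
  qed
  have limS: "(\<lambda>n. nsq lborel (\<lambda>z. ?S n z - ?\<chi> z * \<xi> z)) \<longlonglongrightarrow> 0"
  proof (rule tendsto_sandwich[OF _ _ tendsto_const limS0])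
    show "\<forall>\<^sub>F n in sequentially. nsq lborel (\<lambda>z. ?S n z - ?\<chi> z * \<xi> z) \<le> nsq lborel (\<lambda>z. shift (h n) \<xi> z - \<xi> z)"
    proof (rule always_eventually, rule allI)
      fix n
      have "nsq lborel (\<lambda>z. ?\<chi> z * (shift (h n) \<xi> z - \<xi> z)) \<le> nsq lborel (\<lambda>z. shift (h n) \<xi> z - \<xi> z)"
        by (intro nsq_slab_le square_integrable_diff shift_L2 s\<xi>) auto
      then show "nsq lborel (\<lambda>z. ?S n z - ?\<chi> z * \<xi> z) \<le> nsq lborel (\<lambda>z. shift (h n) \<xi> z - \<xi> z)"
        by (simp add: right_diff_distrib)
    qed
  qed auto
  have s1: "L2 (\<lambda>z. ?\<chi> z * \<xi> z)" by (intro square_integrable_slab s\<xi>) auto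
  have s2: "L2 (?S n)" for n by (intro square_integrable_slab shift_L2 s\<xi>) auto
  have P: "(\<lambda>n. LBINT z. (?\<chi> z * \<xi> z) * ?A n z) \<longlonglongrightarrow> (LBINT z. (?\<chi> z * \<xi> z) * v z)"
    by (rule inner_tendsto2[where f = "\<lambda>n z. ?\<chi> z * \<xi> z" and g = ?A]) (use s1 sA sv limA in \<open>auto simp: nsq_def\<close>)
  have Q: "(\<lambda>n. LBINT z. ?S n z * ?A n z) \<longlonglongrightarrow> (LBINT z. (?\<chi> z * \<xi> z) * v z)"
    by (rule inner_tendsto2[where f = ?S and g = ?A, OF s2 s1 limS sA sv limA])
  let ?L = "\<lambda>n. (LBINT t. indicator {0..<b} t * (\<theta> (t + h n) - \<theta> t)) / h n"
  have iL: "integrable lborel (\<lambda>t. indicator {0..<b} t * (\<theta> (t + h n) - \<theta> t))" for n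
  proof (rule bounded_interval_integrable[of _ _ _ "2 * B"])
    fix t assume "t \<in> {0..<b}"
    then have "\<bar>\<theta> (t + h n)\<bar> \<le> B" "\<bar>\<theta> t\<bar> \<le> B" using h[of n] b by (auto intro!: \<theta>b)
    then show "\<bar>\<theta> (t + h n) - \<theta> t\<bar> \<le> 2 * B" by linarith
  qed measurable
  have Ust: "AE x in lborel. U (t + h n) x - U t x = h n * ?A n (t, x)" if "t \<in> {0..<b}" for t n
  proof -
    have "AE x in lborel. U (t + h n) x - U t x = time_int t (t + h n) v x"
      using that h[of n] by (intro U) auto
    then show ?thesis by eventually_elim (use h(1)[of n] in \<open>simp add: steklov_def\<close>)
  qed
  have pair: "(LBINT x. a x * (U (t + h n) x - U t x)) = h n * (LBINT x. a x * ?A n (t, x))"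
    if t: "t \<in> {0..<b}" and [measurable]: "a \<in> borel_measurable borel" for a t n
  proof -
    have [measurable]: "(\<lambda>x. ?A n (t, x)) \<in> borel_measurable borel"
      using measurable_compose[OF Pair_measurable_borel(1) steklov_measurable[OF mv]] .
    have "(LBINT x. a x * (U (t + h n) x - U t x)) = (LBINT x. h n * (a x * ?A n (t, x)))"
      by (rule integral_cong_AE) (use Ust[OF t, of n] in \<open>auto elim!: eventually_mono simp: mult_ac\<close>)
    then show ?thesis by simp
  qed
  have m\<xi>t: "(\<lambda>x. \<xi> (t, x)) \<in> borel_measurable borel" for t
    using measurable_compose[OF Pair_measurable_borel(1) m\<xi>] .
  \<comment> \<open>Subgradient inequality at t, tested with the state at t + h; the increment of
    the curve is h times the Steklov average.\<close>
  have lower: "(LBINT z. (?\<chi> z * \<xi> z) * ?A n z) \<le> ?L n" for n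
  proof -
    have i: "integrable lborel (\<lambda>z. (?\<chi> z * \<xi> z) * ?A n z)" by (rule square_integrable_mult[OF s1 sA])
    have "(LBINT z. (?\<chi> z * \<xi> z) * ?A n z) = (LBINT t. \<integral>x. (?\<chi> (t, x) * \<xi> (t, x)) * ?A n (t, x) \<partial>lborel)"
      using lborel_Fubini(3)[OF i] by simp
    also have "\<dots> \<le> (LBINT t. indicator {0..<b} t * (\<theta> (t + h n) - \<theta> t) / h n)"
    proof (rule integral_mono_AE)
      show "AE t in lborel. (LBINT x. (?\<chi> (t, x) * \<xi> (t, x)) * ?A n (t, x)) \<le> indicator {0..<b} t * (\<theta> (t + h n) - \<theta> t) / h n"
        using sub
      proof eventually_elim
        case (elim t)
        show ?case
        proof (cases "t \<in> {0..<b}")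
          case True
          then have "t \<in> {0..<T}" "t + h n \<in> {0..T}" using b h[of n] by auto
          then have "\<theta> t + (LBINT x. \<xi> (t, x) * (U (t + h n) x - U t x)) \<le> \<theta> (t + h n)" using elim by blast
          then have "h n * (LBINT x. \<xi> (t, x) * ?A n (t, x)) \<le> \<theta> (t + h n) - \<theta> t"
            by (simp add: pair[OF True m\<xi>t])
          then show ?thesis using True h(1)[of n] by (simp add: pos_le_divide_eq mult.commute)
        qed simp
      qed
    qed (use lborel_Fubini(2)[OF i] iL in auto)
    finally show ?thesis by simp
  qed
  \<comment> \<open>Subgradient inequality at t + h, tested with the state at t. It is available for
    almost every t, since translates of null sets are null, and it produces the shifted
    \<xi>.\<close>
  have upper: "?L n \<le> (LBINT z. ?S n z * ?A n z)" for n
  proof -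
    have i: "integrable lborel (\<lambda>z. ?S n z * ?A n z)" by (rule square_integrable_mult[OF s2 sA])
    have "?L n = (LBINT t. indicator {0..<b} t * (\<theta> (t + h n) - \<theta> t) / h n)" by simp
    also have "\<dots> \<le> (LBINT t. \<integral>x. ?S n (t, x) * ?A n (t, x) \<partial>lborel)"
    proof (rule integral_mono_AE)
      show "AE t in lborel. indicator {0..<b} t * (\<theta> (t + h n) - \<theta> t) / h n \<le> (LBINT x. ?S n (t, x) * ?A n (t, x))"
        using AE_lborel_shift[OF sub, of "h n"]
      proof eventually_elim
        case (elim t)
        show ?case
        proof (cases "t \<in> {0..<b}")
          case True
          then have "t + h n \<in> {0..<T} \<or> t + h n = T" "t \<in> {0..T}" using b h[of n] by auto
          moreover have "t + h n < T" using True h[of n] by auto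
          ultimately have "\<theta> (t + h n) + (LBINT x. \<xi> (t + h n, x) * (U t x - U (t + h n) x)) \<le> \<theta> t" using elim by auto
          moreover have "(LBINT x. \<xi> (t + h n, x) * (U t x - U (t + h n) x)) = - (LBINT x. \<xi> (t + h n, x) * (U (t + h n) x - U t x))"
            by (subst Bochner_Integration.integral_minus[symmetric]) (simp add: algebra_simps)
          ultimately have "\<theta> (t + h n) - \<theta> t \<le> h n * (LBINT x. \<xi> (t + h n, x) * ?A n (t, x))"
            by (simp add: pair[OF True m\<xi>t])
          then show ?thesis using True h(1)[of n] by (simp add: pos_divide_le_eq mult.commute shift_def)
        qed simp
      qed
    qed (use lborel_Fubini(2)[OF i] iL in auto)
    also have "\<dots> = (LBINT z. ?S n z * ?A n z)" using lborel_Fubini(3)[OF i] by simp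
    finally show ?thesis .
  qed
  have "?L \<longlonglongrightarrow> (LBINT z. (?\<chi> z * \<xi> z) * v z)"
    by (rule tendsto_sandwich[OF _ _ P Q]) (use lower upper in auto)
  \<comment> \<open>The indicators of [h, b+h) and [0, b) differ by those of [b, b+h) and [0, h),
    whether h is smaller than b or not.\<close>
  moreover have "?L n = (LBINT t. indicator {b..<b + h n} t * \<theta> t) / h n - (LBINT t. indicator {0..<0 + h n} t * \<theta> t) / h n" for n
  proof -
    have i1: "integrable lborel (\<lambda>t. indicator {c..<d} t * \<theta> t)" if "0 \<le> c" "d \<le> T" for c d
      by (rule bounded_interval_integrable[of _ _ _ B]) (use that \<theta>b in auto)
    have hT: "h n \<le> b + h n" "0 \<le> h n" "h n \<le> T" "b \<le> T" using h[of n] b by auto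
    have "(LBINT t. indicator {0..<b} t * \<theta> (t + h n)) = (LBINT t. indicator {h n..<b + h n} t * \<theta> t)"
    proof -
      have "(LBINT t. indicator {h n..<b + h n} t * \<theta> t) = (LBINT t. indicator {h n..<b + h n} (h n + 1 * t) * \<theta> (h n + 1 * t))"
        using lborel_integral_real_affine[of 1 "\<lambda>t. indicator {h n..<b + h n} t * \<theta> t" "h n"] by simp
      also have "\<dots> = (LBINT t. indicator {0..<b} t * \<theta> (t + h n))"
        by (intro Bochner_Integration.integral_cong) (auto simp: indicator_def add.commute)
      finally show ?thesis ..
    qed
    moreover have "integrable lborel (\<lambda>t. indicator {0..<b} t * \<theta> (t + h n))"
    proof (rule bounded_interval_integrable[of _ _ _ B])
      fix t assume "t \<in> {0..<b}"
      then show "\<bar>\<theta> (t + h n)\<bar> \<le> B" using h[of n] by (intro \<theta>b) auto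
    qed measurable
    moreover have "integrable lborel (\<lambda>t. indicator {0..<b} t * \<theta> t)" using hT by (intro i1) auto
    ultimately have "(LBINT t. indicator {0..<b} t * (\<theta> (t + h n) - \<theta> t))
        = (LBINT t. indicator {h n..<b + h n} t * \<theta> t) - (LBINT t. indicator {0..<b} t * \<theta> t)"
      by (simp add: right_diff_distrib)
    also have "\<dots> = (LBINT t. indicator {h n..<b + h n} t * \<theta> t - indicator {0..<b} t * \<theta> t)"
      using h[of n] b by (intro Bochner_Integration.integral_diff[symmetric] i1) auto
    also have "\<dots> = (LBINT t. indicator {b..<b + h n} t * \<theta> t - indicator {0..<0 + h n} t * \<theta> t)"
      using h[of n] b by (intro Bochner_Integration.integral_cong) (auto simp: indicator_def)
    also have "\<dots> = (LBINT t. indicator {b..<b + h n} t * \<theta> t) - (LBINT t. indicator {0..<0 + h n} t * \<theta> t)"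
      using h[of n] b hT by (intro Bochner_Integration.integral_diff i1) auto
    finally show ?thesis by (simp add: diff_divide_distrib)
  qed
  moreover have "(\<lambda>n. (LBINT t. indicator {b..<b + h n} t * \<theta> t) / h n - (LBINT t. indicator {0..<0 + h n} t * \<theta> t) / h n) \<longlonglongrightarrow> \<theta> b - \<theta> 0"
  proof (intro tendsto_diff right_average)
    show "0 + h n \<le> T" for n using h(2)[of n] b by simp
  qed (use b h h0 in auto)
  ultimately show ?thesis by (simp add: LIMSEQ_unique)
qed

end

section \<open>The energy identity\<close>

lemma tendsto_initial_slab:
  fixes g :: "real \<times> 'b::euclidean_space \<Rightarrow> real"
  assumes g: "integrable lborel g" and b: "b \<longlonglongrightarrow> c"
  shows "(\<lambda>n. LBINT z. indicator {0..<b n} (fst z) * g z) \<longlonglongrightarrow> (LBINT z. indicator {0..<c} (fst z) * g z)"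
proof (rule integral_dominated_convergence)
  have [measurable]: "g \<in> borel_measurable borel" using g by auto
  show "integrable lborel (\<lambda>z. \<bar>g z\<bar>)" using g by (rule integrable_abs)
  show "(\<lambda>z. indicator {0..<c} (fst z) * g z) \<in> borel_measurable lborel"
    "(\<lambda>z. indicator {0..<b n} (fst z) * g z) \<in> borel_measurable lborel" for n by measurable
  show "AE z in lborel. norm (indicator {0..<b n} (fst z) * g z) \<le> \<bar>g z\<bar>" for n
    by (auto simp: indicator_def)
  have "AE z in (lborel :: (real \<times> 'b) measure). fst z \<noteq> c" by (rule AE_lborel_fst_neq)
  then show "AE z in lborel. (\<lambda>n. indicator {0..<b n} (fst z) * g z) \<longlonglongrightarrow> indicator {0..<c} (fst z) * g z"
  proof eventually_elim
    case (elim z)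
    have "\<forall>\<^sub>F n in sequentially. (fst z < b n) = (fst z < c)"
    proof (cases "fst z < c")
      case True
      then have "\<forall>\<^sub>F n in sequentially. fst z < b n" using b by (intro order_tendstoD(1))
      then show ?thesis by eventually_elim (use True in simp)
    next
      case False
      then have "c < fst z" using elim by simp
      then have "\<forall>\<^sub>F n in sequentially. b n < fst z" using b by (intro order_tendstoD(2))
      then show ?thesis by eventually_elim (use False in auto)
    qed
    then have "\<forall>\<^sub>F n in sequentially. indicator {0..<b n} (fst z) * g z = indicator {0..<c} (fst z) * g z"
      by eventually_elim (auto simp: indicator_def)
    then show ?case by (rule tendsto_eventually)
  qed
qed

text \<open>Fatou's lemma for the nonnegative functions |f_n| + |F| - |f_n - F|. A single index with
  small error is enough for the argument by contradiction along subsequences that uses it.\<close>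

lemma Scheffe:
  fixes f :: "nat \<Rightarrow> 'a \<Rightarrow> real"
  assumes f: "\<And>n. integrable M (f n)" and F: "integrable M F"
    and ae: "AE x in M. (\<lambda>n. f n x) \<longlonglongrightarrow> F x"
    and lim: "(\<lambda>n. \<integral>x. \<bar>f n x\<bar> \<partial>M) \<longlonglongrightarrow> (\<integral>x. \<bar>F x\<bar> \<partial>M)" and e: "0 < e"
  shows "\<exists>n. (\<integral>x. \<bar>f n x - F x\<bar> \<partial>M) < e"
proof (rule ccontr)
  assume "\<not> ?thesis"
  then have ge: "e \<le> (\<integral>x. \<bar>f n x - F x\<bar> \<partial>M)" for n by (meson not_less)
  have [measurable]: "f n \<in> borel_measurable M" "F \<in> borel_measurable M" for n using f F by auto
  let ?g = "\<lambda>n x. \<bar>f n x\<bar> + \<bar>F x\<bar> - \<bar>f n x - F x\<bar>"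
  have g0: "0 \<le> ?g n x" for n x by linarith
  have ig: "integrable M (?g n)" for n using f F by auto
  have "(\<integral>\<^sup>+x. ennreal (2 * \<bar>F x\<bar>) \<partial>M) = (\<integral>\<^sup>+x. liminf (\<lambda>n. ennreal (?g n x)) \<partial>M)"
  proof (rule nn_integral_cong_AE, rule AE_mp[OF ae], intro AE_I2 impI)
    fix x assume l: "(\<lambda>n. f n x) \<longlonglongrightarrow> F x"
    have "(\<lambda>n. ?g n x) \<longlonglongrightarrow> \<bar>F x\<bar> + \<bar>F x\<bar> - \<bar>F x - F x\<bar>" by (intro tendsto_intros l)
    then have "(\<lambda>n. ennreal (?g n x)) \<longlonglongrightarrow> ennreal (2 * \<bar>F x\<bar>)" by (intro tendsto_ennrealI) simp
    then show "ennreal (2 * \<bar>F x\<bar>) = liminf (\<lambda>n. ennreal (?g n x))" by (intro lim_imp_Liminf[symmetric]) auto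
  qed
  also have "\<dots> \<le> liminf (\<lambda>n. \<integral>\<^sup>+x. ennreal (?g n x) \<partial>M)" by (rule nn_integral_liminf) simp
  also have "\<dots> \<le> liminf (\<lambda>n. ennreal ((\<integral>x. \<bar>f n x\<bar> \<partial>M) + (\<integral>x. \<bar>F x\<bar> \<partial>M) - e))"
  proof (rule Liminf_mono, rule always_eventually, rule allI)
    fix n
    have "(\<integral>\<^sup>+x. ennreal (?g n x) \<partial>M) = ennreal (\<integral>x. ?g n x \<partial>M)"
      using ig g0 by (intro nn_integral_eq_integral) auto
    also have "(\<integral>x. ?g n x \<partial>M) = (\<integral>x. \<bar>f n x\<bar> \<partial>M) + (\<integral>x. \<bar>F x\<bar> \<partial>M) - (\<integral>x. \<bar>f n x - F x\<bar> \<partial>M)"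
      using f F by simp
    also have "ennreal \<dots> \<le> ennreal ((\<integral>x. \<bar>f n x\<bar> \<partial>M) + (\<integral>x. \<bar>F x\<bar> \<partial>M) - e)"
      using ge[of n] by (intro ennreal_leI) simp
    finally show "(\<integral>\<^sup>+x. ennreal (?g n x) \<partial>M) \<le> \<dots>" .
  qed
  also have "\<dots> = ennreal ((\<integral>x. \<bar>F x\<bar> \<partial>M) + (\<integral>x. \<bar>F x\<bar> \<partial>M) - e)"
  proof (rule lim_imp_Liminf)
    have "(\<lambda>n. (\<integral>x. \<bar>f n x\<bar> \<partial>M) + (\<integral>x. \<bar>F x\<bar> \<partial>M) - e) \<longlonglongrightarrow> (\<integral>x. \<bar>F x\<bar> \<partial>M) + (\<integral>x. \<bar>F x\<bar> \<partial>M) - e"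
      by (intro tendsto_intros lim)
    then show "(\<lambda>n. ennreal ((\<integral>x. \<bar>f n x\<bar> \<partial>M) + (\<integral>x. \<bar>F x\<bar> \<partial>M) - e))
        \<longlonglongrightarrow> ennreal ((\<integral>x. \<bar>F x\<bar> \<partial>M) + (\<integral>x. \<bar>F x\<bar> \<partial>M) - e)"
      by (rule tendsto_ennrealI)
  qed simp
  finally have le: "(\<integral>\<^sup>+x. ennreal (2 * \<bar>F x\<bar>) \<partial>M) \<le> ennreal ((\<integral>x. \<bar>F x\<bar> \<partial>M) + (\<integral>x. \<bar>F x\<bar> \<partial>M) - e)" .
  have "(\<integral>\<^sup>+x. ennreal (2 * \<bar>F x\<bar>) \<partial>M) = ennreal (2 * (\<integral>x. \<bar>F x\<bar> \<partial>M))"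
    using F by (subst nn_integral_eq_integral) auto
  then have *: "ennreal (2 * (\<integral>x. \<bar>F x\<bar> \<partial>M)) \<le> ennreal (2 * (\<integral>x. \<bar>F x\<bar> \<partial>M) - e)" using le by simp
  have F0: "0 \<le> (\<integral>x. \<bar>F x\<bar> \<partial>M)" by simp
  show False
  \<comment> \<open>A negative right-hand side is read as 0 by \<open>ennreal\<close>. Then F has L1
    norm 0, and the convergence of the norms alone gives the contradiction.\<close>
  proof (cases "2 * (\<integral>x. \<bar>F x\<bar> \<partial>M) - e \<ge> 0")
    case True
    then show False using * e by simp
  next
    case False
    then have F00: "(\<integral>x. \<bar>F x\<bar> \<partial>M) = 0" using * F0 by (simp add: ennreal_neg)
    have "(\<lambda>n. \<integral>x. \<bar>f n x\<bar> \<partial>M) \<longlonglongrightarrow> 0" using lim F00 by simp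
    then have "\<forall>\<^sub>F n in sequentially. (\<integral>x. \<bar>f n x\<bar> \<partial>M) < e" using e by (intro order_tendstoD(2))
    then obtain n where n: "(\<integral>x. \<bar>f n x\<bar> \<partial>M) < e" by (auto simp: eventually_sequentially)
    have "(\<integral>x. \<bar>f n x - F x\<bar> \<partial>M) \<le> (\<integral>x. \<bar>f n x\<bar> + \<bar>F x\<bar> \<partial>M)" using f F by (intro integral_mono) auto
    also have "\<dots> < e" using f F n F00 by simp
    finally show False using ge[of n] by simp
  qed
qed

context subcritical_domain
begin

text \<open>If the differences stayed away from 0 along a subsequence, a further subsequence would
  converge almost everywhere, and Scheffe's lemma on pairs of points would contradict this.\<close>

lemma J_strong_convergence:
  assumes w: "\<And>n. w n \<in> D" and W: "W \<in> D"
    and lim: "(\<lambda>n. nsq lborel (\<lambda>x. w n x - W x)) \<longlonglongrightarrow> 0"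
    and J: "(\<lambda>n. LBINT z. \<bar>dK (w n) z\<bar>) \<longlonglongrightarrow> (LBINT z. \<bar>dK W z\<bar>)"
  shows "(\<lambda>n. LBINT z. \<bar>dK (\<lambda>x. w n x - W x) z\<bar>) \<longlonglongrightarrow> 0"
proof (rule ccontr)
  let ?a = "\<lambda>n. \<integral>z. \<bar>dK (\<lambda>x. w n x - W x) z\<bar> \<partial>lborel"
  assume "\<not> ?a \<longlonglongrightarrow> 0"
  then obtain e where e: "0 < e" "\<not> (\<forall>\<^sub>F n in sequentially. dist (?a n) 0 < e)"
    unfolding tendsto_iff by blast
  then obtain r :: "nat \<Rightarrow> nat" where r: "strict_mono r" "\<And>n. \<not> dist (?a (r n)) 0 < e"
    using not_eventually_sequentiallyD[of "\<lambda>n. dist (?a n) 0 < e"] by auto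
  have sq: "L2 (\<lambda>x. w n x - W x)" for n
    by (intro square_integrable_diff D_square_integrable w W)
  have "(\<lambda>n. nsq lborel (\<lambda>x. w (r n) x - W x)) \<longlonglongrightarrow> 0" using LIMSEQ_subseq_LIMSEQ[OF lim r(1)] by (simp add: o_def)
  then obtain q where q: "strict_mono (q :: nat \<Rightarrow> nat)" "AE x in lborel. (\<lambda>n. (w (r (q n)) x - W x)\<^sup>2) \<longlonglongrightarrow> 0"
    using tendsto_L1_AE_subseq[of lborel "\<lambda>n x. (w (r n) x - W x)\<^sup>2"] sq
    by (auto simp: square_integrable_def nsq_def)
  have ae: "AE x in lborel. (\<lambda>n. w (r (q n)) x) \<longlonglongrightarrow> W x"
    using q(2)
  proof eventually_elim
    case (elim x)
    then have "(\<lambda>n. sqrt ((w (r (q n)) x - W x)\<^sup>2)) \<longlonglongrightarrow> sqrt 0" by (rule tendsto_real_sqrt)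
    then have "(\<lambda>n. w (r (q n)) x - W x) \<longlonglongrightarrow> 0" by (simp add: tendsto_rabs_zero_iff)
    then show ?case by (rule LIM_zero_cancel)
  qed
  have rq: "strict_mono (r \<circ> q)" using r(1) q(1) by (rule strict_mono_o)
  have "\<exists>n. (LBINT z. \<bar>dK (w (r (q n))) z - dK W z\<bar>) < e"
  proof (rule Scheffe[OF _ _ _ _ e(1)])
    show "integrable lborel (dK (w (r (q n))))" for n by (rule D_integrable_dK[OF w])
    show "integrable lborel (dK W)" by (rule D_integrable_dK[OF W])
    show "AE z in lborel. (\<lambda>n. dK (w (r (q n))) z) \<longlonglongrightarrow> dK W z"
      using AE_lborel_fst_snd[OF ae] by eventually_elim (auto simp: dK_def intro!: tendsto_intros)
    show "(\<lambda>n. LBINT z. \<bar>dK (w (r (q n))) z\<bar>) \<longlonglongrightarrow> (LBINT z. \<bar>dK W z\<bar>)"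
      using LIMSEQ_subseq_LIMSEQ[OF J rq] by (simp add: o_def)
  qed
  then show False using r(2) by (auto simp: dK_diff dist_real_def)
qed

end

section \<open>Translation continuity of the scheme and convexity of the primitive\<close>

context flow
begin

lemma transl_cont_cut_step:
  assumes "\<And>k. L2 (a k)"
  shows "transl_cont (cut (\<lambda>t. a (idx n t)))"
proof -
  let ?I = "\<lambda>k. {real k * hn n..<(real k + 1) * hn n}"
  have h: "0 < hn n" by (rule hn)
  have "cut (\<lambda>t. a (idx n t)) z = (\<Sum>k<Suc n. 1 * (indicator (?I k) (fst z) * a k (snd z)))" for z
  proof (cases "fst z \<in> {0..<T}")
    case True
    then have t: "0 \<le> fst z" "fst z < T" by auto
    have "(\<Sum>k<Suc n. 1 * (indicator (?I k) (fst z) * a k (snd z))) = (\<Sum>k<Suc n. if k = idx n (fst z) then a k (snd z) else 0)"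
    proof (rule sum.cong[OF refl])
      fix k
      have "fst z \<in> ?I k \<longleftrightarrow> k = idx n (fst z)" using idx_eq[of k n "fst z"] idx[OF t(1), of n] by auto
      then show "1 * (indicator (?I k) (fst z) * a k (snd z)) = (if k = idx n (fst z) then a k (snd z) else 0)"
        by (simp add: indicator_def)
    qed
    also have "\<dots> = a (idx n (fst z)) (snd z)" using idx_less[OF t, of n] by (subst sum.delta) auto
    finally show ?thesis using True by (simp add: cut_def)
  next
    case False
    have "fst z \<notin> ?I k" if "k < Suc n" for k
    proof
      assume "fst z \<in> ?I k"
      moreover have "0 \<le> real k * hn n" using h by simp
      moreover have "(real k + 1) * hn n \<le> real (Suc n) * hn n" using that h by (intro mult_right_mono) auto
      ultimately show False using False hn(3)[of n] by auto
    qed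
    then show ?thesis using False by (simp add: cut_def del: sum.lessThan_Suc)
  qed
  then have eq: "cut (\<lambda>t. a (idx n t)) = (\<lambda>z. \<Sum>k<Suc n. 1 * (indicator (?I k) (fst z) * a k (snd z)))" by (rule ext)
  show ?thesis unfolding eq
    by (rule transl_cont_sum, simp, rule transl_cont_step[OF assms]) (use h in \<open>simp add: mult_right_mono\<close>)
qed

lemma transl_cont_vn: "transl_cont (cut (vn n))"
proof -
  have "transl_cont (cut (\<lambda>t. (\<lambda>k x. dU n k x / hn n) (idx n t)))"
    by (rule transl_cont_cut_step) (use square_integrable_scale[OF dU_square_integrable, of "1 / hn n"] in simp)
  then show ?thesis by (simp add: vn_def[abs_def])
qed

lemma transl_cont_gn: "transl_cont (cut (gn n))"
proof -
  have "transl_cont (cut (\<lambda>t. (\<lambda>k. Nf (U n k)) (idx n t)))"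
    by (rule transl_cont_cut_step) (rule D_Nf[OF U_D])
  then show ?thesis by (simp add: gn_def[abs_def] Nf_def[abs_def] ub_def)
qed

lemma f_zero: "f x 0 = 0" using f_growth[of x 0] by simp

lemma primitive_deriv: "((\<lambda>w. primitive f x w) has_real_derivative f x w) (at w)"
proof -
  \<comment> \<open>The interval contains 0 and has w in its interior, so the derivative within it
    is the full derivative.\<close>
  let ?a = "- (\<bar>w\<bar> + 1)" and ?b = "\<bar>w\<bar> + 1"
  have c: "continuous_on {?a..?b} (f x)" using f_cont continuous_on_subset by blast
  have "((\<lambda>u. LBINT y=0..ereal u. f x y) has_vector_derivative f x w) (at w within {?a..?b})"
    using interval_integral_FTC2[of ?a 0 ?b "f x" w] c by (simp add: zero_ereal_def)
  moreover have "at w within {?a..?b} = at w" by (rule at_within_interior) auto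
  ultimately show ?thesis
    by (simp add: primitive_def[abs_def] has_real_derivative_iff_has_vector_derivative)
qed

lemma primitive_0: "primitive f x 0 = 0"
  by (simp add: primitive_def zero_ereal_def[symmetric])

text \<open>Monotonicity of f(x, \<cdot>) makes the primitive convex with f(x, a) as its slope at a;
  the mean value theorem is applied on the side where b lies.\<close>

lemma primitive_ineq: "primitive f x a + f x a * (b - a) \<le> primitive f x b"
proof (cases a b rule: linorder_cases)
  case less
  then obtain \<xi> where "a < \<xi>" "\<xi> < b" "primitive f x b - primitive f x a = (b - a) * f x \<xi>"
    using MVT2[of a b "primitive f x" "f x"] primitive_deriv by blast
  moreover have "(b - a) * f x a \<le> (b - a) * f x \<xi>"
    using f_mono[of x] \<open>a < \<xi>\<close> less by (intro mult_left_mono) (auto simp: mono_def)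
  moreover have "f x a * (b - a) = (b - a) * f x a" by (rule mult.commute)
  ultimately show ?thesis by linarith
next
  case greater
  then obtain \<xi> where "b < \<xi>" "\<xi> < a" "primitive f x a - primitive f x b = (a - b) * f x \<xi>"
    using MVT2[of b a "primitive f x" "f x"] primitive_deriv by blast
  moreover have "(a - b) * f x \<xi> \<le> (a - b) * f x a"
    using f_mono[of x] \<open>\<xi> < a\<close> greater by (intro mult_left_mono) (auto simp: mono_def)
  moreover have "f x a * (b - a) = - ((a - b) * f x a)" by (simp add: algebra_simps)
  ultimately show ?thesis by linarith
qed simp

lemma primitive_bounds: "0 \<le> primitive f x w" "primitive f x w \<le> f x w * w"
  using primitive_ineq[of x 0 w] primitive_ineq[of x w 0] by (simp_all add: primitive_0 f_zero)

lemma primitive_measurable: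
  assumes [measurable]: "p \<in> borel_measurable M" "q \<in> borel_measurable M"
  shows "(\<lambda>z. primitive f (p z) (q z)) \<in> borel_measurable M"
proof (rule Caratheodory_measurable[where g = "\<lambda>z. primitive f (p z)" and q = q])
  fix w
  have "(\<lambda>z :: 'a \<times> real. f (fst z) (snd z)) \<in> borel_measurable borel"
    by (rule f_measurable[OF measurable_fst_borel measurable_snd_borel])
  note m = borel_measurable_pairI[OF this]
  have "(\<lambda>x. LBINT \<tau>. indicator (einterval a b) \<tau> *\<^sub>R f x \<tau>) \<in> borel_measurable borel" for a b
  proof -
    have "(\<lambda>z :: 'a \<times> real. indicator (einterval a b) (snd z) *\<^sub>R f (fst z) (snd z)) \<in> borel_measurable (borel \<Otimes>\<^sub>M lborel)"
      using m by measurable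
    then have "(\<lambda>(x, \<tau>). indicator (einterval a b) \<tau> *\<^sub>R f x \<tau>) \<in> borel_measurable (borel \<Otimes>\<^sub>M lborel)"
      unfolding case_prod_beta' .
    then show ?thesis by (rule lborel.borel_measurable_lebesgue_integral)
  qed
  then have "(\<lambda>x. primitive f x w) \<in> borel_measurable borel"
    unfolding primitive_def interval_lebesgue_integral_def set_lebesgue_integral_def
    by (cases "0 \<le> ereal w") auto
  then show "(\<lambda>z. primitive f (p z) w) \<in> borel_measurable M"
    using measurable_compose[OF assms(1)] by blast
next
  fix z
  have "isCont (primitive f (p z)) w" for w using primitive_deriv by (rule DERIV_isCont)
  then show "continuous_on UNIV (primitive f (p z))" by (simp add: continuous_on_eq_continuous_at)
qed measurable

lemma primitive_integrable:
  assumes w: "w \<in> D"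
  shows "integrable lborel (\<lambda>x. primitive f x (w x))"
    "0 \<le> (LBINT x. primitive f x (w x))" "(LBINT x. primitive f x (w x)) \<le> (LBINT x. Nf w x * w x)"
proof -
  have [measurable]: "w \<in> borel_measurable borel" using w by (rule D_measurable)
  have i: "integrable lborel (\<lambda>x. Nf w x * w x)"
    by (rule square_integrable_mult[OF D_Nf[OF w] D_square_integrable[OF w]])
  show i': "integrable lborel (\<lambda>x. primitive f x (w x))"
  proof (rule Bochner_Integration.integrable_bound[OF i])
    show "(\<lambda>x. primitive f x (w x)) \<in> borel_measurable lborel" by (intro primitive_measurable) auto
    show "AE x in lborel. norm (primitive f x (w x)) \<le> norm (Nf w x * w x)"
    proof (rule AE_I2)
      fix x show "norm (primitive f x (w x)) \<le> norm (Nf w x * w x)"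
        using primitive_bounds[of x "w x"] unfolding Nf_def by auto
    qed
  qed
  show "0 \<le> (LBINT x. primitive f x (w x))" by (rule integral_nonneg_AE) (simp add: primitive_bounds)
  show "(LBINT x. primitive f x (w x)) \<le> (LBINT x. Nf w x * w x)"
    by (rule integral_mono[OF i' i]) (simp add: primitive_bounds Nf_def)
qed

end

section \<open>Seminorm and potential along the limit\<close>

context flow_limit
begin

lemma transl_cont_v: "transl_cont v"
  by (rule transl_cont_limit[OF _ v Vn_lim]) (unfold Vn_def, intro transl_cont_sum transl_cont_vn finite_lessThan)

lemma transl_cont_Nf: "transl_cont (cut (\<lambda>t. Nf (u t)))"
  by (rule transl_cont_limit[OF _ cut_Nf_square_integrable Gn_lim])
    (unfold Gn_def, intro transl_cont_sum transl_cont_gn finite_lessThan)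

lemma u_increment:
  assumes "0 \<le> a" "a \<le> b" "b \<le> T"
  shows "AE x in lborel. u b x - u a x = time_int a b v x"
  using time_int_split[OF v assms(1,2)] by eventually_elim (simp add: u_def)

lemma u_time_abs:
  assumes "a \<in> {0..T}" "b \<in> {0..T}"
  shows "nsq lborel (\<lambda>x. u b x - u a x) \<le> \<bar>b - a\<bar> * nsq lborel v"
proof (cases "a \<le> b")
  case True
  then show ?thesis using u_time[of a b] assms by simp
next
  case False
  then have "nsq lborel (\<lambda>x. u a x - u b x) \<le> \<bar>b - a\<bar> * nsq lborel v" using u_time[of b a] assms by simp
  then show ?thesis by (subst nsq_minus_commute)
qed

lemma u_tendsto:
  assumes s: "\<And>n. a n \<in> {0..T}" and t: "t \<in> {0..T}" and lim: "a \<longlonglongrightarrow> t"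
  shows "(\<lambda>n. nsq lborel (\<lambda>x. u (a n) x - u t x)) \<longlonglongrightarrow> 0"
proof (rule tendsto_sandwich[OF _ _ tendsto_const])
  have "(\<lambda>n. \<bar>a n - t\<bar> * nsq lborel v) \<longlonglongrightarrow> \<bar>t - t\<bar> * nsq lborel v" by (intro tendsto_intros lim)
  then show "(\<lambda>n. \<bar>a n - t\<bar> * nsq lborel v) \<longlonglongrightarrow> 0" by simp
qed (use u_time_abs[OF t s] in auto)

definition JJ :: "real \<Rightarrow> real" where "JJ t = (LBINT z. \<bar>dK (u t) z\<bar>)"
definition \<Phi> :: "real \<Rightarrow> real" where "\<Phi> t = (LBINT x. primitive f x (u t x))"

lemma JJ_measurable [measurable]: "JJ \<in> borel_measurable borel"
proof -
  have c1: "(\<lambda>q :: real \<times> 'a \<times> 'a. (fst q, fst (snd q))) \<in> borel_measurable borel"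
    and c2: "(\<lambda>q :: real \<times> 'a \<times> 'a. (fst q, snd (snd q))) \<in> borel_measurable borel"
    by (intro borel_measurable_continuous_onI continuous_intros)+
  have [measurable]: "(\<lambda>q :: real \<times> 'a \<times> 'a. u (fst q) (fst (snd q))) \<in> borel_measurable borel"
    "(\<lambda>q :: real \<times> 'a \<times> 'a. u (fst q) (snd (snd q))) \<in> borel_measurable borel"
    using measurable_compose[OF c1 u_measurable] measurable_compose[OF c2 u_measurable] by auto
  have [measurable]: "(\<lambda>q :: real \<times> 'a \<times> 'a. K (snd q)) \<in> borel_measurable borel" by measurable
  have "(\<lambda>q :: real \<times> 'a \<times> 'a. \<bar>dK (u (fst q)) (snd q)\<bar>) \<in> borel_measurable borel"
    unfolding dK_def by measurable
  from borel_measurable_pairI[OF this] have "(\<lambda>(t, z). \<bar>dK (u t) z\<bar>) \<in> borel_measurable (borel \<Otimes>\<^sub>M lborel)"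
    unfolding case_prod_beta' .
  then show ?thesis unfolding JJ_def[abs_def] by (rule lborel.borel_measurable_lebesgue_integral)
qed

lemma \<Phi>_measurable [measurable]: "\<Phi> \<in> borel_measurable borel"
proof -
  have "(\<lambda>q :: real \<times> 'a. primitive f (snd q) (u (fst q) (snd q))) \<in> borel_measurable borel"
    by (rule primitive_measurable[OF measurable_snd_borel u_measurable])
  from borel_measurable_pairI[OF this] have "(\<lambda>(t, x). primitive f x (u t x)) \<in> borel_measurable (borel \<Otimes>\<^sub>M lborel)"
    unfolding case_prod_beta' .
  then show ?thesis unfolding \<Phi>_def[abs_def] by (rule lborel.borel_measurable_lebesgue_integral)
qed

lemma J_u: "t \<in> {0..T} \<Longrightarrow> J (u t) = ennreal (JJ t)"
  using J_eq[OF u_D] by (simp add: JJ_def)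

lemma JJ_nonneg: "0 \<le> JJ t" by (simp add: JJ_def)

lemma JJ_bound: "t \<in> {0..T} \<Longrightarrow> \<bar>JJ t\<bar> \<le> M0"
  using u_J[of t] J_u[of t] JJ_nonneg[of t] M0_nonneg by simp

text \<open>A violation would produce times tending to t with seminorms below
  \<open>JJ t - e\<close>, against lower semicontinuity along the L2-continuous curve.\<close>

lemma JJ_lsc:
  assumes t: "t \<in> {0..T}" and e: "0 < e"
  shows "\<exists>d>0. \<forall>s\<in>{0..T}. \<bar>s - t\<bar> < d \<longrightarrow> JJ t - e \<le> JJ s"
proof (rule ccontr)
  assume "\<not> ?thesis"
  then have "\<exists>s. s \<in> {0..T} \<and> \<bar>s - t\<bar> < 1 / real (Suc n) \<and> JJ s < JJ t - e" for n
    by (meson not_le of_nat_0_less_iff zero_less_Suc zero_less_divide_1_iff)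
  then obtain a where a: "\<And>n. a n \<in> {0..T}" "\<And>n. \<bar>a n - t\<bar> < 1 / real (Suc n)" "\<And>n. JJ (a n) < JJ t - e"
    by metis
  have "(\<lambda>n. a n - t) \<longlonglongrightarrow> 0"
  proof (rule Lim_null_comparison)
    show "\<forall>\<^sub>F n in sequentially. norm (a n - t) \<le> 1 / real (Suc n)" using a(2) by (auto intro!: less_imp_le always_eventually)
    show "(\<lambda>n. 1 / real (Suc n)) \<longlonglongrightarrow> 0" using LIMSEQ_inverse_real_of_nat by (simp add: inverse_eq_divide)
  qed
  then have "a \<longlonglongrightarrow> t" by (rule LIM_zero_cancel)
  from u_tendsto[OF a(1) t this] have lim: "(\<lambda>n. nsq lborel (\<lambda>x. u (a n) x - u t x)) \<longlonglongrightarrow> 0" .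
  have "J (u t) \<le> ennreal (JJ t - e)"
  proof (rule J_lsc_L2[OF u_D[OF a(1)] _ u_X _ lim])
    show "J (u (a n)) \<le> ennreal (JJ t - e)" for n unfolding J_u[OF a(1)[of n]] by (rule ennreal_leI[OF less_imp_le[OF a(3)]])
    show "L2 (u t)" using t by (intro u_square_integrable) auto
  qed
  then have "ennreal (JJ t) \<le> ennreal (JJ t - e)" using J_u[OF t] by simp
  moreover have "0 \<le> JJ t - e" using a(3)[of 0] JJ_nonneg[of "a 0"] by linarith
  ultimately show False using e by simp
qed

text \<open>f(\<cdot>, u) - u_t on [0, T), spelled with coefficients 1 and -1 to match the lemma on
  linear combinations.\<close>

definition \<xi> :: "real \<times> 'a \<Rightarrow> real" where "\<xi> z = 1 * cut (\<lambda>t. Nf (u t)) z + (-1) * v z"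

lemma transl_cont_\<xi>: "transl_cont \<xi>"
  unfolding \<xi>_def[abs_def] by (intro transl_cont_lincomb transl_cont_Nf transl_cont_v)

text \<open>The limit equation is tested with u(s) - u(t). The sign relation turns the pairing of
  \<eta> with u(t) into the seminorm of u(t), and the bound by 1 keeps the pairing with u(s) below
  the seminorm of u(s).\<close>

lemma JJ_subgradient:
  "AE t in lborel. t \<in> {0..<T} \<longrightarrow> (\<forall>s\<in>{0..T}. JJ t + (LBINT x. \<xi> (t, x) * (u s x - u t x)) \<le> JJ s)"
  using limit_equation AE_lborel_rotate[OF \<eta>_sign] square_integrable_Fubini(1)[OF v]
proof eventually_elim
  case (elim t)
  show ?case
  proof (intro impI ballI)
    fix s assume t: "t \<in> {0..<T}" and s: "s \<in> {0..T}"
    then have t': "t \<in> {0..T}" by auto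
    let ?\<phi> = "\<lambda>x. u s x - u t x"
    have \<phi>: "?\<phi> \<in> D" by (intro D_diff u_D s t')
    have s\<phi>: "L2 ?\<phi>" by (rule D_square_integrable[OF \<phi>])
    have i\<eta>: "integrable lborel (\<lambda>p. \<eta> (fst p, snd p, t) * dK w p)" if w: "w \<in> D" for w
    proof (rule Bochner_Integration.integrable_bound[OF D_integrable_dK[OF w]])
      have [measurable]: "w \<in> borel_measurable borel" using w by (rule D_measurable)
      show "(\<lambda>p. \<eta> (fst p, snd p, t) * dK w p) \<in> borel_measurable lborel" by measurable
      show "AE p in lborel. norm (\<eta> (fst p, snd p, t) * dK w p) \<le> norm (dK w p)"
        using \<eta>_le1 by (auto simp: abs_mult intro!: mult_left_le_one_le)
    qed
    have "(LBINT x. \<xi> (t, x) * ?\<phi> x) = (LBINT x. Nf (u t) x * ?\<phi> x - v (t, x) * ?\<phi> x)"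
      using t by (intro Bochner_Integration.integral_cong) (auto simp: \<xi>_def cut_def left_diff_distrib)
    also have "\<dots> = (LBINT x. Nf (u t) x * ?\<phi> x) - (LBINT x. v (t, x) * ?\<phi> x)"
      by (intro Bochner_Integration.integral_diff square_integrable_mult Nf_u_square_integrable t' s\<phi> elim(3))
    also have "\<dots> = (LBINT p. \<eta> (fst p, snd p, t) * dK ?\<phi> p)"
    proof -
      have "(LBINT x. v (t, x) * ?\<phi> x) + (LBINT p. \<eta> (fst p, snd p, t) * dK ?\<phi> p) = (LBINT x. Nf (u t) x * ?\<phi> x)"
        by (rule bspec[OF mp[OF elim(1) t] \<phi>])
      then show ?thesis by linarith
    qed
    also have "\<dots> = (LBINT p. \<eta> (fst p, snd p, t) * dK (u s) p) - (LBINT p. \<eta> (fst p, snd p, t) * dK (u t) p)"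
      unfolding dK_diff right_diff_distrib by (intro Bochner_Integration.integral_diff i\<eta> u_D s t')
    also have "(LBINT p. \<eta> (fst p, snd p, t) * dK (u t) p) = JJ t"
      unfolding JJ_def
    proof (rule integral_cong_AE)
      show "AE p in lborel. \<eta> (fst p, snd p, t) * dK (u t) p = \<bar>dK (u t) p\<bar>"
        using elim(2)
      proof eventually_elim
        case (elim p)
        then have "\<eta> (fst p, snd p, t) \<in> multi_sign (u t (fst p) - u t (snd p))" using t by simp
        then have "\<eta> (fst p, snd p, t) * (u t (fst p) - u t (snd p)) = \<bar>u t (fst p) - u t (snd p)\<bar>"
          by (auto simp: multi_sign_def sgn_mult_self_eq abs_sgn mult.commute split: if_splits)
        then show ?case unfolding dK_def by (simp add: abs_mult mult.assoc[symmetric])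
      qed
    qed measurable
    also have "(LBINT p. \<eta> (fst p, snd p, t) * dK (u s) p) \<le> JJ s"
      unfolding JJ_def
    proof (rule integral_mono[OF i\<eta>[OF u_D[OF s]] integrable_abs[OF D_integrable_dK[OF u_D[OF s]]]])
      fix p
      have "\<eta> (fst p, snd p, t) * dK (u s) p \<le> \<bar>\<eta> (fst p, snd p, t) * dK (u s) p\<bar>" by simp
      also have "\<dots> \<le> \<bar>dK (u s) p\<bar>" using \<eta>_le1 by (simp add: abs_mult mult_left_le_one_le)
      finally show "\<eta> (fst p, snd p, t) * dK (u s) p \<le> \<bar>dK (u s) p\<bar>" .
    qed
    finally show "JJ t + (LBINT x. \<xi> (t, x) * ?\<phi> x) \<le> JJ s" by simp
  qed
qed

lemma \<Phi>_subgradient: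
  assumes t: "t \<in> {0..T}" and b: "b \<in> {0..T}"
  shows "\<Phi> t + (LBINT x. Nf (u t) x * (u b x - u t x)) \<le> \<Phi> b"
proof -
  have i: "integrable lborel (\<lambda>x. Nf (u t) x * (u b x - u t x))"
    by (intro square_integrable_mult square_integrable_diff Nf_u_square_integrable D_square_integrable u_D b t)
  have "\<Phi> t + (LBINT x. Nf (u t) x * (u b x - u t x)) = (LBINT x. primitive f x (u t x) + Nf (u t) x * (u b x - u t x))"
    unfolding \<Phi>_def using primitive_integrable(1)[OF u_D[OF t]] i by simp
  also have "\<dots> \<le> \<Phi> b"
    unfolding \<Phi>_def using primitive_integrable(1)[OF u_D[OF t]] primitive_integrable(1)[OF u_D[OF b]] i primitive_ineq
    by (intro integral_mono) (auto simp: Nf_def)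
  finally show ?thesis .
qed

text \<open>The subgradient inequality at the fixed time t bounds the possible drop by the norm of
  the subgradient times the L2 increment of the curve.\<close>

lemma \<Phi>_lsc:
  assumes t: "t \<in> {0..T}" and e: "0 < e"
  shows "\<exists>d>0. \<forall>s\<in>{0..T}. \<bar>s - t\<bar> < d \<longrightarrow> \<Phi> t - e \<le> \<Phi> s"
proof -
  define c where "c = nsq lborel (Nf (u t)) + 1"
  define k where "k = nsq lborel v + 1"
  have c: "0 < c" "0 < k" by (simp_all add: c_def k_def add_nonneg_pos)
  \<comment> \<open>Within this distance the squared increment is at most e^2 / c, so the
    Cauchy-Schwarz bound is exactly e.\<close>
  have "0 < e\<^sup>2 / (c * k)" using e c by simp
  moreover have "\<Phi> t - e \<le> \<Phi> s" if s: "s \<in> {0..T}" "\<bar>s - t\<bar> < e\<^sup>2 / (c * k)" for s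
  proof -
    have "nsq lborel (\<lambda>x. u s x - u t x) \<le> \<bar>s - t\<bar> * nsq lborel v" by (rule u_time_abs[OF t s(1)])
    also have "\<dots> \<le> e\<^sup>2 / (c * k) * k" using s(2) by (intro mult_mono) (auto simp: k_def)
    also have "\<dots> = e\<^sup>2 / c" using c by simp
    finally have d: "nsq lborel (\<lambda>x. u s x - u t x) \<le> e\<^sup>2 / c" .
    have "\<bar>\<integral>x. Nf (u t) x * (u s x - u t x) \<partial>lborel\<bar> \<le> sqrt (nsq lborel (Nf (u t))) * sqrt (nsq lborel (\<lambda>x. u s x - u t x))"
      by (intro Cauchy_Schwarz_nsq square_integrable_diff Nf_u_square_integrable D_square_integrable u_D s t)
    also have "\<dots> \<le> sqrt c * sqrt (e\<^sup>2 / c)" using d by (intro mult_mono) (auto simp: c_def)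
    also have "\<dots> = e" using c e by (simp flip: real_sqrt_mult)
    finally show ?thesis using \<Phi>_subgradient[OF t s(1)] by linarith
  qed
  ultimately show ?thesis by blast
qed

lemma \<Phi>_bounded: "\<exists>B. \<forall>t\<in>{0..T}. \<bar>\<Phi> t\<bar> \<le> B"
proof -
  obtain B where B: "0 \<le> B" "\<And>w. w \<in> X \<Longrightarrow> J w \<le> ennreal M0 \<Longrightarrow> L2 w \<and> nsq lborel w \<le> B"
    by (rule L2_bound_of_J[OF M0_nonneg]) blast
  have "\<bar>\<Phi> t\<bar> \<le> sqrt (G M0) * sqrt B" if t: "t \<in> {0..T}" for t
  proof -
    have "\<bar>\<Phi> t\<bar> \<le> (LBINT x. Nf (u t) x * u t x)"
      using primitive_integrable[OF u_D[OF t]] by (simp add: \<Phi>_def)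
    also have "\<dots> \<le> sqrt (nsq lborel (Nf (u t))) * sqrt (nsq lborel (u t))"
      using Cauchy_Schwarz_nsq[OF Nf_u_square_integrable[OF t] D_square_integrable[OF u_D[OF t]]] by linarith
    also have "\<dots> \<le> sqrt (G M0) * sqrt B"
      using Nf_square_integrable(2)[OF M0_nonneg u_X u_J[OF t]] B(2)[OF u_X u_J[OF t]] G_nonneg[OF M0_nonneg] by (intro mult_mono) auto
    finally show ?thesis .
  qed
  then show ?thesis by blast
qed

lemma JJ_chain_rule:
  assumes b: "0 \<le> b" "b < T"
  shows "JJ b - JJ 0 = (LBINT z. (indicator {0..<b} (fst z) * \<xi> z) * v z)"
proof -
  interpret subgradient_curve T v \<xi> u JJ M0
  proof
    show "\<exists>d>0. \<forall>s\<in>{0..T}. \<bar>s - t\<bar> < d \<longrightarrow> JJ t - e \<le> JJ s" if "t \<in> {0..T}" "0 < e" for t e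
      by (rule JJ_lsc[OF that])
  qed (use transl_cont_v transl_cont_\<xi> u_increment JJ_bound JJ_subgradient in auto)
  show ?thesis by (rule chain_rule[OF b])
qed

lemma \<Phi>_chain_rule:
  assumes b: "0 \<le> b" "b < T"
  shows "\<Phi> b - \<Phi> 0 = (LBINT z. (indicator {0..<b} (fst z) * cut (\<lambda>t. Nf (u t)) z) * v z)"
proof -
  obtain B where B: "\<forall>t\<in>{0..T}. \<bar>\<Phi> t\<bar> \<le> B" using \<Phi>_bounded by blast
  interpret subgradient_curve T v "cut (\<lambda>t. Nf (u t))" u \<Phi> B
  proof
    show "\<exists>d>0. \<forall>s\<in>{0..T}. \<bar>s - t\<bar> < d \<longrightarrow> \<Phi> t - e \<le> \<Phi> s" if "t \<in> {0..T}" "0 < e" for t e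
      by (rule \<Phi>_lsc[OF that])
    have *: "cut (\<lambda>t. Nf (u t)) (t, x) = Nf (u t) x" if "t \<in> {0..<T}" for t x using that by (simp add: cut_def)
    show "AE t in lborel. t \<in> {0..<T} \<longrightarrow> (\<forall>s\<in>{0..T}. \<Phi> t + (LBINT x. cut (\<lambda>t. Nf (u t)) (t, x) * (u s x - u t x)) \<le> \<Phi> s)"
      using \<Phi>_subgradient by (auto simp: *)
  qed (use transl_cont_v transl_cont_Nf u_increment B in auto)
  show ?thesis by (rule chain_rule[OF b])
qed

text \<open>The two chain rules differ by the pairing of the two subgradients' difference, which is
  u_t, with u_t itself.\<close>

theorem energy_identity:
  assumes b: "0 \<le> b" "b < T"
  shows "(LBINT z. indicator {0..<b} (fst z) * (v z)\<^sup>2) + (JJ b - \<Phi> b) = JJ 0 - \<Phi> 0"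
proof -
  let ?\<chi> = "\<lambda>z :: real \<times> 'a. indicator {0..<b} (fst z) :: real"
  have i1: "integrable lborel (\<lambda>z. (?\<chi> z * cut (\<lambda>t. Nf (u t)) z) * v z)"
    by (intro square_integrable_mult square_integrable_slab cut_Nf_square_integrable v) auto
  have i2: "integrable lborel (\<lambda>z. (?\<chi> z * v z) * v z)"
    by (intro square_integrable_mult square_integrable_slab v) auto
  have "(LBINT z. (?\<chi> z * \<xi> z) * v z) = (LBINT z. (?\<chi> z * cut (\<lambda>t. Nf (u t)) z) * v z - (?\<chi> z * v z) * v z)"
    by (intro Bochner_Integration.integral_cong) (auto simp: \<xi>_def algebra_simps)
  also have "\<dots> = (\<Phi> b - \<Phi> 0) - (LBINT z. (?\<chi> z * v z) * v z)"
    using i1 i2 \<Phi>_chain_rule[OF b] by simp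
  finally have "JJ b - JJ 0 = (\<Phi> b - \<Phi> 0) - (LBINT z. (?\<chi> z * v z) * v z)" using JJ_chain_rule[OF b] by simp
  then show ?thesis by (simp add: power2_eq_square mult.assoc)
qed

text \<open>By the chain rule the seminorm is the indefinite integral of an integrable function of
  time. This upgrades lower semicontinuity to continuity on [0, T).\<close>

lemma JJ_continuous:
  assumes a: "\<And>n. a n \<in> {0..<T}" and t: "t \<in> {0..<T}" and lim: "a \<longlonglongrightarrow> t"
  shows "(\<lambda>n. JJ (a n)) \<longlonglongrightarrow> JJ t"
proof -
  have i: "integrable lborel (\<lambda>z. \<xi> z * v z)"
    by (rule square_integrable_mult) (use transl_cont_\<xi> v in \<open>auto simp: transl_cont_def\<close>)
  have eq: "JJ b = JJ 0 + (LBINT z. indicator {0..<b} (fst z) * (\<xi> z * v z))" if "b \<in> {0..<T}" for b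
    using JJ_chain_rule[of b] that by (simp add: mult.assoc)
  show ?thesis unfolding eq[OF a] eq[OF t] by (intro tendsto_add tendsto_const tendsto_initial_slab i lim)
qed

lemma u_strongly_continuous:
  assumes a: "\<And>n. a n \<in> {0..<T}" and t: "t \<in> {0..<T}" and lim: "a \<longlonglongrightarrow> t"
  shows "(\<lambda>n. LBINT z. \<bar>dK (\<lambda>x. u (a n) x - u t x) z\<bar>) \<longlonglongrightarrow> 0"
    "(\<lambda>n. nsq lborel (\<lambda>x. u (a n) x - u t x)) \<longlonglongrightarrow> 0"
proof -
  have c: "a n \<in> {0..T}" "t \<in> {0..T}" for n using a[of n] t by auto
  show 2: "(\<lambda>n. nsq lborel (\<lambda>x. u (a n) x - u t x)) \<longlonglongrightarrow> 0" by (rule u_tendsto[OF c lim])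
  show "(\<lambda>n. LBINT z. \<bar>dK (\<lambda>x. u (a n) x - u t x) z\<bar>) \<longlonglongrightarrow> 0"
    by (rule J_strong_convergence[OF u_D[OF c(1)] u_D[OF c(2)] 2]) (use JJ_continuous[OF a t lim] in \<open>simp add: JJ_def\<close>)
qed

end

section \<open>Borel representatives\<close>

lemma lebesgue_measurable_AE_eq:
  fixes f f' :: "'a::euclidean_space \<Rightarrow> real"
  assumes f': "f' \<in> borel_measurable borel" and ae: "AE x in lborel. f x = f' x"
  shows "f \<in> borel_measurable lebesgue"
proof (rule measurableI)
  obtain N where N: "{x. \<not> f x = f' x} \<subseteq> N" "N \<in> null_sets lborel"
    using AE_E[OF ae] by (auto simp: null_sets_def)
  fix A :: "real set" assume A: "A \<in> sets borel"
  have "f' -` A \<in> sets borel" using measurable_sets[OF f' A] by simp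
  then have "f' -` A - N \<in> sets lborel" using N(2) by (intro sets.Diff) auto
  then have "f' -` A - N \<in> sets lebesgue" by (rule sets_completionI_sets)
  moreover have "f -` A \<inter> N \<in> sets lebesgue" by (rule null_sets_completion[OF N(2)]) auto
  moreover have "f -` A \<inter> space lebesgue = (f' -` A - N) \<union> (f -` A \<inter> N)" using N(1) by auto
  ultimately show "f -` A \<inter> space lebesgue \<in> sets lebesgue" by (simp only: sets.Un)
qed auto

text \<open>The bridge between the \<open>lebesgue_on\<close> integrals of the definitions and the
  Borel functions used so far; g' is a representative extended by 0.\<close>

lemma lebesgue_on_transfer:
  fixes g g' :: "'a::euclidean_space \<Rightarrow> real"
  assumes S: "S \<in> sets borel" and g': "g' \<in> borel_measurable borel" and off: "\<And>x. x \<notin> S \<Longrightarrow> g' x = 0"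
    and ae: "AE x in lborel. x \<in> S \<longrightarrow> g x = g' x"
  shows "g \<in> borel_measurable (lebesgue_on S)"
    and "integrable (lebesgue_on S) g \<longleftrightarrow> integrable lborel g'"
    and "integral\<^sup>L (lebesgue_on S) g = integral\<^sup>L lborel g'"
proof -
  have S': "S \<inter> space lebesgue \<in> sets lebesgue" using S by auto
  let ?h = "\<lambda>x. indicator S x *\<^sub>R g x"
  have eq: "AE x in lborel. ?h x = g' x" using ae by eventually_elim (auto simp: indicator_def off)
  have m: "?h \<in> borel_measurable lebesgue" by (rule lebesgue_measurable_AE_eq[OF g' eq])
  have m': "g' \<in> borel_measurable lebesgue" using g' by (intro measurable_completion) simp
  have eq': "AE x in lebesgue. ?h x = g' x" using eq by (simp add: AE_completion_iff)
  show "g \<in> borel_measurable (lebesgue_on S)" using m by (subst borel_measurable_restrict_space_iff[OF S']) simp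
  show "integrable (lebesgue_on S) g \<longleftrightarrow> integrable lborel g'"
    unfolding integrable_restrict_space[OF S'] using integrable_cong_AE[OF m m' eq'] g' by (simp add: integrable_completion)
  show "integral\<^sup>L (lebesgue_on S) g = integral\<^sup>L lborel g'"
    unfolding integral_restrict_space[OF S'] using integral_cong_AE[OF m m' eq'] g' by (simp add: integral_completion)
qed

lemma Borel_representative:
  fixes g :: "'a::euclidean_space \<Rightarrow> real"
  assumes S: "S \<in> sets borel" and g: "g \<in> borel_measurable (lebesgue_on S)"
  shows "\<exists>g'\<in>borel_measurable borel. (\<forall>x. x \<notin> S \<longrightarrow> g' x = 0) \<and> (AE x in lborel. x \<in> S \<longrightarrow> g x = g' x)"
proof -
  have S': "S \<inter> space lebesgue \<in> sets lebesgue" using S by auto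
  have "(\<lambda>x. indicator S x *\<^sub>R g x) \<in> borel_measurable lebesgue" using g by (simp add: borel_measurable_restrict_space_iff[OF S'])
  from completion_ex_borel_measurable_real[of _ lborel, OF this]
  obtain h where [measurable]: "h \<in> borel_measurable borel" and h: "AE x in lborel. indicator S x *\<^sub>R g x = h x" by auto
  show ?thesis
  proof (intro bexI conjI)
    show "(\<lambda>x. indicator S x * h x) \<in> borel_measurable borel" using S by measurable
    show "AE x in lborel. x \<in> S \<longrightarrow> g x = indicator S x * h x" using h by eventually_elim auto
  qed auto
qed

lemma AE_lebesgue_on_iff:
  "S \<in> sets borel \<Longrightarrow> (AE x in lebesgue_on S. P x) \<longleftrightarrow> (AE x in (lborel :: 'a::euclidean_space measure). x \<in> S \<longrightarrow> P x)"
  by (subst AE_restrict_space_iff) (auto simp: AE_completion_iff)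

text \<open>A Borel representative for each t has its own exceptional set. Rational t give a single
  null set, and continuity extends measurability to all t.\<close>

lemma Caratheodory_Borel_modification:
  fixes f :: "'a::euclidean_space \<Rightarrow> real \<Rightarrow> real"
  assumes S: "S \<in> sets borel" and m: "\<And>t. (\<lambda>x. f x t) \<in> borel_measurable (lebesgue_on S)"
    and cont: "\<And>x. x \<in> S \<Longrightarrow> continuous_on UNIV (f x)"
  obtains N where "N \<in> null_sets lborel" "\<And>t. (\<lambda>x. if x \<in> S - N then f x t else 0) \<in> borel_measurable borel"
proof -
  have "\<forall>t. \<exists>g. g \<in> borel_measurable borel \<and> (AE x in lborel. x \<in> S \<longrightarrow> f x t = g x)"
    using Borel_representative[OF S m] by blast
  then obtain g where g: "\<And>t. g t \<in> borel_measurable borel" "\<And>t. AE x in lborel. x \<in> S \<longrightarrow> f x t = g t x"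
    by metis
  note [measurable] = g(1) S
  have "AE x in lborel. \<forall>t\<in>\<rat>. x \<in> S \<longrightarrow> f x t = g t x"
    using g(2) by (intro AE_ball_countable[THEN iffD2] countable_rat ballI)
  then obtain N where N: "{x. \<not> (\<forall>t\<in>\<rat>. x \<in> S \<longrightarrow> f x t = g t x)} \<subseteq> N" "N \<in> null_sets lborel"
    by (auto elim!: AE_E simp: null_sets_def)
  have [measurable]: "N \<in> sets borel" using null_setsD2[OF N(2)] by simp
  have "(\<lambda>x. if x \<in> S - N then f x t else 0) \<in> borel_measurable borel" for t
  proof (rule borel_measurable_LIMSEQ_real)
    let ?q = "\<lambda>n. of_int \<lfloor>real (Suc n) * t\<rfloor> / real (Suc n)"
    have q: "?q n \<in> \<rat>" for n by (intro Rats_divide Rats_of_int Rats_of_nat)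
    fix n
    have "(\<lambda>x. if x \<in> S - N then f x (?q n) else 0) = (\<lambda>x. if x \<in> S - N then g (?q n) x else 0)"
    proof (rule ext)
      fix x
      show "(if x \<in> S - N then f x (?q n) else 0) = (if x \<in> S - N then g (?q n) x else 0)"
      proof (cases "x \<in> S - N")
        case True
        then have "f x (?q n) = g (?q n) x" using N(1) q[of n] by blast
        then show ?thesis by (simp only: True if_True)
      qed (simp only: if_False)
    qed
    then show "(\<lambda>x. if x \<in> S - N then f x (?q n) else 0) \<in> borel_measurable borel" by simp
  next
    fix x
    have "(\<lambda>n. f x (of_int \<lfloor>real (Suc n) * t\<rfloor> / real (Suc n))) \<longlonglongrightarrow> f x t" if "x \<in> S"
    proof (rule isCont_tendsto_compose[OF _ floor_approximation])
      show "isCont (f x) t" using cont[OF that] by (simp add: continuous_on_eq_continuous_at)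
    qed
    then show "(\<lambda>n. if x \<in> S - N then f x (of_int \<lfloor>real (Suc n) * t\<rfloor> / real (Suc n)) else 0) \<longlonglongrightarrow> (if x \<in> S - N then f x t else 0)"
      by auto
  qed
  with N(2) that show thesis by blast
qed

text \<open>The derivative has a known sign only away from 0. On either side of 0 the mean value
  theorem applies; across 0 the values are compared through the sign of g.\<close>

lemma mono_if_sign_condition:
  fixes g :: "real \<Rightarrow> real"
  assumes d: "\<And>t. g differentiable at t" and pos: "\<And>t. t \<noteq> 0 \<Longrightarrow> 0 < t * g t"
    and der: "\<And>t. t \<noteq> 0 \<Longrightarrow> 0 < deriv g t" and g0: "g 0 = 0"
  shows "mono g"
proof (rule monoI)
  fix a b :: real assume ab: "a \<le> b"
  have D: "(g has_real_derivative deriv g t) (at t)" for t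
    using d[of t] by (simp add: DERIV_deriv_iff_real_differentiable)
  consider "0 < a" | "b < 0" | "a \<le> 0" "0 \<le> b" by linarith
  then show "g a \<le> g b"
  proof cases
    case 1
    show ?thesis
      by (rule DERIV_nonneg_imp_nondecreasing[OF ab]) (use D der 1 in \<open>metis less_eq_real_def less_le_trans less_irrefl\<close>)
  next
    case 2
    show ?thesis
      by (rule DERIV_nonneg_imp_nondecreasing[OF ab]) (use D der 2 in \<open>metis less_eq_real_def le_less_trans less_irrefl\<close>)
  next
    case 3
    have "g a \<le> 0" using pos[of a] g0 3 by (cases "a = 0") (auto simp: zero_less_mult_iff)
    moreover have "0 \<le> g b" using pos[of b] g0 3 by (cases "b = 0") (auto simp: zero_less_mult_iff)
    ultimately show ?thesis by linarith
  qed
qed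

lemma integrable_lborel_times:
  fixes f :: "'a::euclidean_space \<Rightarrow> real" and g :: "'b::euclidean_space \<Rightarrow> real"
  assumes f: "integrable lborel f" and g: "integrable lborel g"
  shows "integrable lborel (\<lambda>z. f (fst z) * g (snd z))"
proof (rule integrableI_bounded)
  have [measurable]: "f \<in> borel_measurable borel" "g \<in> borel_measurable borel" using f g by auto
  show "(\<lambda>z. f (fst z) * g (snd z)) \<in> borel_measurable lborel" by measurable
  have "(\<integral>\<^sup>+z. ennreal (norm (f (fst z) * g (snd z))) \<partial>lborel) = (\<integral>\<^sup>+x. \<integral>\<^sup>+y. ennreal (norm (f x)) * ennreal (norm (g y)) \<partial>lborel \<partial>lborel)"
    by (subst nn_integral_lborel_iterated) (auto simp: abs_mult ennreal_mult)
  also have "\<dots> = (\<integral>\<^sup>+x. ennreal (norm (f x)) \<partial>lborel) * (\<integral>\<^sup>+y. ennreal (norm (g y)) \<partial>lborel)"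
    by (simp add: nn_integral_cmult nn_integral_multc)
  also have "\<dots> < \<infinity>" using f g by (simp add: integrable_iff_bounded ennreal_mult_less_top)
  finally show "(\<integral>\<^sup>+z. ennreal (norm (f (fst z) * g (snd z))) \<partial>lborel) < \<infinity>" .
qed

section \<open>Test functions in time\<close>

lemma test_functionD:
  assumes "test_function T \<psi>"
  shows "(\<psi> has_real_derivative deriv \<psi> t) (at t)" "continuous_on UNIV (deriv \<psi>)" "continuous_on UNIV \<psi>"
    "t \<notin> {0<..<T} \<Longrightarrow> \<psi> t = 0"
proof -
  have d: "(deriv ^^ n) \<psi> differentiable_on UNIV" for n using assms by (auto simp: test_function_def)
  have "\<psi> differentiable (at t)" for t using d[of 0] by (simp add: differentiable_on_def)
  then show "(\<psi> has_real_derivative deriv \<psi> t) (at t)"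
    by (simp add: DERIV_deriv_iff_real_differentiable)
  show "continuous_on UNIV (deriv \<psi>)" using d[of 1] by (intro differentiable_imp_continuous_on) simp
  show "continuous_on UNIV \<psi>" using d[of 0] by (intro differentiable_imp_continuous_on) simp
  obtain a b where "0 < a" "b < T" "\<And>t. t \<notin> {a..b} \<Longrightarrow> \<psi> t = 0" using assms by (auto simp: test_function_def)
  then show "t \<notin> {0<..<T} \<Longrightarrow> \<psi> t = 0" by force
qed

lemma test_function_integral:
  assumes \<psi>: "test_function T \<psi>" and a: "0 \<le> a" "a \<le> T"
  shows "integrable lborel (\<lambda>t. indicator {a<..<T} t * deriv \<psi> t)"
    and "(LBINT t. indicator {a<..<T} t * deriv \<psi> t) = - \<psi> a"
proof -
  note D = test_functionD[OF \<psi>]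
  have [measurable]: "deriv \<psi> \<in> borel_measurable borel" using D(2) by (rule borel_measurable_continuous_onI)
  have hi: "(deriv \<psi> has_integral (\<psi> T - \<psi> a)) {a..T}"
    by (rule fundamental_theorem_of_calculus[OF a(2)])
      (use D(1) in \<open>auto simp: has_real_derivative_iff_has_vector_derivative[symmetric] intro: DERIV_subset\<close>)
  have si: "set_integrable lborel {a..T} (deriv \<psi>)"
    by (rule borel_integrable_atLeastAtMost'[OF continuous_on_subset[OF D(2)]]) simp
  have ae: "AE t in lborel. indicator {a..T} t *\<^sub>R deriv \<psi> t = indicator {a<..<T} t * deriv \<psi> t"
    using AE_lborel_singleton[of a] AE_lborel_singleton[of T] by eventually_elim (auto simp: indicator_def)
  have m: "(\<lambda>t. indicator {a..T} t *\<^sub>R deriv \<psi> t) \<in> borel_measurable lborel" "(\<lambda>t. indicator {a<..<T} t * deriv \<psi> t) \<in> borel_measurable lborel"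
    by measurable
  show "integrable lborel (\<lambda>t. indicator {a<..<T} t * deriv \<psi> t)"
    using integrable_cong_AE[OF m ae] si by (simp add: set_integrable_def)
  have "(LINT t:{a..T}|lborel. deriv \<psi> t) = \<psi> T - \<psi> a"
    using set_borel_integral_eq_integral(2)[OF si] integral_unique[OF hi] by simp
  moreover have "\<psi> T = 0" using D(4)[of T] by simp
  ultimately show "(LBINT t. indicator {a<..<T} t * deriv \<psi> t) = - \<psi> a"
    using integral_cong_AE[OF m ae] by (simp add: set_lebesgue_integral_def)
qed

text \<open>Integration by parts as Fubini: for fixed \<tau> the integral of the derivative of
  \<psi> over (\<tau>, T) is -\<psi>(\<tau>), and the constant c drops out because \<psi> vanishes
  at 0.\<close>

lemma test_function_primitive:
  assumes \<psi>: "test_function T \<psi>" and T: "0 < T" and h: "integrable lborel h"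
  shows "integrable lborel (\<lambda>t. indicator {0<..<T} t * (deriv \<psi> t * (c + (LBINT \<tau>. indicator {0..<t} \<tau> * h \<tau>))))"
    and "(LBINT t. indicator {0<..<T} t * (deriv \<psi> t * (c + (LBINT \<tau>. indicator {0..<t} \<tau> * h \<tau>))))
    = - (LBINT t. \<psi> t * h t)"
proof -
  note D = test_functionD[OF \<psi>]
  have [measurable]: "deriv \<psi> \<in> borel_measurable borel" using D(2) by (rule borel_measurable_continuous_onI)
  have [measurable]: "h \<in> borel_measurable borel" using h by auto
  note i0 = test_function_integral[OF \<psi> order_refl less_imp_le[OF T]]
  let ?F = "\<lambda>z :: real \<times> real. (indicator {0<..<T} (fst z) * deriv \<psi> (fst z)) * (indicator {0..<fst z} (snd z) * h (snd z))"
  have ind: "(indicator {0..<fst z} (snd z) :: real) = (if 0 \<le> snd z \<and> snd z < fst z then 1 else 0)" for z :: "real \<times> real"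
    by (auto simp: indicator_def)
  have i: "integrable lborel ?F"
  proof (rule Bochner_Integration.integrable_bound[OF integrable_lborel_times[OF i0(1) h]])
    show "?F \<in> borel_measurable lborel" unfolding ind by measurable
    show "AE z in lborel. norm (?F z) \<le> norm (indicator {0<..<T} (fst z) * deriv \<psi> (fst z) * h (snd z))"
      by (auto simp: indicator_def)
  qed
  have 1: "(LBINT \<tau>. ?F (t, \<tau>)) = (indicator {0<..<T} t * deriv \<psi> t) * (LBINT \<tau>. indicator {0..<t} \<tau> * h \<tau>)" for t
    by simp
  have 2: "(LBINT t. ?F (t, \<tau>)) = - (\<psi> \<tau> * h \<tau>)" for \<tau>
  proof (cases "0 \<le> \<tau> \<and> \<tau> \<le> T")
    case True
    have "(LBINT t. ?F (t, \<tau>)) = (LBINT t. (indicator {\<tau><..<T} t * deriv \<psi> t) * h \<tau>)"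
      using True by (intro Bochner_Integration.integral_cong) (auto simp: indicator_def)
    also have "\<dots> = - (\<psi> \<tau> * h \<tau>)" using test_function_integral(2)[OF \<psi>, of \<tau>] True by simp
    finally show ?thesis .
  next
    case False
    then have "?F (t, \<tau>) = 0" for t by (auto simp: indicator_def)
    then have "(LBINT t. ?F (t, \<tau>)) = (\<integral>t. 0 \<partial>(lborel :: real measure))"
      by (rule Bochner_Integration.integral_cong[OF refl])
    moreover have "\<psi> \<tau> = 0" using False T by (intro D(4)) auto
    ultimately show ?thesis by simp
  qed
  have 3: "indicator {0<..<T} t * (deriv \<psi> t * (c + (LBINT \<tau>. indicator {0..<t} \<tau> * h \<tau>)))
      = c * (indicator {0<..<T} t * deriv \<psi> t) + (LBINT \<tau>. ?F (t, \<tau>))" for t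
    unfolding 1 by (simp only: algebra_simps)
  show "integrable lborel (\<lambda>t. indicator {0<..<T} t * (deriv \<psi> t * (c + (LBINT \<tau>. indicator {0..<t} \<tau> * h \<tau>))))"
    unfolding 3 by (intro Bochner_Integration.integrable_add integrable_mult_right i0(1) lborel_Fubini(2)[OF i])
  have "(LBINT t. indicator {0<..<T} t * (deriv \<psi> t * (c + (LBINT \<tau>. indicator {0..<t} \<tau> * h \<tau>))))
      = (LBINT t. c * (indicator {0<..<T} t * deriv \<psi> t) + (LBINT \<tau>. ?F (t, \<tau>)))"
    unfolding 3 ..
  also have "\<dots> = c * (LBINT t. indicator {0<..<T} t * deriv \<psi> t) + (LBINT t. (LBINT \<tau>. ?F (t, \<tau>)))"
    by (subst Bochner_Integration.integral_add[OF integrable_mult_right[OF i0(1)] lborel_Fubini(2)[OF i]]) (simp del: fst_conv snd_conv)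
  also have "(LBINT t. (LBINT \<tau>. ?F (t, \<tau>))) = (LBINT \<tau>. (LBINT t. ?F (t, \<tau>)))"
    using lborel_Fubini(3,6)[OF i] by simp
  finally show "(LBINT t. indicator {0<..<T} t * (deriv \<psi> t * (c + (LBINT \<tau>. indicator {0..<t} \<tau> * h \<tau>))))
    = - (LBINT t. \<psi> t * h t)" unfolding 2 using i0(2) D(4)[of 0] by simp
qed

section \<open>The function spaces in terms of Borel representatives\<close>

context subcritical_domain
begin

lemma Qset_borel: "Qset \<Omega> \<in> sets borel"
proof -
  have "closed ((- \<Omega>) \<times> (- \<Omega>))" using open_dom by (intro closed_Times) auto
  then show ?thesis unfolding Qset_def by auto
qed

lemma dK_off: "w \<in> X \<Longrightarrow> z \<notin> Qset \<Omega> \<Longrightarrow> dK w z = 0"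
  by (cases z) (auto simp: Qset_def dK_def X_off)

lemma AE_dK_eq:
  assumes "AE x in lborel. w x = w' x"
  shows "AE z in lborel. (w (fst z) - w (snd z)) / norm (fst z - snd z) powr (real DIM('a) + s) = dK w' z"
  using AE_lborel_fst_snd[OF assms] by eventually_elim (auto simp: dK_def K_def dim)

text \<open>Equality of functions almost everywhere gives equality of differences for almost all
  pairs, and \<open>dK w'\<close> vanishes off \<open>Qset \<Omega>\<close>, so the integral extends
  to all pairs.\<close>

lemma W0_norm_transfer:
  assumes w': "w' \<in> X" and ae: "AE x in lborel. w x = w' x"
  shows "integrable (lebesgue_on (Qset \<Omega>)) (\<lambda>(x, y). \<bar>w x - w y\<bar> / norm (x - y) powr (real DIM('a) + s)) \<longleftrightarrow> integrable lborel (dK w')"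
    and "W0_norm s \<Omega> w = (LBINT z. \<bar>dK w' z\<bar>)"
proof -
  have [measurable]: "w' \<in> borel_measurable borel" using w' by measurable
  have m: "dK w' \<in> borel_measurable borel" by measurable
  have m': "(\<lambda>z. \<bar>dK w' z\<bar>) \<in> borel_measurable borel" by measurable
  have e: "AE z in lborel. z \<in> Qset \<Omega> \<longrightarrow> (case z of (x, y) \<Rightarrow> \<bar>w x - w y\<bar> / norm (x - y) powr (real DIM('a) + s)) = \<bar>dK w' z\<bar>"
    using AE_dK_eq[OF ae]
  proof eventually_elim
    case (elim z)
    show ?case unfolding elim[symmetric] by (auto simp: case_prod_beta' abs_divide)
  qed
  have off: "\<bar>dK w' z\<bar> = 0" if "z \<notin> Qset \<Omega>" for z using dK_off[OF w' that] by simp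
  note tr = lebesgue_on_transfer[OF Qset_borel m' off e]
  show "integrable (lebesgue_on (Qset \<Omega>)) (\<lambda>(x, y). \<bar>w x - w y\<bar> / norm (x - y) powr (real DIM('a) + s)) \<longleftrightarrow> integrable lborel (dK w')"
    using tr(2) m by (simp add: integrable_abs_iff)
  show "W0_norm s \<Omega> w = (LBINT z. \<bar>dK w' z\<bar>)" unfolding W0_norm_def using tr(3) .
qed

lemma W0_representative:
  assumes w: "w \<in> W0 s \<Omega>"
  obtains w' where "w' \<in> D" "AE x in lborel. w x = w' x"
proof -
  have w1: "w \<in> borel_measurable (lebesgue_on \<Omega>)" and w2: "AE x in lborel. x \<notin> \<Omega> \<longrightarrow> w x = 0"
    and w3: "integrable (lebesgue_on (Qset \<Omega>)) (\<lambda>(x, y). \<bar>w x - w y\<bar> / norm (x - y) powr (real DIM('a) + s))"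
    using w by (auto simp: W0_def AE_completion_iff)
  obtain w' where w': "w' \<in> borel_measurable borel" "\<forall>x. x \<notin> \<Omega> \<longrightarrow> w' x = 0" "AE x in lborel. x \<in> \<Omega> \<longrightarrow> w x = w' x"
    using Borel_representative[OF dom_measurable w1] by blast
  have X: "w' \<in> X" using w' by (auto simp: X_def)
  have ae: "AE x in lborel. w x = w' x" using w2 w'(3) by eventually_elim (use w'(2) in auto)
  have "w' \<in> D" using W0_norm_transfer(1)[OF X ae] w3 X by (simp add: D_iff)
  then show thesis using ae that by blast
qed

lemma X_lebesgue_on:
  assumes w: "w \<in> X"
  shows "w \<in> borel_measurable (lebesgue_on \<Omega>)" "integrable (lebesgue_on \<Omega>) w \<longleftrightarrow> integrable lborel w"
    "integral\<^sup>L (lebesgue_on \<Omega>) w = integral\<^sup>L lborel w"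
  by (rule lebesgue_on_transfer[where g' = w, OF dom_measurable X_measurable[OF w] X_off[OF w]]; simp)+

lemma D_W0: "w \<in> D \<Longrightarrow> w \<in> W0 s \<Omega>"
  using W0_norm_transfer(1)[of w w] X_integrable[OF D_X D_square_integrable, of w] X_off[OF D_X, of w]
    X_lebesgue_on(2)[OF D_X, of w]
  by (auto simp: W0_def D_iff)

lemma D_W0_norm: "w \<in> D \<Longrightarrow> W0_norm s \<Omega> w = (LBINT z. \<bar>dK w z\<bar>)"
  using W0_norm_transfer(2)[of w w] by (simp add: D_X)

lemma kernel_integral_transfer:
  assumes h: "h \<in> borel_measurable borel" and \<phi>: "\<phi>' \<in> D" "AE x in lborel. \<phi> x = \<phi>' x"
  shows "(\<integral>(x, y). h (x, y) * ((\<phi> x - \<phi> y) / norm (x - y) powr (real DIM('a) + s)) \<partial>lebesgue_on (Qset \<Omega>))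
    = (LBINT p. h p * dK \<phi>' p)"
proof (rule lebesgue_on_transfer(3)[OF Qset_borel])
  have [measurable]: "\<phi>' \<in> borel_measurable borel" using \<phi>(1) by (rule D_measurable)
  show "(\<lambda>p. h p * dK \<phi>' p) \<in> borel_measurable borel" using h by measurable
  show "h p * dK \<phi>' p = 0" if "p \<notin> Qset \<Omega>" for p using dK_off[OF D_X[OF \<phi>(1)] that] by simp
  show "AE z in lborel. z \<in> Qset \<Omega> \<longrightarrow>
      (case z of (x, y) \<Rightarrow> h (x, y) * ((\<phi> x - \<phi> y) / norm (x - y) powr (real DIM('a) + s))) = h z * dK \<phi>' z"
    using AE_dK_eq[OF \<phi>(2)]
  proof eventually_elim
    case (elim z)
    show ?case unfolding elim[symmetric] by (simp add: case_prod_beta')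
  qed
qed

lemma X_powr: "w \<in> X \<Longrightarrow> (\<lambda>x. \<bar>w x\<bar> powr p) \<in> X"
  by (auto simp: X_def)

lemma X_Lp_space: "w \<in> X \<Longrightarrow> w \<in> Lp_space p \<Omega> \<longleftrightarrow> integrable lborel (\<lambda>x. \<bar>w x\<bar> powr p)"
  using X_lebesgue_on(1)[of w] X_lebesgue_on(2)[OF X_powr, of w p] by (simp add: Lp_space_def)

lemma X_Lp_norm: "w \<in> X \<Longrightarrow> Lp_norm p \<Omega> w = (LBINT x. \<bar>w x\<bar> powr p) powr (1 / p)"
  using X_lebesgue_on(3)[OF X_powr, of w p] by (simp add: Lp_norm_def)

lemma X_L2_space: "w \<in> X \<Longrightarrow> L2 w \<Longrightarrow> w \<in> Lp_space 2 \<Omega>"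
  by (simp add: X_Lp_space square_integrable_def)

lemma X_L2_norm: "w \<in> X \<Longrightarrow> Lp_norm 2 \<Omega> w = sqrt (nsq lborel w)"
  by (simp add: X_Lp_norm nsq_def powr_half_sqrt)

lemma L2_representative:
  assumes "w \<in> Lp_space 2 \<Omega>"
  obtains w' where "w' \<in> X" "L2 w'" "AE x in lborel. x \<in> \<Omega> \<longrightarrow> w x = w' x"
proof -
  have m: "w \<in> borel_measurable (lebesgue_on \<Omega>)" and i: "integrable (lebesgue_on \<Omega>) (\<lambda>x. (w x)\<^sup>2)"
    using assms by (auto simp: Lp_space_def)
  obtain w' where w': "w' \<in> borel_measurable borel" "\<forall>x. x \<notin> \<Omega> \<longrightarrow> w' x = 0" "AE x in lborel. x \<in> \<Omega> \<longrightarrow> w x = w' x"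
    using Borel_representative[OF dom_measurable m] by blast
  have "integrable lborel (\<lambda>x. (w' x)\<^sup>2)"
  proof (rule iffD1[OF lebesgue_on_transfer(2)[OF dom_measurable] i])
    show "AE x in lborel. x \<in> \<Omega> \<longrightarrow> (w x)\<^sup>2 = (w' x)\<^sup>2" using w'(3) by eventually_elim auto
  qed (use w' in auto)
  then show thesis using w' by (intro that[of w']) (auto simp: X_def square_integrable_def)
qed

lemma integral_dom_transfer:
  assumes g: "g \<in> X" and w': "w' \<in> X" "AE x in lborel. x \<in> \<Omega> \<longrightarrow> w x = w' x"
  shows "(\<integral>x. g x * w x \<partial>lebesgue_on \<Omega>) = (LBINT x. g x * w' x)"
proof (rule lebesgue_on_transfer(3)[OF dom_measurable])
  have [measurable]: "g \<in> borel_measurable borel" "w' \<in> borel_measurable borel" using g w'(1) by measurable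
  show "(\<lambda>x. g x * w' x) \<in> borel_measurable borel" by measurable
  show "AE x in lborel. x \<in> \<Omega> \<longrightarrow> g x * w x = g x * w' x" using w'(2) by eventually_elim auto
qed (simp add: X_off[OF g])

end

section \<open>The strong solution\<close>

lemma measurable_lebesgue_onI: "h \<in> borel_measurable borel \<Longrightarrow> h \<in> borel_measurable (lebesgue_on S)"
  by (intro measurable_restrict_space1 measurable_completion) simp

lemma simple_function_lebesgue_on:
  assumes "g \<in> measurable borel (count_space UNIV)" "finite (g ` S)"
  shows "simple_function (lebesgue_on S) g"
  unfolding simple_function_eq_measurable
  using assms by (auto intro!: measurable_restrict_space1 measurable_completion)

text \<open>The values are functions of x, so the sum is assembled by pairing and composing instead
  of by arithmetic on real-valued simple functions.\<close>

lemma simple_function_weighted_sum: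
  fixes c :: "nat \<Rightarrow> 'b \<Rightarrow> 'a \<Rightarrow> real"
  assumes "\<And>k. simple_function M (c k)"
  shows "simple_function M (\<lambda>t x. \<Sum>k<n. l k * c k t x)"
proof (induction n)
  case 0
  show ?case by simp
next
  case (Suc n)
  have "simple_function M ((\<lambda>p x. fst p x + l n * snd p x) \<circ> (\<lambda>t. ((\<lambda>x. \<Sum>k<n. l k * c k t x), c n t)))"
    by (intro simple_function_compose simple_function_Pair Suc assms)
  then show ?case by (simp add: o_def)
qed

context flow_limit
begin

lemma u_W0: "t \<in> {0..T} \<Longrightarrow> u t \<in> W0 s \<Omega> \<inter> Lp_space 2 \<Omega>"
  using D_W0[OF u_D] X_L2_space[OF u_X D_square_integrable[OF u_D]] by blast

lemma u_diff_norm: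
  assumes "a \<in> {0..T}" "b \<in> {0..T}"
  shows "W0_norm s \<Omega> (\<lambda>x. u a x - u b x) = (LBINT z. \<bar>dK (\<lambda>x. u a x - u b x) z\<bar>)"
    "Lp_norm 2 \<Omega> (\<lambda>x. u a x - u b x) = sqrt (nsq lborel (\<lambda>x. u a x - u b x))"
  using D_W0_norm[OF D_diff[OF u_D u_D]] X_L2_norm[OF X_diff[OF u_X u_X]] assms by auto

text \<open>The simple approximants sample u at the floor times \<lfloor>(n+1) t\<rfloor> / (n+1),
  which stay in [0, T). Strong continuity in the seminorm makes them converge at every t.\<close>

lemma u_Bochner_Linf:
  "u \<in> Bochner_Linf T (W0 s \<Omega> \<inter> Lp_space 2 \<Omega>) (\<lambda>v. W0_norm s \<Omega> v + Lp_norm 2 \<Omega> v)"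
proof -
  have S: "{0<..<T} \<in> sets borel" by simp
  let ?g = "\<lambda>n t. \<lfloor>real (Suc n) * t\<rfloor>"
  let ?a = "\<lambda>n t. of_int (?g n t) / real (Suc n)"
  have a: "?a n t \<in> {0..<T}" if "t \<in> {0<..<T}" for n t
  proof -
    have "of_int (?g n t) \<le> real (Suc n) * t" by (rule of_int_floor_le)
    then have "?a n t \<le> t" by (simp add: divide_le_eq mult.commute)
    moreover have "0 \<le> ?g n t" using that by simp
    then have "0 \<le> ?a n t" by simp
    ultimately show ?thesis using that by auto
  qed
  have "strongly_measurable T (W0 s \<Omega> \<inter> Lp_space 2 \<Omega>) (\<lambda>v. W0_norm s \<Omega> v + Lp_norm 2 \<Omega> v) u"
    unfolding strongly_measurable_def
  proof (intro exI[of _ "\<lambda>n t. u (?a n t)"] conjI allI ballI)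
    fix n
    have "simple_function (lebesgue_on {0<..<T}) (?g n)"
    proof (rule simple_function_lebesgue_on)
      have "?g n t \<in> {0..\<lfloor>real (Suc n) * T\<rfloor>}" if "t \<in> {0<..<T}" for t
        using that by (auto intro!: floor_mono mult_left_mono simp del: of_nat_Suc)
      then have "?g n ` {0<..<T} \<subseteq> {0..\<lfloor>real (Suc n) * T\<rfloor>}" by blast
      then show "finite (?g n ` {0<..<T})" by (rule finite_subset) simp
    qed measurable
    from simple_function_compose[OF this, of "\<lambda>k. u (of_int k / real (Suc n))"]
    show "simple_function (lebesgue_on {0<..<T}) (\<lambda>t. u (?a n t))" by (simp add: o_def)
    show "u (?a n t) \<in> W0 s \<Omega> \<inter> Lp_space 2 \<Omega>" if "t \<in> {0<..<T}" for t
    proof (rule u_W0)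
      show "?a n t \<in> {0..T}" using a[OF that, of n] by simp
    qed
  next
    have "(\<lambda>n. W0_norm s \<Omega> (\<lambda>x. u (?a n t) x - u t x) + Lp_norm 2 \<Omega> (\<lambda>x. u (?a n t) x - u t x)) \<longlonglongrightarrow> 0" if t: "t \<in> {0<..<T}" for t
    proof -
      have t0: "t \<in> {0..<T}" "t \<in> {0..T}" using t by auto
      have at: "?a n t \<in> {0..T}" for n using a[OF t, of n] by auto
      note lim = u_strongly_continuous[OF a[OF t] t0(1) floor_approximation]
      have "(\<lambda>n. (LBINT z. \<bar>dK (\<lambda>x. u (?a n t) x - u t x) z\<bar>) + sqrt (nsq lborel (\<lambda>x. u (?a n t) x - u t x))) \<longlonglongrightarrow> 0 + sqrt 0"
        by (intro tendsto_add tendsto_real_sqrt lim)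
      then show ?thesis unfolding u_diff_norm[OF at t0(2)] by simp
    qed
    then show "AE t in lebesgue_on {0<..<T}. (\<lambda>n. W0_norm s \<Omega> (\<lambda>x. u (?a n t) x - u t x) + Lp_norm 2 \<Omega> (\<lambda>x. u (?a n t) x - u t x)) \<longlonglongrightarrow> 0"
      by (intro AE_I2) simp
  qed
  moreover obtain B where B: "0 \<le> B" "\<And>w. w \<in> X \<Longrightarrow> J w \<le> ennreal M0 \<Longrightarrow> L2 w \<and> nsq lborel w \<le> B"
    by (rule L2_bound_of_J[OF M0_nonneg]) blast
  have "W0_norm s \<Omega> (u t) + Lp_norm 2 \<Omega> (u t) \<le> M0 + sqrt B" if t: "t \<in> {0..T}" for t
    using JJ_bound[OF t] D_W0_norm[OF u_D[OF t]] X_L2_norm[OF u_X] B(2)[OF u_X u_J[OF t]]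
    by (auto simp: JJ_def intro!: add_mono)
  ultimately show ?thesis unfolding Bochner_Linf_def
    using u_W0 by (auto intro!: AE_I2 exI[of _ "M0 + sqrt B"])
qed

lemma slice_X: "(\<lambda>x. v (t, x)) \<in> X"
  using measurable_compose[OF Pair_measurable_borel(1) v_measurable] by (auto simp: X_def v_off)

lemma Vn_slice_X: "(\<lambda>x. Vn n (t, x)) \<in> X"
proof -
  have "vn k t \<in> X" for k
    unfolding vn_def using X_scale[OF X_diff[OF D_X[OF U_D] D_X[OF U_D]], of "1 / hn k"] by (simp add: dU_def del: U.simps)
  then have "(\<lambda>x. cut (vn k) (t, x)) \<in> X" for k unfolding cut_def by (simp add: X_scale)
  then show ?thesis unfolding Vn_def X_def by auto
qed

text \<open>The averaged quotients of the scheme are already simple in time, and their slices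
  converge in L2 for almost every t along one subsequence.\<close>

lemma v_Bochner_L2: "(\<lambda>t x. v (t, x)) \<in> Bochner_L2 T (Lp_space 2 \<Omega>) (Lp_norm 2 \<Omega>)"
proof -
  have S: "{0<..<T} \<in> sets borel" by simp
  obtain \<rho> :: "nat \<Rightarrow> nat" where \<rho>: "AE t in lborel. (\<lambda>n. nsq lborel (\<lambda>x. Vn (\<rho> n) (t, x) - v (t, x))) \<longlonglongrightarrow> 0"
    by (rule slices_converge) blast
  have "strongly_measurable T (Lp_space 2 \<Omega>) (Lp_norm 2 \<Omega>) (\<lambda>t x. v (t, x))"
    unfolding strongly_measurable_def
  proof (intro exI[of _ "\<lambda>n t x. Vn (\<rho> n) (t, x)"] conjI allI ballI)
    fix n
    have "simple_function (lebesgue_on {0<..<T}) (idx k)" for k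
    proof (rule simple_function_lebesgue_on)
      have "idx k ` {0<..<T} \<subseteq> {..<Suc k}" using idx_less[of _ k] by auto
      then show "finite (idx k ` {0<..<T})" by (rule finite_subset) simp
    qed measurable
    then have "simple_function (lebesgue_on {0<..<T}) (vn k)" for k
      using simple_function_compose[of _ "idx k" "\<lambda>i x. dU k i x / hn k"] by (simp add: o_def vn_def[abs_def])
    then have "simple_function (lebesgue_on {0<..<T}) (\<lambda>t x. \<Sum>k<N (\<rho> n). l (\<rho> n) k * vn (\<sigma> k) t x)"
      by (rule simple_function_weighted_sum)
    also have "?this \<longleftrightarrow> simple_function (lebesgue_on {0<..<T}) (\<lambda>t x. Vn (\<rho> n) (t, x))"
      by (rule simple_function_cong) (auto simp: Vn_def cut_def)
    finally show "simple_function (lebesgue_on {0<..<T}) (\<lambda>t x. Vn (\<rho> n) (t, x))" .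
    show "(\<lambda>x. Vn (\<rho> n) (t, x)) \<in> Lp_space 2 \<Omega>" if t: "t \<in> {0<..<T}" for t
    proof (rule X_L2_space[OF Vn_slice_X])
      have "L2 (vn k t)" for k
        using square_integrable_scale[OF dU_square_integrable, of "1 / hn k"] by (simp add: vn_def[abs_def])
      then have "L2 (\<lambda>x. \<Sum>k<N (\<rho> n). l (\<rho> n) k * vn (\<sigma> k) t x)"
        by (rule square_integrable_sum[where f = "\<lambda>k. vn (\<sigma> k) t"])
      then show "L2 (\<lambda>x. Vn (\<rho> n) (t, x))" using t by (simp add: Vn_def cut_def)
    qed
  next
    show "AE t in lebesgue_on {0<..<T}. (\<lambda>n. Lp_norm 2 \<Omega> (\<lambda>x. Vn (\<rho> n) (t, x) - v (t, x))) \<longlonglongrightarrow> 0"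
      unfolding AE_lebesgue_on_iff[OF S] using \<rho>
    proof eventually_elim
      case (elim t)
      have "(\<lambda>n. sqrt (nsq lborel (\<lambda>x. Vn (\<rho> n) (t, x) - v (t, x)))) \<longlonglongrightarrow> sqrt 0" by (rule tendsto_real_sqrt[OF elim])
      then show ?case unfolding X_L2_norm[OF X_diff[OF Vn_slice_X slice_X]] by simp
    qed
  qed
  moreover have "AE t in lebesgue_on {0<..<T}. (\<lambda>x. v (t, x)) \<in> Lp_space 2 \<Omega>"
    unfolding AE_lebesgue_on_iff[OF S] using square_integrable_Fubini(1)[OF v]
    by eventually_elim (simp add: X_L2_space[OF slice_X])
  moreover have "integrable (lebesgue_on {0<..<T}) (\<lambda>t. (Lp_norm 2 \<Omega> (\<lambda>x. v (t, x)))\<^sup>2)"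
  proof (rule iffD2[OF lebesgue_on_transfer(2)[where g' = "\<lambda>t. indicator {0<..<T} t * nsq lborel (\<lambda>x. v (t, x))", OF S]])
    have i: "integrable lborel (\<lambda>t. nsq lborel (\<lambda>x. v (t, x)))" by (rule square_integrable_Fubini(2)[OF v])
    then have [measurable]: "(\<lambda>t. nsq lborel (\<lambda>x. v (t, x))) \<in> borel_measurable borel" by auto
    show "(\<lambda>t. indicator {0<..<T} t * nsq lborel (\<lambda>x. v (t, x))) \<in> borel_measurable borel" by measurable
    show "integrable lborel (\<lambda>t. indicator {0<..<T} t * nsq lborel (\<lambda>x. v (t, x)))"
      using integrable_mult_indicator[OF _ i, of "{0<..<T}"] by simp
  qed (auto simp: X_L2_norm[OF slice_X])
  ultimately show ?thesis by (simp add: Bochner_L2_def)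
qed

text \<open>The closed interval of the definition and the half-open one of the energy identity
  differ by the null set {b}.\<close>

lemma dissipation:
  assumes b: "0 \<le> b"
  shows "(\<integral>\<tau>. (Lp_norm 2 \<Omega> (\<lambda>x. v (\<tau>, x)))\<^sup>2 \<partial>lebesgue_on {0..b}) = (LBINT z. indicator {0..<b} (fst z) * (v z)\<^sup>2)"
proof -
  let ?F = "\<lambda>z :: real \<times> 'a. indicator {0..<b} (fst z) * v z"
  have F: "L2 ?F" by (rule square_integrable_slab[OF v]) simp
  have e: "nsq lborel (\<lambda>x. ?F (\<tau>, x)) = indicator {0..<b} \<tau> * nsq lborel (\<lambda>x. v (\<tau>, x))" for \<tau>
    by (auto simp: nsq_def indicator_def)
  have "integrable lborel (\<lambda>\<tau>. nsq lborel (\<lambda>x. ?F (\<tau>, x)))" by (rule square_integrable_Fubini(2)[OF F])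
  then have m: "(\<lambda>\<tau>. nsq lborel (\<lambda>x. ?F (\<tau>, x))) \<in> borel_measurable borel" by auto
  have "(\<integral>\<tau>. (Lp_norm 2 \<Omega> (\<lambda>x. v (\<tau>, x)))\<^sup>2 \<partial>lebesgue_on {0..b}) = (LBINT \<tau>. nsq lborel (\<lambda>x. ?F (\<tau>, x)))"
  proof (rule lebesgue_on_transfer(3)[OF _ m])
    show "nsq lborel (\<lambda>x. ?F (\<tau>, x)) = 0" if "\<tau> \<notin> {0..b}" for \<tau>
    proof -
      have "\<tau> \<notin> {0..<b}" using that by auto
      then show ?thesis unfolding e by simp
    qed
    show "AE \<tau> in lborel. \<tau> \<in> {0..b} \<longrightarrow> (Lp_norm 2 \<Omega> (\<lambda>x. v (\<tau>, x)))\<^sup>2 = nsq lborel (\<lambda>x. ?F (\<tau>, x))"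
      unfolding e X_L2_norm[OF slice_X] using AE_lborel_singleton[of b] by eventually_elim auto
  qed simp
  also have "\<dots> = nsq lborel ?F" by (rule square_integrable_Fubini(3)[OF F])
  also have "\<dots> = (LBINT z. indicator {0..<b} (fst z) * (v z)\<^sup>2)"
    unfolding nsq_def by (intro Bochner_Integration.integral_cong) (auto simp: indicator_def)
  finally show ?thesis .
qed

text \<open>Cauchy-Schwarz on \<Omega> and the L2 Holder bound give continuity in L1. Differences
  have seminorm at most 2 \<open>M0\<close>, so interpolation lifts this to every subcritical
  exponent.\<close>

lemma u_continuous_into_Lp:
  assumes \<kappa>: "1 \<le> \<kappa>" "\<kappa> < pstar"
  shows "continuous_into_Lp T \<kappa> \<Omega> u"
  unfolding continuous_into_Lp_def
proof (intro ballI conjI)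
  fix t assume t: "t \<in> {0..T}"
  have \<kappa>0: "0 < \<kappa>" using \<kappa> by simp
  have int: "integrable lborel (\<lambda>x. \<bar>w x\<bar> powr \<kappa>)" if w: "w \<in> X" "J w \<le> ennreal M" "0 \<le> M" for w M
  proof (rule integrableI_bounded)
    have [measurable]: "w \<in> borel_measurable borel" using w(1) by measurable
    show "(\<lambda>x. \<bar>w x\<bar> powr \<kappa>) \<in> borel_measurable lborel" by measurable
    obtain B where "0 \<le> B" "\<And>u. u \<in> X \<Longrightarrow> J u \<le> ennreal M \<Longrightarrow> (\<integral>\<^sup>+x. ennreal (\<bar>u x\<bar> powr \<kappa>) \<partial>lborel) \<le> ennreal B"
      by (rule subcritical_embedding[OF \<kappa>0 \<kappa>(2) w(3)]) blast
    then have "(\<integral>\<^sup>+x. ennreal (\<bar>w x\<bar> powr \<kappa>) \<partial>lborel) \<le> ennreal B" using w by blast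
    then show "(\<integral>\<^sup>+x. ennreal (norm (\<bar>w x\<bar> powr \<kappa>)) \<partial>lborel) < \<infinity>"
      using order.strict_trans1[OF _ ennreal_less_top] by simp
  qed
  show "u t \<in> Lp_space \<kappa> \<Omega>" unfolding X_Lp_space[OF u_X] by (rule int[OF u_X u_J[OF t] M0_nonneg])
  let ?d = "\<lambda>\<tau> x. u \<tau> x - u t x"
  have dX: "?d \<tau> \<in> X" for \<tau> by (intro X_diff u_X)
  have dJ: "J (?d \<tau>) \<le> ennreal (2 * M0)" if "\<tau> \<in> {0..T}" for \<tau>
  proof -
    have "J (?d \<tau>) \<le> J (u \<tau>) + J (u t)" by (rule J_diff_le[OF u_X u_X])
    also have "\<dots> \<le> ennreal M0 + ennreal M0" by (intro add_mono u_J that t)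
    finally show ?thesis using M0_nonneg by (simp flip: ennreal_plus)
  qed
  let ?c = "sqrt (nsq lborel (indicator \<Omega> :: 'a \<Rightarrow> real))"
  have L1: "(\<integral>\<^sup>+x. ennreal \<bar>?d \<tau> x\<bar> \<partial>lborel) \<le> ennreal (?c * sqrt (\<bar>\<tau> - t\<bar> * nsq lborel v))" if \<tau>: "\<tau> \<in> {0..T}" for \<tau>
  proof -
    have sq: "L2 (?d \<tau>)" by (intro square_integrable_diff D_square_integrable u_D \<tau> t)
    have sq': "L2 (\<lambda>x. \<bar>?d \<tau> x\<bar>)" using sq by (auto simp: square_integrable_def)
    have si: "L2 (indicator \<Omega> :: 'a \<Rightarrow> real)"
    proof -
      have "(\<lambda>x :: 'a. (indicator \<Omega> x)\<^sup>2 :: real) = indicator \<Omega>" by (auto simp: indicator_def)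
      then show ?thesis using dom_finite by (simp add: square_integrable_def integrable_indicator_iff)
    qed
    have i: "integrable lborel (?d \<tau>)" by (rule X_integrable[OF dX sq])
    have "(\<integral>\<^sup>+x. ennreal \<bar>?d \<tau> x\<bar> \<partial>lborel) = ennreal (LBINT x. \<bar>?d \<tau> x\<bar>)"
      using i by (intro nn_integral_eq_integral) auto
    also have "(LBINT x. \<bar>?d \<tau> x\<bar>) = (LBINT x. indicator \<Omega> x * \<bar>?d \<tau> x\<bar>)"
      by (intro Bochner_Integration.integral_cong) (auto simp: indicator_def X_off[OF u_X])
    also have "ennreal \<dots> \<le> ennreal (?c * sqrt (nsq lborel (\<lambda>x. \<bar>?d \<tau> x\<bar>)))"
      using Cauchy_Schwarz_nsq[OF si sq'] by (intro ennreal_leI) linarith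
    also have "\<dots> \<le> ennreal (?c * sqrt (\<bar>\<tau> - t\<bar> * nsq lborel v))"
      using u_time_abs[OF t \<tau>] by (intro ennreal_leI mult_left_mono real_sqrt_le_mono) (simp_all add: nsq_def)
    finally show ?thesis .
  qed
  have "((\<lambda>\<tau>. ?c * sqrt (\<bar>\<tau> - t\<bar> * nsq lborel v)) \<longlongrightarrow> ?c * sqrt (\<bar>t - t\<bar> * nsq lborel v)) (at t within {0..T})"
    by (intro tendsto_intros)
  then have c0: "((\<lambda>\<tau>. ?c * sqrt (\<bar>\<tau> - t\<bar> * nsq lborel v)) \<longlongrightarrow> 0) (at t within {0..T})" by simp
  have "((\<lambda>\<tau>. LBINT x. \<bar>?d \<tau> x\<bar> powr \<kappa>) \<longlongrightarrow> 0) (at t within {0..T})"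
  proof (rule tendstoI)
    fix e :: real assume e: "0 < e"
    have M: "0 \<le> 2 * M0" using M0_nonneg by simp
    have e2: "0 < e / 2" using e by simp
    obtain \<delta> where \<delta>: "0 < \<delta>" "\<And>u. u \<in> X \<Longrightarrow> J u \<le> ennreal (2 * M0) \<Longrightarrow> (\<integral>\<^sup>+x. ennreal \<bar>u x\<bar> \<partial>lborel) \<le> ennreal \<delta> \<Longrightarrow>
      (\<integral>\<^sup>+x. ennreal (\<bar>u x\<bar> powr \<kappa>) \<partial>lborel) \<le> ennreal (e / 2)"
      by (rule interpolation_to_zero[OF \<kappa> M e2]) blast
    have "\<forall>\<^sub>F \<tau> in at t within {0..T}. ?c * sqrt (\<bar>\<tau> - t\<bar> * nsq lborel v) < \<delta>"
      using c0 \<delta>(1) by (rule order_tendstoD(2))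
    moreover have "\<forall>\<^sub>F \<tau> in at t within {0..T}. \<tau> \<in> {0..T}" by (simp add: eventually_at_filter)
    ultimately show "\<forall>\<^sub>F \<tau> in at t within {0..T}. dist (LBINT x. \<bar>?d \<tau> x\<bar> powr \<kappa>) 0 < e"
    proof eventually_elim
      case (elim \<tau>)
      have "(\<integral>\<^sup>+x. ennreal \<bar>?d \<tau> x\<bar> \<partial>lborel) \<le> ennreal \<delta>"
        using L1[OF elim(2)] ennreal_leI[OF less_imp_le[OF elim(1)]] by (rule order_trans)
      then have "(\<integral>\<^sup>+x. ennreal (\<bar>?d \<tau> x\<bar> powr \<kappa>) \<partial>lborel) \<le> ennreal (e / 2)"
        by (rule \<delta>(2)[OF dX dJ[OF elim(2)]])
      moreover have "(\<integral>\<^sup>+x. ennreal (\<bar>?d \<tau> x\<bar> powr \<kappa>) \<partial>lborel) = ennreal (LBINT x. \<bar>?d \<tau> x\<bar> powr \<kappa>)"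
        by (rule nn_integral_eq_integral[OF int[OF dX dJ[OF elim(2)] M]]) simp
      ultimately have "(LBINT x. \<bar>?d \<tau> x\<bar> powr \<kappa>) \<le> e / 2" using e by simp
      moreover have "0 \<le> (LBINT x. \<bar>?d \<tau> x\<bar> powr \<kappa>)" by simp
      ultimately show ?case using e by (simp add: dist_real_def)
    qed
  qed
  then have "((\<lambda>\<tau>. (LBINT x. \<bar>?d \<tau> x\<bar> powr \<kappa>) powr (1 / \<kappa>)) \<longlongrightarrow> 0) (at t within {0..T})"
    by (rule tendsto_zero_powrI[where b = "1 / \<kappa>"]) (use \<kappa>0 in auto)
  then show "((\<lambda>\<tau>. Lp_norm \<kappa> \<Omega> (?d \<tau>)) \<longlongrightarrow> 0) (at t within {0..T})"
    unfolding X_Lp_norm[OF dX] .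
qed

text \<open>Pairing with a fixed w reduces the identity to the scalar function c + integral of h,
  where h is the pairing of v with w; Fubini moves the pairing inside the time integral.\<close>

lemma u_weak_time_derivative: "weak_time_derivative T \<Omega> u (\<lambda>t x. v (t, x))"
  unfolding weak_time_derivative_def
proof (intro allI impI)
  fix \<psi> w assume \<psi>: "test_function T \<psi>" and "w \<in> Lp_space 2 \<Omega>"
  then obtain w' where w': "w' \<in> X" "L2 w'" "AE x in lborel. x \<in> \<Omega> \<longrightarrow> w x = w' x"
    using L2_representative by blast
  have S: "{0<..<T} \<in> sets borel" by simp
  have [measurable]: "w' \<in> borel_measurable borel" using w'(1) by measurable
  have [measurable]: "\<psi> \<in> borel_measurable borel" using test_functionD(3)[OF \<psi>] by (rule borel_measurable_continuous_onI)
  define h where "h \<tau> = (LBINT x. v (\<tau>, x) * w' x)" for \<tau>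
  define c where "c = (LBINT x. u0 x * w' x)"
  have sw: "L2 (cut (\<lambda>_. w'))"
    by (rule cut_slices(1)[OF cut_measurable nsq_nonneg[of lborel w']]) (use w'(2) in auto)
  have vw: "v z * cut (\<lambda>_. w') z = v z * w' (snd z)" for z
    using v_off[of "fst z" "snd z"] by (cases "fst z \<in> {0..<T}") (auto simp: cut_def)
  have i: "integrable lborel (\<lambda>z. v z * w' (snd z))"
    using square_integrable_mult[OF v sw] by (simp add: vw)
  have hi: "integrable lborel h" using lborel_Fubini(2)[OF i] by (simp add: h_def[abs_def])
  then have [measurable]: "h \<in> borel_measurable borel" by auto
  have key: "(\<integral>x. u t x * w x \<partial>lebesgue_on \<Omega>) = c + (LBINT \<tau>. indicator {0..<t} \<tau> * h \<tau>)" if t: "t \<in> {0<..<T}" for t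
  proof -
    let ?F = "\<lambda>z. indicator {0..<t} (fst z) * v z * w' (snd z)"
    have iF: "integrable lborel ?F"
      using integrable_mult_indicator[OF _ i, of "{0..<t} \<times> UNIV"]
      by (simp add: indicator_times mult.assoc borel_Times)
    have "(\<integral>x. u t x * w x \<partial>lebesgue_on \<Omega>) = (LBINT x. u t x * w' x)" by (rule integral_dom_transfer[OF u_X w'(1,3)])
    also have "\<dots> = (LBINT x. u0 x * w' x + time_int 0 t v x * w' x)" by (simp add: u_def distrib_right)
    also have "\<dots> = c + (LBINT x. time_int 0 t v x * w' x)"
      unfolding c_def using t
      by (intro Bochner_Integration.integral_add square_integrable_mult D_square_integrable u0D w' time_int_nsq(1) v) auto
    also have "(LBINT x. time_int 0 t v x * w' x) = (LBINT x. \<integral>\<tau>. ?F (\<tau>, x) \<partial>lborel)"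
      by (simp add: time_int_def)
    also have "\<dots> = (LBINT \<tau>. \<integral>x. ?F (\<tau>, x) \<partial>lborel)" using lborel_Fubini(3,6)[OF iF] by simp
    also have "\<dots> = (LBINT \<tau>. indicator {0..<t} \<tau> * h \<tau>)" by (simp add: h_def mult.assoc)
    finally show ?thesis .
  qed
  note P = test_function_primitive[OF \<psi> T(2) hi, of c]
  have "(\<integral>t. deriv \<psi> t * (\<integral>x. u t x * w x \<partial>lebesgue_on \<Omega>) \<partial>lebesgue_on {0<..<T})
      = (LBINT t. indicator {0<..<T} t * (deriv \<psi> t * (c + (LBINT \<tau>. indicator {0..<t} \<tau> * h \<tau>))))"
    by (rule lebesgue_on_transfer(3)[OF S]) (use P(1) in \<open>auto simp: key\<close>)
  also have "\<dots> = - (LBINT t. \<psi> t * h t)" by (rule P(2))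
  also have "(LBINT t. \<psi> t * h t) = (\<integral>t. \<psi> t * (\<integral>x. v (t, x) * w x \<partial>lebesgue_on \<Omega>) \<partial>lebesgue_on {0<..<T})"
  proof (rule lebesgue_on_transfer(3)[OF S, symmetric])
    show "\<psi> t * h t = 0" if "t \<notin> {0<..<T}" for t using test_functionD(4)[OF \<psi> that] by simp
    show "AE t in lborel. t \<in> {0<..<T} \<longrightarrow> \<psi> t * (\<integral>x. v (t, x) * w x \<partial>lebesgue_on \<Omega>) = \<psi> t * h t"
      by (simp add: h_def integral_dom_transfer[OF slice_X w'(1,3)])
  qed measurable
  finally show "(\<integral>t. deriv \<psi> t * (\<integral>x. u t x * w x \<partial>lebesgue_on \<Omega>) \<partial>lebesgue_on {0<..<T})
      = - (\<integral>t. \<psi> t * (\<integral>x. v (t, x) * w x \<partial>lebesgue_on \<Omega>) \<partial>lebesgue_on {0<..<T})" .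
qed

text \<open>Antisymmetry and the bound hold at every point, hence on every time slice. The sign
  relation is known for t < T, and the slice t = T is null.\<close>

lemma u_sign_selection: "sign_selection T u (\<lambda>x y t. \<eta> (x, y, t))"
  unfolding sign_selection_def
proof (intro conjI ballI)
  have "(\<lambda>(x, y, t). \<eta> (x, y, t)) = \<eta>" by auto
  then show "(\<lambda>(x, y, t). \<eta> (x, y, t)) \<in> borel_measurable (lebesgue_on (UNIV \<times> UNIV \<times> {0..T}))"
    using measurable_lebesgue_onI[OF \<eta>_measurable] by simp
next
  fix t assume "t \<in> {0..T}"
  show "(\<lambda>(x, y). \<eta> (x, y, t)) \<in> borel_measurable lebesgue"
    unfolding case_prod_beta' by (intro measurable_completion) simp
  show "AE (x, y) in lebesgue. \<eta> (x, y, t) = - \<eta> (y, x, t)"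
  proof (rule AE_I2)
    fix p :: "'a \<times> 'a" show "case p of (x, y) \<Rightarrow> \<eta> (x, y, t) = - \<eta> (y, x, t)" using \<eta>_antisym by (cases p) blast
  qed
  show "AE (x, y) in lebesgue. \<bar>\<eta> (x, y, t)\<bar> \<le> 1" using \<eta>_le1 by (intro AE_I2) auto
next
  have "UNIV \<times> UNIV \<times> {0..T} \<in> sets (borel :: ('a \<times> 'a \<times> real) measure)"
    by (intro borel_closed closed_Times) auto
  then show "AE (x, y, t) in lebesgue_on (UNIV \<times> UNIV \<times> {0..T}). \<eta> (x, y, t) \<in> multi_sign (u t x - u t y)"
  proof (subst AE_lebesgue_on_iff)
    show "AE z in lborel. z \<in> (UNIV :: 'a set) \<times> (UNIV :: 'a set) \<times> {0..T} \<longrightarrow> (case z of (x, y, t) \<Rightarrow> \<eta> (x, y, t) \<in> multi_sign (u t x - u t y))"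
      using \<eta>_sign AE_lborel_space_time_pairs[OF AE_lborel_fst_neq[of T]]
      by eventually_elim (auto simp: case_prod_beta')
  qed
qed

text \<open>Formulated for data equal almost everywhere to the normalised ones, which returns from
  the Borel modification to the original nonlinearity and initial datum.\<close>

lemma u_strong_solution:
  assumes g: "AE x in lborel. x \<in> \<Omega> \<longrightarrow> g x = f x" and w: "AE x in lborel. w x = u0 x"
  shows "strong_solution s \<Omega> g w T u"
proof -
  have en: "energy s \<Omega> g w' = JJ t - \<Phi> t" if t: "t \<in> {0..T}" and w': "AE x in lborel. w' x = u t x" for w' t
  proof -
    have "(\<integral>x. primitive g x (w' x) \<partial>lebesgue_on \<Omega>) = \<Phi> t"
      unfolding \<Phi>_def
    proof (rule lebesgue_on_transfer(3)[OF dom_measurable])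
      show "(\<lambda>x. primitive f x (u t x)) \<in> borel_measurable borel" by (rule primitive_measurable) auto
      show "primitive f x (u t x) = 0" if "x \<notin> \<Omega>" for x using u_off[OF that] by (simp add: primitive_0)
      show "AE x in lborel. x \<in> \<Omega> \<longrightarrow> primitive g x (w' x) = primitive f x (u t x)"
        using g w' by eventually_elim (simp add: primitive_def)
    qed
    then show ?thesis using W0_norm_transfer(2)[OF u_X w'] by (simp add: energy_def JJ_def)
  qed
  have w0: "AE x in lborel. w x = u 0 x" using w by (simp add: u_0)
  have "(0 :: real) \<in> {0..T}" using T(2) by simp
  note en0 = en[OF this w0] en[OF this, of "u 0"]
  have id: "(\<integral>\<tau>. (Lp_norm 2 \<Omega> (\<lambda>x. v (\<tau>, x)))\<^sup>2 \<partial>lebesgue_on {0..t}) + energy s \<Omega> g (u t) = JJ 0 - \<Phi> 0" if "t \<in> {0..<T}" for t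
    using en[of t "u t"] dissipation[of t] energy_identity[of t] that by simp
  have eq: "AE t in lebesgue_on {0..T}. \<forall>\<phi>\<in>W0 s \<Omega> \<inter> Lp_space 2 \<Omega>.
      (\<integral>x. v (t, x) * \<phi> x \<partial>lebesgue_on \<Omega>) +
      (\<integral>(x, y). \<eta> (x, y, t) * ((\<phi> x - \<phi> y) / norm (x - y) powr (real DIM('a) + s)) \<partial>lebesgue_on (Qset \<Omega>)) =
      (\<integral>x. g x (u t x) * \<phi> x \<partial>lebesgue_on \<Omega>)"
  proof (subst AE_lebesgue_on_iff, simp)
    show "AE t in lborel. t \<in> {0..T} \<longrightarrow> (\<forall>\<phi>\<in>W0 s \<Omega> \<inter> Lp_space 2 \<Omega>.
      (\<integral>x. v (t, x) * \<phi> x \<partial>lebesgue_on \<Omega>) +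
      (\<integral>(x, y). \<eta> (x, y, t) * ((\<phi> x - \<phi> y) / norm (x - y) powr (real DIM('a) + s)) \<partial>lebesgue_on (Qset \<Omega>)) =
      (\<integral>x. g x (u t x) * \<phi> x \<partial>lebesgue_on \<Omega>))"
      using limit_equation AE_lborel_singleton[of T]
    proof eventually_elim
      case (elim t)
      show ?case
      proof (intro impI ballI)
        fix \<phi> assume "t \<in> {0..T}" and "\<phi> \<in> W0 s \<Omega> \<inter> Lp_space 2 \<Omega>"
        then have t: "t \<in> {0..<T}" and "\<phi> \<in> W0 s \<Omega>" using elim(2) by auto
        then obtain \<phi>' where \<phi>': "\<phi>' \<in> D" "AE x in lborel. \<phi> x = \<phi>' x" using W0_representative by blast
        have [measurable]: "\<phi>' \<in> borel_measurable borel" using \<phi>'(1) by (rule D_measurable)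
        have ae: "AE x in lborel. x \<in> \<Omega> \<longrightarrow> \<phi> x = \<phi>' x" using \<phi>'(2) by eventually_elim simp
        have 1: "(\<integral>x. v (t, x) * \<phi> x \<partial>lebesgue_on \<Omega>) = (LBINT x. v (t, x) * \<phi>' x)"
          by (rule integral_dom_transfer[OF slice_X D_X[OF \<phi>'(1)] ae])
        have 2: "(\<integral>(x, y). \<eta> (x, y, t) * ((\<phi> x - \<phi> y) / norm (x - y) powr (real DIM('a) + s)) \<partial>lebesgue_on (Qset \<Omega>))
            = (LBINT p. \<eta> (fst p, snd p, t) * dK \<phi>' p)"
          using kernel_integral_transfer[OF slice_measurable(2) \<phi>'] by simp
        have 3: "(\<integral>x. g x (u t x) * \<phi> x \<partial>lebesgue_on \<Omega>) = (LBINT x. Nf (u t) x * \<phi>' x)"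
        proof (rule lebesgue_on_transfer(3)[OF dom_measurable])
          have [measurable]: "Nf (u t) \<in> borel_measurable borel" using Nf_X[OF u_X] by (rule X_measurable)
          show "(\<lambda>x. Nf (u t) x * \<phi>' x) \<in> borel_measurable borel" by measurable
          show "Nf (u t) x * \<phi>' x = 0" if "x \<notin> \<Omega>" for x using X_off[OF D_X[OF \<phi>'(1)] that] by simp
          show "AE x in lborel. x \<in> \<Omega> \<longrightarrow> g x (u t x) * \<phi> x = Nf (u t) x * \<phi>' x"
            using g \<phi>'(2) by eventually_elim (auto simp: Nf_def)
        qed
        show "(\<integral>x. v (t, x) * \<phi> x \<partial>lebesgue_on \<Omega>) +
          (\<integral>(x, y). \<eta> (x, y, t) * ((\<phi> x - \<phi> y) / norm (x - y) powr (real DIM('a) + s)) \<partial>lebesgue_on (Qset \<Omega>)) =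
          (\<integral>x. g x (u t x) * \<phi> x \<partial>lebesgue_on \<Omega>)"
          unfolding 1 2 3 by (rule bspec[OF mp[OF elim(1) t] \<phi>'(1)])
      qed
    qed
  qed
  have swap: "(\<lambda>z :: 'a \<times> real. (snd z, fst z)) \<in> borel_measurable borel"
    by (intro borel_measurable_continuous_onI continuous_intros)
  have "weak_solution s \<Omega> g w T u (\<lambda>t x. v (t, x))"
    unfolding weak_solution_def
  proof (intro conjI allI impI exI[of _ "\<lambda>x y t. \<eta> (x, y, t)"])
    have "(\<lambda>z. u (snd z) (fst z)) \<in> borel_measurable borel"
      using measurable_compose[OF swap u_measurable] by simp
    then show "(\<lambda>(x, t). u t x) \<in> borel_measurable (lebesgue_on (UNIV \<times> {0<..<T}))"
      unfolding case_prod_beta' by (rule measurable_lebesgue_onI)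
    show "AE x in lebesgue_on \<Omega>. u 0 x = w x"
      unfolding AE_lebesgue_on_iff[OF dom_measurable] using w0 by eventually_elim simp
    show "continuous_into_Lp T \<kappa> \<Omega> u" if "1 \<le> \<kappa> \<and> \<kappa> < real DIM('a) / (real DIM('a) - s)" for \<kappa>
      using that by (intro u_continuous_into_Lp) (auto simp: pstar_def dim)
    show "AE t in lebesgue_on {0..<T}. (\<integral>\<tau>. (Lp_norm 2 \<Omega> (\<lambda>x. v (\<tau>, x)))\<^sup>2 \<partial>lebesgue_on {0..t}) + energy s \<Omega> g (u t) \<le> energy s \<Omega> g w"
      using id en0 by (intro AE_I2) simp
  qed (fact u_Bochner_Linf v_Bochner_L2 u_weak_time_derivative u_sign_selection eq)+
  moreover have "u t \<in> W0 s \<Omega>" if "t \<in> {0..<T}" for t using u_W0[of t] that by auto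
  ultimately show ?thesis
    unfolding strong_solution_def using id en0(2) by (intro exI[of _ "\<lambda>t x. v (t, x)"]) auto
qed

end

theorem theorem2p10:
  fixes \<Omega> :: "'a::euclidean_space set"
    and f :: "'a \<Rightarrow> real \<Rightarrow> real"
    and u0 :: "'a \<Rightarrow> real"
    and s r C \<theta> \<Theta> :: real
  assumes "0 < s" and "s < 1"
    and "real DIM('a) < 2 * s"
    and "bounded_lipschitz_domain \<Omega>"
    and "caratheodory \<Omega> f"
    and "1 < r" and "r < real DIM('a) / (real DIM('a) - s)" and "C > 0"
    and "\<forall>x\<in>\<Omega>. \<forall>t. \<bar>f x t\<bar> \<le> C * \<bar>t\<bar> powr (r - 1)"
    and "\<theta> > 1"
    and "\<forall>x\<in>\<Omega>. \<forall>t. t \<noteq> 0 \<longrightarrow>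
           0 < \<theta> * primitive f x t \<and> \<theta> * primitive f x t \<le> t * f x t"
    and "\<forall>x\<in>\<Omega>. f x C1_differentiable_on UNIV"
    and "\<Theta> > 1"
    and "\<forall>x\<in>\<Omega>. \<forall>t. t \<noteq> 0 \<longrightarrow> (\<Theta> - 1) * f x t * t < t\<^sup>2 * deriv (f x) t"
    and "r < 1 + real DIM('a) / (2 * (real DIM('a) - s))"
    and "u0 \<in> W0 s \<Omega>"
  shows "\<exists>T>0. \<exists>u. strong_solution s \<Omega> f u0 T u"
proof -
  note s = assms(1,2) and half = assms(3) and dom = assms(4) and car = assms(5) and r = assms(6) and C = assms(8)
    and growth = assms(9) and \<theta> = assms(10) and sgn = assms(11) and diff = assms(12) and \<Theta> = assms(13)
    and der = assms(14) and r2 = assms(15) and u0 = assms(16)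
  \<comment> \<open>From N < 2s < 2.\<close>
  have dim: "DIM('a) = 1"
  proof -
    have "real DIM('a) < 2" using half s by linarith
    moreover have "0 < DIM('a)" by simp
    ultimately show ?thesis by linarith
  qed
  have op: "open \<Omega>" "bounded \<Omega>" using dom by (auto simp: bounded_lipschitz_domain_def)
  interpret subcritical_domain \<Omega> s
    using s half dim op by unfold_locales auto
  have d: "f x differentiable at t" if "x \<in> \<Omega>" for x t
    using diff that by (auto simp: C1_differentiable_on_eq)
  have cont: "continuous_on UNIV (f x)" if "x \<in> \<Omega>" for x
    using d[OF that] differentiable_imp_continuous_within by (auto simp: continuous_on_eq_continuous_at)
  have f0: "f x 0 = 0" if "x \<in> \<Omega>" for x using bspec[OF growth that, THEN spec, of 0] by simp
  \<comment> \<open>Condition (b) gives t f(x, t) > 0 for nonzero t; with \<Theta> > 1, condition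
    (c) then makes the derivative positive there.\<close>
  have mono: "mono (f x)" if x: "x \<in> \<Omega>" for x
  proof (rule mono_if_sign_condition[OF d[OF x] _ _ f0[OF x]])
    fix t :: real assume t: "t \<noteq> 0"
    show pos: "0 < t * f x t" using sgn x t by (meson less_le_trans)
    have "0 < (\<Theta> - 1) * f x t * t" using pos \<Theta> by (simp add: mult.assoc mult.commute[of "f x t"])
    also have "\<dots> < t\<^sup>2 * deriv (f x) t" using der x t by blast
    finally show "0 < deriv (f x) t" using t by (simp add: zero_less_mult_iff)
  qed
  obtain N where N: "N \<in> null_sets lborel" "\<And>t. (\<lambda>x. if x \<in> \<Omega> - N then f x t else 0) \<in> borel_measurable borel"
    by (rule Caratheodory_Borel_modification[OF dom_measurable _ cont]) (use car in \<open>auto simp: caratheodory_def\<close>)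
  \<comment> \<open>A modification of f, not its derivative: Borel in x for each t, with continuity,
    growth and monotonicity valid at every x.\<close>
  define f' where "f' x t = (if x \<in> \<Omega> - N then f x t else 0)" for x t
  obtain u0' where u0': "u0' \<in> D" "AE x in lborel. u0 x = u0' x" using W0_representative[OF u0] .
  interpret flow \<Omega> s f' u0' r C
  proof
    show "(\<lambda>x. f' x t) \<in> borel_measurable borel" for t unfolding f'_def by (rule N(2))
    show "continuous_on UNIV (f' x)" for x
      using cont[of x] by (cases "x \<in> \<Omega> - N") (auto simp: f'_def[abs_def])
    show "x \<notin> \<Omega> \<Longrightarrow> f' x t = 0" for x t by (simp add: f'_def)
    show "\<bar>f' x t\<bar> \<le> C * \<bar>t\<bar> powr (r - 1)" for x t using growth C by (auto simp: f'_def)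
    show "mono (f' x)" for x using mono[of x] by (cases "x \<in> \<Omega> - N") (auto simp: f'_def[abs_def] mono_def)
    show "0 < C" "1 < r" "u0' \<in> D" by (fact C r u0')+
    \<comment> \<open>Hypothesis (d) for N = 1.\<close>
    show "2 * (r - 1) < pstar" using r2 s by (simp add: pstar_def dim field_simps)
  qed
  obtain \<sigma> l N' v H W W' where "flow_limit \<Omega> s f' u0' r C \<sigma> l N' v H W W'" using ex_flow_limit by blast
  then interpret flow_limit \<Omega> s f' u0' r C \<sigma> l N' v H W W' .
  have "AE x in lborel. x \<in> \<Omega> \<longrightarrow> f x = f' x"
    using AE_not_in[OF N(1)] by eventually_elim (auto simp: f'_def)
  from u_strong_solution[OF this u0'(2)] show ?thesis using T(2) by blast
qed

end
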